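(* Let $m\ge 4$ be an integer, $0<\epsilon\le 1$, $\Omega=(a,b)$, $T_{\rm end}>0$, and let $\Phi$ be the exact solution of the one-dimensional semiclassical Dirac equation with periodic boundary conditions (written out in the context). Assume: (A) $\Phi\in C^2([0,T_{\rm end}];W^{m,\infty}_p(\Omega))$ and $V,A_1\in C^m(\Omega)$, with $V,A_1$ periodic on $\Omega$; (B) for all $0\le r\le 2$ and $0\le k\le m$, $$\Big\|\frac{\partial^{r+k}}{\partial t^r\partial x^k}\Phi\Big\|_{L^\infty([0,T_{\rm end}];(L^\infty(\Omega))^2)}\le \frac{C_{r+k}}{\epsilon^{r+k}},\qquad \|\partial_x^kV\|_{L^\infty(\Omega)}\le D_k,\qquad \|\partial_x^kA_1\|_{L^\infty(\Omega)}\le D_k,$$ with constants $C_{r+k},D_k$ independent of $\epsilon$. Assume further that $\tau=o(\epsilon)$ and $h=o(\epsilon)$. Let $\Phi_I^n$ be the trigonometric interpolant of the numerical solution $\Phi^n$ produced by the compact fourth-order splitting scheme $S_{4c}$ in one dimension. Then there are positive constants $C_3$ and $E_{m,3}$, independent of $\epsilon,\tau,h$, such that for all integers $0\le n\le T_{\rm end}/\tau$, $$\|\Phi(t_n,\cdot)-\Phi_I^n(\cdot)\|_{L^2}\le C_3T_{\rm end}\,\frac{\tau^4}{\epsilon^5}+E_{m,3}\,\frac{T_{\rm end}}{\tau}\Big(\frac{h}{\epsilon(b-a)}\Big)^m .$$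
   Context: Pauli matrices: $\sigma_1=\begin{pmatrix}0&1\\1&0\end{pmatrix}$, $\sigma_3=\begin{pmatrix}1&0\\0&-1\end{pmatrix}$; $I_2$ is the $2\times2$ identity. Problem: $V,A_1:\overline\Omega\to\mathbb R$ are given time-independent potentials, $\Phi=\Phi(t,x)\in\mathbb C^2$ solves $$i\epsilon\,\partial_t\Phi=\big[-i\epsilon\sigma_1\partial_x+\sigma_3+V(x)I_2-A_1(x)\sigma_1\big]\Phi,\quad x\in\Omega=(a,b),$$ with $\Phi(t,a)=\Phi(t,b)$, $\partial_x\Phi(t,a)=\partial_x\Phi(t,b)$ and $\Phi(0,x)=\Phi_0(x)$. The solution (and initial datum) may depend on $\epsilon$. $W^{m,\infty}_p(\Omega)=\{f\in W^{m,\infty}(\Omega):\partial_x^kf(a)=\partial_x^kf(b),\ k=0,\dots,m-1\}$ (componentwise for $\mathbb C^2$-valued functions). Periodicity of $V,A_1$ means that $\partial_x^k V$ and $\partial_x^k A_1$ agree at $a$ and $b$ for $k=0,\dots,m-1$. $\|f\|_{L^2}=(\int_\Omega|f|^2dx)^{1/2}$. Grid: $M$ is an even positive integer, $h=(b-a)/M$, $x_j=a+jh$ $(0\le j\le M-1)$, $\tau>0$, $t_n=n\tau$, $\mu_l=2\pi l/(b-a)$ for $-M/2\le l\le M/2-1$. For grid values $U=(U_0,\dots,U_{M-1})$ put $\hat U_l=\frac1M\sum_{j=0}^{M-1}U_je^{-i\mu_l(x_j-a)}$ and let the interpolant be $U_I(x)=\sum_{l=-M/2}^{M/2-1}\hat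 U_le^{i\mu_l(x-a)}$. Scheme $S_{4c}$: put $T=-\sigma_1\partial_x-\frac i\epsilon\sigma_3$ and $W=-\frac i\epsilon V(x)I_2+\frac i\epsilon A_1(x)\sigma_1$, with $[X,Y]=XY-YX$. The scheme is $$\Phi^{n+1}=e^{\frac16\tau W}e^{\frac\tau2T}e^{\frac23\tau W+\frac{\tau^3}{72}[W,[T,W]]}e^{\frac\tau2T}e^{\frac16\tau W}\Phi^n,\qquad \Phi^0_j=\Phi_0(x_j),\ n\ge0.$$ In one dimension $[W,[T,W]]$ is the operator of multiplication by the matrix $-\frac{4i}{\epsilon^3}A_1(x)^2\sigma_3$. In the fully discrete scheme, the exponentials involving $W$ and $[W,[T,W]]$ act on grid vectors by multiplying the $j$-th entry by the corresponding $2\times2$ matrix exponential evaluated at $x_j$, and $e^{\frac\tau2T}$ acts by $U\mapsto\Big(\sum_{l=-M/2}^{M/2-1}e^{\frac\tau2(-i\mu_l\sigma_1-\frac i\epsilon\sigma_3)}\hat U_le^{i\mu_l(x_j-a)}\Big)_{j}$. Asymptotic conditions: $\tau=o(\epsilon)$, $h=o(\epsilon)$ are understood as: there is a fixed bounded function $\eta:(0,1]\to(0,\infty)$ with $\eta(\epsilon)\to0$ as $\epsilon\to0^+$ such that $\tau/\epsilon\le\eta(\epsilon)$ and $h/\epsilon\le\eta(\epsilon)$; constants in the conclusion may depend on $\eta$ and on the data of the problem ($m$, $T_{\rm end}$, $a$, $b$, the $C_{r+k}$, $D_k$), but not on $\epsilon,\tau,h$. *)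

theory Defs
  imports "HOL-Analysis.Analysis" "HOL-Probability.Essential_Supremum"
begin

section \<open>Matrices\<close>

definition sigma1 :: "complex^2^2" where
  "sigma1 = vector [vector [0, 1], vector [1, 0]]"

definition sigma3 :: "complex^2^2" where
  "sigma3 = vector [vector [1, 0], vector [0, -1]]"

definition cscale :: "complex \<Rightarrow> complex^2^2 \<Rightarrow> complex^2^2" (infixr "*\<^sub>C" 75) where
  "c *\<^sub>C A = (\<chi> i j. c * A $ i $ j)"

text \<open>The multiplication of the type class on \<^typ>\<open>complex^2^2\<close> is componentwise, so neither the
  class power nor \<^const>\<open>exp\<close> is the matrix notion; the series below uses \<open>**\<close>.\<close>

definition mexp :: "complex^2^2 \<Rightarrow> complex^2^2" where
  "mexp A = (\<Sum>k. (1 / fact k) *\<^sub>R ((\<lambda>B. A ** B) ^^ k) (mat 1))"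

section \<open>Function spaces on the interval (a,b)\<close>

subsection \<open>Classical partial derivatives\<close>

text \<open>At the end points of \<open>[a,b]\<close> (resp. \<open>[0,T]\<close>) these are one-sided derivatives; in the
  interior they are the ordinary ones.\<close>

definition dx :: "real \<Rightarrow> real \<Rightarrow> (real \<Rightarrow> 'v) \<Rightarrow> real \<Rightarrow> 'v::real_normed_vector" where
  "dx a b f x = vector_derivative f (at x within {a..b})"

definition dt :: "real \<Rightarrow> (real \<Rightarrow> real \<Rightarrow> 'v) \<Rightarrow> real \<Rightarrow> real \<Rightarrow> 'v::real_normed_vector" where
  "dt T F t x = vector_derivative (\<lambda>s. F s x) (at t within {0..T})"

definition Cm_fun :: "nat \<Rightarrow> real \<Rightarrow> real \<Rightarrow> (real \<Rightarrow> 'v::real_normed_vector) set" where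
  "Cm_fun m a b = {f. (\<forall>k<m. ((dx a b ^^ k) f) differentiable_on {a<..<b}) \<and>
                      continuous_on {a<..<b} ((dx a b ^^ m) f)}"

text \<open>Agreement of the derivatives of order \<open>0,\<dots>,m-1\<close> at \<open>a\<close> and \<open>b\<close>.  The continuity clause says
  that the values at the end points are the boundary values of these derivatives.  For an element of
  \<open>W\<^bsup>m,\<infinity>\<^esup>\<close> the case \<open>k = 0\<close> also selects the continuous representative of the a.e.-class; that
  representative is \<open>C\<^bsup>m-1\<^esup>\<close> on \<open>[a,b]\<close>, so that the classical derivatives \<^const>\<open>dx\<close> exist.\<close>

definition periodic_upto :: "nat \<Rightarrow> real \<Rightarrow> real \<Rightarrow> (real \<Rightarrow> 'v::real_normed_vector) \<Rightarrow> bool" where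
  "periodic_upto m a b f \<longleftrightarrow>
     (\<forall>k<m. continuous_on {a..b} ((dx a b ^^ k) f) \<and> (dx a b ^^ k) f a = (dx a b ^^ k) f b)"

subsection \<open>Lebesgue norms\<close>

definition L2_norm :: "real \<Rightarrow> real \<Rightarrow> (real \<Rightarrow> 'v::real_normed_vector) \<Rightarrow> real" where
  "L2_norm a b f = sqrt (LINT x|lebesgue_on {a<..<b}. (norm (f x))\<^sup>2)"

definition Linf_norm :: "real \<Rightarrow> real \<Rightarrow> (real \<Rightarrow> 'v::real_normed_vector) \<Rightarrow> ereal" where
  "Linf_norm a b f = esssup (lebesgue_on {a<..<b}) (\<lambda>x. ereal (norm (f x)))"

definition Linf :: "real \<Rightarrow> real \<Rightarrow> (real \<Rightarrow> 'v::real_normed_vector) set" where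
  "Linf a b = {f. f \<in> borel_measurable (lebesgue_on {a<..<b}) \<and> Linf_norm a b f < \<infinity>}"

subsection \<open>Weak derivatives and Sobolev spaces\<close>

definition test_fun :: "real \<Rightarrow> real \<Rightarrow> (real \<Rightarrow> real) \<Rightarrow> bool" where
  "test_fun a b \<phi> \<longleftrightarrow>
     (\<forall>k. ((deriv ^^ k) \<phi>) differentiable_on UNIV) \<and>
     (\<exists>c d. a < c \<and> d < b \<and> (\<forall>x. x \<notin> {c..d} \<longrightarrow> \<phi> x = 0))"

definition loc_integrable :: "real \<Rightarrow> real \<Rightarrow> (real \<Rightarrow> 'v::euclidean_space) \<Rightarrow> bool" where
  "loc_integrable a b f \<longleftrightarrow> (\<forall>c d. a < c \<longrightarrow> d < b \<longrightarrow> integrable (lebesgue_on {c..d}) f)"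

definition weak_deriv ::
    "real \<Rightarrow> real \<Rightarrow> nat \<Rightarrow> (real \<Rightarrow> 'v::euclidean_space) \<Rightarrow> (real \<Rightarrow> 'v) \<Rightarrow> bool" where
  "weak_deriv a b k f g \<longleftrightarrow>
     loc_integrable a b f \<and> loc_integrable a b g \<and>
     (\<forall>\<phi>. test_fun a b \<phi> \<longrightarrow>
        (LINT x|lebesgue_on {a<..<b}. (deriv ^^ k) \<phi> x *\<^sub>R f x) =
        (-1) ^ k *\<^sub>R (LINT x|lebesgue_on {a<..<b}. \<phi> x *\<^sub>R g x))"

text \<open>The weak derivative of order \<open>k\<close>, determined up to equality almost everywhere on \<open>(a,b)\<close>.\<close>

definition wderiv ::
    "real \<Rightarrow> real \<Rightarrow> nat \<Rightarrow> (real \<Rightarrow> 'v::euclidean_space) \<Rightarrow> real \<Rightarrow> 'v" where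
  "wderiv a b k f = (SOME g. weak_deriv a b k f g)"

definition W_inf :: "nat \<Rightarrow> real \<Rightarrow> real \<Rightarrow> (real \<Rightarrow> 'v::euclidean_space) set" where
  "W_inf m a b = {f. \<forall>k\<le>m. \<exists>g\<in>Linf a b. weak_deriv a b k f g}"

definition W_inf_norm :: "nat \<Rightarrow> real \<Rightarrow> real \<Rightarrow> (real \<Rightarrow> 'v::euclidean_space) \<Rightarrow> ereal" where
  "W_inf_norm m a b f = (\<Sum>k\<le>m. Linf_norm a b (wderiv a b k f))"

definition W_inf_per :: "nat \<Rightarrow> real \<Rightarrow> real \<Rightarrow> (real \<Rightarrow> 'v::euclidean_space) set" where
  "W_inf_per m a b = {f \<in> W_inf m a b. periodic_upto m a b f}"

text \<open>The space \<open>C\<^sup>l([0,T]; W\<^sub>p\<^bsup>m,\<infinity>\<^esup>)\<close>: difference quotients converge, and the last derivative is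
  continuous, in the norm of \<open>W\<^bsup>m,\<infinity>\<^esup>\<close>.  Since the elements are continuous on \<open>[a,b]\<close>, a derivative in
  this sense is also the pointwise derivative \<^const>\<open>dt\<close>.\<close>

definition C_time_W_inf_per ::
    "nat \<Rightarrow> real \<Rightarrow> nat \<Rightarrow> real \<Rightarrow> real \<Rightarrow> (real \<Rightarrow> real \<Rightarrow> 'v::euclidean_space) set" where
  "C_time_W_inf_per l T m a b = {F.
     (\<forall>r\<le>l. \<forall>t\<in>{0..T}. (dt T ^^ r) F t \<in> W_inf_per m a b) \<and>
     (\<forall>r<l. \<forall>t\<in>{0..T}.
        ((\<lambda>s. W_inf_norm m a b (\<lambda>x. ((dt T ^^ r) F s x - (dt T ^^ r) F t x) /\<^sub>R (s - t)
                                     - (dt T ^^ Suc r) F t x)) \<longlongrightarrow> 0) (at t within {0..T})) \<and>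
     (\<forall>t\<in>{0..T}.
        ((\<lambda>s. W_inf_norm m a b (\<lambda>x. (dt T ^^ l) F s x - (dt T ^^ l) F t x)) \<longlongrightarrow> 0)
          (at t within {0..T}))}"

definition mixed_Linf_norm ::
    "real \<Rightarrow> real \<Rightarrow> real \<Rightarrow> nat \<Rightarrow> nat \<Rightarrow> (real \<Rightarrow> real \<Rightarrow> 'v::euclidean_space) \<Rightarrow> ereal" where
  "mixed_Linf_norm T a b r k F =
     esssup (lebesgue_on {0..T}) (\<lambda>t. Linf_norm a b (wderiv a b k ((dt T ^^ r) F t)))"

section \<open>The semiclassical Dirac equation with periodic boundary conditions\<close>

definition dirac_solution ::
    "real \<Rightarrow> real \<Rightarrow> real \<Rightarrow> real \<Rightarrow> (real \<Rightarrow> real) \<Rightarrow> (real \<Rightarrow> real) \<Rightarrow>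
     (real \<Rightarrow> complex^2) \<Rightarrow> (real \<Rightarrow> real \<Rightarrow> complex^2) \<Rightarrow> bool" where
  "dirac_solution \<epsilon> T a b V A1 \<Phi>0 \<Phi> \<longleftrightarrow>
     (\<forall>t\<in>{0..T}. \<forall>x\<in>{a<..<b}.
        (\<i> * of_real \<epsilon>) *s dt T \<Phi> t x =
          (- \<i> * of_real \<epsilon>) *s (sigma1 *v dx a b (\<Phi> t) x) + sigma3 *v \<Phi> t x
          + of_real (V x) *s \<Phi> t x - of_real (A1 x) *s (sigma1 *v \<Phi> t x)) \<and>
     (\<forall>t\<in>{0..T}. \<Phi> t a = \<Phi> t b \<and> dx a b (\<Phi> t) a = dx a b (\<Phi> t) b) \<and>
     (\<forall>x\<in>{a..b}. \<Phi> 0 x = \<Phi>0 x)"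

section \<open>Trigonometric interpolation\<close>

text \<open>Grid vectors are functions on \<^typ>\<open>nat\<close> of which only the entries \<open>j < M\<close> matter.\<close>

definition grid :: "real \<Rightarrow> real \<Rightarrow> nat \<Rightarrow> nat \<Rightarrow> real" where
  "grid a b M j = a + real j * ((b - a) / real M)"

definition freq :: "real \<Rightarrow> real \<Rightarrow> int \<Rightarrow> real" where
  "freq a b l = 2 * pi * of_int l / (b - a)"

definition modes :: "nat \<Rightarrow> int set" where
  "modes M = {- int (M div 2) .. int (M div 2) - 1}"

definition dft :: "real \<Rightarrow> real \<Rightarrow> nat \<Rightarrow> (nat \<Rightarrow> complex^2) \<Rightarrow> int \<Rightarrow> complex^2" where
  "dft a b M U l =
     (1 / of_nat M) *s (\<Sum>j<M. exp (- \<i> * of_real (freq a b l * (grid a b M j - a))) *s U j)"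

definition interpolant :: "real \<Rightarrow> real \<Rightarrow> nat \<Rightarrow> (nat \<Rightarrow> complex^2) \<Rightarrow> real \<Rightarrow> complex^2" where
  "interpolant a b M U x =
     (\<Sum>l\<in>modes M. exp (\<i> * of_real (freq a b l * (x - a))) *s dft a b M U l)"

section \<open>The compact fourth-order splitting scheme\<close>

definition W_mat :: "real \<Rightarrow> (real \<Rightarrow> real) \<Rightarrow> (real \<Rightarrow> real) \<Rightarrow> real \<Rightarrow> complex^2^2" where
  "W_mat \<epsilon> V A1 x =
     (- \<i> / of_real \<epsilon> * of_real (V x)) *\<^sub>C mat 1 + (\<i> / of_real \<epsilon> * of_real (A1 x)) *\<^sub>C sigma1"

text \<open>With \<open>T = -\<sigma>\<^sub>1\<partial>\<^sub>x - (\<i>/\<epsilon>)\<sigma>\<^sub>3\<close> one has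
  \<open>[T,W] = (\<i>/\<epsilon>)(V' \<sigma>\<^sub>1 - A\<^sub>1' I) + (1/\<epsilon>\<^sup>2) A\<^sub>1 [\<sigma>\<^sub>3,\<sigma>\<^sub>1]\<close>, and the double commutator \<open>[W,[T,W]]\<close> is
  multiplication by the following matrix.\<close>

definition WTW_mat :: "real \<Rightarrow> (real \<Rightarrow> real) \<Rightarrow> real \<Rightarrow> complex^2^2" where
  "WTW_mat \<epsilon> A1 x = (- 4 * \<i> / of_real (\<epsilon> ^ 3) * of_real ((A1 x)\<^sup>2)) *\<^sub>C sigma3"

definition T_symbol :: "real \<Rightarrow> real \<Rightarrow> complex^2^2" where
  "T_symbol \<epsilon> \<mu> = (- \<i> * of_real \<mu>) *\<^sub>C sigma1 - (\<i> / of_real \<epsilon>) *\<^sub>C sigma3"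

definition exp_T ::
    "real \<Rightarrow> real \<Rightarrow> real \<Rightarrow> nat \<Rightarrow> real \<Rightarrow> (nat \<Rightarrow> complex^2) \<Rightarrow> nat \<Rightarrow> complex^2" where
  "exp_T \<epsilon> a b M s U j =
     (\<Sum>l\<in>modes M. exp (\<i> * of_real (freq a b l * (grid a b M j - a))) *s
        (mexp (s *\<^sub>R T_symbol \<epsilon> (freq a b l)) *v dft a b M U l))"

definition exp_mult ::
    "real \<Rightarrow> real \<Rightarrow> nat \<Rightarrow> (real \<Rightarrow> complex^2^2) \<Rightarrow> (nat \<Rightarrow> complex^2) \<Rightarrow> nat \<Rightarrow> complex^2" where
  "exp_mult a b M B U j = mexp (B (grid a b M j)) *v U j"

definition S4c_step ::
    "real \<Rightarrow> real \<Rightarrow> real \<Rightarrow> (real \<Rightarrow> real) \<Rightarrow> (real \<Rightarrow> real) \<Rightarrow> nat \<Rightarrow> real \<Rightarrow>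
     (nat \<Rightarrow> complex^2) \<Rightarrow> nat \<Rightarrow> complex^2" where
  "S4c_step \<epsilon> a b V A1 M \<tau> =
     exp_mult a b M (\<lambda>x. (\<tau> / 6) *\<^sub>R W_mat \<epsilon> V A1 x)
     \<circ> exp_T \<epsilon> a b M (\<tau> / 2)
     \<circ> exp_mult a b M (\<lambda>x. (2 / 3 * \<tau>) *\<^sub>R W_mat \<epsilon> V A1 x + (\<tau> ^ 3 / 72) *\<^sub>R WTW_mat \<epsilon> A1 x)
     \<circ> exp_T \<epsilon> a b M (\<tau> / 2)
     \<circ> exp_mult a b M (\<lambda>x. (\<tau> / 6) *\<^sub>R W_mat \<epsilon> V A1 x)"

definition S4c ::
    "real \<Rightarrow> real \<Rightarrow> real \<Rightarrow> (real \<Rightarrow> real) \<Rightarrow> (real \<Rightarrow> real) \<Rightarrow> nat \<Rightarrow> real \<Rightarrow>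
     (real \<Rightarrow> complex^2) \<Rightarrow> nat \<Rightarrow> nat \<Rightarrow> complex^2" where
  "S4c \<epsilon> a b V A1 M \<tau> \<Phi>0 n = (S4c_step \<epsilon> a b V A1 M \<tau> ^^ n) (\<lambda>j. \<Phi>0 (grid a b M j))"

end

theory Submission
  imports Defs "HOL-Computational_Algebra.Polynomial"
begin

text \<open>In the variables \<open>y = (x - a)/\<epsilon>\<close>, \<open>s = t/\<epsilon>\<close> the parameter \<open>\<epsilon>\<close> disappears from the equation and from the
  scheme, the solution and the potentials become periodic functions with period \<open>L = (b - a)/\<epsilon>\<close> whose
  derivatives are bounded independently of \<open>\<epsilon>\<close>, and the mesh sizes become \<open>\<sigma> = \<tau>/\<epsilon>\<close> and \<open>H = h/\<epsilon>\<close>.  Every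
  factor of the scheme is an isometry of the mean-square norm on the grid, so that the theorem
  reduces to a local error \<open>O(\<sigma>\<^sup>5 + H\<^sup>m)\<close>.

  For the local error, the exact flow and the five factors of the scheme are expanded in words in the
  operators \<open>T\<close> and \<open>W\<close>; the coefficients of all words of length at most four agree.  The spectral
  evaluation of the free evolution costs \<open>O(H\<^sup>m)\<close> by Jackson's theorem, obtained by iterating a positive
  kernel.  In the supremum norm the free evolution is controlled along characteristics, which avoids
  any loss in the number of grid points.  For \<open>\<sigma> > 1/2\<close> the bound is trivial, and since \<open>\<tau>\<close> is bounded the
  factor \<open>T/\<tau>\<close> is bounded below, which absorbs the interpolation error of a single time level.\<close>

section \<open>Regularity of the solution and the potentials\<close>

text \<open>The data are given by weak derivatives and essential bounds, while the expansions need
  pointwise ones. Mollification yields classical derivatives up to order m - 1 and a Lipschitz bound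
  for the last of them; a Lipschitz condition passes through limits, closures and periodic gluing,
  so the function classes are built on it. The rest is shaped by two norms that do not fit together.
  The factors of the scheme are isometries only in the mean-square grid norm, in which errors are
  therefore propagated, whereas derivatives and products with potentials are estimated pointwise;
  the passage is one-way, from supremum to mean square. Moreover \<open>T\<close> is unbounded and
  the data have finite smoothness, so that the free evolution can be expanded on a word of length n
  only to degree 4 - n; the weight \<open>\<sigma> ^ n\<close> of the word supplies the missing
  order. Fourth order then is a finite identity for the 31 words of length at most four, each of
  which has coefficient 1/n! in the exact flow. The weights 1/6, 2/3, 1/6 make the third-order error
  a multiple of [W,[T,W]], and 1/72 cancels it.\<close>

definition bump :: "real poly \<Rightarrow> nat \<Rightarrow> real \<Rightarrow> real" where
  "bump p n x = (if \<bar>x\<bar> < 1 then poly p x / (1 - x\<^sup>2) ^ n * exp (- (1 / (1 - x\<^sup>2))) else 0)"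

lemma power_le_fact_exp: "0 \<le> t \<Longrightarrow> t ^ k \<le> fact k * exp (t :: real)"
proof -
  assume t: "0 \<le> t"
  have s: "(\<lambda>n. inverse (fact n) * t ^ n) sums exp t"
    using exp_converges[of t] by (simp add: divide_inverse mult.commute)
  have "(\<Sum>n\<in>{k}. inverse (fact n) * t ^ n) \<le> (\<Sum>n. inverse (fact n) * t ^ n)"
    using s t by (intro sum_le_suminf) (auto simp: sums_iff)
  then have "inverse (fact k) * t ^ k \<le> exp t" using s by (simp add: sums_iff)
  then show ?thesis by (simp add: field_simps)
qed

text \<open>With w = 1 - x^2, the inequality exp(-1/w) <= (n+2)! w^(n+2) absorbs the pole of order n
  and still leaves w^2, which vanishes quadratically at both end points. Quadratic flatness is what
  differentiability at x = 1 and x = -1 needs.\<close>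

lemma bump_flat: "\<exists>C. \<forall>x. \<bar>bump p n x\<bar> \<le> C * (x - 1)\<^sup>2 \<and> \<bar>bump p n x\<bar> \<le> C * (x + 1)\<^sup>2"
proof -
  have "bounded (poly p ` {-1..1})"
    by (intro compact_imp_bounded compact_continuous_image continuous_intros) auto
  then obtain K where K: "K > 0" "\<And>x. x \<in> {-1..1} \<Longrightarrow> \<bar>poly p x\<bar> \<le> K"
    unfolding bounded_pos by auto
  let ?C = "K * fact (n + 2) * 4"
  have "\<bar>bump p n x\<bar> \<le> ?C * (x - 1)\<^sup>2 \<and> \<bar>bump p n x\<bar> \<le> ?C * (x + 1)\<^sup>2" for x
  proof (cases "\<bar>x\<bar> < 1")
    case True
    define w where "w = 1 - x\<^sup>2"
    have x2: "x\<^sup>2 < 1" using True by (simp add: abs_square_less_1)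
    then have w: "w > 0" by (simp add: w_def)
    have wf: "w = (1 - x) * (1 + x)" by (simp add: w_def power2_eq_square algebra_simps)
    have "(1 / w) ^ (n + 2) \<le> fact (n + 2) * exp (1 / w)"
      using w by (intro power_le_fact_exp) auto
    then have "exp (- (1 / w)) \<le> fact (n + 2) * w ^ (n + 2)"
      using w by (simp add: exp_minus power_divide field_simps)
    then have "exp (- (1 / w)) / w ^ n \<le> fact (n + 2) * w\<^sup>2"
      using w by (simp add: field_simps power_add power2_eq_square)
    moreover have "\<bar>poly p x\<bar> \<le> K" using True by (intro K) auto
    ultimately have "\<bar>poly p x\<bar> * (exp (- (1 / w)) / w ^ n) \<le> K * (fact (n + 2) * w\<^sup>2)"
      using w K(1) by (intro mult_mono) auto
    moreover have "\<bar>bump p n x\<bar> = \<bar>poly p x\<bar> * (exp (- (1 / w)) / w ^ n)"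
      using True w by (simp add: bump_def abs_mult w_def)
    ultimately have 1: "\<bar>bump p n x\<bar> \<le> (K * fact (n + 2)) * w\<^sup>2" by simp
    have "(1 - x) * (1 + x) \<le> (1 - x) * 2" "(1 + x) * (1 - x) \<le> (1 + x) * 2"
      using True by (intro mult_left_mono; simp)+
    then have "w \<le> 2 * (1 - x)" "w \<le> 2 * (1 + x)" unfolding wf by (simp_all only: mult.commute)
    then have "w\<^sup>2 \<le> (2 * (1 - x))\<^sup>2" "w\<^sup>2 \<le> (2 * (1 + x))\<^sup>2" using w by (intro power_mono; simp)+
    moreover have "(2 * (1 - x))\<^sup>2 = 4 * (x - 1)\<^sup>2" "(2 * (1 + x))\<^sup>2 = 4 * (x + 1)\<^sup>2"
      by (simp_all add: power2_eq_square algebra_simps)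
    ultimately have 2: "w\<^sup>2 \<le> 4 * (x - 1)\<^sup>2" "w\<^sup>2 \<le> 4 * (x + 1)\<^sup>2" by simp_all
    have "(K * fact (n + 2)) * w\<^sup>2 \<le> (K * fact (n + 2)) * (4 * (x - 1)\<^sup>2)"
       "(K * fact (n + 2)) * w\<^sup>2 \<le> (K * fact (n + 2)) * (4 * (x + 1)\<^sup>2)"
      using K(1) 2 by (intro mult_left_mono; simp)+
    then show ?thesis using 1 by (simp add: mult.assoc)
  next
    case False
    then show ?thesis using K(1) by (simp add: bump_def)
  qed
  then show ?thesis by blast
qed

lemma flat_deriv:
  assumes "\<And>y. \<bar>f y\<bar> \<le> C * (y - x)\<^sup>2" shows "(f has_real_derivative 0) (at x)"
proof -
  have fx: "f x = 0" using assms[of x] by simp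
  have "((\<lambda>y. (f y - f x) / (y - x)) \<longlongrightarrow> 0) (at x)"
  proof (rule Lim_null_comparison)
    show "\<forall>\<^sub>F y in at x. norm ((f y - f x) / (y - x)) \<le> C * \<bar>y - x\<bar>"
    proof (rule eventually_at_filter[THEN iffD2], rule always_eventually, intro allI impI)
      fix y assume "y \<noteq> x"
      then show "norm ((f y - f x) / (y - x)) \<le> C * \<bar>y - x\<bar>"
        using assms[of y] by (simp add: fx divide_le_eq power2_eq_square abs_mult_self_eq mult.assoc)
    qed
    show "((\<lambda>y. C * \<bar>y - x\<bar>) \<longlongrightarrow> 0) (at x)" by (auto intro!: tendsto_eq_intros)
  qed
  then show ?thesis by (simp add: has_field_derivative_iff)
qed

text \<open>The functions polynomial / (1 - x^2)^n times exp(-1/(1 - x^2)) form a family closed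
  under differentiation, so smoothness of all orders follows from this single step. The parameters
  \<open>p\<close> and \<open>n\<close> exist for this closure only; the mollifier itself is
  \<open>bump 1 0\<close>.\<close>

lemma bump_deriv: "\<exists>q k. \<forall>x. (bump p n has_real_derivative bump q k x) (at x)"
proof (intro exI allI)
  let ?w = "[:1, 0, -1:] :: real poly"
  \<comment> \<open>Product rule over the common denominator w^(n+2): the three summands come from
    differentiating \<open>p\<close>, the power w^(-n) and the exponential.\<close>
  let ?q = "pderiv p * ?w\<^sup>2 + smult (2 * real n) (monom 1 1 * p * ?w) - smult 2 (monom 1 1 * p)"
  fix x :: real
  show "(bump p n has_real_derivative bump ?q (n + 2) x) (at x)"
  proof (cases "\<bar>x\<bar> < 1")
    case True
    have x2: "x\<^sup>2 < 1" using True by (simp add: abs_square_less_1)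
    define w where "w = 1 - x\<^sup>2"
    have w: "w > 0" using x2 by (simp add: w_def)
    have dw: "((\<lambda>x. 1 - x\<^sup>2) has_real_derivative - 2 * x) (at x)"
      by (auto intro!: derivative_eq_intros)
    have de: "((\<lambda>x. exp (- (1 / (1 - x\<^sup>2)))) has_real_derivative (- 2 * x / w\<^sup>2) * exp (- (1 / w))) (at x)"
      using w by (auto intro!: derivative_eq_intros simp: w_def power2_eq_square)
    have dp: "((\<lambda>x. poly p x / (1 - x\<^sup>2) ^ n) has_real_derivative
       (poly (pderiv p) x * w ^ n - poly p x * (real n * w ^ (n - 1) * (- 2 * x))) / (w ^ n * w ^ n)) (at x)"
      unfolding w_def
      by (rule DERIV_divide[OF poly_DERIV]) (use w in \<open>auto intro!: derivative_eq_intros simp: w_def\<close>)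
    have d: "((\<lambda>x. poly p x / (1 - x\<^sup>2) ^ n * exp (- (1 / (1 - x\<^sup>2)))) has_real_derivative
       (poly (pderiv p) x * w ^ n - poly p x * (real n * w ^ (n - 1) * (- 2 * x))) / (w ^ n * w ^ n) * exp (- (1 / w))
       + ((- 2 * x / w\<^sup>2) * exp (- (1 / w))) * (poly p x / w ^ n)) (at x)"
      using DERIV_mult[OF dp de] by (simp add: w_def)
    have q: "poly ?q x = poly (pderiv p) x * w\<^sup>2 + 2 * real n * x * poly p x * w - 2 * x * poly p x"
      by (simp add: w_def poly_monom power2_eq_square algebra_simps)
    have eq: "(poly (pderiv p) x * w ^ n - poly p x * (real n * w ^ (n - 1) * (- 2 * x))) / (w ^ n * w ^ n) * exp (- (1 / w))
       + ((- 2 * x / w\<^sup>2) * exp (- (1 / w))) * (poly p x / w ^ n) = bump ?q (n + 2) x"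
    proof -
      have "(real n * w ^ (n - 1)) * w = real n * w ^ n" by (cases n) auto
      then have 1: "real n * w ^ (n - 1) = real n * w ^ n / w" using w by (simp add: field_simps)
      have "bump ?q (n + 2) x = (poly (pderiv p) x * w\<^sup>2 + 2 * real n * x * poly p x * w - 2 * x * poly p x) / w ^ (n + 2) * exp (- (1 / w))"
        using True unfolding bump_def q w_def by simp
      also have "\<dots> = (poly (pderiv p) x * w ^ n - poly p x * (real n * w ^ (n - 1) * (- 2 * x))) / (w ^ n * w ^ n) * exp (- (1 / w))
       + ((- 2 * x / w\<^sup>2) * exp (- (1 / w))) * (poly p x / w ^ n)"
        unfolding 1 using w by (simp add: field_simps power2_eq_square power_add)
      finally show ?thesis by simp
    qed
    show ?thesis
      by (rule has_field_derivative_transform_within_open[OF d[unfolded eq], of "{-1<..<1}"])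
        (use True in \<open>auto simp: bump_def abs_less_iff\<close>)
  next
    case False
    have b0: "bump ?q (n + 2) x = 0" using False by (simp add: bump_def)
    obtain C where C: "\<And>x. \<bar>bump p n x\<bar> \<le> C * (x - 1)\<^sup>2" "\<And>x. \<bar>bump p n x\<bar> \<le> C * (x + 1)\<^sup>2"
      using bump_flat[of p n] by blast
    consider "x = 1" | "x = -1" | "x > 1" | "x < -1" using False by linarith
    then have "(bump p n has_real_derivative 0) (at x)"
    proof cases
      case 1 then show ?thesis using flat_deriv[OF C(1)] by simp
    next
      case 2 then show ?thesis using flat_deriv[of "bump p n" C "-1"] C(2) by simp
    next
      case 3
      have "((\<lambda>_. 0::real) has_real_derivative 0) (at x)" by simp
      then show ?thesis
        by (rule has_field_derivative_transform_within_open[of _ _ _ "{1<..}"]) (use 3 in \<open>auto simp: bump_def\<close>)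
    next
      case 4
      have "((\<lambda>_. 0::real) has_real_derivative 0) (at x)" by simp
      then show ?thesis
        by (rule has_field_derivative_transform_within_open[of _ _ _ "{..<-1}"]) (use 4 in \<open>auto simp: bump_def\<close>)
    qed
    then show ?thesis by (simp only: b0)
  qed
qed

definition bump_deriv :: "nat \<Rightarrow> real \<Rightarrow> real" where "bump_deriv k = (deriv ^^ k) (bump 1 0)"

lemma bump_deriv_bump: "\<exists>p n. bump_deriv k = bump p n"
proof (induction k)
  case 0 then show ?case by (auto simp: bump_deriv_def)
next
  case (Suc k)
  then obtain p n where pn: "bump_deriv k = bump p n" by blast
  obtain q j where "\<And>x. (bump p n has_real_derivative bump q j x) (at x)" using bump_deriv by blast
  then have "deriv (bump p n) = bump q j" by (intro ext DERIV_imp_deriv)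
  then show ?case using pn by (auto simp: bump_deriv_def)
qed

lemma bump_deriv_deriv: "(bump_deriv k has_real_derivative bump_deriv (Suc k) x) (at x)"
proof -
  obtain p n where pn: "bump_deriv k = bump p n" using bump_deriv_bump by blast
  obtain q j where d: "\<And>x. (bump p n has_real_derivative bump q j x) (at x)" using bump_deriv by blast
  then have "deriv (bump p n) = bump q j" by (intro ext DERIV_imp_deriv)
  then have "bump_deriv (Suc k) = bump q j" using pn by (simp add: bump_deriv_def)
  then show ?thesis using d pn by simp
qed

lemma bump_deriv_out: "1 \<le> \<bar>x\<bar> \<Longrightarrow> bump_deriv k x = 0"
  using bump_deriv_bump[of k] by (auto simp: bump_def)

lemma bump_deriv_cont [continuous_intros]: "continuous_on S g \<Longrightarrow> continuous_on S (\<lambda>x. bump_deriv k (g x))"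
proof -
  have "continuous_on UNIV (bump_deriv k)"
    by (rule DERIV_continuous_on) (use bump_deriv_deriv in blast)
  then show "continuous_on S g \<Longrightarrow> ?thesis" by (rule continuous_on_compose2) auto
qed

lemma bump_deriv_nonneg: "0 \<le> bump_deriv 0 x" by (simp add: bump_deriv_def bump_def)

definition bump_mass :: real where "bump_mass = integral {-1..1} (bump_deriv 0)"

lemma bump_mass_integral: "(bump_deriv 0 has_integral bump_mass) {-1..1}"
  unfolding bump_mass_def by (intro integrable_integral integrable_continuous_interval continuous_intros)

lemma bump_mass_pos: "0 < bump_mass"
proof -
  have "0 \<le> bump_mass" unfolding bump_mass_def
    by (intro integral_nonneg integrable_continuous_interval continuous_intros) (auto simp: bump_deriv_nonneg)
  moreover have "bump_mass \<noteq> 0"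
  proof
    assume "bump_mass = 0"
    moreover have "continuous_on {-1..1} (bump_deriv 0)" using bump_deriv_cont[of "{-1..1}" "\<lambda>x. x" 0] by simp
    ultimately have "bump_deriv 0 0 = 0"
      using has_integral_0_cbox_imp_0[of "-1" 1 "bump_deriv 0" 0] bump_mass_integral bump_deriv_nonneg by auto
    then show False by (simp add: bump_deriv_def bump_def)
  qed
  ultimately show ?thesis by simp
qed

section \<open>Scaled bumps as test functions, and mollification\<close>

lemma bump_deriv_chain: "(g has_real_derivative g') (at y) \<Longrightarrow>
    ((\<lambda>y. C * bump_deriv k (g y)) has_real_derivative C * (bump_deriv (Suc k) (g y) * g')) (at y)"
  by (intro DERIV_cmult DERIV_chain2[OF bump_deriv_deriv])

lemma bump_deriv_affine_deriv: "((\<lambda>y. c ^ k * bump_deriv k (c * y + d)) has_real_derivative c ^ Suc k * bump_deriv (Suc k) (c * y + d)) (at y)"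
proof -
  have "((\<lambda>y. c * y + d) has_real_derivative c) (at y)" by (auto intro!: derivative_eq_intros)
  from bump_deriv_chain[OF this, of "c ^ k" k] show ?thesis by (simp add: mult_ac)
qed

lemma affine_abs:
  assumes "(\<delta>::real) > 0" shows "\<bar>(-1/\<delta>) * y + x / \<delta>\<bar> = \<bar>x - y\<bar> / \<delta>"
proof -
  have "(-1/\<delta>) * y + x / \<delta> = (x - y) / \<delta>" using assms by (simp add: field_simps)
  then have "\<bar>(-1/\<delta>) * y + x / \<delta>\<bar> = \<bar>(x - y) / \<delta>\<bar>" by (rule arg_cong)
  also have "\<dots> = \<bar>x - y\<bar> / \<delta>" using assms by (simp add: abs_divide)
  finally show ?thesis .
qed

lemma deriv_affine: "(deriv ^^ k) (\<lambda>y. bump_deriv 0 (c * y + d)) = (\<lambda>y. c ^ k * bump_deriv k (c * y + d))"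
proof (induction k)
  case (Suc k)
  show ?case unfolding funpow.simps o_def Suc.IH
    by (rule ext) (rule DERIV_imp_deriv[OF bump_deriv_affine_deriv])
qed simp

lemma bump_deriv_affine_differentiable: "(\<lambda>y. c ^ k * bump_deriv k (c * y + d)) differentiable_on UNIV"
  using bump_deriv_affine_deriv unfolding differentiable_on_def has_field_derivative_def differentiable_def by blast

text \<open>The slope is negative because the test variable is the integration variable of a
  convolution: the affine argument equals \<open>(x - y) / \<delta>\<close>. The condition on x
  keeps the support inside (a,b).\<close>

lemma test_fun_affine:
  assumes "\<delta> > 0" "a < x - \<delta>" "x + \<delta> < b"
  shows "test_fun a b (\<lambda>y. bump_deriv 0 ((-1/\<delta>) * y + x / \<delta>))"
  unfolding test_fun_def deriv_affine
proof (rule conjI, rule allI, rule bump_deriv_affine_differentiable, rule exI[of _ "x - \<delta>"], rule exI[of _ "x + \<delta>"],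
    intro conjI allI impI)
  fix y assume y: "y \<notin> {x - \<delta>..x + \<delta>}"
  have "\<bar>(-1/\<delta>) * y + x / \<delta>\<bar> = \<bar>x - y\<bar> / \<delta>" by (rule affine_abs[OF assms(1)])
  also have "1 \<le> \<dots>" using y assms(1) by (auto simp: le_divide_eq)
  finally show "bump_deriv 0 ((-1/\<delta>) * y + x / \<delta>) = 0" by (rule bump_deriv_out)
qed (use assms in auto)

lemma lint_cont:
  fixes g :: "real \<Rightarrow> 'v::euclidean_space"
  assumes "continuous_on {a..b} g"
  shows "integrable (lebesgue_on {a<..<b}) g" "(LINT x|lebesgue_on {a<..<b}. g x) = integral {a..b} g"
proof -
  have "g absolutely_integrable_on {a..b}" by (rule absolutely_integrable_continuous_real[OF assms])
  then have "g absolutely_integrable_on {a<..<b}"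
    by (rule set_integrable_subset) auto
  then show i: "integrable (lebesgue_on {a<..<b}) g"
    by (simp add: set_integrable_def integrable_restrict_space)
  show "(LINT x|lebesgue_on {a<..<b}. g x) = integral {a..b} g"
    using lebesgue_integral_eq_integral[OF i] by (simp add: integral_open_interval_real)
qed

text \<open>The k-th derivative of the convolution of f with a bump of radius \<delta> and mass one.
  The derivatives sit on the kernel, so that f only has to be continuous; it is meant for points
  whose distance to the boundary exceeds \<delta>.\<close>

definition mollify :: "real \<Rightarrow> real \<Rightarrow> (real \<Rightarrow> 'v::euclidean_space) \<Rightarrow> real \<Rightarrow> nat \<Rightarrow> real \<Rightarrow> 'v" where
  "mollify a b f \<delta> k x = (1 / (\<delta> * bump_mass)) *\<^sub>R integral {a..b} (\<lambda>y. ((1/\<delta>) ^ k * bump_deriv k ((-1/\<delta>) * y + x / \<delta>)) *\<^sub>R f y)"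

lemma mollify_deriv:
  assumes "continuous_on {a..b} f"
  shows "(mollify a b f \<delta> k has_vector_derivative mollify a b f \<delta> (Suc k) x) (at x)"
proof -
  have "((\<lambda>x. integral (cbox a b) (\<lambda>y. ((1/\<delta>) ^ k * bump_deriv k ((-1/\<delta>) * y + x / \<delta>)) *\<^sub>R f y)) has_vector_derivative
     integral (cbox a b) (\<lambda>y. ((1/\<delta>) ^ Suc k * bump_deriv (Suc k) ((-1/\<delta>) * y + x / \<delta>)) *\<^sub>R f y)) (at x within UNIV)"
  proof (rule leibniz_rule_vector_derivative)
    fix x t
    have "((\<lambda>x. (1/\<delta>) ^ k * bump_deriv k ((-1/\<delta>) * t + x / \<delta>)) has_real_derivative (1/\<delta>) ^ Suc k * bump_deriv (Suc k) ((-1/\<delta>) * t + x / \<delta>)) (at x)"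
    proof -
      have "((\<lambda>x. (-1/\<delta>) * t + x / \<delta>) has_real_derivative 1 / \<delta>) (at x)"
      proof -
        have "((\<lambda>x. x / \<delta>) has_real_derivative 1 / \<delta>) (at x)" using DERIV_cdivide[OF DERIV_ident] by blast
        from DERIV_add[OF DERIV_const[of "(-1/\<delta>) * t"] this] show ?thesis by simp
      qed
      from bump_deriv_chain[OF this, of "(1/\<delta>) ^ k" k] show ?thesis by (simp add: mult_ac)
    qed
    then show "((\<lambda>x. ((1/\<delta>) ^ k * bump_deriv k ((-1/\<delta>) * t + x / \<delta>)) *\<^sub>R f t) has_vector_derivative ((1/\<delta>) ^ Suc k * bump_deriv (Suc k) ((-1/\<delta>) * t + x / \<delta>)) *\<^sub>R f t) (at x within UNIV)"
      using has_vector_derivative_scaleR[of _ _ x UNIV "\<lambda>_. f t" 0] by auto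
  next
    show "(\<lambda>y. ((1/\<delta>) ^ k * bump_deriv k ((-1/\<delta>) * y + x / \<delta>)) *\<^sub>R f y) integrable_on cbox a b" for x
      unfolding divide_inverse by (intro integrable_continuous continuous_intros) (use assms in simp)
    show "continuous_on (UNIV \<times> cbox a b) (\<lambda>(x, y). ((1/\<delta>) ^ Suc k * bump_deriv (Suc k) ((-1/\<delta>) * y + x / \<delta>)) *\<^sub>R f y)"
      unfolding split_def divide_inverse
      by (intro continuous_intros continuous_on_compose2[OF assms]) auto
  qed auto
  then show ?thesis unfolding mollify_def cbox_interval
    by (intro bounded_linear.has_vector_derivative[OF bounded_linear_scaleR_right]) simp
qed

lemma bump_deriv_scaled_integral:
  assumes "\<delta> > 0" "a < x - \<delta>" "x + \<delta> < b"
  shows "((\<lambda>y. bump_deriv 0 ((-1/\<delta>) * y + x / \<delta>)) has_integral \<delta> * bump_mass) {a..b}"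
proof -
  have "((\<lambda>y. bump_deriv 0 ((-1/\<delta>) *\<^sub>R y + x / \<delta>)) has_integral (1 / \<bar>-1/\<delta>\<bar> ^ DIM(real)) *\<^sub>R bump_mass)
     ((\<lambda>y. (1 / (-1/\<delta>)) *\<^sub>R y + - ((1 / (-1/\<delta>)) *\<^sub>R (x / \<delta>))) ` cbox (-1) 1)"
    by (rule has_integral_affinity) (use bump_mass_integral assms in auto)
  moreover have "(\<lambda>y. (1 / (-1/\<delta>)) *\<^sub>R y + - ((1 / (-1/\<delta>)) *\<^sub>R (x / \<delta>))) ` cbox (-1) 1 = {x - \<delta>..x + \<delta>}"
  proof -
    have "(\<lambda>y. (1 / (-1/\<delta>)) *\<^sub>R y + - ((1 / (-1/\<delta>)) *\<^sub>R (x / \<delta>))) = (\<lambda>y. (-\<delta>) * y + x)"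
      using assms(1) by auto
    then show ?thesis using assms(1) image_affinity_atLeastAtMost[of "-\<delta>" x "-1" 1] by simp
  qed
  ultimately have "((\<lambda>y. bump_deriv 0 ((-1/\<delta>) * y + x / \<delta>)) has_integral \<delta> * bump_mass) {x - \<delta>..x + \<delta>}"
    using assms(1) by simp
  then show ?thesis
  proof (rule has_integral_on_superset)
    fix y assume y: "y \<notin> {x - \<delta>..x + \<delta>}"
    have "\<bar>(-1/\<delta>) * y + x / \<delta>\<bar> = \<bar>x - y\<bar> / \<delta>" by (rule affine_abs[OF assms(1)])
    also have "1 \<le> \<dots>" using y assms(1) by (auto simp: le_divide_eq)
    finally show "bump_deriv 0 ((-1/\<delta>) * y + x / \<delta>) = 0" by (rule bump_deriv_out)
  qed (use assms in auto)
qed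

text \<open>As a function of y the kernel is a test function, so its derivatives can be exchanged
  for the weak derivative g. Derivatives in x and in y differ by the sign (-1)^k, which cancels the
  sign in \<open>weak_deriv\<close>. What remains is an average of g against a nonnegative kernel of
  mass one.\<close>

lemma mollify_bound:
  fixes f g :: "real \<Rightarrow> 'v::euclidean_space"
  assumes f: "continuous_on {a..b} f" and w: "weak_deriv a b k f g"
    and g: "AE x in lebesgue_on {a<..<b}. norm (g x) \<le> B"
    and \<delta>: "\<delta> > 0" "a < x - \<delta>" "x + \<delta> < b"
  shows "norm (mollify a b f \<delta> k x) \<le> B"
proof -
  let ?\<phi> = "\<lambda>y. bump_deriv 0 ((-1/\<delta>) * y + x / \<delta>)"
  have c: "continuous_on S ?\<phi>" for S unfolding divide_inverse by (intro continuous_intros)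
  have "(LINT y|lebesgue_on {a<..<b}. ((deriv ^^ k) ?\<phi> y) *\<^sub>R f y) = (-1) ^ k *\<^sub>R (LINT y|lebesgue_on {a<..<b}. ?\<phi> y *\<^sub>R g y)"
    using w test_fun_affine[OF \<delta>] unfolding weak_deriv_def by blast
  then have 1: "integral {a..b} (\<lambda>y. ((-1/\<delta>) ^ k * bump_deriv k ((-1/\<delta>) * y + x / \<delta>)) *\<^sub>R f y) = (-1) ^ k *\<^sub>R (LINT y|lebesgue_on {a<..<b}. ?\<phi> y *\<^sub>R g y)"
    unfolding deriv_affine
    by (subst (asm) lint_cont(2)) (auto simp: divide_inverse intro!: continuous_intros f)
  have "integral {a..b} (\<lambda>y. ((1/\<delta>) ^ k * bump_deriv k ((-1/\<delta>) * y + x / \<delta>)) *\<^sub>R f y)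
    = integral {a..b} (\<lambda>y. (-1) ^ k *\<^sub>R (((-1/\<delta>) ^ k * bump_deriv k ((-1/\<delta>) * y + x / \<delta>)) *\<^sub>R f y))"
  proof -
    have p: "(1/\<delta>) ^ k = (-1) ^ k * (-1/\<delta>) ^ k" by (simp add: power_mult_distrib[symmetric])
    show ?thesis unfolding p by (simp only: scaleR_scaleR mult.assoc)
  qed
  also have "\<dots> = (LINT y|lebesgue_on {a<..<b}. ?\<phi> y *\<^sub>R g y)"
    unfolding integral_cmul 1 by (simp flip: power_mult_distrib)
  finally have 2: "mollify a b f \<delta> k x = (1 / (\<delta> * bump_mass)) *\<^sub>R (LINT y|lebesgue_on {a<..<b}. ?\<phi> y *\<^sub>R g y)"
    unfolding mollify_def by simp
  have "a < b" using \<delta> by simp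
  \<comment> \<open>The sign of B is not among the assumptions; a negative essential bound for a
    norm would make the whole nonempty interval a null set.\<close>
  have B: "0 \<le> B"
  proof (rule ccontr)
    assume neg: "\<not> 0 \<le> B"
    have "AE x in lebesgue_on {a<..<b}. x \<notin> {a<..<b}"
      using g
    proof eventually_elim
      case (elim x)
      then show ?case using order_trans[OF norm_ge_zero elim] neg by simp
    qed
    then have "emeasure (lebesgue_on {a<..<b}) {a<..<b} = 0"
      by (subst (asm) AE_iff_measurable[of "{a<..<b}"]) (auto simp: space_restrict_space sets_restrict_space_iff)
    then show False using \<open>a < b\<close> by (simp add: emeasure_restrict_space)
  qed
  have "norm (LINT y|lebesgue_on {a<..<b}. ?\<phi> y *\<^sub>R g y) \<le> (LINT y|lebesgue_on {a<..<b}. norm (?\<phi> y *\<^sub>R g y))"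
    by (rule integral_norm_bound)
  also have "\<dots> \<le> (LINT y|lebesgue_on {a<..<b}. ?\<phi> y * B)"
  proof (rule integral_mono_AE')
    show "integrable (lebesgue_on {a<..<b}) (\<lambda>y. ?\<phi> y * B)"
      by (rule lint_cont(1)) (intro continuous_intros c)
    show "AE y in lebesgue_on {a<..<b}. norm (?\<phi> y *\<^sub>R g y) \<le> ?\<phi> y * B"
      using g by eventually_elim (simp add: bump_deriv_nonneg mult_left_mono)
    show "AE y in lebesgue_on {a<..<b}. 0 \<le> ?\<phi> y * B"
      using B by (simp add: bump_deriv_nonneg)
  qed
  also have "\<dots> = integral {a..b} (\<lambda>y. ?\<phi> y * B)"
    by (rule lint_cont(2)) (intro continuous_intros c)
  also have "\<dots> = \<delta> * bump_mass * B"
    by (rule integral_unique[OF has_integral_mult_left[OF bump_deriv_scaled_integral[OF \<delta>]]])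
  finally have "norm (LINT y|lebesgue_on {a<..<b}. ?\<phi> y *\<^sub>R g y) \<le> \<delta> * bump_mass * B" .
  then have "norm (mollify a b f \<delta> k x) \<le> (1 / (\<delta> * bump_mass)) * (\<delta> * bump_mass * B)"
    unfolding 2 norm_scaleR using \<delta>(1) bump_mass_pos by (intro mult_mono) auto
  then show ?thesis using \<delta>(1) bump_mass_pos by simp
qed

lemma mollify_tendsto:
  fixes f :: "real \<Rightarrow> 'v::euclidean_space"
  assumes f: "continuous_on {a..b} f" and x: "x \<in> {a<..<b}"
  shows "(\<lambda>n. mollify a b f (1 / real (Suc n)) 0 x) \<longlonglongrightarrow> f x"
proof (rule LIMSEQ_I)
  fix e :: real assume e: "e > 0"
  have "isCont f x" using continuous_on_interior[OF f] x by simp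
  then obtain d where d: "d > 0" "\<And>y. \<bar>y - x\<bar> < d \<Longrightarrow> norm (f y - f x) < e / 2"
    using e unfolding continuous_at_eps_delta dist_norm real_norm_def by (metis half_gt_zero)
  define d' where "d' = min d (min (x - a) (b - x))"
  have d': "d' > 0" using d(1) x by (simp add: d'_def)
  obtain n0 where n0: "1 / real (Suc n0) < d'" using d' by (meson nat_approx_posE)
  show "\<exists>n0. \<forall>n\<ge>n0. norm (mollify a b f (1 / real (Suc n)) 0 x - f x) < e"
  proof (intro exI allI impI)
    fix n assume n: "n \<ge> n0"
    define \<delta> where "\<delta> = 1 / real (Suc n)"
    have "\<delta> \<le> 1 / real (Suc n0)" unfolding \<delta>_def using n by (intro divide_left_mono) auto
    then have \<delta>: "\<delta> > 0" "a < x - \<delta>" "x + \<delta> < b" "\<delta> < d"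
      using n0 by (auto simp: \<delta>_def d'_def)
    let ?\<phi> = "\<lambda>y. bump_deriv 0 ((-1/\<delta>) * y + x / \<delta>)"
    have c: "continuous_on S ?\<phi>" for S unfolding divide_inverse by (intro continuous_intros)
    note I = bump_deriv_scaled_integral[OF \<delta>(1-3)]
    have 1: "((\<lambda>y. ?\<phi> y *\<^sub>R f y - ?\<phi> y *\<^sub>R f x) has_integral integral {a..b} (\<lambda>y. ?\<phi> y *\<^sub>R f y) - (\<delta> * bump_mass) *\<^sub>R f x) {a..b}"
      by (intro has_integral_diff has_integral_scaleR_left I integrable_integral integrable_continuous_interval continuous_intros c f)
    have 2: "((\<lambda>y. ?\<phi> y * (e / 2)) has_integral \<delta> * bump_mass * (e / 2)) {a..b}"
      by (rule has_integral_mult_left[OF I])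
    have le: "norm (?\<phi> y *\<^sub>R f y - ?\<phi> y *\<^sub>R f x) \<le> ?\<phi> y * (e / 2)" for y
    proof (cases "\<bar>y - x\<bar> < \<delta>")
      case True
      then have "norm (f y - f x) \<le> e / 2" using d(2)[of y] \<delta>(4) by simp
      from mult_left_mono[OF this bump_deriv_nonneg]
      have "?\<phi> y * norm (f y - f x) \<le> ?\<phi> y * (e / 2)" .
      then show ?thesis unfolding scaleR_diff_right[symmetric] norm_scaleR using bump_deriv_nonneg by (simp only: abs_of_nonneg)
    next
      case False
      have "\<bar>(-1/\<delta>) * y + x / \<delta>\<bar> = \<bar>x - y\<bar> / \<delta>" by (rule affine_abs[OF \<delta>(1)])
      also have "1 \<le> \<dots>" using False \<delta>(1) by (auto simp: le_divide_eq)
      finally show ?thesis by (simp only: bump_deriv_out) simp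
    qed
    have "norm (integral {a..b} (\<lambda>y. ?\<phi> y *\<^sub>R f y) - (\<delta> * bump_mass) *\<^sub>R f x) \<le> \<delta> * bump_mass * (e / 2)"
      using integral_norm_bound_integral[OF has_integral_integrable[OF 1] has_integral_integrable[OF 2] le]
      by (simp only: integral_unique[OF 1] integral_unique[OF 2])
    moreover have "mollify a b f \<delta> 0 x - f x = (1 / (\<delta> * bump_mass)) *\<^sub>R (integral {a..b} (\<lambda>y. ?\<phi> y *\<^sub>R f y) - (\<delta> * bump_mass) *\<^sub>R f x)"
      using \<delta>(1) bump_mass_pos by (simp add: mollify_def scaleR_diff_right)
    ultimately have "norm (mollify a b f \<delta> 0 x - f x) \<le> (1 / (\<delta> * bump_mass)) * (\<delta> * bump_mass * (e / 2))"
      unfolding norm_scaleR using \<delta>(1) bump_mass_pos by (simp only: norm_scaleR) (intro mult_mono; simp)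
    also have "\<dots> = e / 2" using \<delta>(1) bump_mass_pos by simp
    also have "\<dots> < e" using e by simp
    finally show "norm (mollify a b f (1 / real (Suc n)) 0 x - f x) < e" by (simp only: \<delta>_def)
  qed
qed

section \<open>Derivatives of limits, and classical derivatives from weak ones\<close>

lemma has_vector_derivative_iff_slope:
  "(f has_vector_derivative f') (at x within S) \<longleftrightarrow>
     ((\<lambda>y. (f y - f x) /\<^sub>R (y - x)) \<longlongrightarrow> f') (at x within S)"
proof -
  have "(f has_vector_derivative f') (at x within S) \<longleftrightarrow>
     ((\<lambda>y. norm (f y - f x - (y - x) *\<^sub>R f') / norm (y - x)) \<longlongrightarrow> 0) (at x within S)"
    unfolding has_vector_derivative_def has_derivative_iff_norm
    by (simp add: bounded_linear_scaleR_left)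
  also have "\<dots> \<longleftrightarrow> ((\<lambda>y. norm ((f y - f x) /\<^sub>R (y - x) - f')) \<longlongrightarrow> 0) (at x within S)"
  proof (rule tendsto_cong)
    have "norm (f y - f x - (y - x) *\<^sub>R f') / norm (y - x) = norm ((f y - f x) /\<^sub>R (y - x) - f')"
      if "y \<noteq> x" for y
    proof -
      have "(f y - f x) /\<^sub>R (y - x) - f' = (f y - f x - (y - x) *\<^sub>R f') /\<^sub>R (y - x)"
        using that by (simp add: scaleR_diff_right)
      then show ?thesis by (simp add: divide_inverse mult.commute)
    qed
    then show "\<forall>\<^sub>F y in at x within S. norm (f y - f x - (y - x) *\<^sub>R f') / norm (y - x) = norm ((f y - f x) /\<^sub>R (y - x) - f')"
      by (auto simp: eventually_at_filter)
  qed
  also have "\<dots> \<longleftrightarrow> ((\<lambda>y. (f y - f x) /\<^sub>R (y - x)) \<longlongrightarrow> f') (at x within S)"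
    by (simp add: tendsto_norm_zero_iff LIM_zero_iff)
  finally show ?thesis .
qed

lemma lip_of_deriv_ivl:
  fixes f :: "real \<Rightarrow> 'a::real_normed_vector"
  assumes "convex S" "\<And>x. x \<in> S \<Longrightarrow> (f has_vector_derivative f' x) (at x within S)" "\<And>x. x \<in> S \<Longrightarrow> norm (f' x) \<le> B"
    "x \<in> S" "y \<in> S"
  shows "norm (f x - f y) \<le> B * \<bar>x - y\<bar>"
proof -
  have "norm (f x - f y) \<le> B * norm (x - y)"
  proof (rule differentiable_bound[OF assms(1), of f "\<lambda>x h. h *\<^sub>R f' x"])
    show "onorm (\<lambda>h. h *\<^sub>R f' x) \<le> B" if "x \<in> S" for x
      using assms(3)[OF that] by (intro onorm_le) (metis abs_ge_zero mult.commute mult_left_mono norm_scaleR real_norm_def)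
  qed (use assms in \<open>auto simp: has_vector_derivative_def\<close>)
  then show ?thesis by simp
qed

text \<open>Derivatives of a pointwise convergent sequence converge if they are equi-Lipschitz: the
  difference quotients with a fixed increment \<open>h\<close> converge and differ from the derivatives by at most
  \<open>B\<bar>h\<bar>\<close>.\<close>

lemma tendsto_deriv:
  fixes G :: "nat \<Rightarrow> real \<Rightarrow> 'a::banach"
  assumes r: "r > 0"
    and G: "\<And>n y. n \<ge> n0 \<Longrightarrow> \<bar>y - x\<bar> < r \<Longrightarrow> (G n has_vector_derivative G' n y) (at y)"
    and lip: "\<And>n y. n \<ge> n0 \<Longrightarrow> \<bar>y - x\<bar> < r \<Longrightarrow> norm (G' n y - G' n x) \<le> B * \<bar>y - x\<bar>"
    and lim: "\<And>y. \<bar>y - x\<bar> < r \<Longrightarrow> (\<lambda>n. G n y) \<longlonglongrightarrow> g y"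
  shows "\<exists>l. (\<lambda>n. G' n x) \<longlonglongrightarrow> l \<and> (g has_vector_derivative l) (at x)"
proof -
  have B: "0 \<le> B"
  proof -
    have "0 \<le> B * \<bar>(x + r/2) - x\<bar>" using order_trans[OF norm_ge_zero lip[of n0 "x + r/2"]] r by simp
    then show ?thesis using r by (simp add: zero_le_mult_iff)
  qed
  have est: "norm (G n y - G n x - (y - x) *\<^sub>R G' n x) \<le> B * \<bar>y - x\<bar> * \<bar>y - x\<bar>" if n: "n \<ge> n0" and y: "\<bar>y - x\<bar> < r" for n y
  proof -
    let ?S = "closed_segment x y" and ?F = "\<lambda>z. G n z - (z - x) *\<^sub>R G' n x"
    have S: "\<bar>z - x\<bar> \<le> \<bar>y - x\<bar>" if "z \<in> ?S" for z
      using that by (auto simp: closed_segment_eq_real_ivl split: if_splits)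
    have "norm (?F y - ?F x) \<le> B * \<bar>y - x\<bar> * \<bar>y - x\<bar>"
    proof (rule lip_of_deriv_ivl[where S="?S" and f'="\<lambda>z. G' n z - G' n x"])
      fix z assume z: "z \<in> ?S"
      have zr: "\<bar>z - x\<bar> < r" using S[OF z] y by simp
      have "((\<lambda>z. (z - x) *\<^sub>R G' n x) has_vector_derivative G' n x) (at z)"
        by (auto intro!: derivative_eq_intros)
      from has_vector_derivative_diff[OF G[OF n zr] this]
      show "(?F has_vector_derivative G' n z - G' n x) (at z within ?S)"
        by (rule has_vector_derivative_at_within)
      show "norm (G' n z - G' n x) \<le> B * \<bar>y - x\<bar>"
        using lip[OF n zr] mult_left_mono[OF S[OF z] B] by linarith
    qed auto
    then show ?thesis by (simp add: algebra_simps)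
  qed
  define Q where "Q n h = (G n (x + h) - G n x) /\<^sub>R h" for n h
  have Qest: "norm (Q n h - G' n x) \<le> B * \<bar>h\<bar>" if "n \<ge> n0" "h \<noteq> 0" "\<bar>h\<bar> < r" for n h
  proof -
    have "Q n h - G' n x = (G n (x + h) - G n x - h *\<^sub>R G' n x) /\<^sub>R h"
      using that by (simp add: Q_def scaleR_diff_right)
    then have "norm (Q n h - G' n x) = norm (G n (x + h) - G n x - h *\<^sub>R G' n x) / \<bar>h\<bar>"
      by (simp add: divide_inverse mult.commute)
    also have "\<dots> \<le> (B * \<bar>h\<bar> * \<bar>h\<bar>) / \<bar>h\<bar>"
      using est[of n "x + h"] that by (intro divide_right_mono) auto
    finally show ?thesis using that by simp
  qed
  have Qlim: "(\<lambda>n. Q n h) \<longlonglongrightarrow> (g (x + h) - g x) /\<^sub>R h" if "\<bar>h\<bar> < r" for h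
    unfolding Q_def using lim[of "x + h"] lim[of x] that r by (intro tendsto_intros) auto
  have "Cauchy (\<lambda>n. G' n x)"
  proof (rule metric_CauchyI)
    fix e :: real assume e: "e > 0"
    \<comment> \<open>The increment is fixed so small that replacing a derivative by its difference
      quotient costs less than e/3, once for p and once for q; the third e/3 is for the Cauchy
      property of the quotients. The summand 1 in B + 1 avoids a division by zero.\<close>
    define h where "h = min (r / 2) (e / (4 * (B + 1)))"
    have h: "h > 0" "h < r" "B * h < e / 3"
    proof -
      show "h > 0" "h < r" using r e B by (auto simp: h_def)
      have "B * h \<le> B * (e / (4 * (B + 1)))" using B by (intro mult_left_mono) (auto simp: h_def)
      also have "\<dots> = (e / 4) * (B / (B + 1))" by simp
      also have "\<dots> \<le> (e / 4) * 1" using B e by (intro mult_left_mono) auto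
      finally show "B * h < e / 3" using e by simp
    qed
    have "Cauchy (\<lambda>n. Q n h)" using Qlim[of h] h by (intro LIMSEQ_imp_Cauchy) auto
    then obtain n1 where n1: "\<And>p q. p \<ge> n1 \<Longrightarrow> q \<ge> n1 \<Longrightarrow> dist (Q p h) (Q q h) < e / 3"
      using e by (metis metric_CauchyD zero_less_divide_iff zero_less_numeral)
    show "\<exists>M. \<forall>p\<ge>M. \<forall>q\<ge>M. dist (G' p x) (G' q x) < e"
    proof (intro exI[of _ "max n0 n1"] allI impI)
      fix p q assume "p \<ge> max n0 n1" "q \<ge> max n0 n1"
      then have pq: "norm (Q p h - G' p x) \<le> B * h" "norm (Q q h - G' q x) \<le> B * h" "dist (Q p h) (Q q h) < e / 3"
        using Qest[of p h] Qest[of q h] n1[of p q] h by auto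
      have "dist (G' p x) (G' q x) \<le> dist (G' p x) (Q p h) + (dist (Q p h) (Q q h) + dist (Q q h) (G' q x))"
        using dist_triangle[of "G' p x" "G' q x" "Q p h"] dist_triangle[of "Q p h" "G' q x" "Q q h"] by linarith
      also have "\<dots> < e" using pq h(3) by (simp add: dist_norm norm_minus_commute)
      finally show "dist (G' p x) (G' q x) < e" .
    qed
  qed
  then obtain l where l: "(\<lambda>n. G' n x) \<longlonglongrightarrow> l" using Cauchy_convergent convergent_def by blast
  have le: "norm ((g (x + h) - g x) /\<^sub>R h - l) \<le> B * \<bar>h\<bar>" if h: "h \<noteq> 0" "\<bar>h\<bar> < r" for h
  proof (rule LIMSEQ_le_const2)
    show "(\<lambda>n. norm (Q n h - G' n x)) \<longlonglongrightarrow> norm ((g (x + h) - g x) /\<^sub>R h - l)"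
      by (intro tendsto_intros Qlim h l)
    show "\<exists>N. \<forall>n\<ge>N. norm (Q n h - G' n x) \<le> B * \<bar>h\<bar>" using Qest h by blast
  qed
  have "((\<lambda>h. (g (x + h) - g x) /\<^sub>R h) \<longlongrightarrow> l) (at 0)"
  proof (rule LIM_zero_cancel, rule Lim_null_comparison)
    show "\<forall>\<^sub>F h in at 0. norm ((g (x + h) - g x) /\<^sub>R h - l) \<le> B * \<bar>h\<bar>"
      unfolding eventually_at using r le by (intro exI[of _ r]) (auto simp: dist_norm)
    show "((\<lambda>h. B * \<bar>h\<bar>) \<longlongrightarrow> 0) (at 0)" by (auto intro!: tendsto_eq_intros)
  qed
  then have "(g has_vector_derivative l) (at x)"
    unfolding has_vector_derivative_iff_slope
    using LIM_offset_zero_cancel[where f="\<lambda>y. (g y - g x) /\<^sub>R (y - x)" and a=x and L=l] by simp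
  with l show ?thesis by blast
qed

text \<open>The mollifications converge together with their derivatives, one order after the other:
  the bound on order k + 2 makes the mollified derivatives of order k + 1 equi-Lipschitz, which is
  what \<open>tendsto_deriv\<close> asks for. The bound of order m comes last and has no further
  derivative above it, so it survives only as a Lipschitz estimate for order m - 1.\<close>

lemma weak_chain:
  fixes f :: "real \<Rightarrow> 'v::euclidean_space"
  assumes f: "continuous_on {a..b} f"
    and w: "\<And>k. k \<le> m \<Longrightarrow> weak_deriv a b k f (g k)"
    and g: "\<And>k. k \<le> m \<Longrightarrow> AE x in lebesgue_on {a<..<b}. norm (g k x) \<le> B k"
  obtains h where "\<And>x. x \<in> {a<..<b} \<Longrightarrow> h 0 x = f x"
    "\<And>k x. Suc k < m \<Longrightarrow> x \<in> {a<..<b} \<Longrightarrow> (h k has_vector_derivative h (Suc k) x) (at x)"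
    "\<And>k x. k < m \<Longrightarrow> x \<in> {a<..<b} \<Longrightarrow> norm (h k x) \<le> B k"
    "\<And>x y. 0 < m \<Longrightarrow> x \<in> {a<..<b} \<Longrightarrow> y \<in> {a<..<b} \<Longrightarrow> norm (h (m - 1) x - h (m - 1) y) \<le> B m * \<bar>x - y\<bar>"
proof -
  define F where "F n k = mollify a b f (1 / real (Suc n)) k" for n k
  have Fd: "(F n k has_vector_derivative F n (Suc k) x) (at x)" for n k x
    unfolding F_def by (rule mollify_deriv[OF f])
  \<comment> \<open>The radius of the mollifier has to stay below the distance to the boundary, so
    the bounds hold on compact subintervals and for large n only.\<close>
  have Fb: "\<exists>n0. \<forall>n\<ge>n0. \<forall>k\<le>m. \<forall>x\<in>{c..d}. norm (F n k x) \<le> B k" if cd: "a < c" "d < b" for c d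
  proof -
    define e where "e = min (c - a) (b - d)"
    have "e > 0" using cd by (simp add: e_def)
    then obtain n0 where n0: "1 / real (Suc n0) < e" by (meson nat_approx_posE)
    have "norm (F n k x) \<le> B k" if "n \<ge> n0" "k \<le> m" "x \<in> {c..d}" for n k x
    proof -
      have "1 / real (Suc n) \<le> 1 / real (Suc n0)" using that(1) by (intro divide_left_mono) auto
      then have d: "1 / real (Suc n) > 0" "a < x - 1 / real (Suc n)" "x + 1 / real (Suc n) < b"
        using n0 that(3) by (auto simp: e_def)
      show ?thesis unfolding F_def by (rule mollify_bound[OF f w[OF that(2)] g[OF that(2)] d])
    qed
    then show ?thesis by blast
  qed
  define h where "h k x = lim (\<lambda>n. F n k x)" for k x
  have step: "(\<lambda>n. F n (Suc k) x) \<longlonglongrightarrow> h (Suc k) x \<and> (h k has_vector_derivative h (Suc k) x) (at x)"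
    if k: "Suc k < m" and IH: "\<And>y. y \<in> {a<..<b} \<Longrightarrow> (\<lambda>n. F n k y) \<longlonglongrightarrow> h k y" and x: "x \<in> {a<..<b}" for k x
  proof -
    define r where "r = min (x - a) (b - x) / 2"
    have r: "r > 0" using x by (simp add: r_def)
    have ab: "a < x - r" "x + r < b" using x by (auto simp: r_def min_def field_simps)
    obtain n0 where n0: "\<And>n k y. n \<ge> n0 \<Longrightarrow> k \<le> m \<Longrightarrow> y \<in> {x - r..x + r} \<Longrightarrow> norm (F n k y) \<le> B k"
      using Fb[OF ab] by blast
    have "\<exists>l. (\<lambda>n. F n (Suc k) x) \<longlonglongrightarrow> l \<and> (h k has_vector_derivative l) (at x)"
    proof (rule tendsto_deriv[OF r])
      show "norm (F n (Suc k) y - F n (Suc k) x) \<le> B (Suc (Suc k)) * \<bar>y - x\<bar>" if "n \<ge> n0" "\<bar>y - x\<bar> < r" for n y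
        by (rule lip_of_deriv_ivl[of "{x - r..x + r}" _ "F n (Suc (Suc k))"])
          (use that n0 k r in \<open>auto intro: has_vector_derivative_at_within[OF Fd]\<close>)
      show "(\<lambda>n. F n k y) \<longlonglongrightarrow> h k y" if "\<bar>y - x\<bar> < r" for y
        using that ab by (intro IH) auto
    qed (rule Fd)
    then obtain l where l: "(\<lambda>n. F n (Suc k) x) \<longlonglongrightarrow> l" "(h k has_vector_derivative l) (at x)" by blast
    moreover have "h (Suc k) x = l" unfolding h_def by (rule limI[OF l(1)])
    ultimately show ?thesis by simp
  qed
  have F0: "(\<lambda>n. F n 0 x) \<longlonglongrightarrow> f x" if "x \<in> {a<..<b}" for x
    unfolding F_def by (rule mollify_tendsto[OF f that])
  have h0: "h 0 x = f x" if "x \<in> {a<..<b}" for x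
    unfolding h_def by (rule limI[OF F0[OF that]])
  have lim: "(\<lambda>n. F n k x) \<longlonglongrightarrow> h k x" if "k < m" "x \<in> {a<..<b}" for k x
    using that
  proof (induction k arbitrary: x)
    case 0 then show ?case using F0 h0 by simp
  next
    case (Suc k) then show ?case using step[of k x] by simp
  qed
  show ?thesis
  proof (rule that[of h])
    show "h 0 x = f x" if "x \<in> {a<..<b}" for x by (rule h0[OF that])
    show "(h k has_vector_derivative h (Suc k) x) (at x)" if "Suc k < m" "x \<in> {a<..<b}" for k x
      using step[OF that(1) lim that(2)] that(1) by simp
    show "norm (h k x) \<le> B k" if k: "k < m" and x: "x \<in> {a<..<b}" for k x
    proof (rule LIMSEQ_le_const2)
      show "(\<lambda>n. norm (F n k x)) \<longlonglongrightarrow> norm (h k x)" by (intro tendsto_intros lim k x)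
      have ab: "a < x" "x < b" using x by auto
      obtain n0 where "\<And>n k y. n \<ge> n0 \<Longrightarrow> k \<le> m \<Longrightarrow> y \<in> {x..x} \<Longrightarrow> norm (F n k y) \<le> B k"
        using Fb[OF ab] by blast
      then show "\<exists>N. \<forall>n\<ge>N. norm (F n k x) \<le> B k" using k by (intro exI[of _ n0]) auto
    qed
    show "norm (h (m - 1) x - h (m - 1) y) \<le> B m * \<bar>x - y\<bar>" if m: "0 < m" and xy: "x \<in> {a<..<b}" "y \<in> {a<..<b}" for x y
    proof (rule LIMSEQ_le_const2)
      show "(\<lambda>n. norm (F n (m - 1) x - F n (m - 1) y)) \<longlonglongrightarrow> norm (h (m - 1) x - h (m - 1) y)"
        using m by (intro tendsto_intros lim xy) auto
      have ab: "a < min x y" "max x y < b" using xy by auto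
      obtain n0 where n0: "\<And>n k z. n \<ge> n0 \<Longrightarrow> k \<le> m \<Longrightarrow> z \<in> {min x y..max x y} \<Longrightarrow> norm (F n k z) \<le> B k"
        using Fb[OF ab] by blast
      have "norm (F n (m - 1) x - F n (m - 1) y) \<le> B m * \<bar>x - y\<bar>" if "n \<ge> n0" for n
        by (rule lip_of_deriv_ivl[of "{min x y..max x y}" _ "F n m"])
          (use that n0 m Fd[of n "m - 1"] in \<open>auto intro: has_vector_derivative_at_within\<close>)
      then show "\<exists>N. \<forall>n\<ge>N. norm (F n (m - 1) x - F n (m - 1) y) \<le> B m * \<bar>x - y\<bar>" by blast
    qed
  qed
qed

section \<open>From almost everywhere to everywhere, and up to the end points\<close>

lemma AE_dense:
  fixes U S :: "real set"
  assumes "AE x in lebesgue_on S. P x" "S \<in> sets lebesgue" "open U" "U \<noteq> {}" "U \<subseteq> S"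
  shows "\<exists>x\<in>U. P x"
proof (rule ccontr)
  assume n: "\<not> (\<exists>x\<in>U. P x)"
  have "AE x in lebesgue. x \<in> S \<longrightarrow> P x"
    using assms(1,2) by (simp add: AE_restrict_space_iff)
  then obtain N where N: "\<And>x. x \<in> space lebesgue - N \<Longrightarrow> x \<in> S \<longrightarrow> P x" "N \<in> null_sets lebesgue"
    by (rule AE_E3) blast
  have "U \<subseteq> N" using n assms(5) N(1) by auto
  moreover have "negligible N" using N(2) by (simp add: negligible_iff_null_sets)
  ultimately have "negligible U" by (rule negligible_subset[rotated])
  then show False using open_not_negligible assms(3,4) by blast
qed

lemma Linf_norm_AE: "Linf_norm a b f \<le> ereal B \<Longrightarrow> AE x in lebesgue_on {a<..<b}. norm (f x) \<le> B"
proof -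
  assume "Linf_norm a b f \<le> ereal B"
  then have le: "esssup (lebesgue_on {a<..<b}) (\<lambda>x. ereal (norm (f x))) \<le> ereal B" by (simp add: Linf_norm_def)
  have "AE x in lebesgue_on {a<..<b}. ereal (norm (f x)) \<le> esssup (lebesgue_on {a<..<b}) (\<lambda>x. ereal (norm (f x)))"
    by (rule esssup_AE)
  then show ?thesis
  proof eventually_elim
    case (elim x)
    from order_trans[OF elim le] show ?case by simp
  qed
qed

lemma continuous_AE_bound:
  fixes f :: "real \<Rightarrow> 'v::real_normed_vector"
  assumes c: "continuous_on {a<..<b} f" and ae: "AE x in lebesgue_on {a<..<b}. norm (f x) \<le> B" and x: "x \<in> {a<..<b}"
  shows "norm (f x) \<le> B"
proof (rule ccontr)
  assume "\<not> norm (f x) \<le> B"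
  moreover have o: "open {y \<in> {a<..<b}. norm (f y) \<in> {B<..}}"
  proof -
    have "{y \<in> {a<..<b}. norm (f y) \<in> {B<..}} = {a<..<b} \<inter> (\<lambda>y. norm (f y)) -` {B<..}" by auto
    then show ?thesis
      using continuous_open_preimage[OF continuous_on_norm[OF c] open_greaterThanLessThan open_greaterThan] by simp
  qed
  ultimately have "\<exists>y\<in>{y \<in> {a<..<b}. norm (f y) \<in> {B<..}}. norm (f y) \<le> B"
    using x by (intro AE_dense[OF ae _ o]) auto
  then show False by auto
qed

text \<open>Class C^(m-1) on the closed interval, with one-sided derivatives at the end points. The
  derivative of order m is left out because an element of W^(m,\<infinity>) has it only almost
  everywhere; its bound is carried separately as a Lipschitz estimate.\<close>

definition cls :: "nat \<Rightarrow> real \<Rightarrow> real \<Rightarrow> (real \<Rightarrow> 'v::real_normed_vector) \<Rightarrow> bool" where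
  "cls m a b f \<longleftrightarrow> (\<forall>k<m. continuous_on {a..b} ((dx a b ^^ k) f)) \<and>
     (\<forall>k. Suc k < m \<longrightarrow> (\<forall>x\<in>{a..b}. ((dx a b ^^ k) f has_vector_derivative (dx a b ^^ Suc k) f x) (at x within {a..b})))"

lemma clsD: "cls m a b f \<Longrightarrow> k < m \<Longrightarrow> continuous_on {a..b} ((dx a b ^^ k) f)"
  "cls m a b f \<Longrightarrow> Suc k < m \<Longrightarrow> x \<in> {a..b} \<Longrightarrow> ((dx a b ^^ k) f has_vector_derivative (dx a b ^^ Suc k) f x) (at x within {a..b})"
  unfolding cls_def by blast+

text \<open>The fundamental theorem of calculus asks for the derivative in the interior only. The
  integral representation it gives is then differentiable up to the end points, since the integrand
  is continuous there.\<close>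

lemma deriv_closed:
  fixes g :: "real \<Rightarrow> 'v::banach"
  assumes c: "continuous_on {a..b} g" "continuous_on {a..b} g'"
    and d: "\<And>x. x \<in> {a<..<b} \<Longrightarrow> (g has_vector_derivative g' x) (at x)" and x: "x \<in> {a..b}"
  shows "(g has_vector_derivative g' x) (at x within {a..b})"
proof -
  have eq: "g y = g a + integral {a..y} g'" if y: "y \<in> {a..b}" for y
  proof -
    have "(g' has_integral (g y - g a)) {a..y}"
      by (rule fundamental_theorem_of_calculus_interior)
        (use y d in \<open>auto intro: continuous_on_subset[OF c(1)]\<close>)
    then show ?thesis by (simp add: integral_unique)
  qed
  have "((\<lambda>y. g a + integral {a..y} g') has_vector_derivative 0 + g' x) (at x within {a..b})"
    by (intro has_vector_derivative_add has_vector_derivative_const integral_has_vector_derivative c x)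
  then have D: "((\<lambda>y. g a + integral {a..y} g') has_vector_derivative g' x) (at x within {a..b})"
    by (simp only: add_0)
  show ?thesis
  proof (rule has_vector_derivative_transform[OF x _ D])
    show "g y = g a + integral {a..y} g'" if "y \<in> {a..b}" for y by (rule eq[OF that])
  qed
qed

lemma dx_interior: "x \<in> {a<..<b} \<Longrightarrow> (f has_vector_derivative f') (at x) \<Longrightarrow> dx a b f x = f'"
  by (simp add: dx_def at_within_Icc_at vector_derivative_at)

lemma chain_dx:
  assumes h: "\<And>x. x \<in> {a<..<b} \<Longrightarrow> h 0 x = f x"
    "\<And>k x. Suc k < m \<Longrightarrow> x \<in> {a<..<b} \<Longrightarrow> (h k has_vector_derivative h (Suc k) x) (at x)"
  shows "k < m \<Longrightarrow> x \<in> {a<..<b} \<Longrightarrow> (dx a b ^^ k) f x = h k x"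
proof (induction k arbitrary: x)
  case (Suc k)
  have "((dx a b ^^ k) f has_vector_derivative h (Suc k) x) (at x)"
    by (rule has_vector_derivative_transform_within_open[OF h(2)[OF Suc.prems] open_greaterThanLessThan Suc.prems(2)])
      (use Suc in auto)
  then show ?case using dx_interior[OF Suc.prems(2)] by simp
qed (use h(1) in simp)

lemma norm_le_closed:
  fixes f :: "real \<Rightarrow> 'v::real_normed_vector"
  assumes "a < b" "continuous_on {a..b} f" "\<And>x. x \<in> {a<..<b} \<Longrightarrow> norm (f x) \<le> B" "x \<in> {a..b}"
  shows "norm (f x) \<le> B"
proof (rule continuous_le_on_closure[of "{a<..<b}" "\<lambda>x. norm (f x)"])
  show "continuous_on (closure {a<..<b}) (\<lambda>x. norm (f x))"
    using continuous_on_norm[OF assms(2)] assms(1) by simp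
qed (use assms in simp_all)

lemma lip_closed:
  fixes f :: "real \<Rightarrow> 'v::real_normed_vector"
  assumes ab: "a < b" and c: "continuous_on {a..b} f"
    and l: "\<And>x y. x \<in> {a<..<b} \<Longrightarrow> y \<in> {a<..<b} \<Longrightarrow> norm (f x - f y) \<le> B * \<bar>x - y\<bar>"
    and xy: "x \<in> {a..b}" "y \<in> {a..b}"
  shows "norm (f x - f y) \<le> B * \<bar>x - y\<bar>"
proof -
  have cl: "closure {a<..<b} = {a..b}" using ab by simp
  have 1: "norm (f x - f y) - B * \<bar>x - y\<bar> \<le> 0" if x: "x \<in> {a<..<b}" and y: "y \<in> {a..b}" for x y
    by (rule continuous_le_on_closure[of "{a<..<b}" "\<lambda>y. norm (f x - f y) - B * \<bar>x - y\<bar>"])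
      (use l x y cl c in \<open>auto intro!: continuous_intros\<close>)
  have "norm (f x - f y) - B * \<bar>x - y\<bar> \<le> 0"
    by (rule continuous_le_on_closure[of "{a<..<b}" "\<lambda>x. norm (f x - f y) - B * \<bar>x - y\<bar>"])
      (use 1 xy cl c in \<open>auto intro!: continuous_intros\<close>)
  then show ?thesis by simp
qed

text \<open>The functions produced by \<open>weak_chain\<close> live on the open interval. They
  agree there with the iterated one-sided derivatives \<open>dx\<close>, and the assumed continuity
  of the latter carries differentiability and bounds to the end points.\<close>

lemma weak_classical:
  fixes f :: "real \<Rightarrow> 'v::euclidean_space"
  assumes ab: "a < b" and m: "0 < m" and c: "\<And>k. k < m \<Longrightarrow> continuous_on {a..b} ((dx a b ^^ k) f)"
    and w: "\<And>k. k \<le> m \<Longrightarrow> weak_deriv a b k f (g k)"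
    and g: "\<And>k. k \<le> m \<Longrightarrow> AE x in lebesgue_on {a<..<b}. norm (g k x) \<le> B k"
  shows "cls m a b f"
    and "k < m \<Longrightarrow> x \<in> {a..b} \<Longrightarrow> norm ((dx a b ^^ k) f x) \<le> B k"
    and "x \<in> {a..b} \<Longrightarrow> y \<in> {a..b} \<Longrightarrow> norm ((dx a b ^^ (m - 1)) f x - (dx a b ^^ (m - 1)) f y) \<le> B m * \<bar>x - y\<bar>"
proof -
  have "continuous_on {a..b} f" using c[of 0] m by simp
  from weak_chain[OF this w g] obtain h where
    h: "\<And>x. x \<in> {a<..<b} \<Longrightarrow> h 0 x = f x"
    "\<And>k x. Suc k < m \<Longrightarrow> x \<in> {a<..<b} \<Longrightarrow> (h k has_vector_derivative h (Suc k) x) (at x)"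
    "\<And>k x. k < m \<Longrightarrow> x \<in> {a<..<b} \<Longrightarrow> norm (h k x) \<le> B k"
    "\<And>x y. 0 < m \<Longrightarrow> x \<in> {a<..<b} \<Longrightarrow> y \<in> {a<..<b} \<Longrightarrow> norm (h (m - 1) x - h (m - 1) y) \<le> B m * \<bar>x - y\<bar>"
    by blast
  have e: "(dx a b ^^ k) f x = h k x" if "k < m" "x \<in> {a<..<b}" for k x
    by (rule chain_dx[OF h(1,2) that])
  show "cls m a b f" unfolding cls_def
  proof (intro conjI allI impI ballI c)
    fix k x assume k: "Suc k < m" and x: "x \<in> {a..b}"
    have "((dx a b ^^ k) f has_vector_derivative (dx a b ^^ Suc k) f x) (at x)" if x: "x \<in> {a<..<b}" for x
      unfolding e[OF k x]
      by (rule has_vector_derivative_transform_within_open[OF h(2)[OF k x] open_greaterThanLessThan x])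
        (use e k in auto)
    then show "((dx a b ^^ k) f has_vector_derivative (dx a b ^^ Suc k) f x) (at x within {a..b})"
      using k by (intro deriv_closed c x) auto
  qed
  show "k < m \<Longrightarrow> x \<in> {a..b} \<Longrightarrow> norm ((dx a b ^^ k) f x) \<le> B k"
    by (rule norm_le_closed[OF ab c]) (use e h(3) in auto)
  show "x \<in> {a..b} \<Longrightarrow> y \<in> {a..b} \<Longrightarrow> norm ((dx a b ^^ (m - 1)) f x - (dx a b ^^ (m - 1)) f y) \<le> B m * \<bar>x - y\<bar>"
    by (rule lip_closed[OF ab c]) (use e h(4) m in auto)
qed

lemma test_fun_out:
  assumes "\<And>x. x \<notin> {c..d} \<Longrightarrow> \<phi> x = 0" "x \<notin> {c..d}"
  shows "(deriv ^^ j) \<phi> x = (0::real)"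
  using assms(2)
proof (induction j arbitrary: x)
  case (Suc j)
  have "((\<lambda>_. 0::real) has_real_derivative 0) (at x)" by simp
  then have "((deriv ^^ j) \<phi> has_real_derivative 0) (at x)"
    by (rule has_field_derivative_transform_within_open[of _ _ _ "- {c..d}"]) (use Suc in auto)
  then show ?case by (simp add: DERIV_imp_deriv)
qed (use assms(1) in simp)

lemma test_fun_deriv: "test_fun a b \<phi> \<Longrightarrow> ((deriv ^^ j) \<phi> has_real_derivative (deriv ^^ Suc j) \<phi> x) (at x)"
proof -
  assume "test_fun a b \<phi>"
  then have "((deriv ^^ j) \<phi>) differentiable (at x)" unfolding test_fun_def differentiable_on_def by auto
  then show ?thesis using DERIV_deriv_iff_real_differentiable by simp
qed

text \<open>Repeated integration by parts without boundary terms. The induction has to allow j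
  further derivatives on the test function, since they are moved to f one at a time.\<close>

lemma weak_deriv_classical:
  fixes f :: "real \<Rightarrow> 'v::euclidean_space"
  assumes ab: "a < b" and f: "cls m a b f" and k: "k < m"
  shows "weak_deriv a b k f ((dx a b ^^ k) f)"
proof -
  have loc: "loc_integrable a b g" if "continuous_on {a..b} g" for g :: "real \<Rightarrow> 'v"
    unfolding loc_integrable_def
    by (intro allI impI continuous_imp_integrable_real continuous_on_subset[OF that]) auto
  have main: "integral {a..b} (\<lambda>x. (deriv ^^ (j + i)) \<phi> x *\<^sub>R f x) = (-1) ^ i *\<^sub>R integral {a..b} (\<lambda>x. (deriv ^^ j) \<phi> x *\<^sub>R (dx a b ^^ i) f x)"
    if \<phi>: "test_fun a b \<phi>" and i: "i < m" for \<phi> i j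
    using i
  proof (induction i arbitrary: j)
    case (Suc i)
    let ?f = "(dx a b ^^ i) f" and ?f' = "(dx a b ^^ Suc i) f" and ?p = "(deriv ^^ j) \<phi>" and ?p' = "(deriv ^^ Suc j) \<phi>"
    obtain c d where cd: "a < c" "d < b" "\<And>x. x \<notin> {c..d} \<Longrightarrow> \<phi> x = 0" using \<phi> unfolding test_fun_def by blast
    have z: "?p a = 0" "?p b = 0"
      using test_fun_out[of c d \<phi> a j, OF cd(3)] test_fun_out[of c d \<phi> b j, OF cd(3)] cd(1,2) by simp_all
    have cp: "continuous_on S ((deriv ^^ n) \<phi>)" for n S
      using test_fun_deriv[OF \<phi>] by (intro DERIV_continuous_on) (auto intro: has_field_derivative_at_within)
    have cf: "continuous_on {a..b} ?f" "continuous_on {a..b} ?f'" using clsD(1)[OF f, of i] clsD(1)[OF f, of "Suc i"] Suc.prems by simp_all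
    have "((\<lambda>x. ?p x *\<^sub>R ?f x) has_vector_derivative ?p x *\<^sub>R ?f' x + ?p' x *\<^sub>R ?f x) (at x within {a..b})" if "x \<in> {a..b}" for x
      by (intro has_vector_derivative_scaleR has_field_derivative_at_within[OF test_fun_deriv[OF \<phi>]] clsD(2)[OF f] that Suc.prems)
    then have "((\<lambda>x. ?p x *\<^sub>R ?f' x + ?p' x *\<^sub>R ?f x) has_integral (?p b *\<^sub>R ?f b - ?p a *\<^sub>R ?f a)) {a..b}"
      using ab by (intro fundamental_theorem_of_calculus) auto
    then have "integral {a..b} (\<lambda>x. ?p x *\<^sub>R ?f' x + ?p' x *\<^sub>R ?f x) = 0" by (simp add: z integral_unique)
    moreover have "integral {a..b} (\<lambda>x. ?p x *\<^sub>R ?f' x + ?p' x *\<^sub>R ?f x) = integral {a..b} (\<lambda>x. ?p x *\<^sub>R ?f' x) + integral {a..b} (\<lambda>x. ?p' x *\<^sub>R ?f x)"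
      by (intro integral_add integrable_continuous_interval continuous_on_scaleR cp cf)
    ultimately have p: "integral {a..b} (\<lambda>x. ?p' x *\<^sub>R ?f x) = - integral {a..b} (\<lambda>x. ?p x *\<^sub>R ?f' x)"
      by (simp add: eq_neg_iff_add_eq_0 add.commute)
    have "integral {a..b} (\<lambda>x. (deriv ^^ (Suc j + i)) \<phi> x *\<^sub>R f x) = (-1) ^ i *\<^sub>R integral {a..b} (\<lambda>x. ?p' x *\<^sub>R ?f x)"
      by (rule Suc.IH) (use Suc.prems in simp)
    then show ?case unfolding p by simp
  qed simp
  show ?thesis unfolding weak_deriv_def
  proof (intro conjI allI impI)
    have "0 < m" using k by simp
    from clsD(1)[OF f this] show "loc_integrable a b f" by (intro loc) simp
    show "loc_integrable a b ((dx a b ^^ k) f)" by (rule loc[OF clsD(1)[OF f k]])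
    fix \<phi> assume \<phi>: "test_fun a b \<phi>"
    have cp: "continuous_on S ((deriv ^^ n) \<phi>)" for n S
      using test_fun_deriv[OF \<phi>] by (intro DERIV_continuous_on) (auto intro: has_field_derivative_at_within)
    have c0: "continuous_on {a..b} f" using clsD(1)[OF f \<open>0 < m\<close>] by simp
    have "continuous_on {a..b} (\<lambda>x. (deriv ^^ k) \<phi> x *\<^sub>R f x)" "continuous_on {a..b} (\<lambda>x. \<phi> x *\<^sub>R (dx a b ^^ k) f x)"
      using cp[of _ 0] by (auto intro!: continuous_on_scaleR cp c0 clsD(1)[OF f k])
    then show "(LINT x|lebesgue_on {a<..<b}. (deriv ^^ k) \<phi> x *\<^sub>R f x) = (- 1) ^ k *\<^sub>R (LINT x|lebesgue_on {a<..<b}. \<phi> x *\<^sub>R (dx a b ^^ k) f x)"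
      using main[OF \<phi> k, of 0] by (simp only: lint_cont(2)) simp
  qed
qed

text \<open>\<open>wderiv\<close> is a choice of which nothing is known but that it is a weak
  derivative. It pairs with every test function like the classical derivative does; hence it is a
  weak derivative of order zero of the latter, and mollification transfers the essential bound to a
  pointwise one.\<close>

lemma wderiv_bound:
  fixes f :: "real \<Rightarrow> 'v::euclidean_space"
  assumes ab: "a < b" and f: "cls m a b f" and k: "k < m" and B: "Linf_norm a b (wderiv a b k f) \<le> ereal B"
    and x: "x \<in> {a..b}"
  shows "norm ((dx a b ^^ k) f x) \<le> B"
proof (rule norm_le_closed[OF ab clsD(1)[OF f k] _ x])
  let ?f = "(dx a b ^^ k) f" and ?g = "wderiv a b k f"
  fix x assume x: "x \<in> {a<..<b}"
  have w1: "weak_deriv a b k f ?f" by (rule weak_deriv_classical[OF ab f k])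
  then have w2: "weak_deriv a b k f ?g" unfolding wderiv_def by (rule someI[where P="weak_deriv a b k f"])
  have "(LINT x|lebesgue_on {a<..<b}. \<phi> x *\<^sub>R ?f x) = (LINT x|lebesgue_on {a<..<b}. \<phi> x *\<^sub>R ?g x)"
    if "test_fun a b \<phi>" for \<phi>
  proof -
    have "(- 1) ^ k *\<^sub>R (LINT x|lebesgue_on {a<..<b}. \<phi> x *\<^sub>R ?f x) = (- 1) ^ k *\<^sub>R (LINT x|lebesgue_on {a<..<b}. \<phi> x *\<^sub>R ?g x)"
      using w1 w2 that unfolding weak_deriv_def by metis
    then show ?thesis by simp
  qed
  then have w0: "weak_deriv a b 0 ?f ?g"
    using w1 w2 unfolding weak_deriv_def by simp
  have ae: "AE x in lebesgue_on {a<..<b}. norm (?g x) \<le> B" by (rule Linf_norm_AE[OF B])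
  have lim: "(\<lambda>n. mollify a b ?f (1 / real (Suc n)) 0 x) \<longlonglongrightarrow> ?f x"
    by (rule mollify_tendsto[OF clsD(1)[OF f k] x])
  define e where "e = min (x - a) (b - x)"
  have "e > 0" using x by (simp add: e_def)
  then obtain n0 where n0: "1 / real (Suc n0) < e" by (meson nat_approx_posE)
  have "norm (mollify a b ?f (1 / real (Suc n)) 0 x) \<le> B" if "n \<ge> n0" for n
  proof -
    have "1 / real (Suc n) \<le> 1 / real (Suc n0)" using that by (intro divide_left_mono) auto
    then have d: "1 / real (Suc n) > 0" "a < x - 1 / real (Suc n)" "x + 1 / real (Suc n) < b"
      using n0 by (auto simp: e_def)
    show ?thesis by (rule mollify_bound[OF clsD(1)[OF f k] w0 ae d])
  qed
  then show "norm (?f x) \<le> B"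
    by (intro LIMSEQ_le_const2[OF tendsto_norm[OF lim]]) blast
qed

lemma W_inf_per_cls:
  fixes f :: "real \<Rightarrow> 'v::euclidean_space"
  assumes ab: "a < b" and m: "0 < m" and f: "f \<in> W_inf_per m a b"
  shows "cls m a b f" "k < m \<Longrightarrow> (dx a b ^^ k) f a = (dx a b ^^ k) f b"
    "(\<And>k. k \<le> m \<Longrightarrow> Linf_norm a b (wderiv a b k f) \<le> ereal (B k)) \<Longrightarrow> x \<in> {a..b} \<Longrightarrow> y \<in> {a..b} \<Longrightarrow>
       norm ((dx a b ^^ (m - 1)) f x - (dx a b ^^ (m - 1)) f y) \<le> B m * \<bar>x - y\<bar>"
proof -
  have per: "\<And>k. k < m \<Longrightarrow> continuous_on {a..b} ((dx a b ^^ k) f)" "\<And>k. k < m \<Longrightarrow> (dx a b ^^ k) f a = (dx a b ^^ k) f b"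
    using f unfolding W_inf_per_def periodic_upto_def by auto
  have "\<forall>k\<le>m. \<exists>g\<in>Linf a b. weak_deriv a b k f g"
    using f unfolding W_inf_per_def W_inf_def by auto
  then obtain g where g: "\<And>k. k \<le> m \<Longrightarrow> g k \<in> Linf a b" "\<And>k. k \<le> m \<Longrightarrow> weak_deriv a b k f (g k)"
    by metis
  have "\<exists>B. AE x in lebesgue_on {a<..<b}. norm (g k x) \<le> B" if "k \<le> m" for k
  proof -
    have "Linf_norm a b (g k) < \<infinity>" using g(1)[OF that] by (simp add: Linf_def)
    then obtain B where "Linf_norm a b (g k) \<le> ereal B"
      by (cases "Linf_norm a b (g k)") auto
    then show ?thesis using Linf_norm_AE by blast
  qed
  then obtain B' where B': "\<And>k. k \<le> m \<Longrightarrow> AE x in lebesgue_on {a<..<b}. norm (g k x) \<le> B' k" by metis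
  show "cls m a b f" by (rule weak_classical(1)[OF ab m per(1) g(2) B'])
  show "k < m \<Longrightarrow> (dx a b ^^ k) f a = (dx a b ^^ k) f b" by (rule per(2))
  assume B: "\<And>k. k \<le> m \<Longrightarrow> Linf_norm a b (wderiv a b k f) \<le> ereal (B k)" and xy: "x \<in> {a..b}" "y \<in> {a..b}"
  have w: "weak_deriv a b k f (wderiv a b k f)" if "k \<le> m" for k
    unfolding wderiv_def by (rule someI[where P="weak_deriv a b k f", OF g(2)[OF that]])
  show "norm ((dx a b ^^ (m - 1)) f x - (dx a b ^^ (m - 1)) f y) \<le> B m * \<bar>x - y\<bar>"
    by (rule weak_classical(3)[OF ab m per(1) w Linf_norm_AE[OF B] xy])
qed

lemma dx_within: "a < b \<Longrightarrow> x \<in> {a..b} \<Longrightarrow> (f has_vector_derivative f') (at x within {a..b}) \<Longrightarrow> dx a b f x = f'"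
  using vector_derivative_within_cbox[of a b x f f'] by (simp add: dx_def)

text \<open>The combination is a difference quotient in time minus a candidate for the time
  derivative, the quantity whose Sobolev norm tends to zero in \<open>C_time_W_inf_per\<close>. It
  has to be in \<open>cls\<close> before \<open>wderiv_bound\<close> can read off pointwise
  smallness.\<close>

lemma cls_lincomb:
  fixes f g d :: "real \<Rightarrow> 'v::real_normed_vector" and c :: real
  assumes ab: "a < b" and f: "cls m a b f" and g: "cls m a b g" and d: "cls m a b d"
  defines "r \<equiv> \<lambda>x. (f x - g x) /\<^sub>R c - d x"
  shows "k < m \<Longrightarrow> x \<in> {a..b} \<Longrightarrow> (dx a b ^^ k) r x = ((dx a b ^^ k) f x - (dx a b ^^ k) g x) /\<^sub>R c - (dx a b ^^ k) d x"
    and "cls m a b r"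
proof -
  define H where "H k x = ((dx a b ^^ k) f x - (dx a b ^^ k) g x) /\<^sub>R c - (dx a b ^^ k) d x" for k x
  have Hd: "(H k has_vector_derivative H (Suc k) x) (at x within {a..b})" if "Suc k < m" "x \<in> {a..b}" for k x
    unfolding H_def[abs_def]
    by (intro has_vector_derivative_diff bounded_linear.has_vector_derivative[OF bounded_linear_scaleR_right]
        clsD(2)[OF f that] clsD(2)[OF g that] clsD(2)[OF d that])
  have Hc: "continuous_on {a..b} (H k)" if "k < m" for k
    unfolding H_def[abs_def]
    by (intro continuous_on_diff continuous_on_scaleR continuous_on_const clsD(1)[OF f that] clsD(1)[OF g that] clsD(1)[OF d that])
  have e: "(dx a b ^^ k) r x = H k x" if "k < m" "x \<in> {a..b}" for k x
    using that
  proof (induction k arbitrary: x)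
    case (Suc k)
    have "((dx a b ^^ k) r has_vector_derivative H (Suc k) x) (at x within {a..b})"
    proof (rule has_vector_derivative_transform[OF Suc.prems(2) _ Hd[OF Suc.prems]])
      show "(dx a b ^^ k) r y = H k y" if "y \<in> {a..b}" for y
        using Suc.IH[OF _ that] Suc.prems by simp
    qed
    then show ?case using dx_within[OF ab Suc.prems(2)] by simp
  qed (simp add: H_def r_def)
  then show "k < m \<Longrightarrow> x \<in> {a..b} \<Longrightarrow> (dx a b ^^ k) r x = ((dx a b ^^ k) f x - (dx a b ^^ k) g x) /\<^sub>R c - (dx a b ^^ k) d x"
    by (simp only: H_def)
  show "cls m a b r" unfolding cls_def
  proof (intro conjI allI impI ballI)
    show "continuous_on {a..b} ((dx a b ^^ k) r)" if "k < m" for k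
      using Hc[OF that] by (rule continuous_on_eq) (simp add: e that)
    show "((dx a b ^^ k) r has_vector_derivative (dx a b ^^ Suc k) r x) (at x within {a..b})" if k: "Suc k < m" and x: "x \<in> {a..b}" for k x
      unfolding e[OF k x]
    proof (rule has_vector_derivative_transform[OF x _ Hd[OF k x]])
      show "(dx a b ^^ k) r y = H k y" if "y \<in> {a..b}" for y using e[OF _ that] k by simp
    qed
  qed
qed

section \<open>Pointwise consequences for the solution and the potentials\<close>

lemma Linf_norm_nonneg: "a < b \<Longrightarrow> 0 \<le> Linf_norm a b f"
proof (rule ccontr)
  assume ab: "a < b" and n: "\<not> 0 \<le> Linf_norm a b f"
  have "AE x in lebesgue_on {a<..<b}. ereal (norm (f x)) \<le> Linf_norm a b f"
    unfolding Linf_norm_def by (rule esssup_AE)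
  then have "\<exists>x\<in>{a<..<b}. ereal (norm (f x)) \<le> Linf_norm a b f"
    by (rule AE_dense) (use ab in auto)
  then obtain x where "ereal (norm (f x)) \<le> Linf_norm a b f" by blast
  moreover have "0 \<le> ereal (norm (f x))" by simp
  ultimately show False using n order_trans by blast
qed

lemma Linf_le_W_inf_norm: "a < b \<Longrightarrow> k \<le> m \<Longrightarrow> Linf_norm a b (wderiv a b k f) \<le> W_inf_norm m a b f"
proof -
  assume ab: "a < b" and k: "k \<le> m"
  have "(\<Sum>j\<in>{k}. Linf_norm a b (wderiv a b j f)) \<le> (\<Sum>j\<le>m. Linf_norm a b (wderiv a b j f))"
    by (rule sum_mono2) (use k Linf_norm_nonneg[OF ab] in auto)
  then show ?thesis by (simp add: W_inf_norm_def)
qed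

text \<open>Each summand of the Sobolev norm controls one space derivative uniformly. Convergence of
  the time difference quotients in that norm therefore gives convergence of their space derivatives
  at every point, which is the exchange of time and space derivatives, end points included.\<close>

lemma time_deriv:
  fixes \<Phi> :: "real \<Rightarrow> real \<Rightarrow> 'v::euclidean_space"
  assumes ab: "a < b" and \<Phi>: "\<Phi> \<in> C_time_W_inf_per l T m a b" and r: "r < l" and k: "k < m"
    and t: "t \<in> {0..T}" and x: "x \<in> {a..b}"
  shows "((\<lambda>s. (dx a b ^^ k) ((dt T ^^ r) \<Phi> s) x) has_vector_derivative (dx a b ^^ k) ((dt T ^^ Suc r) \<Phi> t) x) (at t within {0..T})"
  unfolding has_vector_derivative_iff_slope
proof (rule tendstoI)
  fix e :: real assume e: "e > 0"
  define F where "F = (dt T ^^ r) \<Phi>"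
  define G where "G = (dt T ^^ Suc r) \<Phi> t"
  have m: "0 < m" using k by simp
  have W: "(dt T ^^ q) \<Phi> s \<in> W_inf_per m a b" if "q \<le> l" "s \<in> {0..T}" for q s
    using \<Phi> that unfolding C_time_W_inf_per_def by blast
  have cF: "cls m a b (F s)" if "s \<in> {0..T}" for s
    unfolding F_def using r that by (intro W_inf_per_cls(1)[OF ab m] W) auto
  have cG: "cls m a b G" unfolding G_def using r t by (intro W_inf_per_cls(1)[OF ab m] W) auto
  have "((\<lambda>s. W_inf_norm m a b (\<lambda>x. (F s x - F t x) /\<^sub>R (s - t) - G x)) \<longlongrightarrow> 0) (at t within {0..T})"
    using \<Phi> r t unfolding C_time_W_inf_per_def F_def G_def by blast
  then have "\<forall>\<^sub>F s in at t within {0..T}. W_inf_norm m a b (\<lambda>x. (F s x - F t x) /\<^sub>R (s - t) - G x) < ereal (e / 2)"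
    by (rule order_tendstoD(2)) (use e in simp)
  moreover have "\<forall>\<^sub>F s in at t within {0..T}. s \<in> {0..T}"
    by (simp add: eventually_at_filter)
  ultimately show "\<forall>\<^sub>F s in at t within {0..T}. dist (((dx a b ^^ k) ((dt T ^^ r) \<Phi> s) x - (dx a b ^^ k) ((dt T ^^ r) \<Phi> t) x) /\<^sub>R (s - t)) ((dx a b ^^ k) ((dt T ^^ Suc r) \<Phi> t) x) < e"
  proof eventually_elim
    case (elim s)
    let ?r = "\<lambda>x. (F s x - F t x) /\<^sub>R (s - t) - G x"
    note lc = cls_lincomb[OF ab cF[OF elim(2)] cF[OF t] cG, where c="s - t"]
    have "Linf_norm a b (wderiv a b k ?r) \<le> ereal (e / 2)"
      using Linf_le_W_inf_norm[OF ab less_imp_le[OF k], of ?r] elim(1) by (meson less_imp_le order_trans)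
    from wderiv_bound[OF ab lc(2) k this x] lc(1)[OF k x]
    have "norm (((dx a b ^^ k) (F s) x - (dx a b ^^ k) (F t) x) /\<^sub>R (s - t) - (dx a b ^^ k) G x) \<le> e / 2" by simp
    then show ?case using e unfolding dist_norm F_def G_def by (simp only:) 
  qed
qed

lemma closed_time_bound:
  fixes g :: "real \<Rightarrow> 'v::real_normed_vector"
  assumes T: "0 < T" and c: "continuous_on {0..T} g" and ae: "AE t in lebesgue_on {0..T}. norm (g t) \<le> B" and t: "t \<in> {0..T}"
  shows "norm (g t) \<le> B"
proof (rule norm_le_closed[OF T c _ t])
  fix s assume s: "s \<in> {0<..<T}"
  show "norm (g s) \<le> B"
  proof (rule ccontr)
    assume n: "\<not> norm (g s) \<le> B"
    have c': "continuous_on {0<..<T} g" by (rule continuous_on_subset[OF c]) auto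
    have "{y \<in> {0<..<T}. norm (g y) \<in> {B<..}} = {0<..<T} \<inter> (\<lambda>y. norm (g y)) -` {B<..}" by auto
    then have o: "open {y \<in> {0<..<T}. norm (g y) \<in> {B<..}}"
      using continuous_open_preimage[OF continuous_on_norm[OF c'] open_greaterThanLessThan open_greaterThan] by simp
    have "\<exists>y\<in>{y \<in> {0<..<T}. norm (g y) \<in> {B<..}}. norm (g y) \<le> B"
      using s n by (intro AE_dense[OF ae _ o]) auto
    then show False by auto
  qed
qed

lemma mixed_norm_AE:
  "mixed_Linf_norm T a b r k \<Phi> \<le> ereal C \<Longrightarrow> AE t in lebesgue_on {0..T}. Linf_norm a b (wderiv a b k ((dt T ^^ r) \<Phi> t)) \<le> ereal C"
proof -
  assume le: "mixed_Linf_norm T a b r k \<Phi> \<le> ereal C"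
  have "AE t in lebesgue_on {0..T}. Linf_norm a b (wderiv a b k ((dt T ^^ r) \<Phi> t)) \<le> mixed_Linf_norm T a b r k \<Phi>"
    unfolding mixed_Linf_norm_def by (rule esssup_AE)
  then show ?thesis
  proof eventually_elim
    case (elim t)
    from order_trans[OF elim le] show ?case .
  qed
qed

text \<open>The mixed norms bound the solution for almost every time; continuity in time extends the
  bounds to every time. The condition r < l leaves one more time derivative, from which
  \<open>time_deriv\<close> obtains that continuity.\<close>

lemma regular_solution:
  fixes \<Phi> :: "real \<Rightarrow> real \<Rightarrow> 'v::euclidean_space"
  assumes ab: "a < b" and T: "0 < T" and m: "0 < m" and \<Phi>: "\<Phi> \<in> C_time_W_inf_per l T m a b" and r: "r < l"
    and C: "\<And>k. k \<le> m \<Longrightarrow> mixed_Linf_norm T a b r k \<Phi> \<le> ereal (C k)" and t: "t \<in> {0..T}"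
  defines "F \<equiv> (dt T ^^ r) \<Phi>"
  shows "cls m a b (F t)" "k < m \<Longrightarrow> (dx a b ^^ k) (F t) a = (dx a b ^^ k) (F t) b"
    "k < m \<Longrightarrow> x \<in> {a..b} \<Longrightarrow> norm ((dx a b ^^ k) (F t) x) \<le> C k"
    "x \<in> {a..b} \<Longrightarrow> y \<in> {a..b} \<Longrightarrow> norm ((dx a b ^^ (m - 1)) (F t) x - (dx a b ^^ (m - 1)) (F t) y) \<le> C m * \<bar>x - y\<bar>"
proof -
  have W: "F s \<in> W_inf_per m a b" if "s \<in> {0..T}" for s
    using \<Phi> that r unfolding C_time_W_inf_per_def F_def by (auto simp: less_imp_le)
  note cl = W_inf_per_cls[OF ab m W]
  show "cls m a b (F t)" "k < m \<Longrightarrow> (dx a b ^^ k) (F t) a = (dx a b ^^ k) (F t) b"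
    by (rule cl[OF t], assumption?)+
  have ct: "continuous_on {0..T} (\<lambda>s. (dx a b ^^ k) (F s) x)" if "k < m" "x \<in> {a..b}" for k x
    unfolding continuous_on_eq_continuous_within F_def
    by (intro ballI has_vector_derivative_continuous[OF time_deriv[OF ab \<Phi> r that(1) _ that(2)]])
  have ae: "AE s in lebesgue_on {0..T}. \<forall>k\<in>{..m}. Linf_norm a b (wderiv a b k (F s)) \<le> ereal (C k)"
    unfolding F_def by (intro AE_finite_allI mixed_norm_AE C) auto
  have ae': "AE s in lebesgue_on {0..T}. s \<in> {0..T} \<and> (\<forall>k\<le>m. Linf_norm a b (wderiv a b k (F s)) \<le> ereal (C k))"
    using ae AE_space by eventually_elim (auto simp: space_restrict_space)
  show "norm ((dx a b ^^ k) (F t) x) \<le> C k" if k: "k < m" and x: "x \<in> {a..b}"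
  proof (rule closed_time_bound[OF T ct[OF k x] _ t])
    show "AE s in lebesgue_on {0..T}. norm ((dx a b ^^ k) (F s) x) \<le> C k"
      using ae'
    proof eventually_elim
      case (elim s)
      then show ?case using wderiv_bound[OF ab cl(1) k _ x] k by auto
    qed
  qed
  show "norm ((dx a b ^^ (m - 1)) (F t) x - (dx a b ^^ (m - 1)) (F t) y) \<le> C m * \<bar>x - y\<bar>" if x: "x \<in> {a..b}" and y: "y \<in> {a..b}"
  proof (rule closed_time_bound[OF T _ _ t, of "\<lambda>t. (dx a b ^^ (m - 1)) (F t) x - (dx a b ^^ (m - 1)) (F t) y"])
    show "continuous_on {0..T} (\<lambda>t. (dx a b ^^ (m - 1)) (F t) x - (dx a b ^^ (m - 1)) (F t) y)"
      using m x y by (intro continuous_on_diff ct) auto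
    show "AE s in lebesgue_on {0..T}. norm ((dx a b ^^ (m - 1)) (F s) x - (dx a b ^^ (m - 1)) (F s) y) \<le> C m * \<bar>x - y\<bar>"
      using ae'
    proof eventually_elim
      case (elim s)
      then show ?case using cl(3)[of s C x y] x y by auto
    qed
  qed
qed

lemma regular_potential:
  fixes V :: "real \<Rightarrow> 'v::euclidean_space"
  assumes ab: "a < b" and m: "0 < m" and V: "V \<in> Cm_fun m a b" and per: "periodic_upto m a b V"
    and D: "\<And>k. k \<le> m \<Longrightarrow> Linf_norm a b ((dx a b ^^ k) V) \<le> ereal (D k)"
  shows "cls m a b V" "k < m \<Longrightarrow> (dx a b ^^ k) V a = (dx a b ^^ k) V b"
    "k < m \<Longrightarrow> x \<in> {a..b} \<Longrightarrow> norm ((dx a b ^^ k) V x) \<le> D k"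
    "x \<in> {a..b} \<Longrightarrow> y \<in> {a..b} \<Longrightarrow> norm ((dx a b ^^ (m - 1)) V x - (dx a b ^^ (m - 1)) V y) \<le> D m * \<bar>x - y\<bar>"
proof -
  have c: "continuous_on {a..b} ((dx a b ^^ k) V)" if "k < m" for k
    using per that unfolding periodic_upto_def by blast
  have d: "((dx a b ^^ k) V has_vector_derivative (dx a b ^^ Suc k) V x) (at x)" if "k < m" "x \<in> {a<..<b}" for k x
  proof -
    have "(dx a b ^^ k) V differentiable_on {a<..<b}" using V that(1) unfolding Cm_fun_def by blast
    then have "(dx a b ^^ k) V differentiable (at x)"
      using that(2) by (simp add: differentiable_on_eq_differentiable_at)
    then have "((dx a b ^^ k) V has_vector_derivative vector_derivative ((dx a b ^^ k) V) (at x)) (at x)"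
      by (simp add: vector_derivative_works)
    then show ?thesis using that(2) by (simp add: dx_def at_within_Icc_at)
  qed
  have bd: "norm ((dx a b ^^ k) V x) \<le> D k" if "k \<le> m" "x \<in> {a<..<b}" for k x
  proof (rule continuous_AE_bound[OF _ Linf_norm_AE[OF D[OF that(1)]] that(2)])
    show "continuous_on {a<..<b} ((dx a b ^^ k) V)"
    proof (cases "k = m")
      case True then show ?thesis using V unfolding Cm_fun_def by blast
    next
      case False
      with that(1) have "k < m" by simp
      from c[OF this] show ?thesis by (rule continuous_on_subset) auto
    qed
  qed
  show "cls m a b V" unfolding cls_def
  proof (intro conjI allI impI ballI c)
    fix k x assume "Suc k < m" "x \<in> {a..b}"
    then show "((dx a b ^^ k) V has_vector_derivative (dx a b ^^ Suc k) V x) (at x within {a..b})"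
      by (intro deriv_closed c d) auto
  qed
  show "k < m \<Longrightarrow> (dx a b ^^ k) V a = (dx a b ^^ k) V b"
    using per unfolding periodic_upto_def by blast
  show "k < m \<Longrightarrow> x \<in> {a..b} \<Longrightarrow> norm ((dx a b ^^ k) V x) \<le> D k"
    by (rule norm_le_closed[OF ab c]) (use bd in auto)
  show "norm ((dx a b ^^ (m - 1)) V x - (dx a b ^^ (m - 1)) V y) \<le> D m * \<bar>x - y\<bar>" if "x \<in> {a..b}" "y \<in> {a..b}"
  proof (rule lip_closed[OF ab c _ that])
    show "norm ((dx a b ^^ (m - 1)) V x - (dx a b ^^ (m - 1)) V y) \<le> D m * \<bar>x - y\<bar>"
      if "x \<in> {a<..<b}" "y \<in> {a<..<b}" for x y
    proof (rule lip_of_deriv_ivl[of "{a<..<b}" _ "(dx a b ^^ m) V"])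
      show "((dx a b ^^ (m - 1)) V has_vector_derivative (dx a b ^^ m) V x) (at x within {a<..<b})" if "x \<in> {a<..<b}" for x
        using has_vector_derivative_at_within[OF d[of "m - 1" x]] that m by simp
    qed (use bd that in auto)
  qed (use m in simp)
qed

section \<open>Matrix exponentials\<close>

lemmas scaleR_complex = scaleR_conv_of_real[where 'a=complex]

lemma norm_vec2_sq: "(norm (v::complex^2))\<^sup>2 = (cmod (v$1))\<^sup>2 + (cmod (v$2))\<^sup>2"
  by (simp add: norm_vec_def L2_set_def UNIV_2)

lemma norm_vsmult: "norm (c *s (v::complex^2)) = cmod c * norm v"
proof -
  have "(norm (c *s v))\<^sup>2 = (cmod c * norm v)\<^sup>2"
    by (simp add: norm_vec2_sq norm_mult power_mult_distrib distrib_left)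
  then show ?thesis
    by (metis abs_norm_cancel norm_ge_zero power2_eq_iff_nonneg zero_le_mult_iff)
qed

lemma bounded_bilinear_vsmult:
  "bounded_bilinear ((*s) :: complex \<Rightarrow> complex^2 \<Rightarrow> complex^2)"
  by (standard; (intro exI[of _ 1])?)
    (auto simp: vec_eq_iff algebra_simps norm_vsmult scaleR_complex)

lemmas bounded_linear_vsmult_left = bounded_bilinear.bounded_linear_left[OF bounded_bilinear_vsmult]
lemmas bounded_linear_vsmult_right = bounded_bilinear.bounded_linear_right[OF bounded_bilinear_vsmult]

lemma vec2_decomp: "(v::complex^2) = v$1 *s axis 1 1 + v$2 *s axis 2 1"
  by (simp add: vec_eq_iff forall_2 axis_def)

lemma has_vector_derivative_vec2I:
  assumes "\<And>i. ((\<lambda>s. f s $ i) has_vector_derivative f' $ i) F"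
  shows "((f::real \<Rightarrow> complex^2) has_vector_derivative f') F"
proof -
  have "((\<lambda>s. f s $ 1 *s axis 1 1 + f s $ 2 *s axis 2 1 :: complex^2) has_vector_derivative
      f' $ 1 *s axis 1 1 + f' $ 2 *s axis 2 1) F"
    by (intro has_vector_derivative_add bounded_linear.has_vector_derivative[OF bounded_linear_vsmult_left, OF assms])
  then show ?thesis by (simp add: vec2_decomp[symmetric])
qed

lemma norm_le_sum_vec2: "norm (v::complex^2) \<le> cmod (v$1) + cmod (v$2)"
  using L2_set_le_sum[of UNIV "\<lambda>i. norm (v$i)"]
  by (simp add: norm_vec_def UNIV_2)

lemma matrix_vector_mult_scaleR: "(c *\<^sub>R (A::complex^2^2)) *v v = c *\<^sub>R (A *v v)"
  by (simp add: vec_eq_iff matrix_vector_mult_def sum_distrib_left scaleR_complex algebra_simps)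

lemma matrix_vector_mult_scaleR_right: "(A::complex^2^2) *v (c *\<^sub>R v) = c *\<^sub>R (A *v v)"
  by (simp add: vec_eq_iff matrix_vector_mult_def sum_distrib_left scaleR_complex algebra_simps)

lemma matrix_vector_mult_cscale: "(c *\<^sub>C A) *v v = c *s (A *v v)"
  by (simp add: vec_eq_iff matrix_vector_mult_def cscale_def sum_distrib_left algebra_simps)

lemma bounded_linear_matrix_left: "bounded_linear (\<lambda>A. (A::complex^2^2) *v v)"
  unfolding linear_conv_bounded_linear[symmetric]
  by (rule linearI) (simp_all add: matrix_vector_mult_scaleR matrix_vector_mult_add_rdistrib)

lemma bounded_linear_matrix_mult_right: "bounded_linear (\<lambda>B::complex^2^2. (A::complex^2^2) ** B)"
  unfolding linear_conv_bounded_linear[symmetric]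
  by (rule linearI) (simp_all add: vec_eq_iff matrix_matrix_mult_def algebra_simps sum.distrib sum_distrib_left scaleR_complex)

lemma mexp_iter: "((\<lambda>B. (A::complex^2^2) ** B) ^^ k) (mat 1) *v v = (((*v) A) ^^ k) v"
  by (induction k) (simp_all add: matrix_vector_mul_assoc[symmetric])

lemma mexp_summable: "summable (\<lambda>k. (1 / fact k) *\<^sub>R ((\<lambda>B. (A::complex^2^2) ** B) ^^ k) (mat 1))"
proof -
  obtain K where K: "K > 0" "\<And>B::complex^2^2. norm (A ** B) \<le> norm B * K"
    using bounded_linear.pos_bounded[OF bounded_linear_matrix_mult_right] by blast
  have *: "norm (((\<lambda>B. A ** B) ^^ k) (mat 1 :: complex^2^2)) \<le> K ^ k * norm (mat 1 :: complex^2^2)" for k :: nat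
  proof (induction k)
    case (Suc k)
    have "norm (A ** ((\<lambda>B. A ** B) ^^ k) (mat 1 :: complex^2^2)) \<le> K * norm (((\<lambda>B. A ** B) ^^ k) (mat 1 :: complex^2^2))"
      using K(2) by (simp add: mult.commute)
    also have "\<dots> \<le> K * (K ^ k * norm (mat 1 :: complex^2^2))"
      by (rule mult_left_mono[OF Suc less_imp_le[OF K(1)]])
    finally show ?case by (simp add: mult_ac)
  qed simp
  show ?thesis
  proof (rule summable_comparison_test')
    show "summable (\<lambda>k. (inverse (fact k) * K ^ k) * norm (mat 1 :: complex^2^2))"
      by (intro summable_mult2 summable_exp)
    show "norm ((1 / fact k) *\<^sub>R ((\<lambda>B. A ** B) ^^ k) (mat 1)) \<le> (inverse (fact k) * K ^ k) * norm (mat 1 :: complex^2^2)"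
      for k using mult_left_mono[OF *[of k], of "1 / fact k"] by (simp add: field_simps)
  qed
qed

lemma mexp_sums: "(\<lambda>k. (1 / fact k) *\<^sub>R (((*v) A) ^^ k) v) sums (mexp A *v v)"
  using bounded_linear.sums[OF bounded_linear_matrix_left summable_sums[OF mexp_summable], of A v]
  by (simp add: mexp_def matrix_vector_mult_scaleR mexp_iter)

text \<open>The form r^n exp(r) of the remainder comes from 1/(k+n)! <= 1/k!. The operator norm is
  expressed through the action on vectors.\<close>

lemma mexp_tail:
  assumes "\<And>v. norm (A *v v) \<le> r * norm v" "0 \<le> r"
  shows "norm (mexp A *v v - (\<Sum>k<n. (1 / fact k) *\<^sub>R (((*v) A) ^^ k) v)) \<le> r ^ n * exp r * norm v"
proof -
  have b: "norm ((((*v) A) ^^ k) v) \<le> r ^ k * norm v" for k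
  proof (induction k)
    case (Suc k)
    have "norm ((((*v) A) ^^ Suc k) v) \<le> r * norm ((((*v) A) ^^ k) v)"
      using assms(1) by simp
    also have "\<dots> \<le> r * (r ^ k * norm v)" using Suc assms(2) by (rule mult_left_mono)
    finally show ?case by (simp add: mult_ac)
  qed simp
  let ?f = "\<lambda>k. (1 / fact k) *\<^sub>R (((*v) A) ^^ k) v"
  have s: "(\<lambda>k. ?f (k + n)) sums (mexp A *v v - (\<Sum>k<n. ?f k))"
    using mexp_sums by (subst sums_iff_shift) simp
  have e: "(\<lambda>k. r ^ n * norm v * (inverse (fact k) * r ^ k)) sums (r ^ n * norm v * exp r)"
    using sums_mult[OF exp_converges[of r], of "r ^ n * norm v"] by (simp add: divide_inverse mult_ac)
  have "norm (?f (k + n)) \<le> r ^ n * norm v * (inverse (fact k) * r ^ k)" for k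
  proof -
    have "norm (?f (k + n)) \<le> (1 / fact (k + n)) * (r ^ (k + n) * norm v)"
      using mult_left_mono[OF b[of "k + n"], of "1 / fact (k+n)"] by simp
    also have "\<dots> \<le> (1 / fact k) * (r ^ (k + n) * norm v)"
      using assms(2) by (intro mult_right_mono divide_left_mono) (auto simp: fact_mono)
    finally show ?thesis by (simp add: field_simps power_add)
  qed
  then have "norm (\<Sum>k. ?f (k + n)) \<le> (\<Sum>k. r ^ n * norm v * (inverse (fact k) * r ^ k))"
    by (intro norm_suminf_le) (use e in \<open>auto simp: sums_iff\<close>)
  then show ?thesis using s e by (simp add: sums_iff mult_ac)
qed

lemma power_matrix_scaleR: "(((*v) (s *\<^sub>R A)) ^^ k) v = s ^ k *\<^sub>R (((*v) (A::complex^2^2)) ^^ k) v"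
  by (induction k) (simp_all add: matrix_vector_mult_scaleR matrix_vector_mult_scaleR_right)

lemma mexp_commute: "mexp A *v (A *v v) = A *v (mexp A *v v)"
proof -
  have "(\<lambda>k. A *v ((1 / fact k) *\<^sub>R (((*v) A) ^^ k) v)) sums (A *v (mexp A *v v))"
    by (rule bounded_linear.sums[OF matrix_vector_mul_bounded_linear mexp_sums])
  moreover have "(\<lambda>k. A *v ((1 / fact k) *\<^sub>R (((*v) A) ^^ k) v)) = (\<lambda>k. (1 / fact k) *\<^sub>R (((*v) A) ^^ k) (A *v v))"
    by (simp add: matrix_vector_mult_scaleR_right funpow_swap1)
  ultimately show ?thesis using mexp_sums[of A "A *v v"] by (auto intro: sums_unique2)
qed

lemma mexp_zero: "mexp (0 *\<^sub>R A) *v w = w"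
  using mexp_tail[of "0 *\<^sub>R A" 0 w 1] by (simp add: matrix_vector_mult_scaleR)

text \<open>Each component of the flow is an everywhere convergent complex power series in s with
  coefficients (A^k v)_i / k!. Termwise differentiation shifts them, which amounts to replacing v by
  A v; commutation of A with its exponential puts the factor in front.\<close>

lemma mexp_has_derivative:
  "((\<lambda>s. mexp (s *\<^sub>R A) *v v) has_vector_derivative A *v (mexp (s *\<^sub>R A) *v v)) (at s)"
proof (rule has_vector_derivative_vec2I)
  fix i
  define c where "c v k = ((((*v) A) ^^ k) v $ i) / fact k" for v k
  have sm: "(\<lambda>k. c v k * of_real s ^ k) sums ((mexp (s *\<^sub>R A) *v v) $ i)" for s v
    using bounded_linear.sums[OF bounded_linear_vec_nth mexp_sums[of "s *\<^sub>R A" v], of i]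
    by (simp add: c_def power_matrix_scaleR scaleR_complex mult_ac)
  have sc: "summable (\<lambda>k. c v k * y ^ k)" for y
  proof -
    have 1: "(\<lambda>k. c v k * of_real (norm y + 1) ^ k) sums ((mexp ((norm y + 1) *\<^sub>R A) *v v) $ i)"
      by (rule sm)
    show ?thesis
      by (rule powser_inside[OF sums_summable[OF 1]]) (simp del: of_real_add)
  qed
  have d: "diffs (c v) k = c (A *v v) k" for k
    by (simp add: diffs_def c_def funpow_swap1 field_simps del: of_nat_Suc)
  have "((\<lambda>x. \<Sum>n. c v n * x ^ n) has_field_derivative (\<Sum>n. diffs (c v) n * (of_real s) ^ n)) (at (of_real s))"
    by (rule termdiffs_strong_converges_everywhere[OF sc])
  then have "((\<lambda>x. \<Sum>n. c v n * x ^ n) \<circ> of_real has_vector_derivative (\<Sum>n. diffs (c v) n * (of_real s) ^ n)) (at s)"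
    by (auto simp: o_def intro: has_vector_derivative_real_field)
  moreover have "(\<Sum>n. diffs (c v) n * (of_real s) ^ n) = (A *v (mexp (s *\<^sub>R A) *v v)) $ i"
  proof -
    have "(\<Sum>n. diffs (c v) n * (of_real s) ^ n) = (mexp (s *\<^sub>R A) *v (A *v v)) $ i"
      unfolding d using sm[of "A *v v" s] by (simp add: sums_iff)
    also have "mexp (s *\<^sub>R A) *v (A *v v) = A *v (mexp (s *\<^sub>R A) *v v)"
    proof (cases "s = 0")
      case True
      show ?thesis unfolding True mexp_zero ..
    next
      case False
      then show ?thesis using mexp_commute[of "s *\<^sub>R A" v]
        by (simp add: matrix_vector_mult_scaleR matrix_vector_mult_scaleR_right)
    qed
    finally show ?thesis .
  qed
  moreover have "(\<lambda>x. \<Sum>n. c v n * x ^ n) \<circ> of_real = (\<lambda>s. (mexp (s *\<^sub>R A) *v v) $ i)"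
    using sm by (auto simp: sums_iff o_def)
  ultimately show "((\<lambda>s. (mexp (s *\<^sub>R A) *v v) $ i) has_vector_derivative (A *v (mexp (s *\<^sub>R A) *v v)) $ i) (at s)"
    by simp
qed

text \<open>The inner product of the type class is the real part of the Hermitian one, so the
  hypothesis says that A is skew-Hermitian. The squared norm along the flow then has derivative
  zero.\<close>

lemma norm_mexp_skew:
  assumes "\<And>v. v \<bullet> (A *v v) = 0"
  shows "norm (mexp A *v v) = norm v"
proof -
  let ?f = "\<lambda>s. mexp (s *\<^sub>R A) *v v"
  have "((\<lambda>s. ?f s \<bullet> ?f s) has_vector_derivative 0) (at s)" for s
    using has_derivative_inner[OF mexp_has_derivative[of A v s, unfolded has_vector_derivative_def]
       mexp_has_derivative[of A v s, unfolded has_vector_derivative_def]]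
    by (simp add: has_vector_derivative_def assms inner_commute)
  then have "((\<lambda>s. ?f s \<bullet> ?f s) has_derivative (\<lambda>h. 0)) (at s within UNIV)" for s
    unfolding has_vector_derivative_def by simp
  then have "?f 1 \<bullet> ?f 1 = ?f 0 \<bullet> ?f 0"
    using has_derivative_zero_unique_connected
    by (intro has_derivative_zero_unique[OF convex_UNIV]) auto
  then show ?thesis using mexp_zero[of A v] by (simp add: dot_square_norm)
qed

section \<open>Periodic functions and smoothing kernels\<close>

definition DD :: "(real \<Rightarrow> 'a::real_normed_vector) \<Rightarrow> real \<Rightarrow> 'a" where
  "DD f = (\<lambda>x. vector_derivative f (at x))"

text \<open>For \<open>k > 0\<close> this is the class of \<open>L\<close>-periodic functions of class \<open>C\<^bsup>k-1,1\<^esup>\<close>; the bound \<open>B\<close> on the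
  derivative of order \<open>k\<close> is expressed as a Lipschitz condition.\<close>

fun cb :: "real \<Rightarrow> nat \<Rightarrow> real \<Rightarrow> (real \<Rightarrow> 'a::real_normed_vector) \<Rightarrow> bool" where
  "cb L 0 B f \<longleftrightarrow> (\<forall>x. f (x + L) = f x) \<and> (\<forall>x. norm (f x) \<le> B)"
| "cb L (Suc 0) B f \<longleftrightarrow> (\<forall>x. f (x + L) = f x) \<and> (\<forall>x. norm (f x) \<le> B) \<and>
     (\<forall>x y. norm (f x - f y) \<le> B * \<bar>x - y\<bar>)"
| "cb L (Suc (Suc k)) B f \<longleftrightarrow> (\<forall>x. f (x + L) = f x) \<and> (\<forall>x. norm (f x) \<le> B) \<and>
     (\<forall>x. (f has_vector_derivative DD f x) (at x)) \<and> cb L (Suc k) B (DD f)"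

lemma DD_eqI: "(\<And>x. (f has_vector_derivative g x) (at x)) \<Longrightarrow> DD f = g"
  by (auto simp: DD_def fun_eq_iff intro: vector_derivative_at)

lemma cb_per: "cb L k B f \<Longrightarrow> f (x + L) = f x"
  by (induction L k B f rule: cb.induct) auto

lemma cb_bdd: "cb L k B f \<Longrightarrow> norm (f x) \<le> B"
  by (induction L k B f rule: cb.induct) auto

lemma cb_nonneg: "cb L k B f \<Longrightarrow> 0 \<le> B"
  using cb_bdd norm_ge_zero order_trans by blast

lemma cb_deriv: "cb L (Suc (Suc k)) B f \<Longrightarrow> (f has_vector_derivative DD f x) (at x)"
  by simp

lemma cb_DD: "cb L (Suc (Suc k)) B f \<Longrightarrow> cb L (Suc k) B (DD f)"
  by simp

lemma lip_of_deriv: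
  fixes f :: "real \<Rightarrow> 'a::real_normed_vector"
  assumes "\<And>x. (f has_vector_derivative f' x) (at x)" "\<And>x. norm (f' x) \<le> B"
  shows "norm (f x - f y) \<le> B * \<bar>x - y\<bar>"
proof -
  have "norm (f x - f y) \<le> B * norm (x - y)"
  proof (rule differentiable_bound[of UNIV f "\<lambda>x h. h *\<^sub>R f' x"])
    show "onorm (\<lambda>h. h *\<^sub>R f' x) \<le> B" for x
      using assms(2)[of x] by (intro onorm_le) (metis abs_ge_zero mult.commute mult_left_mono norm_scaleR real_norm_def)
  qed (use assms(1) in \<open>auto simp: has_vector_derivative_def\<close>)
  then show ?thesis by simp
qed

lemma cb_lip:
  assumes "cb L (Suc k) B f" shows "norm (f x - f y) \<le> B * \<bar>x - y\<bar>"
proof (cases k)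
  case (Suc j)
  then show ?thesis using assms
    by (intro lip_of_deriv[of f "DD f"]) (auto intro: cb_bdd)
qed (use assms in auto)

lemma cb_Suc: "cb L (Suc k) B f \<Longrightarrow> cb L k B f"
proof (induction k arbitrary: f)
  case (Suc k)
  show ?case
  proof (cases k)
    case 0
    then show ?thesis using Suc.prems cb_lip[OF Suc.prems] by auto
  next
    case (Suc j)
    then show ?thesis using Suc.IH Suc.prems by auto
  qed
qed (auto intro: cb_per cb_bdd)

lemma cb_le: "cb L k B f \<Longrightarrow> j \<le> k \<Longrightarrow> cb L j B f"
  by (induction k arbitrary: j) (auto simp: le_Suc_eq dest: cb_Suc)

lemma cb_mono: "cb L k B f \<Longrightarrow> B \<le> B' \<Longrightarrow> cb L k B' f"
proof (induction L k B f rule: cb.induct)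
  case (2 L B f)
  then show ?case
    by (auto intro: order_trans mult_right_mono) (meson abs_ge_zero mult_right_mono order_trans)
qed (auto intro: order_trans)

lemma cb_continuous: "cb L (Suc k) B f \<Longrightarrow> continuous_on S f"
proof -
  assume a: "cb L (Suc k) B f"
  have "B-lipschitz_on S f"
    using cb_lip[OF a] cb_nonneg[OF a] by (auto simp: lipschitz_on_def dist_norm)
  then show ?thesis by (rule lipschitz_on_continuous_on)
qed

lemma cb_linear:
  fixes l :: "'a::real_normed_vector \<Rightarrow> 'b::real_normed_vector"
  assumes l: "bounded_linear l" "\<And>v. norm (l v) \<le> norm v"
  shows "cb L k B f \<Longrightarrow> cb L k B (\<lambda>x. l (f x))"
proof (induction L k B f rule: cb.induct)
  case (2 L B f)
  have "norm (l (f x) - l (f y)) \<le> B * \<bar>x - y\<bar>" for x y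
    using order_trans[OF l(2)[of "f x - f y"]] 2
    by (simp add: linear_diff[OF bounded_linear.linear[OF l(1)]])
  moreover have "norm (l (f x)) \<le> B" for x
    using order_trans[OF l(2)[of "f x"]] 2 by simp
  ultimately show ?case using 2 by simp
next
  case (3 L k B f)
  have d: "((\<lambda>x. l (f x)) has_vector_derivative l (DD f x)) (at x)" for x
    using 3 by (intro bounded_linear.has_vector_derivative[OF l(1)]) auto
  then have "DD (\<lambda>x. l (f x)) = (\<lambda>x. l (DD f x))" by (rule DD_eqI)
  moreover have "norm (l (f x)) \<le> B" for x
    using order_trans[OF l(2)[of "f x"]] 3 by simp
  ultimately show ?case using 3 d by simp
next
  case (1 L B f)
  moreover have "norm (l (f x)) \<le> B" for x
    using order_trans[OF l(2)[of "f x"]] 1 by simp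
  ultimately show ?case by simp
qed

lemma cb_add: "cb L k B f \<Longrightarrow> cb L k B' g \<Longrightarrow> cb L k (B + B') (\<lambda>x. f x + g x)"
proof (induction L k B f arbitrary: g rule: cb.induct)
  case (1 L B f)
  then show ?case by (auto intro: norm_triangle_mono)
next
  case (2 L B f)
  have "norm (f x + g x - (f y + g y)) \<le> B * \<bar>x - y\<bar> + B' * \<bar>x - y\<bar>" for x y
    using norm_triangle_mono[of "f x - f y" "B * \<bar>x - y\<bar>" "g x - g y" "B' * \<bar>x - y\<bar>"] 2
    by (simp add: algebra_simps)
  then show ?case using 2 by (auto simp: distrib_right intro: norm_triangle_mono)
next
  case (3 L k B f)
  have d: "((\<lambda>x. f x + g x) has_vector_derivative DD f x + DD g x) (at x)" for x
    using 3 by (intro has_vector_derivative_add) auto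
  then have e: "DD (\<lambda>x. f x + g x) = (\<lambda>x. DD f x + DD g x)" by (rule DD_eqI)
  show ?case unfolding cb.simps e using 3 d by (auto intro: norm_triangle_mono)
qed

text \<open>Leibniz rule: every derivative doubles the number of summands, whence the factor
  2^k.\<close>

lemma cb_mult_scaleR:
  fixes f :: "real \<Rightarrow> 'a::real_normed_vector"
  shows "cb L k Bv v \<Longrightarrow> cb L k B f \<Longrightarrow> cb L k (2 ^ k * Bv * B) (\<lambda>x. v x *\<^sub>R f x)"
proof (induction k arbitrary: v f)
  case 0
  then show ?case using cb_nonneg[OF 0(1)] by (auto intro!: mult_mono)
next
  case (Suc k)
  note nn = cb_nonneg[OF Suc.prems(1)] cb_nonneg[OF Suc.prems(2)]
  have p1: "(1::real) \<le> 2 ^ Suc k" by (rule one_le_power) simp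
  have bd: "norm (v x *\<^sub>R f x) \<le> 2 ^ Suc k * Bv * B" for x
  proof -
    have "norm (v x *\<^sub>R f x) \<le> 1 * (Bv * B)"
      using cb_bdd[OF Suc.prems(1), of x] cb_bdd[OF Suc.prems(2), of x] nn by (auto intro!: mult_mono)
    also have "\<dots> \<le> 2 ^ Suc k * (Bv * B)" using nn p1 by (intro mult_right_mono) auto
    finally show ?thesis by (simp add: mult_ac)
  qed
  have pe: "v (x + L) *\<^sub>R f (x + L) = v x *\<^sub>R f x" for x
    using cb_per[OF Suc.prems(1)] cb_per[OF Suc.prems(2)] by simp
  show ?case
  proof (cases k)
    case 0
    have "norm (v x *\<^sub>R f x - v y *\<^sub>R f y) \<le> 2 * Bv * B * \<bar>x - y\<bar>" for x y
    proof -
      have "v x *\<^sub>R f x - v y *\<^sub>R f y = (v x - v y) *\<^sub>R f x + v y *\<^sub>R (f x - f y)"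
        by (simp add: algebra_simps)
      also have "norm \<dots> \<le> (Bv * \<bar>x - y\<bar>) * B + Bv * (B * \<bar>x - y\<bar>)"
        using cb_lip[OF Suc.prems(1), of x y] cb_lip[OF Suc.prems(2), of x y]
          cb_bdd[OF Suc.prems(1), of y] cb_bdd[OF Suc.prems(2), of x] nn
        by (intro norm_triangle_mono) (auto intro!: mult_mono)
      finally show ?thesis by (simp add: algebra_simps)
    qed
    then show ?thesis using 0 bd pe by simp
  next
    case (Suc j)
    have c: "cb L (Suc j) Bv v" "cb L (Suc j) B f" "cb L (Suc j) Bv (DD v)" "cb L (Suc j) B (DD f)"
      using Suc.prems Suc by (auto intro: cb_Suc)
    have d: "((\<lambda>x. v x *\<^sub>R f x) has_vector_derivative v x *\<^sub>R DD f x + DD v x *\<^sub>R f x) (at x)" for x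
      using Suc.prems Suc
      by (auto intro!: has_vector_derivative_scaleR simp: has_real_derivative_iff_has_vector_derivative)
    have e: "DD (\<lambda>x. v x *\<^sub>R f x) = (\<lambda>x. v x *\<^sub>R DD f x + DD v x *\<^sub>R f x)"
      by (rule DD_eqI[OF d])
    have "cb L (Suc j) (2 ^ k * Bv * B + 2 ^ k * Bv * B) (DD (\<lambda>x. v x *\<^sub>R f x))"
      unfolding e using Suc.IH[of v "DD f"] Suc.IH[of "DD v" f] c Suc by (intro cb_add) auto
    then show ?thesis unfolding Suc cb.simps(3) using Suc bd pe d e by (auto simp: algebra_simps)
  qed
qed

lemma cb_scaleR: "cb L k B f \<Longrightarrow> cb L k (\<bar>c\<bar> * B) (\<lambda>x. c *\<^sub>R f x)"
proof (induction L k B f rule: cb.induct)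
  case (2 L B f)
  have "norm (c *\<^sub>R f x - c *\<^sub>R f y) \<le> \<bar>c\<bar> * (B * \<bar>x - y\<bar>)" for x y
    using 2 by (auto simp: scaleR_diff_right[symmetric] intro!: mult_left_mono simp del: scaleR_diff_right)
  then show ?case using 2 by (auto simp: mult.assoc intro: mult_left_mono)
next
  case (3 L k B f)
  have d: "((\<lambda>x. c *\<^sub>R f x) has_vector_derivative c *\<^sub>R DD f x) (at x)" for x
    using 3 by (intro bounded_linear.has_vector_derivative[OF bounded_linear_scaleR_right]) auto
  then have "DD (\<lambda>x. c *\<^sub>R f x) = (\<lambda>x. c *\<^sub>R DD f x)" by (rule DD_eqI)
  then show ?case using 3 d by (auto intro: mult_left_mono)
qed (auto intro: mult_left_mono)

lemma cb_zero: "cb L k 0 (\<lambda>x. 0 :: 'a::real_normed_vector)"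
proof -
  have e: "DD (\<lambda>x. 0 :: 'a) = (\<lambda>x. 0)" by (rule DD_eqI) simp
  show ?thesis
  proof (induction k)
    case (Suc k)
    then show ?case by (cases k) (auto simp: e)
  qed simp
qed

lemma cb_diff: "cb L k B f \<Longrightarrow> cb L k B' g \<Longrightarrow> cb L k (B + B') (\<lambda>x. f x - g x)"
  using cb_add[OF _ cb_scaleR[where c="-1"], of L k B f B' g] by simp

lemma DD_add: "cb L (Suc (Suc k)) B f \<Longrightarrow> cb L (Suc (Suc k)) B' g \<Longrightarrow> DD (\<lambda>x. f x + g x) = (\<lambda>x. DD f x + DD g x)"
  by (intro DD_eqI has_vector_derivative_add) auto

lemma DD_scaleR: "cb L (Suc (Suc k)) B f \<Longrightarrow> DD (\<lambda>x. c *\<^sub>R f x) = (\<lambda>x. c *\<^sub>R DD f x)"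
  by (intro DD_eqI bounded_linear.has_vector_derivative[OF bounded_linear_scaleR_right]) auto

section \<open>Fourier modes and coefficients\<close>

definition ee :: "real \<Rightarrow> int \<Rightarrow> real \<Rightarrow> complex" where
  "ee L l x = cis (freq 0 L l * x)"

lemma ee_add_freq: "ee L l x * ee L k x = ee L (l + k) x"
  by (simp add: ee_def cis_mult freq_def algebra_simps add_divide_distrib)

lemma ee_add_arg: "ee L l (x + y) = ee L l x * ee L l y"
  by (simp add: ee_def cis_mult algebra_simps)

lemma ee_zero [simp]: "ee L 0 x = 1" "ee L l 0 = 1"
  by (simp_all add: ee_def freq_def)

lemma norm_ee [simp]: "cmod (ee L l x) = 1"
  by (simp add: ee_def)

lemma ee_per: "L > 0 \<Longrightarrow> ee L l (x + L) = ee L l x"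
proof -
  assume "L > 0"
  then have "ee L l L = 1" by (simp add: ee_def freq_def cis_multiple_2pi)
  then show ?thesis by (simp add: ee_add_arg)
qed

lemma cnj_ee: "cnj (ee L l x) = ee L (- l) x"
  by (simp add: ee_def freq_def cis_cnj)

lemma ee_minus_arg: "ee L l (- x) = ee L (- l) x"
  by (simp add: ee_def freq_def)

lemma ee_diff_arg: "ee L l (x - y) = ee L l x * ee L (- l) y"
  using ee_add_arg[of L l x "- y"] by (simp add: ee_minus_arg)

lemma ee_deriv: "(ee L l has_vector_derivative (\<i> * of_real (freq 0 L l)) * ee L l x) (at x within S)"
proof -
  have "((\<lambda>x. exp (x *\<^sub>R (\<i> * of_real (freq 0 L l)))) has_vector_derivative
      exp (x *\<^sub>R (\<i> * of_real (freq 0 L l))) * (\<i> * of_real (freq 0 L l))) (at x within S)"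
    by (rule exp_scaleR_has_vector_derivative_right)
  then show ?thesis
    by (simp add: ee_def[abs_def] cis_conv_exp scaleR_complex mult_ac)
qed

lemma ee_continuous [continuous_intros]: "continuous_on S (ee L l)"
  using ee_deriv by (intro differentiable_imp_continuous_on)
    (auto simp: differentiable_on_def has_vector_derivative_def intro!: differentiableI)

lemma ee_integral:
  assumes "L > 0" shows "(ee L l has_integral (if l = 0 then of_real L else 0)) {0..L}"
proof (cases "l = 0")
  case True
  have "((\<lambda>x. 1::complex) has_integral (L - 0) *\<^sub>R 1) {0..L}"
    using has_integral_const_real[of "1::complex" 0 L] assms by simp
  moreover have "ee L 0 = (\<lambda>x. 1)" by auto
  ultimately show ?thesis using True by (simp add: scaleR_complex)
next
  case False
  let ?f = "\<i> * of_real (freq 0 L l) :: complex"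
  have nz: "?f \<noteq> 0" using False assms by (simp add: freq_def)
  have "((\<lambda>x. (1/?f) * ee L l x) has_vector_derivative ee L l x) (at x within {0..L})" for x
    using has_vector_derivative_mult_right[OF ee_deriv[of L l x "{0..L}"], of "1/?f"] nz by simp
  then have "(ee L l has_integral ((1/?f) * ee L l L - (1/?f) * ee L l 0)) {0..L}"
    using assms by (intro fundamental_theorem_of_calculus) auto
  moreover have "ee L l L = 1" using ee_per[OF assms, of l 0] by simp
  ultimately show ?thesis using False by simp
qed

definition fc :: "real \<Rightarrow> (real \<Rightarrow> complex^2) \<Rightarrow> int \<Rightarrow> complex^2" where
  "fc L f l = integral {0..L} (\<lambda>y. ee L (- l) y *s f y) /\<^sub>R L"

lemma vsmult_continuous [continuous_intros]:
  "continuous_on S g \<Longrightarrow> continuous_on S f \<Longrightarrow> continuous_on S (\<lambda>x. g x *s (f x :: complex^2))"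
  by (rule bounded_bilinear.continuous_on[OF bounded_bilinear_vsmult])

lemma fc_integrable: "continuous_on {0..L} (f::real \<Rightarrow> complex^2) \<Longrightarrow> (\<lambda>y. ee L l y *s f y) integrable_on {0..L}"
  by (intro integrable_continuous_interval continuous_intros)

lemma fc_add: "continuous_on {0..L} f \<Longrightarrow> continuous_on {0..L} g \<Longrightarrow>
    fc L (\<lambda>x. f x + g x) l = fc L f l + fc L g l"
  by (simp add: fc_def bounded_bilinear.add_right[OF bounded_bilinear_vsmult] integral_add[OF fc_integrable fc_integrable] scaleR_add_right)

lemma vsmult_scaleR: "c *s (r *\<^sub>R v) = r *\<^sub>R (c *s (v::complex^2))"
  by (simp add: vec_eq_iff)

lemma fc_scaleR: "fc L (\<lambda>x. c *\<^sub>R f x) l = c *\<^sub>R fc L f l"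
  by (simp add: fc_def vsmult_scaleR)

lemma fc_diff: "continuous_on {0..L} f \<Longrightarrow> continuous_on {0..L} g \<Longrightarrow>
    fc L (\<lambda>x. f x - g x) l = fc L f l - fc L g l"
  using fc_add[of L f "\<lambda>x. (-1) *\<^sub>R g x" l] fc_scaleR[of L "-1" g l]
  by (simp add: continuous_on_minus)

lemma fc_matrix:
  assumes "continuous_on {0..L} f" shows "fc L (\<lambda>x. A *v f x) l = A *v fc L f l"
proof -
  have "(\<lambda>y. ee L (- l) y *s (A *v f y)) = (*v) A \<circ> (\<lambda>y. ee L (- l) y *s f y)"
    by (auto simp: vec_eq_iff matrix_vector_mult_def sum_distrib_left algebra_simps)
  then show ?thesis
    unfolding fc_def using integral_linear[OF fc_integrable[OF assms, of "-l"] matrix_vector_mul_bounded_linear[of A]]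
    by (simp add: matrix_vector_mult_scaleR_right)
qed

lemma fc_DD:
  assumes "L > 0" "cb L (Suc (Suc k)) B f"
  shows "fc L (DD f) l = (\<i> * of_real (freq 0 L l)) *s fc L f l"
proof -
  let ?c = "\<i> * of_real (freq 0 L l) :: complex"
  have d: "((\<lambda>y. ee L (- l) y *s f y) has_vector_derivative
      ee L (- l) y *s DD f y + (- ?c * ee L (- l) y) *s f y) (at y within {0..L})" for y
    using bounded_bilinear.has_vector_derivative[OF bounded_bilinear_vsmult ee_deriv[of L "-l" y "{0..L}"]
       has_vector_derivative_at_within[OF cb_deriv[OF assms(2), of y]]]
    by (simp add: freq_def)
  have "((\<lambda>y. ee L (- l) y *s DD f y + (- ?c * ee L (- l) y) *s f y) has_integral
      (ee L (- l) L *s f L - ee L (- l) 0 *s f 0)) {0..L}"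
    using assms(1) d by (intro fundamental_theorem_of_calculus) auto
  moreover have "ee L (- l) L = 1" "f L = f 0"
    using ee_per[OF assms(1), of "-l" 0] cb_per[OF assms(2), of 0] by auto
  ultimately have 1: "((\<lambda>y. ee L (- l) y *s DD f y + (- ?c * ee L (- l) y) *s f y) has_integral 0) {0..L}"
    by simp
  have 2: "((\<lambda>y. ?c *s (ee L (- l) y *s f y)) has_integral (?c *s (L *\<^sub>R fc L f l))) {0..L}"
    using has_integral_linear[OF integrable_integral[OF fc_integrable[OF cb_continuous[OF cb_Suc[OF assms(2)]], of L "-l"]]
      bounded_linear_vsmult_right[of ?c]] assms(1) by (simp add: fc_def o_def)
  have "((\<lambda>y. ee L (- l) y *s DD f y) has_integral (?c *s (L *\<^sub>R fc L f l))) {0..L}"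
  proof -
    have "ee L (- l) y *s DD f y + (- ?c * ee L (- l) y) *s f y + ?c *s (ee L (- l) y *s f y) = ee L (- l) y *s DD f y" for y
      by (simp add: vec_eq_iff)
    then show ?thesis using has_integral_add[OF 1 2] by (simp only: add_0)
  qed
  then show ?thesis using assms(1) by (simp add: fc_def integral_unique vsmult_scaleR)
qed

lemma integral_periodic_shift:
  fixes g :: "real \<Rightarrow> 'a::euclidean_space"
  assumes "L > 0" and c: "continuous_on UNIV g" and p: "\<And>x. g (x + L) = g x"
  shows "integral {0..L} (\<lambda>y. g (y + h)) = integral {0..L} g"
proof -
  have pk: "g (x + of_int k * L) = g x" for x k
  proof (induction k rule: int_induct[of _ 0])
    case (step1 i)
    then show ?case using p[of "x + of_int i * L"] by (simp add: algebra_simps)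
  next
    case (step2 i)
    then show ?case using p[of "x + of_int (i - 1) * L"] by (simp add: algebra_simps)
  qed simp
  define k where "k = \<lfloor>h / L\<rfloor>"
  define h' where "h' = h - of_int k * L"
  have "of_int k \<le> h / L" "h / L < of_int k + 1" unfolding k_def by linarith+
  then have h': "0 \<le> h'" "h' \<le> L" using assms(1) by (auto simp: h'_def field_simps)
  have i: "g integrable_on {a..b}" for a b
    by (rule integrable_continuous_interval) (rule continuous_on_subset[OF c], simp)
  have "integral {0..L} (\<lambda>y. g (y + h)) = integral {0..L} (\<lambda>y. g (y + h'))"
    using pk[of "_ + h'" k] by (simp add: h'_def algebra_simps)
  also have "\<dots> = integral {h'..L + h'} g"
    using integral_shift_real_ivl[of h' h' "L + h'" g] by simp
  also have "\<dots> = integral {h'..L} g + integral {L..L + h'} g"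
    using h' by (intro Henstock_Kurzweil_Integration.integral_combine[symmetric] i) auto
  also have "integral {L..L + h'} g = integral {0..h'} (\<lambda>y. g (y + L))"
    using integral_shift_real_ivl[of L L "L + h'" g] by simp
  also have "\<dots> = integral {0..h'} g" by (simp add: p)
  also have "integral {h'..L} g + integral {0..h'} g = integral {0..L} g"
    using h' by (subst add.commute, intro Henstock_Kurzweil_Integration.integral_combine i) auto
  finally show ?thesis .
qed

lemma fc_shift:
  assumes "L > 0" "continuous_on UNIV f" "\<And>x. f (x + L) = f x"
  shows "fc L (\<lambda>x. f (x + h)) l = ee L l h *s fc L f l"
proof -
  have "integral {0..L} (\<lambda>y. ee L (- l) (y + h) *s f (y + h)) = integral {0..L} (\<lambda>y. ee L (- l) y *s f y)"
    by (rule integral_periodic_shift[OF assms(1)]) (auto intro!: continuous_intros assms simp: ee_per[OF assms(1)])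
  moreover have "ee L (- l) (y + h) *s f (y + h) = ee L (- l) h *s (ee L (- l) y *s f (y + h))" for y
    by (simp add: ee_add_arg mult.commute)
  moreover have "(\<lambda>y. f (y + h)) = f \<circ> (\<lambda>y. y + h)" by auto
  then have c: "continuous_on {0..L} (\<lambda>y. f (y + h))"
    by (auto intro!: continuous_on_compose2[OF assms(2)] continuous_intros)
  ultimately have "ee L (- l) h *s fc L (\<lambda>x. f (x + h)) l = fc L f l"
    using integral_linear[OF fc_integrable[OF c, of "-l"] bounded_linear_vsmult_right[of "ee L (- l) h"]]
    by (simp add: fc_def o_def vsmult_scaleR)
  then have "ee L l h *s (ee L (- l) h *s fc L (\<lambda>x. f (x + h)) l) = ee L l h *s fc L f l" by simp
  then show ?thesis by (simp add: ee_add_freq)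
qed

section \<open>A positive summation kernel\<close>

definition ker_coeff :: "nat \<Rightarrow> nat \<Rightarrow> real" where
  "ker_coeff N k = sin (real (Suc k) * (pi / real (N + 2)))
     / sqrt (\<Sum>j\<le>N. (sin (real (Suc j) * (pi / real (N + 2))))\<^sup>2)"

definition rho :: "nat \<Rightarrow> int \<Rightarrow> real" where
  "rho N l = (\<Sum>k\<le>N. \<Sum>j\<le>N. if int k - int j = l then ker_coeff N k * ker_coeff N j else 0)"

text \<open>The Fejer-Korovkin kernel. Being the squared modulus of a trigonometric polynomial it is
  nonnegative, and \<open>rho\<close>, the autocorrelation of the coefficients
  \<open>ker_coeff\<close>, is the sequence of its Fourier coefficients. The sine samples make the
  first of them as close to 1 as nonnegativity and degree N permit.\<close>

definition kap :: "nat \<Rightarrow> real \<Rightarrow> real \<Rightarrow> real" where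
  "kap N L t = (cmod (\<Sum>k\<le>N. of_real (ker_coeff N k) * ee L (int k) t))\<^sup>2"

lemma ker_sum_pos: "0 < (\<Sum>j\<le>N. (sin (real (Suc j) * (pi / real (N + 2))))\<^sup>2)"
proof (rule sum_pos2[of _ 0])
  show "0 < (sin (real (Suc 0) * (pi / real (N + 2))))\<^sup>2"
  proof -
    have "pi / real (N + 2) < pi / 1" using pi_gt_zero by (intro divide_strict_left_mono) auto
    then have "0 < sin (pi / real (N + 2))" by (intro sin_gt_zero) auto
    then show ?thesis by (simp add: power2_eq_square)
  qed
qed auto

lemma ker_norm: "(\<Sum>k\<le>N. (ker_coeff N k)\<^sup>2) = 1"
  using ker_sum_pos[of N] by (simp add: ker_coeff_def power_divide sum_divide_distrib[symmetric])

lemma rho_0: "rho N 0 = 1"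
proof -
  have "(\<Sum>j\<le>N. if int k - int j = 0 then ker_coeff N k * ker_coeff N j else 0) = (ker_coeff N k)\<^sup>2"
    if "k \<le> N" for k
  proof -
    have "(\<Sum>j\<le>N. if int k - int j = 0 then ker_coeff N k * ker_coeff N j else 0)
       = (\<Sum>j\<le>N. if k = j then ker_coeff N k * ker_coeff N j else 0)" by (intro sum.cong) auto
    then show ?thesis using that by (simp add: power2_eq_square)
  qed
  then show ?thesis by (simp add: rho_def ker_norm)
qed

lemma rho_minus: "rho N (- l) = rho N l"
  unfolding rho_def by (subst sum.swap) (intro sum.cong refl, auto simp: mult.commute)

lemma rho_out: "\<bar>l\<bar> > int N \<Longrightarrow> rho N l = 0"
  unfolding rho_def by (intro sum.neutral ballI) auto

text \<open>The coefficient vector of the kernel is the Perron eigenvector of the path graph, so that the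
  first Fourier coefficient of the kernel is half of the largest eigenvalue.\<close>

lemma rho_1: "rho N 1 = cos (pi / real (N + 2))"
proof -
  define t where "t = pi / real (N + 2)"
  define s where "s k = sin (real k * t)" for k
  define Z where "Z = (\<Sum>j\<le>N. (s (Suc j))\<^sup>2)"
  have Z: "Z > 0" using ker_sum_pos[of N] by (simp add: Z_def s_def t_def)
  have a: "ker_coeff N k = s (Suc k) / sqrt Z" for k by (simp add: ker_coeff_def s_def t_def Z_def)
  have send: "s (Suc (Suc N)) = 0"
  proof -
    have "real (Suc (Suc N)) * t = pi" by (simp add: t_def)
    then show ?thesis by (simp add: s_def)
  qed
  have rec: "s (Suc (Suc k)) + s k = 2 * cos t * s (Suc k)" for k
  proof -
    have "real (Suc (Suc k)) * t = real (Suc k) * t + t" "real k * t = real (Suc k) * t - t"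
      by (simp_all add: algebra_simps)
    then show ?thesis unfolding s_def by (simp only: sin_add sin_diff) (simp add: algebra_simps)
  qed
  have "2 * cos t * Z = (\<Sum>k\<le>N. s (Suc k) * (s (Suc (Suc k)) + s k))"
    unfolding Z_def rec by (simp add: sum_distrib_left power2_eq_square mult_ac)
  also have "\<dots> = (\<Sum>k\<le>N. s (Suc k) * s (Suc (Suc k))) + (\<Sum>k\<le>N. s (Suc k) * s k)"
    by (simp add: algebra_simps sum.distrib)
  also have "(\<Sum>k\<le>N. s (Suc k) * s (Suc (Suc k))) = (\<Sum>k<N. s (Suc k) * s (Suc (Suc k)))"
    using send by (simp add: lessThan_Suc_atMost[symmetric])
  also have "(\<Sum>k\<le>N. s (Suc k) * s k) = (\<Sum>k<N. s (Suc (Suc k)) * s (Suc k))"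
    unfolding lessThan_Suc_atMost[symmetric] by (subst sum.lessThan_Suc_shift) (simp add: s_def)
  finally have S: "(\<Sum>k<N. s (Suc k) * s (Suc (Suc k))) = cos t * Z" by (simp add: mult.commute)
  have "rho N 1 = (\<Sum>j\<le>N. \<Sum>k\<le>N. if int k - int j = 1 then ker_coeff N k * ker_coeff N j else 0)"
    unfolding rho_def by (rule sum.swap)
  also have "\<dots> = (\<Sum>j\<le>N. if j < N then ker_coeff N (Suc j) * ker_coeff N j else 0)"
  proof (rule sum.cong[OF refl])
    fix j assume "j \<in> {..N}"
    have "(\<Sum>k\<le>N. if int k - int j = 1 then ker_coeff N k * ker_coeff N j else 0)
        = (\<Sum>k\<le>N. if k = Suc j then ker_coeff N k * ker_coeff N j else 0)" by (intro sum.cong) auto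
    then show "(\<Sum>k\<le>N. if int k - int j = 1 then ker_coeff N k * ker_coeff N j else 0)
        = (if j < N then ker_coeff N (Suc j) * ker_coeff N j else 0)" by auto
  qed
  also have "\<dots> = (\<Sum>j<N. ker_coeff N (Suc j) * ker_coeff N j)"
    by (simp add: lessThan_Suc_atMost[symmetric])
  also have "\<dots> = (\<Sum>k<N. s (Suc k) * s (Suc (Suc k))) / Z"
    using Z by (simp add: a sum_divide_distrib mult.commute)
  finally show ?thesis using S Z by (simp add: t_def)
qed

lemma sum_if_int_collect:
  fixes F :: "int \<Rightarrow> 'a::comm_monoid_add"
  assumes "d \<in> {- int N..int N}"
  shows "(\<Sum>l=- int N..int N. if d = l then F l else 0) = F d"
  using assms by simp

lemma kap_eq: "of_real (kap N L t) = (\<Sum>l=- int N..int N. of_real (rho N l) * ee L l t)"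
proof -
  let ?a = "\<lambda>k. of_real (ker_coeff N k) :: complex"
  have "of_real (kap N L t) = (\<Sum>k\<le>N. ?a k * ee L (int k) t) * cnj (\<Sum>k\<le>N. ?a k * ee L (int k) t)"
    by (simp add: kap_def complex_norm_square flip: of_real_power)
  also have "\<dots> = (\<Sum>k\<le>N. \<Sum>j\<le>N. ?a k * ?a j * (ee L (int k) t * ee L (- int j) t))"
    by (simp add: sum_product cnj_ee mult_ac)
  also have "\<dots> = (\<Sum>k\<le>N. \<Sum>j\<le>N. ?a k * ?a j * ee L (int k - int j) t)"
    by (simp add: ee_add_freq)
  also have "\<dots> = (\<Sum>k\<le>N. \<Sum>j\<le>N. \<Sum>l=- int N..int N. if int k - int j = l then ?a k * ?a j * ee L l t else 0)"
    by (intro sum.cong refl, subst sum_if_int_collect) auto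
  also have "\<dots> = (\<Sum>k\<le>N. \<Sum>l=- int N..int N. \<Sum>j\<le>N. if int k - int j = l then ?a k * ?a j * ee L l t else 0)"
    by (intro sum.cong refl, rule sum.swap)
  also have "\<dots> = (\<Sum>l=- int N..int N. \<Sum>k\<le>N. \<Sum>j\<le>N. if int k - int j = l then ?a k * ?a j * ee L l t else 0)"
    by (rule sum.swap)
  also have "\<dots> = (\<Sum>l=- int N..int N. of_real (rho N l) * ee L l t)"
    unfolding rho_def of_real_sum sum_distrib_right by (intro sum.cong refl) auto
  finally show ?thesis .
qed

lemma kap_nonneg: "0 \<le> kap N L t" by (simp add: kap_def)

definition ev :: "real \<Rightarrow> nat \<Rightarrow> (int \<Rightarrow> complex^2) \<Rightarrow> real \<Rightarrow> complex^2" where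
  "ev L R c x = (\<Sum>l=- int R..int R. ee L l x *s c l)"

definition kc :: "nat \<Rightarrow> real \<Rightarrow> (real \<Rightarrow> complex^2) \<Rightarrow> int \<Rightarrow> complex^2" where
  "kc N L f l = of_real (rho N l) *s fc L f l"

definition KN :: "nat \<Rightarrow> real \<Rightarrow> (real \<Rightarrow> complex^2) \<Rightarrow> real \<Rightarrow> complex^2" where
  "KN N L f = ev L N (kc N L f)"

lemma kap_integral_mode:
  assumes "L > 0" "\<bar>p\<bar> \<le> int N"
  shows "((\<lambda>y. of_real (kap N L (x - y)) * ee L p (x - y)) has_integral of_real (L * rho N p)) {0..L}"
proof -
  have 1: "of_real (kap N L (x - y)) * ee L p (x - y)
      = (\<Sum>l=- int N..int N. (of_real (rho N l) * ee L (l + p) x) * ee L (- (l + p)) y)" for y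
  proof -
    have "of_real (rho N l) * ee L l (x - y) * ee L p (x - y) = (of_real (rho N l) * ee L (l + p) x) * ee L (- (l + p)) y" for l
    proof -
      have "ee L l (x - y) * ee L p (x - y) = ee L (l + p) x * ee L (- (l + p)) y"
        unfolding ee_add_freq by (rule ee_diff_arg)
      then show ?thesis by (simp only: mult.assoc)
    qed
    then show ?thesis unfolding kap_eq sum_distrib_right by (intro sum.cong refl) blast
  qed
  have "((\<lambda>y. \<Sum>l=- int N..int N. (of_real (rho N l) * ee L (l + p) x) * ee L (- (l + p)) y) has_integral
      (\<Sum>l=- int N..int N. (of_real (rho N l) * ee L (l + p) x) * (if - (l + p) = 0 then of_real L else 0))) {0..L}"
    by (intro has_integral_sum has_integral_mult_right ee_integral assms) auto
  also have "(\<Sum>l=- int N..int N. (of_real (rho N l) * ee L (l + p) x) * (if - (l + p) = 0 then of_real L else (0::complex)))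
     = (\<Sum>l=- int N..int N. if - p = l then of_real (rho N l) * of_real L else 0)"
    by (intro sum.cong refl) auto
  also have "\<dots> = of_real (L * rho N p)"
    using assms(2) by (subst sum_if_int_collect) (auto simp: rho_minus)
  finally show ?thesis unfolding 1 .
qed

lemma kap_integral: "L > 0 \<Longrightarrow> ((\<lambda>y. kap N L (x - y)) has_integral L) {0..L}"
  using has_integral_Re[OF kap_integral_mode[of L 0 N x]] by (simp add: rho_0)

lemma kap_integral_cos:
  assumes "L > 0"
  shows "((\<lambda>y. kap N L (x - y) * cos (2 * pi * (x - y) / L)) has_integral L * cos (pi / real (N + 2))) {0..L}"
proof (cases "N = 0")
  \<comment> \<open>The frequency 1 exceeds the degree N = 0, so \<open>kap_integral_mode\<close>
    does not cover it. The kernel is constant and both sides vanish, the right one because of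
    cos(pi/2).\<close>
  case True
  have r: "rho 0 l = (if l = 0 then 1 else 0)" for l
    using rho_0[of 0] rho_out[of 0 l] by auto
  have "kap 0 L t = 1" for t
    using kap_eq[of 0 L t] by (simp add: r)
  moreover have "((\<lambda>y. ee L 1 x * ee L (-1) y) has_integral ee L 1 x * 0) {0..L}"
    using has_integral_mult_right[OF ee_integral[OF assms, of "-1"], of "ee L 1 x"] by simp
  then have "((\<lambda>y. Re (ee L 1 (x - y))) has_integral 0) {0..L}"
    using has_integral_Re[of "\<lambda>y. ee L 1 (x - y)" 0] by (simp add: ee_diff_arg)
  ultimately show ?thesis using True by (simp add: ee_def freq_def)
next
  case False
  then show ?thesis
    using has_integral_Re[OF kap_integral_mode[OF assms, of 1 N x]]
    by (simp add: rho_1 ee_def freq_def)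
qed

text \<open>\<open>KN\<close> is defined as a Fourier multiplier, which suits derivatives and the
  free evolution; its supremum estimates come from this second form, an average against a
  nonnegative kernel of total mass L.\<close>

lemma KN_conv:
  assumes "L > 0" "continuous_on {0..L} f"
  shows "((\<lambda>y. kap N L (x - y) *\<^sub>R f y) has_integral L *\<^sub>R KN N L f x) {0..L}"
proof -
  have 1: "kap N L (x - y) *\<^sub>R f y = (\<Sum>l=- int N..int N. (of_real (rho N l) * ee L l x) *s (ee L (- l) y *s f y))" for y
  proof -
    have "kap N L (x - y) *\<^sub>R f y = of_real (kap N L (x - y)) *s f y"
      by (simp add: vec_eq_iff scaleR_complex)
    then show ?thesis unfolding kap_eq
      by (simp add: bounded_bilinear.sum_left[OF bounded_bilinear_vsmult] ee_diff_arg mult_ac)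
  qed
  have "((\<lambda>y. \<Sum>l=- int N..int N. (of_real (rho N l) * ee L l x) *s (ee L (- l) y *s f y)) has_integral
      (\<Sum>l=- int N..int N. (of_real (rho N l) * ee L l x) *s (L *\<^sub>R fc L f l))) {0..L}"
  proof (intro has_integral_sum)
    fix l
    show "((\<lambda>y. (of_real (rho N l) * ee L l x) *s (ee L (- l) y *s f y)) has_integral
       (of_real (rho N l) * ee L l x) *s (L *\<^sub>R fc L f l)) {0..L}"
      using has_integral_linear[OF integrable_integral[OF fc_integrable[OF assms(2), of "-l"]]
        bounded_linear_vsmult_right[of "of_real (rho N l) * ee L l x"]] assms(1)
      by (simp add: fc_def o_def)
  qed auto
  also have "(\<Sum>l=- int N..int N. (of_real (rho N l) * ee L l x) *s (L *\<^sub>R fc L f l)) = L *\<^sub>R KN N L f x"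
    by (simp add: KN_def ev_def kc_def scaleR_sum_right vsmult_scaleR mult.commute)
  finally show ?thesis unfolding 1 .
qed

lemma KN_bound:
  assumes "L > 0" "continuous_on {0..L} f" "\<And>x. norm (f x) \<le> B"
  shows "norm (KN N L f x) \<le> B"
proof -
  have "norm (L *\<^sub>R KN N L f x) \<le> integral {0..L} (\<lambda>y. kap N L (x - y) * B)"
    unfolding integral_unique[OF KN_conv[OF assms(1,2)], symmetric]
    by (intro integral_norm_bound_integral has_integral_integrable[OF KN_conv[OF assms(1,2)]]
        integrable_on_mult_left has_integral_integrable[OF kap_integral[OF assms(1)]])
      (auto simp: kap_nonneg intro: mult_left_mono assms(3))
  also have "\<dots> = L * B"
    by (rule integral_unique[OF has_integral_mult_left[OF kap_integral[OF assms(1)]]])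
  finally show ?thesis using assms(1) by simp
qed

lemma jordan_sin: "\<bar>u\<bar> \<le> pi / 2 \<Longrightarrow> \<bar>u\<bar> \<le> pi / 2 * \<bar>sin u\<bar>"
proof -
  have main: "u \<le> pi / 2 * sin u" if u: "0 \<le> u" "u \<le> pi / 2" for u
  proof -
    have "convex_on {0..pi/2} (\<lambda>x. - sin x)"
      by (rule f''_ge0_imp_convex[where f' = "\<lambda>x. - cos x" and f'' = sin])
        (auto intro!: derivative_eq_intros sin_ge_zero)
    from convex_onD_Icc'[OF this, of u] u show ?thesis by (simp add: field_simps)
  qed
  show "\<bar>u\<bar> \<le> pi / 2 \<Longrightarrow> ?thesis"
    using main[of "\<bar>u\<bar>"] sin_ge_zero[of "\<bar>u\<bar>"] pi_gt_zero by (cases "u \<ge> 0") auto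
qed

text \<open>A periodic function only sees the distance to the nearest period, and Jordan's
  inequality bounds that distance by a sine. The sine is used because its square is a trigonometric
  polynomial of degree one, whose integral against the kernel is known exactly.\<close>

lemma periodic_lip:
  fixes f :: "real \<Rightarrow> 'a::real_normed_vector"
  assumes "L > 0" "\<And>x. f (x + L) = f x" "\<And>x y. norm (f x - f y) \<le> B * \<bar>x - y\<bar>"
  shows "norm (f x - f y) \<le> B * (L / 2 * \<bar>sin (pi * (x - y) / L)\<bar>)"
proof -
  have B: "B \<ge> 0" using order_trans[OF norm_ge_zero assms(3)[of 1 0]] by simp
  have pk: "f (x + of_int k * L) = f x" for x k
  proof (induction k rule: int_induct[of _ 0])
    case (step1 i)
    then show ?case using assms(2)[of "x + of_int i * L"] by (simp add: algebra_simps)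
  next
    case (step2 i)
    then show ?case using assms(2)[of "x + of_int (i - 1) * L"] by (simp add: algebra_simps)
  qed simp
  define k where "k = round ((x - y) / L)"
  define t where "t = x - y - of_int k * L"
  have "\<bar>of_int k - (x - y) / L\<bar> \<le> 1/2" unfolding k_def by (rule of_int_round_abs_le)
  moreover have "t = - (L * (of_int k - (x - y) / L))"
    using assms(1) by (simp add: t_def field_simps)
  then have "\<bar>t\<bar> = L * \<bar>of_int k - (x - y) / L\<bar>" using assms(1) by (simp add: abs_mult)
  ultimately have t: "\<bar>t\<bar> \<le> L / 2"
    using assms(1) by simp
  have "\<bar>pi * t / L\<bar> \<le> pi / 2"
    using t assms(1) pi_gt_zero by (auto simp: abs_mult field_simps)
  from jordan_sin[OF this] have "\<bar>t\<bar> \<le> L / 2 * \<bar>sin (pi * t / L)\<bar>"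
    using assms(1) pi_gt_zero by (auto simp: abs_mult field_simps)
  also have "pi * t / L = pi * (x - y) / L - of_int k * pi"
    using assms(1) by (simp add: t_def field_simps)
  also have "\<bar>sin (pi * (x - y) / L - of_int k * pi)\<bar> = \<bar>sin (pi * (x - y) / L)\<bar>"
    by (simp add: sin_diff abs_mult cos_int_times_real sin_int_times_real mult.commute)
  finally have "\<bar>t\<bar> \<le> L / 2 * \<bar>sin (pi * (x - y) / L)\<bar>" .
  moreover have "norm (f x - f y) \<le> B * \<bar>t\<bar>"
    using assms(3)[of x "y + of_int k * L"] pk[of y k] by (simp add: t_def algebra_simps)
  ultimately show ?thesis using B by (meson mult_left_mono order_trans)
qed

text \<open>By \<open>periodic_lip\<close> the error is a kernel average of |sin|, but only the
  average of sin^2 is known, through the first Fourier coefficient. An inequality between arithmetic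
  and geometric mean with weight n = N + 2 passes from one to the other, and 1 - cos(pi/n) =
  O(1/n^2) then yields the rate 1/n.\<close>

lemma KN_approx:
  assumes "L > 0" "\<And>x. f (x + L) = f x" "\<And>x y. norm (f x - f y) \<le> B * \<bar>x - y\<bar>" "continuous_on UNIV f"
  shows "norm (f x - KN N L f x) \<le> B * (L / real (N + 2))"
proof -
  define n where "n = real (N + 2)"
  have n: "n > 0" by (simp add: n_def)
  have B: "B \<ge> 0" using order_trans[OF norm_ge_zero assms(3)[of 1 0]] by simp
  have c: "continuous_on {0..L} f" using assms(4) continuous_on_subset by blast
  let ?k = "\<lambda>y. kap N L (x - y)" and ?C = "\<lambda>y. cos (2 * pi * (x - y) / L)"
  have 1: "((\<lambda>y. ?k y *\<^sub>R f x - ?k y *\<^sub>R f y) has_integral (L *\<^sub>R f x - L *\<^sub>R KN N L f x)) {0..L}"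
    by (intro has_integral_diff KN_conv c assms(1) has_integral_scaleR_left kap_integral)
  have 2: "((\<lambda>y. (B * L * (1 / (2 * n) + n / 16)) * ?k y - (B * L * n / 16) * (?k y * ?C y)) has_integral
     ((B * L * (1 / (2 * n) + n / 16)) * L - (B * L * n / 16) * (L * cos (pi / n)))) {0..L}"
    unfolding n_def
    by (intro has_integral_diff has_integral_mult_right kap_integral kap_integral_cos assms(1))
  have le: "norm (?k y *\<^sub>R f x - ?k y *\<^sub>R f y) \<le> (B * L * (1 / (2 * n) + n / 16)) * ?k y - (B * L * n / 16) * (?k y * ?C y)" for y
  proof -
    let ?s = "\<bar>sin (pi * (x - y) / L)\<bar>"
    have "1 - ?C y = 2 * ?s\<^sup>2"
      using cos_double_sin[of "pi * (x - y) / L"] by (simp add: mult_ac)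
    moreover have "?s / 2 \<le> 1 / (2 * n) + n / 8 * ?s\<^sup>2"
    proof -
      \<comment> \<open>The square is centred at ?s = 2/n, the scale on which the kernel
        concentrates; this balances the two summands after averaging.\<close>
      have "0 \<le> (n * ?s - 2)\<^sup>2 / (8 * n)" using n by simp
      also have "\<dots> = 1 / (2 * n) + n / 8 * ?s\<^sup>2 - ?s / 2"
        using n by (simp add: field_simps power2_eq_square)
      finally show ?thesis by simp
    qed
    ultimately have "?s / 2 \<le> 1 / (2 * n) + n / 16 * (1 - ?C y)" by simp
    then have "(B * L) * (?s / 2) \<le> (B * L) * (1 / (2 * n) + n / 16 * (1 - ?C y))"
      using B assms(1) by (intro mult_left_mono) auto
    moreover have "norm (f x - f y) \<le> (B * L) * (?s / 2)"
      using periodic_lip[OF assms(1-3), of x y] by (simp add: mult_ac)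
    ultimately have "norm (f x - f y) \<le> (B * L) * (1 / (2 * n) + n / 16 * (1 - ?C y))" by simp
    then have "?k y * norm (f x - f y) \<le> ?k y * ((B * L) * (1 / (2 * n) + n / 16 * (1 - ?C y)))"
      by (intro mult_left_mono kap_nonneg)
    moreover have "norm (?k y *\<^sub>R f x - ?k y *\<^sub>R f y) = ?k y * norm (f x - f y)"
      by (simp add: scaleR_diff_right[symmetric] kap_nonneg del: scaleR_diff_right)
    ultimately show ?thesis by (simp add: algebra_simps)
  qed
  have "norm (L *\<^sub>R f x - L *\<^sub>R KN N L f x) \<le>
     (B * L * (1 / (2 * n) + n / 16)) * L - (B * L * n / 16) * (L * cos (pi / n))"
    using integral_norm_bound_integral[OF has_integral_integrable[OF 1] has_integral_integrable[OF 2] le]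
    by (simp only: integral_unique[OF 1] integral_unique[OF 2])
  also have "\<dots> = L * (B * L * (1 / (2 * n) + n / 16 * (1 - cos (pi / n))))"
    using n by (simp add: field_simps)
  also have "\<dots> \<le> L * (B * L * (1 / n))"
  proof -
    have "1 - cos (pi / n) = 2 * (sin (pi / (2 * n)))\<^sup>2"
      using cos_double_sin[of "pi / (2 * n)"] by simp
    also have "(sin (pi / (2 * n)))\<^sup>2 \<le> (pi / (2 * n))\<^sup>2"
      using abs_sin_x_le_abs_x[of "pi / (2 * n)"] by (simp only: abs_le_square_iff)
    \<comment> \<open>The crude bound pi < 4 already makes the final constant equal to one.\<close>
    also have "(pi / (2 * n))\<^sup>2 \<le> (4 / (2 * n))\<^sup>2"
      using pi_less_4 pi_gt_zero n by (intro power_mono divide_right_mono) auto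
    finally have "1 - cos (pi / n) \<le> 8 / n\<^sup>2" by (simp add: power2_eq_square)
    then have "n / 16 * (1 - cos (pi / n)) \<le> n / 16 * (8 / n\<^sup>2)"
      using n by (intro mult_left_mono) auto
    also have "\<dots> = 1 / (2 * n)" using n by (simp add: power2_eq_square)
    finally have "1 / (2 * n) + n / 16 * (1 - cos (pi / n)) \<le> 1 / (2 * n) + 1 / (2 * n)" by simp
    also have "\<dots> = 1 / n" using n by (simp add: field_simps)
    finally have "1 / (2 * n) + n / 16 * (1 - cos (pi / n)) \<le> 1 / n" .
    then show ?thesis using B assms(1) by (intro mult_left_mono) auto
  qed
  finally have "L * norm (f x - KN N L f x) \<le> L * (B * L * (1 / n))"
    using assms(1) by (simp add: scaleR_diff_right[symmetric] del: scaleR_diff_right)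
  then have "norm (f x - KN N L f x) \<le> B * L * (1 / n)"
    using assms(1) by (simp only: mult_le_cancel_left_pos)
  then show ?thesis by (simp add: n_def)
qed

section \<open>The free evolution\<close>

lemma deriv_le_lip:
  fixes f :: "real \<Rightarrow> 'a::real_normed_vector"
  assumes "(f has_vector_derivative f') (at x)" "\<And>y. norm (f y - f x) \<le> B * \<bar>y - x\<bar>"
  shows "norm f' \<le> B"
proof (rule Lim_norm_ubound[OF _ assms(1)[unfolded has_vector_derivative_iff_slope]])
  have "norm ((f y - f x) /\<^sub>R (y - x)) \<le> B" if "y \<noteq> x" for y
  proof -
    have "norm ((f y - f x) /\<^sub>R (y - x)) = norm (f y - f x) / \<bar>y - x\<bar>"
      unfolding norm_scaleR abs_inverse divide_inverse by (rule mult.commute)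
    then show ?thesis using assms(2)[of y] that by (simp add: pos_divide_le_eq)
  qed
  then show "\<forall>\<^sub>F y in at x. norm ((f y - f x) /\<^sub>R (y - x)) \<le> B"
    by (auto simp: eventually_at_filter)
qed simp

lemma bounded_deriv_diff:
  fixes f :: "real \<Rightarrow> 'a::real_normed_vector"
  assumes "0 \<le> s" "\<And>r. r \<in> {0..s} \<Longrightarrow> (f has_vector_derivative f' r) (at r within {0..s})"
    "\<And>r. r \<in> {0..s} \<Longrightarrow> norm (f' r) \<le> M"
  shows "norm (f s - f 0) \<le> M * s"
proof -
  have "norm (f s - f 0) \<le> M * norm (s - 0)"
  proof (rule differentiable_bound[of "{0..s}" f "\<lambda>x h. h *\<^sub>R f' x"])
    show "onorm (\<lambda>h. h *\<^sub>R f' x) \<le> M" if "x \<in> {0..s}" for x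
      using assms(3)[OF that] by (intro onorm_le) (metis abs_ge_zero mult.commute mult_left_mono norm_scaleR real_norm_def)
  qed (use assms in \<open>auto simp: has_vector_derivative_def\<close>)
  then show ?thesis using assms(1) by simp
qed

text \<open>The derivatives are given as a chain of functions, since in the application the j-th one
  arises by applying an operator j times. The factor 1/k! of the usual remainder is given up because
  each integration is replaced by an estimate with the maximum.\<close>

lemma taylor_chain:
  fixes y :: "nat \<Rightarrow> real \<Rightarrow> 'a::real_normed_vector"
  assumes "\<And>n r. n < k \<Longrightarrow> r \<in> {0..S} \<Longrightarrow> (y n has_vector_derivative y (Suc n) r) (at r within {0..S})"
    "\<And>r. r \<in> {0..S} \<Longrightarrow> norm (y k r) \<le> M" "s \<in> {0..S}"
  shows "norm (y 0 s - (\<Sum>j<k. (s ^ j / fact j) *\<^sub>R y j 0)) \<le> M * s ^ k"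
  using assms
proof (induction k arbitrary: y s)
  case 0
  then show ?case by simp
next
  case (Suc k)
  have M: "0 \<le> M" using order_trans[OF norm_ge_zero Suc.prems(2)[OF Suc.prems(3)]] .
  define g where "g r = y 0 r - (\<Sum>j<Suc k. (r ^ j / fact j) *\<^sub>R y j 0)" for r
  define g' where "g' r = y 1 r - (\<Sum>j<k. (r ^ j / fact j) *\<^sub>R y (Suc j) 0)" for r
  have IH: "norm (g' r) \<le> M * r ^ k" if "r \<in> {0..S}" for r
    unfolding g'_def One_nat_def
    by (rule Suc.IH[of "\<lambda>n. y (Suc n)"]) (simp_all only: Suc.prems(1,2) that Suc_less_eq)
  have gexp: "g r = y 0 r - (y 0 0 + (\<Sum>j<k. (r ^ Suc j / fact (Suc j)) *\<^sub>R y (Suc j) 0))" for r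
    unfolding g_def sum.lessThan_Suc_shift power_0 fact_0 div_by_1 scaleR_one by (rule refl)
  have d: "(g has_vector_derivative g' r) (at r within {0..s})" if "r \<in> {0..s}" for r
  proof -
    have "(y 0 has_vector_derivative y 1 r) (at r within {0..s})"
      using Suc.prems(1)[of 0 r] Suc.prems(3) that
      by (auto intro: has_vector_derivative_within_subset[of "y 0" _ r "{0..S}"])
    moreover have "((\<lambda>r. (r ^ Suc j / fact (Suc j)) *\<^sub>R y (Suc j) 0) has_vector_derivative (r ^ j / fact j) *\<^sub>R y (Suc j) 0) (at r within {0..s})" for j
    proof -
      have "((\<lambda>r. r ^ Suc j / fact (Suc j)) has_real_derivative r ^ j / fact j) (at r within {0..s})"
      proof -
        have "real (Suc j) * r ^ j / fact (Suc j) = r ^ j / fact j"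
          unfolding fact_Suc by (rule mult_divide_mult_cancel_left) (rule of_nat_neq_0)
        then show ?thesis using DERIV_cdivide[OF DERIV_pow[of "Suc j" r "{0..s}"], of "fact (Suc j)"] by simp
      qed
      then show ?thesis
        using has_vector_derivative_scaleR[of "\<lambda>r. r ^ Suc j / fact (Suc j)" "r ^ j / fact j" r "{0..s}" "\<lambda>_. y (Suc j) 0" 0]
        by simp
    qed
    ultimately have "((\<lambda>r. y 0 r - (y 0 0 + (\<Sum>j<k. (r ^ Suc j / fact (Suc j)) *\<^sub>R y (Suc j) 0))) has_vector_derivative
        y 1 r - (0 + (\<Sum>j<k. (r ^ j / fact j) *\<^sub>R y (Suc j) 0))) (at r within {0..s})"
      by (intro has_vector_derivative_diff has_vector_derivative_add has_vector_derivative_sum has_vector_derivative_const)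
    then show ?thesis unfolding gexp[abs_def] g'_def by (simp only: add_0)
  qed
  have "norm (g' r) \<le> M * s ^ k" if "r \<in> {0..s}" for r
    using IH[of r] that Suc.prems(3) M
  proof -
    have "M * r ^ k \<le> M * s ^ k" using that M by (intro mult_left_mono power_mono) auto
    then show ?thesis using IH[of r] that Suc.prems(3) by simp
  qed
  moreover have "0 \<le> s" using Suc.prems(3) by simp
  ultimately have "norm (g s - g 0) \<le> M * s ^ k * s"
    using bounded_deriv_diff[OF _ d] by blast
  moreover have "g 0 = 0" by (simp add: gexp)
  ultimately show ?case by (simp add: g_def mult_ac)
qed

lemma T_symbol_mult:
  "(T_symbol \<epsilon> \<mu> *v v) $ 1 = - \<i> * of_real \<mu> * v $ 2 - \<i> / of_real \<epsilon> * v $ 1"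
  "(T_symbol \<epsilon> \<mu> *v v) $ 2 = - \<i> * of_real \<mu> * v $ 1 + \<i> / of_real \<epsilon> * v $ 2"
  by (simp_all add: T_symbol_def sigma1_def sigma3_def cscale_def matrix_vector_mult_def UNIV_2 vector_2 algebra_simps)

lemma T_symbol_skew: "v \<bullet> (T_symbol \<epsilon> \<mu> *v v) = 0"
  by (simp add: inner_vec_def UNIV_2 T_symbol_mult inner_complex_def algebra_simps)

lemma inner_matrix_scaleR: "v \<bullet> ((s *\<^sub>R A) *v v) = s * (v \<bullet> (A *v (v :: complex^2)))"
  by (simp add: matrix_vector_mult_scaleR)

definition EC :: "real \<Rightarrow> real \<Rightarrow> (int \<Rightarrow> complex^2) \<Rightarrow> int \<Rightarrow> complex^2" where
  "EC L s c l = mexp (s *\<^sub>R T_symbol 1 (freq 0 L l)) *v c l"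

lemma norm_EC: "norm (EC L s c l) = norm (c l)"
  unfolding EC_def by (rule norm_mexp_skew) (simp add: inner_matrix_scaleR T_symbol_skew)

lemma EC_0: "EC L 0 c = c"
  unfolding EC_def by (rule ext, rule mexp_zero)

lemma EC_deriv: "((\<lambda>s. EC L s c l) has_vector_derivative T_symbol 1 (freq 0 L l) *v EC L s c l) (at s within S)"
  unfolding EC_def by (rule has_vector_derivative_at_within[OF mexp_has_derivative])

lemma ev_nth: "ev L R c x $ i = (\<Sum>l=- int R..int R. ee L l x * c l $ i)"
  by (simp add: ev_def)

text \<open>In the variables \<open>u\<^sub>1 \<plusminus> u\<^sub>2\<close> the free evolution is a transport with speeds \<open>\<plusminus>1\<close> plus a coupling
  of norm one, which gives the supremum bound along characteristics.\<close>

lemma EC_sup: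
  assumes s: "0 \<le> s" "s \<le> 1/2" and B: "\<And>x. norm (ev L R c x) \<le> B"
  shows "norm (ev L R (EC L s c) x) \<le> 8 * B"
proof -
  let ?I = "{- int R..int R}"
  define p where "p r l = EC L r c l $ 1 + EC L r c l $ 2" for r l
  define q where "q r l = EC L r c l $ 1 - EC L r c l $ 2" for r l
  define P where "P r x = (\<Sum>l\<in>?I. ee L l x * p r l)" for r x
  define Q where "Q r x = (\<Sum>l\<in>?I. ee L l x * q r l)" for r x
  have PQ: "P r x = ev L R (EC L r c) x $ 1 + ev L R (EC L r c) x $ 2"
     "Q r x = ev L R (EC L r c) x $ 1 - ev L R (EC L r c) x $ 2" for r x
    by (simp_all add: P_def Q_def p_def q_def ev_nth algebra_simps sum.distrib sum_subtractf)
  have dnth: "((\<lambda>r. EC L r c l $ i) has_vector_derivative (T_symbol 1 (freq 0 L l) *v EC L r c l) $ i) (at r within S)" for l i r S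
    by (rule bounded_linear.has_vector_derivative[OF bounded_linear_vec_nth EC_deriv])
  have dp: "((\<lambda>r. p r l) has_vector_derivative - \<i> * of_real (freq 0 L l) * p r l - \<i> * q r l) (at r within S)" for l r S
    using has_vector_derivative_add[OF dnth[of l 1 r S] dnth[of l 2 r S]]
    by (simp add: p_def[abs_def] q_def T_symbol_mult algebra_simps)
  have dq: "((\<lambda>r. q r l) has_vector_derivative \<i> * of_real (freq 0 L l) * q r l - \<i> * p r l) (at r within S)" for l r S
    using has_vector_derivative_diff[OF dnth[of l 1 r S] dnth[of l 2 r S]]
    by (simp add: q_def[abs_def] p_def T_symbol_mult algebra_simps)
  have e1: "((\<lambda>r. ee L l (y + r)) has_vector_derivative \<i> * of_real (freq 0 L l) * ee L l (y + r)) (at r within S)" for l y r S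
    using has_vector_derivative_mult_right[OF ee_deriv[of L l r S], of "ee L l y"]
    by (simp add: ee_add_arg mult_ac)
  have e2: "((\<lambda>r. ee L l (y - r)) has_vector_derivative - \<i> * of_real (freq 0 L l) * ee L l (y - r)) (at r within S)" for l y r S
    using has_vector_derivative_mult_right[OF ee_deriv[of L "- l" r S], of "ee L l y"]
    by (simp add: ee_diff_arg mult_ac freq_def)
  have dP: "((\<lambda>r. P r (y + r)) has_vector_derivative - \<i> * Q r (y + r)) (at r within S)" for y r S
  proof -
    have "((\<lambda>r. ee L l (y + r) * p r l) has_vector_derivative - \<i> * (ee L l (y + r) * q r l)) (at r within S)" for l
      using has_vector_derivative_mult[OF e1[of l y r S] dp[of l r S]] by (simp add: algebra_simps)
    then show ?thesis unfolding P_def Q_def sum_distrib_left by (intro has_vector_derivative_sum)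
  qed
  have dQ: "((\<lambda>r. Q r (y - r)) has_vector_derivative - \<i> * P r (y - r)) (at r within S)" for y r S
  proof -
    have "((\<lambda>r. ee L l (y - r) * q r l) has_vector_derivative - \<i> * (ee L l (y - r) * p r l)) (at r within S)" for l
      using has_vector_derivative_mult[OF e2[of l y r S] dq[of l r S]] by (simp add: algebra_simps)
    then show ?thesis unfolding P_def Q_def sum_distrib_left by (intro has_vector_derivative_sum)
  qed
  have comp: "cmod (v $ 1 + v $ 2) \<le> 2 * norm v" "cmod (v $ 1 - v $ 2) \<le> 2 * norm v" for v :: "complex^2"
    using norm_triangle_ineq[of "v$1" "v$2"] norm_triangle_ineq4[of "v$1" "v$2"]
      Finite_Cartesian_Product.norm_nth_le[of v 1] Finite_Cartesian_Product.norm_nth_le[of v 2] by linarith+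
  \<comment> \<open>The supremum runs over the whole time interval and all points. It is finite
    because only finitely many modes occur, with a bound that depends on R; finiteness alone is
    needed to absorb S/2 into the left side, and the resulting bound is free of R.\<close>
  define A where "A = (\<lambda>(r, y). max (cmod (P r y)) (cmod (Q r y))) ` ({0..1/2} \<times> UNIV)"
  define S where "S = Sup A"
  have evK: "norm (ev L R (EC L r c) y) \<le> (\<Sum>l\<in>?I. norm (c l))" for r y
    unfolding ev_def by (rule order_trans[OF norm_sum]) (simp add: norm_vsmult norm_EC)
  have bdd: "bdd_above A"
  proof (rule bdd_aboveI)
    fix z assume "z \<in> A"
    then obtain r y where "z = max (cmod (P r y)) (cmod (Q r y))" by (auto simp: A_def)
    then show "z \<le> 2 * (\<Sum>l\<in>?I. norm (c l))"
      using comp[of "ev L R (EC L r c) y"] evK[of r y] by (simp add: PQ)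
  qed
  have le: "cmod (P r y) \<le> S" "cmod (Q r y) \<le> S" if "r \<in> {0..1/2}" for r y
  proof -
    have "max (cmod (P r y)) (cmod (Q r y)) \<le> S" unfolding S_def
      by (rule cSup_upper[OF _ bdd]) (use that in \<open>force simp: A_def\<close>)
    then show "cmod (P r y) \<le> S" "cmod (Q r y) \<le> S" by auto
  qed
  have S0: "0 \<le> S" using order_trans[OF norm_ge_zero le(1)[of 0 0]] by simp
  have init: "cmod (P 0 y) \<le> 2 * B" "cmod (Q 0 y) \<le> 2 * B" for y
    using comp[of "ev L R c y"] B[of y] by (auto simp: PQ EC_0)
  have "z \<le> 2 * B + S / 2" if zA: "z \<in> A" for z
  proof -
    obtain r y where r: "r \<in> {0..1/2}" and z: "z = max (cmod (P r y)) (cmod (Q r y))"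
    proof -
      from zA obtain u where "z = (\<lambda>(r, y). max (cmod (P r y)) (cmod (Q r y))) u" "u \<in> {0..1/2} \<times> UNIV"
        unfolding A_def by (rule imageE)
      then show ?thesis using that by (cases u) simp
    qed
    have rS: "S * r \<le> S / 2" using r mult_left_mono[of r "1/2" S] S0 by simp
    have "norm (P r (y - r + r) - P 0 (y - r + 0)) \<le> S * r"
      by (rule bounded_deriv_diff[OF _ dP[of "y - r"]]) (use r le in \<open>auto simp: norm_mult\<close>)
    then have "cmod (P r y) \<le> 2 * B + S / 2"
      using norm_triangle_sub[of "P r y" "P 0 (y - r)"] init(1)[of "y - r"] rS by simp
    moreover have "norm (Q r (y + r - r) - Q 0 (y + r - 0)) \<le> S * r"
      by (rule bounded_deriv_diff[OF _ dQ[of "y + r"]]) (use r le in \<open>auto simp: norm_mult\<close>)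
    then have "cmod (Q r y) \<le> 2 * B + S / 2"
      using norm_triangle_sub[of "Q r y" "Q 0 (y + r)"] init(2)[of "y + r"] rS by simp
    ultimately show ?thesis by (simp add: z)
  qed
  moreover have "A \<noteq> {}" by (auto simp: A_def)
  ultimately have "S \<le> 2 * B + S / 2" unfolding S_def by (intro cSup_least) 
  \<comment> \<open>Each component of the spinor is half the sum or difference of P and Q, so at
    most 4 B; the two components together give 8 B.\<close>
  then have "S \<le> 4 * B" by simp
  moreover have "2 * ev L R (EC L s c) x $ 1 = P s x + Q s x" "2 * ev L R (EC L s c) x $ 2 = P s x - Q s x"
    by (simp_all add: PQ)
  then have "2 * cmod (ev L R (EC L s c) x $ 1) \<le> cmod (P s x) + cmod (Q s x)"
      "2 * cmod (ev L R (EC L s c) x $ 2) \<le> cmod (P s x) + cmod (Q s x)"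
    using norm_triangle_ineq[of "P s x" "Q s x"] norm_triangle_ineq4[of "P s x" "Q s x"]
    by (simp_all add: norm_mult flip: norm_mult_numeral1)
  ultimately show ?thesis
    using norm_le_sum_vec2[of "ev L R (EC L s c) x"] le[of s x] s by simp
qed

section \<open>The generator of the free evolution and the smoothed evolution\<close>

definition TT :: "(real \<Rightarrow> complex^2) \<Rightarrow> real \<Rightarrow> complex^2" where
  "TT f x = - (sigma1 *v DD f x) - \<i> *s (sigma3 *v f x)"

lemma sigma_mult [simp]:
  "(sigma1 *v v) $ 1 = v $ 2" "(sigma1 *v v) $ 2 = v $ 1"
  "(sigma3 *v v) $ 1 = v $ 1" "(sigma3 *v v) $ 2 = - (v $ 2)"
  by (simp_all add: sigma1_def sigma3_def matrix_vector_mult_def UNIV_2 vector_2)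

lemma norm_sigma [simp]: "norm (sigma1 *v v) = norm v" "norm (sigma3 *v v) = norm v"
proof -
  have "(norm (sigma1 *v v))\<^sup>2 = (norm v)\<^sup>2" "(norm (sigma3 *v v))\<^sup>2 = (norm v)\<^sup>2"
    by (simp_all add: norm_vec2_sq)
  then show "norm (sigma1 *v v) = norm v" "norm (sigma3 *v v) = norm v" by simp_all
qed

lemma bounded_linear_s1: "bounded_linear (\<lambda>v. - (sigma1 *v v))"
  by (intro bounded_linear_minus matrix_vector_mul_bounded_linear)

lemma bounded_linear_s3: "bounded_linear (\<lambda>v. - (\<i> *s (sigma3 *v v)))"
  by (intro bounded_linear_minus bounded_linear_compose[OF bounded_linear_vsmult_right matrix_vector_mul_bounded_linear])

lemma TT_eq: "TT f = (\<lambda>x. - (sigma1 *v DD f x) + - (\<i> *s (sigma3 *v f x)))"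
  by (simp add: TT_def[abs_def])

lemma cb_TT: "cb L (Suc (Suc k)) B f \<Longrightarrow> cb L (Suc k) (2 * B) (TT f)"
  unfolding TT_eq mult_2
  by (intro cb_add cb_linear[OF bounded_linear_s1] cb_linear[OF bounded_linear_s3])
    (auto simp: norm_vsmult dest: cb_DD cb_Suc simp del: cb.simps)

lemma cb_TT_pow: "cb L (Suc (j + k)) B f \<Longrightarrow> cb L (Suc k) (2 ^ j * B) ((TT ^^ j) f)"
proof (induction j arbitrary: k)
  case (Suc j)
  then have "cb L (Suc (Suc k)) (2 ^ j * B) ((TT ^^ j) f)" by (intro Suc.IH) simp
  from cb_TT[OF this] show ?case by (simp add: mult_ac)
qed simp

lemma fc_TT:
  assumes "L > 0" "cb L (Suc (Suc k)) B f"
  shows "fc L (TT f) l = T_symbol 1 (freq 0 L l) *v fc L f l"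
proof -
  have c: "continuous_on {0..L} f" "continuous_on {0..L} (DD f)"
    using cb_continuous[OF assms(2)] cb_continuous[OF cb_DD[OF assms(2)]] .
  have e: "TT f = (\<lambda>x. (- 1) *\<^sub>R (sigma1 *v DD f x) + (- 1) *\<^sub>R (((\<i> *\<^sub>C sigma3)) *v f x))"
    by (auto simp: TT_eq matrix_vector_mult_cscale)
  have mc: "continuous_on {0..L} (\<lambda>x. (- 1) *\<^sub>R (A *v g x))" if "continuous_on {0..L} g" for A :: "complex^2^2" and g
    by (intro continuous_on_scaleR continuous_on_const bounded_linear.continuous_on[OF matrix_vector_mul_bounded_linear] that)
  show ?thesis unfolding e
    by (subst fc_add[OF mc[OF c(2)] mc[OF c(1)]])
      (simp only: fc_scaleR fc_matrix[OF c(1)] fc_matrix[OF c(2)] fc_DD[OF assms],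
       simp add: vec_eq_iff forall_2 T_symbol_mult matrix_vector_mult_cscale)
qed

text \<open>Smoothing the data makes the free evolution act on trigonometric polynomials, so that it has a
  Taylor expansion with bounds that do not depend on \<open>N\<close>; later \<open>N\<close> is so large that the smoothing itself
  costs only \<open>O(\<sigma>\<^sup>5)\<close>.\<close>

definition Et :: "nat \<Rightarrow> real \<Rightarrow> real \<Rightarrow> (real \<Rightarrow> complex^2) \<Rightarrow> real \<Rightarrow> complex^2" where
  "Et N L s f = ev L N (EC L s (kc N L f))"

lemma ev_add: "ev L R (\<lambda>l. c l + d l) x = ev L R c x + ev L R d x"
  by (simp add: ev_def bounded_bilinear.add_right[OF bounded_bilinear_vsmult] sum.distrib)

lemma ev_diff: "ev L R (\<lambda>l. c l - d l) x = ev L R c x - ev L R d x"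
  by (simp add: ev_def bounded_bilinear.diff_right[OF bounded_bilinear_vsmult] sum_subtractf)

lemma ev_scaleR: "ev L R (\<lambda>l. r *\<^sub>R c l) x = r *\<^sub>R ev L R c x"
  by (simp add: ev_def vsmult_scaleR scaleR_sum_right)

lemma matrix_vsmult: "A *v (c *s v) = c *s (A *v (v :: complex^2))"
  by (simp add: vec_eq_iff matrix_vector_mult_def sum_distrib_left mult_ac)

lemma ev_matrix: "ev L R (\<lambda>l. A *v c l) x = A *v ev L R c x"
  by (simp add: ev_def linear_sum[OF bounded_linear.linear[OF matrix_vector_mul_bounded_linear]] matrix_vsmult)

lemma ev_extend: "R \<le> R' \<Longrightarrow> (\<And>l. \<bar>l\<bar> > int R \<Longrightarrow> c l = 0) \<Longrightarrow> ev L R' c x = ev L R c x"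
  unfolding ev_def by (intro sum.mono_neutral_right) auto

lemma ev_deriv: "(ev L R c has_vector_derivative ev L R (\<lambda>l. (\<i> * of_real (freq 0 L l)) *s c l) x) (at x)"
proof -
  have "((\<lambda>x. ee L l x *s c l) has_vector_derivative ee L l x *s ((\<i> * of_real (freq 0 L l)) *s c l)) (at x)" for l
    using bounded_linear.has_vector_derivative[OF bounded_linear_vsmult_left ee_deriv[of L l x UNIV]]
    by (simp add: vector_smult_assoc mult_ac)
  then show ?thesis unfolding ev_def by (intro has_vector_derivative_sum)
qed

lemma ev_per: "L > 0 \<Longrightarrow> ev L R c (x + L) = ev L R c x"
  by (simp add: ev_def ee_per)

lemma EC_add: "EC L s (\<lambda>l. c l + d l) = (\<lambda>l. EC L s c l + EC L s d l)"
  by (rule ext) (simp add: EC_def matrix_vector_right_distrib)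

lemma EC_diff: "EC L s (\<lambda>l. c l - d l) = (\<lambda>l. EC L s c l - EC L s d l)"
  by (rule ext) (simp add: EC_def matrix_vector_mult_diff_distrib)

lemma EC_vsmult: "EC L s (\<lambda>l. a l *s c l) = (\<lambda>l. a l *s EC L s c l)"
  by (rule ext) (simp add: EC_def matrix_vsmult)

lemma EC_scaleR: "EC L s (\<lambda>l. a *\<^sub>R c l) = (\<lambda>l. a *\<^sub>R EC L s c l)"
  by (rule ext) (simp add: EC_def matrix_vector_mult_scaleR_right)

lemma EC_T: "EC L s (\<lambda>l. T_symbol 1 (freq 0 L l) *v c l) = (\<lambda>l. T_symbol 1 (freq 0 L l) *v EC L s c l)"
proof
  fix l
  show "EC L s (\<lambda>l. T_symbol 1 (freq 0 L l) *v c l) l = T_symbol 1 (freq 0 L l) *v EC L s c l"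
  proof (cases "s = 0")
    case False
    then show ?thesis using mexp_commute[of "s *\<^sub>R T_symbol 1 (freq 0 L l)" "c l"]
      by (simp add: EC_def matrix_vector_mult_scaleR matrix_vector_mult_scaleR_right)
  qed (simp add: EC_0)
qed

lemma kc_add: "continuous_on {0..L} f \<Longrightarrow> continuous_on {0..L} g \<Longrightarrow>
    kc N L (\<lambda>x. f x + g x) = (\<lambda>l. kc N L f l + kc N L g l)"
  by (auto simp: kc_def fc_add vector_add_ldistrib)

lemma kc_diff: "continuous_on {0..L} f \<Longrightarrow> continuous_on {0..L} g \<Longrightarrow>
    kc N L (\<lambda>x. f x - g x) = (\<lambda>l. kc N L f l - kc N L g l)"
  by (auto simp: kc_def fc_diff bounded_bilinear.diff_right[OF bounded_bilinear_vsmult])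

lemma kc_scaleR: "kc N L (\<lambda>x. r *\<^sub>R f x) = (\<lambda>l. r *\<^sub>R kc N L f l)"
  by (auto simp: kc_def fc_scaleR vsmult_scaleR)

lemma kc_out: "\<bar>l\<bar> > int N \<Longrightarrow> kc N L f l = 0"
  by (simp add: kc_def rho_out)

lemma Et_add: "continuous_on {0..L} f \<Longrightarrow> continuous_on {0..L} g \<Longrightarrow>
    Et N L s (\<lambda>x. f x + g x) x = Et N L s f x + Et N L s g x"
  by (simp add: Et_def kc_add EC_add ev_add)

lemma Et_diff: "continuous_on {0..L} f \<Longrightarrow> continuous_on {0..L} g \<Longrightarrow>
    Et N L s (\<lambda>x. f x - g x) x = Et N L s f x - Et N L s g x"
  by (simp add: Et_def kc_diff EC_diff ev_diff)

lemma Et_scaleR: "Et N L s (\<lambda>x. r *\<^sub>R f x) x = r *\<^sub>R Et N L s f x"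
  by (simp add: Et_def kc_scaleR EC_scaleR ev_scaleR)

lemma Et_0: "Et N L 0 f = KN N L f"
  by (simp add: Et_def KN_def EC_0)

lemma Et_bound:
  assumes "L > 0" "0 \<le> s" "s \<le> 1/2" "continuous_on {0..L} f" "\<And>x. norm (f x) \<le> B"
  shows "norm (Et N L s f x) \<le> 8 * B"
  unfolding Et_def
  by (rule EC_sup[OF assms(2,3)]) (use KN_bound[OF assms(1,4,5), of N] in \<open>simp add: KN_def\<close>)

lemma Et_shift:
  assumes "L > 0" "continuous_on UNIV f" "\<And>x. f (x + L) = f x"
  shows "Et N L s (\<lambda>x. f (x + h)) x = Et N L s f (x + h)"
proof -
  have "kc N L (\<lambda>x. f (x + h)) = (\<lambda>l. ee L l h *s kc N L f l)"
    using fc_shift[OF assms] by (auto simp: kc_def vector_smult_assoc mult_ac)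
  then show ?thesis by (simp add: Et_def EC_vsmult ev_def ee_add_arg vector_smult_assoc)
qed

lemma cont_shift: "continuous_on UNIV f \<Longrightarrow> continuous_on S (\<lambda>x. f (x + h :: real))"
  by (rule continuous_on_compose2[of UNIV f]) (auto intro!: continuous_intros)

text \<open>The smoothed evolution commutes with translations, which act on Fourier coefficients by
  a scalar phase. The supremum bound applied to the difference of f and its translate is then a
  Lipschitz bound.\<close>

lemma Et_lip:
  assumes "L > 0" "0 \<le> s" "s \<le> 1/2" "cb L (Suc k) B f"
  shows "norm (Et N L s f x - Et N L s f y) \<le> 8 * (B * \<bar>x - y\<bar>)"
proof -
  define h where "h = x - y"
  have c: "continuous_on S f" for S by (rule cb_continuous[OF assms(4)])
  have "Et N L s (\<lambda>x. f (x + h) - f x) y = Et N L s (\<lambda>x. f (x + h)) y - Et N L s f y"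
    by (rule Et_diff[OF cont_shift[OF c] c])
  then have "Et N L s f x - Et N L s f y = Et N L s (\<lambda>x. f (x + h) - f x) y"
    using Et_shift[OF assms(1) c cb_per[OF assms(4)], of N s h y] by (simp add: h_def)
  also have "norm \<dots> \<le> 8 * (B * \<bar>h\<bar>)"
  proof (intro Et_bound assms continuous_on_diff cont_shift c)
    show "norm (f (x + h) - f x) \<le> B * \<bar>h\<bar>" for x
      using cb_lip[OF assms(4), of "x + h" x] by simp
  qed
  finally show ?thesis by (simp add: h_def)
qed

lemma kc_DD:
  assumes "L > 0" "cb L (Suc (Suc k)) B f"
  shows "kc N L (DD f) = (\<lambda>l. (\<i> * of_real (freq 0 L l)) *s kc N L f l)"
  using fc_DD[OF assms] by (auto simp: kc_def vector_smult_assoc mult_ac)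

lemma Et_deriv:
  assumes "L > 0" "cb L (Suc (Suc k)) B f"
  shows "(Et N L s f has_vector_derivative Et N L s (DD f) x) (at x)"
  using ev_deriv[of L N "EC L s (kc N L f)" x] unfolding Et_def kc_DD[OF assms] EC_vsmult .

lemma cb_Et:
  assumes "L > 0" "0 \<le> s" "s \<le> 1/2"
  shows "cb L (Suc k) B f \<Longrightarrow> cb L (Suc k) (8 * B) (Et N L s f)"
proof (induction k arbitrary: f)
  case 0
  then show ?case
    using Et_lip[OF assms 0] Et_bound[OF assms cb_continuous[OF 0] cb_bdd[OF 0]]
    by (auto simp: Et_def ev_per[OF assms(1)] mult_ac)
next
  case (Suc k)
  have "DD (Et N L s f) = Et N L s (DD f)"
    by (rule DD_eqI[OF Et_deriv[OF assms(1) Suc.prems]])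
  then show ?case
    using Et_deriv[OF assms(1) Suc.prems] Et_bound[OF assms cb_continuous[OF Suc.prems] cb_bdd[OF Suc.prems]]
      Suc.IH[of "DD f"] Suc.prems
    by (auto simp: Et_def ev_per[OF assms(1)])
qed

lemma kc_TT:
  assumes "L > 0" "cb L (Suc (Suc k)) B f"
  shows "kc N L (TT f) = (\<lambda>l. T_symbol 1 (freq 0 L l) *v kc N L f l)"
  using fc_TT[OF assms] by (auto simp: kc_def vec_eq_iff matrix_vector_mult_def sum_distrib_left mult_ac)

lemma ev_T: "ev L R (\<lambda>l. T_symbol 1 (freq 0 L l) *v c l) x = TT (ev L R c) x"
proof -
  have d: "DD (ev L R c) x = ev L R (\<lambda>l. (\<i> * of_real (freq 0 L l)) *s c l) x"
    using DD_eqI[OF ev_deriv] by metis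
  have "(\<lambda>l. T_symbol 1 (freq 0 L l) *v c l) =
     (\<lambda>l. ((-1) *\<^sub>C sigma1) *v ((\<i> * of_real (freq 0 L l)) *s c l) + ((-\<i>) *\<^sub>C sigma3) *v c l)"
    by (auto simp: vec_eq_iff forall_2 T_symbol_mult matrix_vector_mult_cscale)
  then have "ev L R (\<lambda>l. T_symbol 1 (freq 0 L l) *v c l) x =
     ((-1) *\<^sub>C sigma1) *v ev L R (\<lambda>l. (\<i> * of_real (freq 0 L l)) *s c l) x + ((-\<i>) *\<^sub>C sigma3) *v ev L R c x"
    by (simp only: ev_add ev_matrix)
  then show ?thesis unfolding d[symmetric]
    by (simp add: TT_def vec_eq_iff forall_2 matrix_vector_mult_cscale)
qed

lemma TT_bound:
  assumes "\<And>x. norm (g x) \<le> B" "(g has_vector_derivative DD g x) (at x)" "\<And>x y. norm (g x - g y) \<le> B * \<bar>x - y\<bar>"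
  shows "norm (TT g x) \<le> 2 * B"
proof -
  have "norm (DD g x) \<le> B" by (rule deriv_le_lip[OF assms(2,3)])
  then have "norm (sigma1 *v DD g x) + norm (\<i> *s (sigma3 *v g x)) \<le> 2 * B"
    using assms(1)[of x] by (simp add: norm_vsmult)
  moreover have "norm (TT g x) \<le> norm (sigma1 *v DD g x) + norm (\<i> *s (sigma3 *v g x))"
    unfolding TT_def using norm_triangle_ineq4[of "- (sigma1 *v DD g x)"] by simp
  ultimately show ?thesis by simp
qed

text \<open>The Taylor coefficients of the smoothed evolution are the smoothed functions
  \<open>TT ^^ j\<close> of f, and the remainder contains one more generator. The first error term
  comes from this remainder, the second one from removing the smoothing in each of the k + 1
  coefficients.\<close>

lemma Et_taylor:
  assumes L: "L > 0" and s: "0 \<le> s" "s \<le> 1/2" and f: "cb L (Suc k) B f" and N: "L / real (N + 2) \<le> \<delta>"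
  shows "norm (Et N L s f x - (\<Sum>j\<le>k. (s ^ j / fact j) *\<^sub>R (TT ^^ j) f x))
     \<le> 16 * (2 ^ k * (8 * B)) * s ^ Suc k + real (Suc k) * (2 ^ k * B * \<delta>)"
proof -
  have B: "0 \<le> B" by (rule cb_nonneg[OF f])
  have d0: "0 \<le> \<delta>" using L N by (meson divide_nonneg_nonneg less_imp_le of_nat_0_le_iff order_trans)
  let ?Tl = "\<lambda>l. (*v) (T_symbol 1 (freq 0 L l))"
  define y where "y j r = ev L N (\<lambda>l. (?Tl l ^^ j) (EC L r (kc N L f) l)) x" for j r
  have fj: "cb L (Suc (k - j)) (2 ^ j * B) ((TT ^^ j) f)" if "j \<le> k" for j
    using cb_TT_pow[of L j "k - j" B f] f that by simp
  have yj: "(\<lambda>l. (?Tl l ^^ j) (EC L r (kc N L f) l)) = EC L r (kc N L ((TT ^^ j) f))" if "j \<le> k" for j r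
    using that
  proof (induction j)
    case (Suc j)
    have "k - j = Suc (k - Suc j)" using Suc.prems by simp
    then have "cb L (Suc (Suc (k - Suc j))) (2 ^ j * B) ((TT ^^ j) f)" using fj[of j] Suc.prems by simp
    from kc_TT[OF L this] Suc show ?case
      by (simp add: EC_T fun_eq_iff)
  qed simp
  have yE: "y j r = Et N L r ((TT ^^ j) f) x" if "j \<le> k" for j r
    by (simp add: y_def yj[OF that] Et_def)
  have dy: "(y j has_vector_derivative y (Suc j) r) (at r within S)" for j r S
  proof -
    have 1: "bounded_linear (?Tl l ^^ j)" for l
    proof (induction j)
      case 0
      then show ?case by (simp add: id_def)
    next
      case (Suc j)
      then show ?case unfolding funpow.simps o_def
        by (intro bounded_linear_compose[OF matrix_vector_mul_bounded_linear])
    qed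
    have "((\<lambda>r. ee L l x *s (?Tl l ^^ j) (EC L r (kc N L f) l)) has_vector_derivative
       ee L l x *s (?Tl l ^^ j) (?Tl l (EC L r (kc N L f) l))) (at r within S)" for l
      by (intro bounded_linear.has_vector_derivative[OF bounded_linear_vsmult_right]
          bounded_linear.has_vector_derivative[OF 1] EC_deriv)
    then show ?thesis unfolding y_def ev_def
      by (intro has_vector_derivative_sum) (simp add: funpow_swap1)
  qed
  define g where "g = (TT ^^ k) f"
  have g: "cb L (Suc 0) (2 ^ k * B) g" using fj[of k] by (simp add: g_def)
  have cg: "continuous_on S g" for S by (rule cb_continuous[OF g])
  have Kg: "norm (TT (KN N L g) z) \<le> 2 * (8 * (2 ^ k * B))" for z
  proof (rule TT_bound)
    have "cb L (Suc 0) (8 * (2 ^ k * B)) (KN N L g)"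
      using cb_Et[OF L _ _ g, of 0 N] by (simp add: Et_0)
    then show "norm (KN N L g x) \<le> 8 * (2 ^ k * B)" "norm (KN N L g x - KN N L g y) \<le> 8 * (2 ^ k * B) * \<bar>x - y\<bar>" for x y
      by auto
    show "(KN N L g has_vector_derivative DD (KN N L g) z) (at z)"
      unfolding KN_def using ev_deriv DD_eqI[OF ev_deriv] by metis
  qed
  \<comment> \<open>The regularity of f is spent on k generators and a Lipschitz bound. The last
    generator is applied after the smoothing, to a trigonometric polynomial that inherits this
    Lipschitz bound independently of N.\<close>
  have top: "norm (y (Suc k) r) \<le> 8 * (2 * (8 * (2 ^ k * B)))" if "r \<in> {0..1/2}" for r
  proof -
    have "y (Suc k) r = ev L N (EC L r (\<lambda>l. ?Tl l (kc N L g l))) x"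
      using yj[of k r] by (simp add: y_def EC_T fun_eq_iff g_def)
    also have "norm \<dots> \<le> 8 * (2 * (8 * (2 ^ k * B)))"
      using that Kg by (intro EC_sup) (auto simp: ev_T KN_def)
    finally show ?thesis .
  qed
  have 1: "norm (y 0 s - (\<Sum>j<Suc k. (s ^ j / fact j) *\<^sub>R y j 0)) \<le> 8 * (2 * (8 * (2 ^ k * B))) * s ^ Suc k"
    by (rule taylor_chain[of _ "1/2"]) (use dy top s in auto)
  have 2: "norm ((\<Sum>j<Suc k. (s ^ j / fact j) *\<^sub>R y j 0) - (\<Sum>j\<le>k. (s ^ j / fact j) *\<^sub>R (TT ^^ j) f x)) \<le> real (Suc k) * (2 ^ k * B * \<delta>)"
  proof -
    have "norm ((s ^ j / fact j) *\<^sub>R (y j 0 - (TT ^^ j) f x)) \<le> 2 ^ k * B * \<delta>" if "j \<le> k" for j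
    proof -
      have c: "cb L (Suc 0) (2 ^ j * B) ((TT ^^ j) f)" by (rule cb_le[OF fj[OF that]]) simp
      have "norm ((TT ^^ j) f x - KN N L ((TT ^^ j) f) x) \<le> 2 ^ j * B * (L / real (N + 2))"
        by (rule KN_approx[OF L cb_per[OF c] cb_lip[OF c] cb_continuous[OF c]])
      also have "\<dots> \<le> 2 ^ k * B * \<delta>" using that B N d0 L
        by (intro mult_mono power_increasing) auto
      finally have a: "norm (y j 0 - (TT ^^ j) f x) \<le> 2 ^ k * B * \<delta>"
        by (simp add: yE[OF that] Et_0 norm_minus_commute)
      have "s ^ j \<le> 1" using s by (intro power_le_one) auto
      then have "s ^ j / fact j \<le> 1" using order_trans[OF _ fact_ge_1[of j, where 'a=real]]
        by (simp add: divide_le_eq_1) 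
      then have "norm ((s ^ j / fact j) *\<^sub>R (y j 0 - (TT ^^ j) f x)) \<le> 1 * norm (y j 0 - (TT ^^ j) f x)"
        unfolding norm_scaleR using s by (intro mult_right_mono) auto
      then show ?thesis using a by simp
    qed
    then have "norm (\<Sum>j\<le>k. (s ^ j / fact j) *\<^sub>R (y j 0 - (TT ^^ j) f x)) \<le> of_nat (card {..k}) * (2 ^ k * B * \<delta>)"
      by (intro sum_norm_bound) auto
    then show ?thesis by (simp add: lessThan_Suc_atMost sum_subtractf scaleR_diff_right del: sum.lessThan_Suc)
  qed
  have "y 0 s = Et N L s f x" using yE[of 0 s] by simp
  then show ?thesis using norm_triangle_le[OF add_mono[OF 1 2]] by (simp add: algebra_simps)
qed

section \<open>Grid functions and trigonometric interpolation\<close>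

text \<open>Root mean square over the nodes. The division by sqrt M makes it at most the supremum,
  and equal to the L2 norm of the interpolant up to the factor sqrt(b - a).\<close>

definition gnorm :: "nat \<Rightarrow> (nat \<Rightarrow> complex^2) \<Rightarrow> real" where
  "gnorm M U = L2_set (\<lambda>j. norm (U j)) {..<M} / sqrt (real M)"

lemma gnorm_triangle: "gnorm M (\<lambda>j. U j + V j) \<le> gnorm M U + gnorm M V"
proof -
  have "L2_set (\<lambda>j. norm (U j + V j)) {..<M} \<le> L2_set (\<lambda>j. norm (U j) + norm (V j)) {..<M}"
    by (intro L2_set_mono norm_triangle_ineq) auto
  also have "\<dots> \<le> L2_set (\<lambda>j. norm (U j)) {..<M} + L2_set (\<lambda>j. norm (V j)) {..<M}"
    by (rule L2_set_triangle_ineq)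
  finally show ?thesis by (simp add: gnorm_def add_divide_distrib[symmetric] divide_right_mono)
qed

lemma gnorm_triangle_diff: "gnorm M (\<lambda>j. U j - W j) \<le> gnorm M (\<lambda>j. U j - V j) + gnorm M (\<lambda>j. V j - W j)"
  using gnorm_triangle[of M "\<lambda>j. U j - V j" "\<lambda>j. V j - W j"] by simp

lemma gnorm_le_sup:
  assumes "\<And>j. j < M \<Longrightarrow> norm (U j) \<le> B" "0 < M" "0 \<le> B"
  shows "gnorm M U \<le> B"
proof -
  have "L2_set (\<lambda>j. norm (U j)) {..<M} \<le> L2_set (\<lambda>j. B) {..<M}"
    by (intro L2_set_mono assms) auto
  also have "\<dots> = sqrt (real M) * B" using assms by (simp add: L2_set_def real_sqrt_mult)
  finally show ?thesis using assms(2) by (simp add: gnorm_def field_simps)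
qed

lemma gnorm_cong: "(\<And>j. j < M \<Longrightarrow> norm (U j) = norm (V j)) \<Longrightarrow> gnorm M U = gnorm M V"
  by (simp add: gnorm_def L2_set_def)

lemma gnorm_sq: "0 < M \<Longrightarrow> real M * (gnorm M U)\<^sup>2 = (\<Sum>j<M. (norm (U j))\<^sup>2)"
  by (simp add: gnorm_def L2_set_def power_divide sum_nonneg)

lemma gnorm_nonneg: "0 \<le> gnorm M U"
  by (simp add: gnorm_def L2_set_nonneg)

section \<open>The discrete Fourier transform and the spectral step\<close>

lemma cis_2pi_div_neq_1:
  assumes "d \<noteq> 0" "\<bar>d\<bar> < int M" shows "cis (2 * pi * of_int d / real M) \<noteq> 1"
proof
  assume "cis (2 * pi * of_int d / real M) = 1"
  then have "cos (2 * pi * of_int d / real M) = 1" by (simp add: complex_eq_iff)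
  then obtain k :: int where "2 * pi * of_int d / real M = of_int k * 2 * pi"
    using cos_one_2pi_int by blast
  then have "real_of_int d = of_int (k * int M)" using assms by (simp add: field_simps)
  then have "d = k * int M" by (simp only: of_int_eq_iff)
  then have "1 * int M \<le> \<bar>d\<bar>" using assms(1) by (auto simp: abs_mult intro!: mult_right_mono)
  then show False using assms(2) by simp
qed

lemma root_power_sum:
  assumes "\<bar>d\<bar> < int M"
  shows "(\<Sum>j<M. cis (2 * pi * of_int d / real M) ^ j) = (if d = 0 then of_nat M else 0)"
proof (cases "d = 0")
  case False
  let ?w = "cis (2 * pi * of_int d / real M)"
  have M: "M > 0" using assms by auto
  have "?w ^ M = cis (2 * pi * of_int d)" unfolding Complex.DeMoivre using M by simp
  then have "?w ^ M = 1" by (simp only: cis_multiple_2pi Ints_of_int)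
  then show ?thesis using geometric_sum[OF cis_2pi_div_neq_1[OF False assms], of M] False by simp
qed simp

abbreviation gp :: "real \<Rightarrow> nat \<Rightarrow> nat \<Rightarrow> real" where "gp L M j \<equiv> grid 0 L M j"

lemma ee_grid: "L > 0 \<Longrightarrow> ee L l (gp L M j) = cis (2 * pi * of_int l / real M) ^ j"
  unfolding Complex.DeMoivre by (simp add: ee_def freq_def grid_def mult_ac)

lemma ee_grid_sum:
  assumes "L > 0" "l \<in> modes M" "l' \<in> modes M"
  shows "(\<Sum>j<M. ee L l (gp L M j) * ee L (- l') (gp L M j)) = (if l = l' then of_nat M else 0)"
proof -
  have "\<bar>l - l'\<bar> < int M" using assms by (auto simp: modes_def)
  then show ?thesis
    using root_power_sum[of "l - l'" M] unfolding ee_grid[OF assms(1), symmetric]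
    by (simp add: ee_add_freq)
qed

text \<open>The dual orthogonality relation, summed over frequencies. The unsymmetric band from -M/2
  to M/2 - 1 is shifted to 0, ..., M - 1 at the price of a phase, which leaves a geometric sum of
  roots of unity.\<close>

lemma ee_modes_sum:
  assumes "L > 0" "even M" "j < M" "k < M"
  shows "(\<Sum>l\<in>modes M. ee L l (gp L M j) * ee L (- l) (gp L M k)) = (if j = k then of_nat M else 0)"
proof -
  let ?w = "cis (2 * pi * of_int (int j - int k) / real M)"
  have M: "M > 0" using assms by simp
  have e: "ee L l (gp L M j) * ee L (- l) (gp L M k) = cis (2 * pi * of_int (int j - int k) / real M * of_int l)" for l
  proof -
    have "freq 0 L l * gp L M j + freq 0 L (- l) * gp L M k = 2 * pi * of_int (int j - int k) / real M * of_int l"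
      using assms(1) M by (simp add: freq_def grid_def field_simps)
    then show ?thesis by (simp only: ee_def cis_mult)
  qed
  have "(\<Sum>l\<in>modes M. ee L l (gp L M j) * ee L (- l) (gp L M k)) =
      (\<Sum>i<M. cis (2 * pi * of_int (int j - int k) / real M * of_int (int i - int (M div 2))))"
    unfolding e
  proof (rule sum.reindex_bij_witness[of _ "\<lambda>i. int i - int (M div 2)" "\<lambda>l. nat (l + int (M div 2))"])
  qed (use assms in \<open>auto simp: modes_def elim!: evenE\<close>)
  also have "\<dots> = cis (2 * pi * of_int (int j - int k) / real M * (- real (M div 2))) * (\<Sum>i<M. ?w ^ i)"
  proof -
    have "cis (2 * pi * of_int (int j - int k) / real M * of_int (int i - int (M div 2)))
       = cis (2 * pi * of_int (int j - int k) / real M * (- real (M div 2))) * ?w ^ i" for i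
      unfolding Complex.DeMoivre cis_mult by (rule arg_cong[of _ _ cis]) (simp add: algebra_simps add_divide_distrib diff_divide_distrib)
    then show ?thesis unfolding sum_distrib_left by (intro sum.cong refl)
  qed
  also have "(\<Sum>i<M. ?w ^ i) = (if int j - int k = 0 then of_nat M else 0)"
    by (rule root_power_sum) (use assms in auto)
  finally show ?thesis by auto
qed

lemma exp_ee: "exp (\<i> * of_real (freq a b l * (x - a))) = ee (b - a) l (x - a)"
  "exp (- \<i> * of_real (freq a b l * (x - a))) = ee (b - a) (- l) (x - a)"
  by (simp_all add: ee_def freq_def cis_conv_exp)

lemma grid_shift: "grid a b M j - a = gp (b - a) M j"
  by (simp add: grid_def)

lemma dft_eq: "dft a b M U l = (1 / of_nat M) *s (\<Sum>j<M. ee (b - a) (- l) (gp (b - a) M j) *s U j)"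
  unfolding dft_def exp_ee unfolding grid_shift ..

lemma dft_inversion:
  assumes "L > 0" "even M" "j < M"
  shows "(\<Sum>l\<in>modes M. ee L l (gp L M j) *s dft 0 L M U l) = U j"
proof -
  have "(\<Sum>l\<in>modes M. ee L l (gp L M j) *s dft 0 L M U l)
    = (\<Sum>l\<in>modes M. \<Sum>k<M. ((1 / of_nat M) * (ee L l (gp L M j) * ee L (- l) (gp L M k))) *s U k)"
    by (simp add: dft_eq bounded_bilinear.sum_right[OF bounded_bilinear_vsmult] vector_smult_assoc mult_ac)
  also have "\<dots> = (\<Sum>k<M. ((1 / of_nat M) * (\<Sum>l\<in>modes M. ee L l (gp L M j) * ee L (- l) (gp L M k))) *s U k)"
    by (subst sum.swap) (simp add: bounded_bilinear.sum_left[OF bounded_bilinear_vsmult] sum_distrib_left)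
  also have "\<dots> = (\<Sum>k<M. if j = k then U k else 0)"
    using assms by (intro sum.cong refl) (auto simp: ee_modes_sum)
  finally show ?thesis using assms(3) by simp
qed

text \<open>Two frequencies in \<open>modes M\<close> differ by less than M, so that no aliasing
  occurs.\<close>

lemma dft_trig:
  assumes "L > 0" "0 < M" "S \<subseteq> modes M" "l \<in> modes M"
  shows "dft 0 L M (\<lambda>j. \<Sum>k\<in>S. ee L k (gp L M j) *s c k) l = (if l \<in> S then c l else 0)"
proof -
  have fin: "finite S" using assms(3) by (rule finite_subset) (simp add: modes_def)
  have "dft 0 L M (\<lambda>j. \<Sum>k\<in>S. ee L k (gp L M j) *s c k) l
    = (\<Sum>j<M. \<Sum>k\<in>S. ((1 / of_nat M) * (ee L k (gp L M j) * ee L (- l) (gp L M j))) *s c k)"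
    by (simp add: dft_eq bounded_bilinear.sum_right[OF bounded_bilinear_vsmult] vector_smult_assoc mult_ac)
  also have "\<dots> = (\<Sum>k\<in>S. ((1 / of_nat M) * (\<Sum>j<M. ee L k (gp L M j) * ee L (- l) (gp L M j))) *s c k)"
    by (subst sum.swap) (simp add: bounded_bilinear.sum_left[OF bounded_bilinear_vsmult] sum_distrib_left)
  also have "\<dots> = (\<Sum>k\<in>S. if l = k then c k else 0)"
    using assms ee_grid_sum[OF assms(1) _ assms(4)] by (intro sum.cong refl) auto
  finally show ?thesis using fin by simp
qed

lemma parseval_scalar:
  assumes "L > 0"
  shows "(\<Sum>j<M. (cmod (\<Sum>l\<in>modes M. ee L l (gp L M j) * c l))\<^sup>2) = real M * (\<Sum>l\<in>modes M. (cmod (c l))\<^sup>2)"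
proof -
  have "of_real (\<Sum>j<M. (cmod (\<Sum>l\<in>modes M. ee L l (gp L M j) * c l))\<^sup>2)
    = (\<Sum>j<M. (\<Sum>l\<in>modes M. ee L l (gp L M j) * c l) * (\<Sum>k\<in>modes M. ee L (- k) (gp L M j) * cnj (c k)))"
    by (simp add: complex_norm_square cnj_ee flip: of_real_power)
  also have "\<dots> = (\<Sum>j<M. \<Sum>l\<in>modes M. \<Sum>k\<in>modes M. (c l * cnj (c k)) * (ee L l (gp L M j) * ee L (- k) (gp L M j)))"
    by (simp add: sum_product mult_ac)
  also have "\<dots> = (\<Sum>l\<in>modes M. \<Sum>k\<in>modes M. \<Sum>j<M. (c l * cnj (c k)) * (ee L l (gp L M j) * ee L (- k) (gp L M j)))"
    by (subst sum.swap, intro sum.cong refl, rule sum.swap)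
  also have "\<dots> = (\<Sum>l\<in>modes M. \<Sum>k\<in>modes M. if l = k then of_nat M * (c l * cnj (c k)) else 0)"
    using ee_grid_sum[OF assms] by (intro sum.cong refl) (simp add: sum_distrib_left[symmetric])
  also have "\<dots> = of_real (real M * (\<Sum>l\<in>modes M. (cmod (c l))\<^sup>2))"
    by (simp add: modes_def complex_norm_square sum_distrib_left flip: of_real_power)
  finally show ?thesis by (simp only: of_real_eq_iff)
qed

lemma parseval:
  assumes "L > 0"
  shows "(\<Sum>j<M. (norm (\<Sum>l\<in>modes M. ee L l (gp L M j) *s c l))\<^sup>2) = real M * (\<Sum>l\<in>modes M. (norm (c l :: complex^2))\<^sup>2)"
  using parseval_scalar[OF assms, of M "\<lambda>l. c l $ 1"] parseval_scalar[OF assms, of M "\<lambda>l. c l $ 2"]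
  by (simp add: norm_vec2_sq sum.distrib distrib_left)

lemma gnorm_dft:
  assumes "L > 0" "0 < M" "even M"
  shows "(gnorm M U)\<^sup>2 = (\<Sum>l\<in>modes M. (norm (dft 0 L M U l))\<^sup>2)"
proof -
  have "real M * (gnorm M U)\<^sup>2 = (\<Sum>j<M. (norm (\<Sum>l\<in>modes M. ee L l (gp L M j) *s dft 0 L M U l))\<^sup>2)"
    unfolding gnorm_sq[OF assms(2)] using dft_inversion[OF assms(1,3)] by (intro sum.cong refl) simp
  then show ?thesis unfolding parseval[OF assms(1)] using assms(2) by simp
qed

lemma exp_T_eq: "exp_T 1 0 L M s U j = (\<Sum>l\<in>modes M. ee L l (gp L M j) *s EC L s (dft 0 L M U) l)"
  unfolding exp_T_def exp_ee EC_def by simp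

text \<open>Discrete Parseval on both sides; in between every 2x2 block is unitary because its
  exponent is skew-Hermitian.\<close>

lemma gnorm_exp_T:
  assumes "L > 0" "0 < M" "even M"
  shows "gnorm M (exp_T 1 0 L M s U) = gnorm M U"
proof -
  have "real M * (gnorm M (exp_T 1 0 L M s U))\<^sup>2 = real M * (\<Sum>l\<in>modes M. (norm (dft 0 L M U l))\<^sup>2)"
    unfolding gnorm_sq[OF assms(2)] exp_T_eq parseval[OF assms(1)] norm_EC ..
  then have "(gnorm M (exp_T 1 0 L M s U))\<^sup>2 = (gnorm M U)\<^sup>2"
    using assms by (simp add: gnorm_dft)
  then show ?thesis using gnorm_nonneg by (simp add: power2_eq_iff_nonneg)
qed

lemma exp_T_diff: "exp_T 1 0 L M s (\<lambda>j. U j - V j) j = exp_T 1 0 L M s U j - exp_T 1 0 L M s V j"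
proof -
  have "dft 0 L M (\<lambda>j. U j - V j) = (\<lambda>l. dft 0 L M U l - dft 0 L M V l)"
    by (rule ext) (simp add: dft_eq bounded_bilinear.diff_right[OF bounded_bilinear_vsmult] sum_subtractf)
  then show ?thesis
    by (simp add: exp_T_eq EC_diff bounded_bilinear.diff_right[OF bounded_bilinear_vsmult] sum_subtractf)
qed

text \<open>The lowest frequency -M/2 of the grid has no partner M/2; N = M/2 - 1 is the largest
  symmetric band inside \<open>modes M\<close>. On this band the spectral step is the exact free
  evolution.\<close>

lemma exp_T_trig:
  assumes "L > 0" "0 < M" "even M" "N = M div 2 - 1" "j < M"
  shows "exp_T 1 0 L M s (\<lambda>j. ev L N c (gp L M j)) j = ev L N (EC L s c) (gp L M j)"
proof -
  have sub: "{- int N..int N} \<subseteq> modes M" using assms by (auto simp: modes_def elim!: evenE)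
  have d: "dft 0 L M (\<lambda>j. ev L N c (gp L M j)) l = (if l \<in> {- int N..int N} then c l else 0)"
    if "l \<in> modes M" for l
    unfolding ev_def using dft_trig[OF assms(1,2) sub that] by simp
  have z: "EC L s (dft 0 L M (\<lambda>j. ev L N c (gp L M j))) l = (if l \<in> {- int N..int N} then EC L s c l else 0)"
    if "l \<in> modes M" for l
    unfolding EC_def d[OF that] by simp
  have "exp_T 1 0 L M s (\<lambda>j. ev L N c (gp L M j)) j =
     (\<Sum>l\<in>modes M. if l \<in> {- int N..int N} then ee L l (gp L M j) *s EC L s c l else 0)"
    unfolding exp_T_eq using z by (intro sum.cong refl) simp
  also have "\<dots> = (\<Sum>l\<in>{- int N..int N}. ee L l (gp L M j) *s EC L s c l)"
    using sub by (intro sum.mono_neutral_cong_right) (auto simp: modes_def)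
  finally show ?thesis by (simp add: ev_def)
qed

section \<open>Jackson's theorem by iterated smoothing\<close>

definition RN :: "nat \<Rightarrow> real \<Rightarrow> (real \<Rightarrow> complex^2) \<Rightarrow> real \<Rightarrow> complex^2" where
  "RN N L f x = f x - KN N L f x"

lemma cb_KN: "L > 0 \<Longrightarrow> cb L (Suc k) B f \<Longrightarrow> cb L (Suc k) (8 * B) (KN N L f)"
  using cb_Et[of L 0 k B f N] by (simp add: Et_0)

lemma cb_RN: "L > 0 \<Longrightarrow> cb L (Suc k) B f \<Longrightarrow> cb L (Suc k) (9 * B) (RN N L f)"
proof -
  assume a: "L > 0" "cb L (Suc k) B f"
  from cb_diff[OF a(2) cb_KN[OF a, of N]] show ?thesis by (simp add: RN_def[abs_def])
qed

lemma cb_RN_pow: "L > 0 \<Longrightarrow> cb L (Suc k) B f \<Longrightarrow> cb L (Suc k) (9 ^ i * B) ((RN N L ^^ i) f)"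
proof (induction i)
  case (Suc i)
  from cb_RN[OF Suc.prems(1) Suc.IH[OF Suc.prems]] show ?case by (simp add: mult_ac)
qed simp

lemma DD_RN:
  assumes "L > 0" "cb L (Suc (Suc k)) B f"
  shows "DD (RN N L f) = RN N L (DD f)"
proof (rule DD_eqI)
  show "(RN N L f has_vector_derivative RN N L (DD f) x) (at x)" for x
    unfolding RN_def[abs_def]
    using Et_deriv[OF assms, of N 0 x] cb_deriv[OF assms(2)]
    by (intro has_vector_derivative_diff) (simp_all add: Et_0)
qed

lemma DD_RN_pow:
  assumes "L > 0" "cb L (Suc (Suc k)) B f"
  shows "DD ((RN N L ^^ i) f) = (RN N L ^^ i) (DD f)"
proof (induction i)
  case (Suc i)
  then show ?case using DD_RN[OF assms(1) cb_RN_pow[OF assms, of i N]] by simp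
qed simp

text \<open>Every residual factor \<open>RN\<close> turns one derivative into a factor L/(N+2).
  Since \<open>RN\<close> commutes with \<open>DD\<close>, the induction hypothesis for the
  derivative of f bounds the derivative of the iterated residual, hence its Lipschitz constant, and
  \<open>KN_approx\<close> is applied once more.\<close>

lemma jackson:
  assumes L: "L > 0"
  shows "cb L (Suc k) B f \<Longrightarrow> norm ((RN N L ^^ Suc k) f x) \<le> B * (L / real (N + 2)) ^ Suc k"
proof (induction k arbitrary: f x)
  case 0
  then show ?case
    using KN_approx[OF L cb_per[OF 0] cb_lip[OF 0] cb_continuous[OF 0], of x N] by (simp add: RN_def)
next
  case (Suc k)
  let ?g = "(RN N L ^^ Suc k) f" and ?B = "B * (L / real (N + 2)) ^ Suc k"
  note c = cb_RN_pow[OF L Suc.prems, of "Suc k" N]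
  have "norm (DD ?g x) \<le> ?B" for x
    unfolding DD_RN_pow[OF L Suc.prems] by (rule Suc.IH[OF cb_DD[OF Suc.prems]])
  then have "norm (?g x - ?g y) \<le> ?B * \<bar>x - y\<bar>" for x y
    by (rule lip_of_deriv[OF cb_deriv[OF c]])
  from KN_approx[OF L cb_per[OF c] this cb_continuous[OF c]]
  have "norm (RN N L ?g x) \<le> ?B * (L / real (N + 2))" by (simp only: RN_def)
  then show ?case by (simp add: mult_ac)
qed

lemma RN_pow_telescope: "f x - (\<Sum>i<n. KN N L ((RN N L ^^ i) f) x) = (RN N L ^^ n) f x"
  by (induction n) (simp_all add: RN_def algebra_simps)

lemma ev_sum: "ev L R (\<lambda>l. \<Sum>i\<in>A. c i l) x = (\<Sum>i\<in>A. ev L R (c i) x)"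
  unfolding ev_def bounded_bilinear.sum_right[OF bounded_bilinear_vsmult] by (rule sum.swap)

text \<open>As \<open>RN\<close> is the identity minus \<open>KN\<close>, a power of
  \<open>RN\<close> applied to F is F minus an explicit trigonometric polynomial of degree N. The
  degree is chosen to fit the grid; N + 2 >= M/2 accounts for the factor 2 in the rate.\<close>

lemma trig_approx:
  assumes L: "0 < L" and M: "0 < M" "even M" and F: "cb L (Suc k) B F"
  obtains c where "\<And>x. norm (F x - ev L (M div 2 - 1) c x) \<le> B * (2 * L / real M) ^ Suc k"
    "\<And>l. \<bar>l\<bar> > int (M div 2 - 1) \<Longrightarrow> c l = 0"
proof -
  define N where "N = M div 2 - 1"
  define c where "c l = (\<Sum>i<Suc k. kc N L ((RN N L ^^ i) F) l)" for l
  have B: "0 \<le> B" by (rule cb_nonneg[OF F])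
  have "real M \<le> 2 * real (N + 2)"
    using M by (auto simp: N_def elim!: evenE)
  then have "L / real (N + 2) \<le> L / (real M / 2)"
    using L M by (intro divide_left_mono) auto
  then have "L / real (N + 2) \<le> 2 * L / real M" by (simp add: mult.commute)
  then have b: "B * (L / real (N + 2)) ^ Suc k \<le> B * (2 * L / real M) ^ Suc k"
    using B L by (intro mult_left_mono power_mono) auto
  have "norm (F x - ev L N c x) \<le> B * (2 * L / real M) ^ Suc k" for x
  proof -
    have "c = (\<lambda>l. \<Sum>i<Suc k. kc N L ((RN N L ^^ i) F) l)" by (rule ext) (rule c_def)
    then have "ev L N c x = (\<Sum>i<Suc k. KN N L ((RN N L ^^ i) F) x)"
      unfolding KN_def by (simp only: ev_sum)
    then have "F x - ev L N c x = (RN N L ^^ Suc k) F x"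
      using RN_pow_telescope[of F x N L "Suc k"] by (simp only:)
    then show ?thesis using order_trans[OF jackson[OF L F, of N x] b] by (simp only:)
  qed
  moreover have "c l = 0" if "\<bar>l\<bar> > int N" for l using that by (simp add: c_def kc_out)
  ultimately show ?thesis using that unfolding N_def by blast
qed

text \<open>An approximating polynomial p, resolved by the grid, is put in between. The difference F
  - p is moved by the spectral step, which is isometric in mean square; what remains is the
  difference of two exact evolutions, of p and of the smoothed F, for which \<open>EC_sup\<close>
  applies. Thus no supremum bound for the spectral step on grid vectors is called for.\<close>

lemma grid_exp_T:
  assumes L: "L > 0" and M: "0 < M" "even M" and s: "0 \<le> s" "s \<le> 1/2"
    and F: "cb L (Suc k) B F" and N': "L / real (N' + 2) \<le> \<delta>"
  shows "gnorm M (\<lambda>j. exp_T 1 0 L M s (\<lambda>j. F (gp L M j)) j - Et N' L s F (gp L M j))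
    \<le> 9 * (B * (2 * L / real M) ^ Suc k) + 8 * (B * \<delta>)"
proof -
  define N where "N = M div 2 - 1"
  define b where "b = B * (2 * L / real M) ^ Suc k"
  obtain c where c: "\<And>x. norm (F x - ev L (M div 2 - 1) c x) \<le> B * (2 * L / real M) ^ Suc k"
    "\<And>l. \<bar>l\<bar> > int (M div 2 - 1) \<Longrightarrow> c l = 0"
    by (rule trig_approx[OF L M F]) (rule that)
  define p where "p = ev L N c"
  have r: "norm (F x - p x) \<le> b" for x unfolding p_def N_def b_def by (rule c(1))
  have out: "c l = 0" if "\<bar>l\<bar> > int N" for l using c(2) that unfolding N_def .
  have B: "0 \<le> B" by (rule cb_nonneg[OF F])
  have cF: "continuous_on S F" for S by (rule cb_continuous[OF F])
  have b0: "0 \<le> b" using order_trans[OF norm_ge_zero r[of 0]] .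
  have \<delta>: "0 \<le> \<delta>" using L N' by (meson divide_nonneg_nonneg less_imp_le of_nat_0_le_iff order_trans)
  \<comment> \<open>The grid degree N and the smoothing degree N' are unrelated;
    \<open>EC_sup\<close> takes the difference as one polynomial of a common degree.\<close>
  define R where "R = max N N'"
  have out': "EC L s d l = 0" if "d l = 0" for d l using that by (simp add: EC_def)
  have ext: "(\<And>l. \<bar>l\<bar> > int N \<Longrightarrow> d l = 0) \<Longrightarrow> ev L R d x = ev L N d x"
    "(\<And>l. \<bar>l\<bar> > int N' \<Longrightarrow> d l = 0) \<Longrightarrow> ev L R d x = ev L N' d x" for d x
    by (rule ev_extend, simp_all add: R_def)+
  have e1: "ev L R c x = ev L N c x" and e2: "ev L R (kc N' L F) x = ev L N' (kc N' L F) x"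
    and e3: "ev L R (EC L s c) x = ev L N (EC L s c) x"
    and e4: "ev L R (EC L s (kc N' L F)) x = ev L N' (EC L s (kc N' L F)) x" for x
    by (rule ext, simp add: out out' kc_out)+
  have "norm (ev L R (EC L s (\<lambda>l. c l - kc N' L F l)) x) \<le> 8 * (b + B * \<delta>)" for x
  proof (rule EC_sup[OF s])
    fix x
    have "norm (F x - KN N' L F x) \<le> B * (L / real (N' + 2))"
      by (rule KN_approx[OF L cb_per[OF F] cb_lip[OF F] cF])
    also have "\<dots> \<le> B * \<delta>" by (rule mult_left_mono[OF N' B])
    finally have "norm (p x - KN N' L F x) \<le> b + B * \<delta>"
      using norm_triangle_mono[OF r[of x], of "F x - KN N' L F x" "B * \<delta>"]
        norm_triangle_ineq4[of "F x - KN N' L F x" "F x - p x"] r[of x] by simp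
    moreover have "ev L R (\<lambda>l. c l - kc N' L F l) x = p x - KN N' L F x"
      unfolding ev_diff p_def KN_def e1 e2 by (rule refl)
    ultimately show "norm (ev L R (\<lambda>l. c l - kc N' L F l) x) \<le> b + B * \<delta>" by simp
  qed
  moreover have "ev L R (EC L s (\<lambda>l. c l - kc N' L F l)) x = ev L N (EC L s c) x - Et N' L s F x" for x
    unfolding EC_diff ev_diff Et_def e3 e4 by (rule refl)
  ultimately have 1: "gnorm M (\<lambda>j. ev L N (EC L s c) (gp L M j) - Et N' L s F (gp L M j)) \<le> 8 * (b + B * \<delta>)"
    using M b0 B \<delta> by (intro gnorm_le_sup) auto
  have "gnorm M (\<lambda>j. exp_T 1 0 L M s (\<lambda>j. F (gp L M j)) j - ev L N (EC L s c) (gp L M j))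
      = gnorm M (exp_T 1 0 L M s (\<lambda>j. F (gp L M j) - p (gp L M j)))"
    by (intro gnorm_cong) (simp add: exp_T_diff p_def exp_T_trig[OF L M N_def])
  also have "\<dots> = gnorm M (\<lambda>j. F (gp L M j) - p (gp L M j))" by (rule gnorm_exp_T[OF L M])
  also have "\<dots> \<le> b" using r M b0 by (intro gnorm_le_sup) auto
  finally show ?thesis
    using order_trans[OF gnorm_triangle_diff add_mono[OF _ 1]] unfolding b_def[symmetric] by force
qed

section \<open>Expansion of the scheme in words\<close>

definition WW :: "(real \<Rightarrow> real) \<Rightarrow> (real \<Rightarrow> real) \<Rightarrow> (real \<Rightarrow> complex^2) \<Rightarrow> real \<Rightarrow> complex^2" where
  "WW V A f x = W_mat 1 V A x *v f x"

definition QQ :: "(real \<Rightarrow> real) \<Rightarrow> (real \<Rightarrow> complex^2) \<Rightarrow> real \<Rightarrow> complex^2" where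
  "QQ A f x = WTW_mat 1 A x *v f x"

lemma W_mat_mult: "W_mat 1 V A x *v v = (-\<i>) *s (V x *\<^sub>R v) + \<i> *s (A x *\<^sub>R (sigma1 *v v))"
  by (simp add: W_mat_def matrix_vector_mult_add_rdistrib matrix_vector_mult_cscale vec_eq_iff scaleR_complex)

lemma WTW_mat_mult: "WTW_mat 1 A x *v v = 4 *\<^sub>R ((-\<i>) *s (A x *\<^sub>R (A x *\<^sub>R (sigma3 *v v))))"
  by (simp add: WTW_mat_def matrix_vector_mult_cscale vec_eq_iff scaleR_complex power2_eq_square)

lemma W_mat_bound: "norm (W_mat 1 V A x *v v) \<le> (\<bar>V x\<bar> + \<bar>A x\<bar>) * norm v"
  unfolding W_mat_mult by (rule order_trans[OF norm_triangle_ineq]) (simp add: norm_vsmult distrib_right)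

lemma WTW_mat_bound: "norm (WTW_mat 1 A x *v v) \<le> 4 * (A x)\<^sup>2 * norm v"
  unfolding WTW_mat_mult by (simp add: norm_vsmult power2_eq_square)

lemma cb_WW:
  assumes "cb L k BV V" "cb L k BV A" "cb L k B f"
  shows "cb L k (2 * 2 ^ k * BV * B) (WW V A f)"
proof -
  have i: "norm (\<i> *s v) \<le> norm v" "norm ((-\<i>) *s v) \<le> norm v" "norm (sigma1 *v v) \<le> norm v" for v :: "complex^2"
    by (simp_all add: norm_vsmult)
  have "cb L k (2 ^ k * BV * B + 2 ^ k * BV * B)
    (\<lambda>x. (-\<i>) *s (V x *\<^sub>R f x) + \<i> *s (A x *\<^sub>R (sigma1 *v f x)))"
    by (intro cb_add cb_linear[OF bounded_linear_vsmult_right i(1)] cb_linear[OF bounded_linear_vsmult_right i(2)]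
        cb_mult_scaleR cb_linear[OF matrix_vector_mul_bounded_linear i(3)] assms)
  moreover have "2 ^ k * BV * B + 2 ^ k * BV * B = 2 * 2 ^ k * BV * B" by simp
  ultimately show ?thesis unfolding WW_def[abs_def] W_mat_mult by (simp only:)
qed

lemma cb_QQ:
  assumes "cb L k BV A" "cb L k B f"
  shows "cb L k (4 * (2 ^ k * BV * (2 ^ k * BV * B))) (QQ A f)"
proof -
  have i: "norm ((-\<i>) *s v) \<le> norm v" "norm (sigma3 *v v) \<le> norm v" for v :: "complex^2"
    by (simp_all add: norm_vsmult)
  have "cb L k (\<bar>4\<bar> * (2 ^ k * BV * (2 ^ k * BV * B)))
    (\<lambda>x. 4 *\<^sub>R ((-\<i>) *s (A x *\<^sub>R (A x *\<^sub>R (sigma3 *v f x)))))"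
    by (intro cb_scaleR cb_linear[OF bounded_linear_vsmult_right i(1)]
        cb_mult_scaleR cb_linear[OF matrix_vector_mul_bounded_linear i(2)] assms)
  then show ?thesis by (simp add: QQ_def[abs_def] WTW_mat_mult)
qed

lemma TT_scaleR: "cb L (Suc (Suc k)) B f \<Longrightarrow> TT (\<lambda>x. c *\<^sub>R f x) = (\<lambda>x. c *\<^sub>R TT f x)"
  by (auto simp: TT_def DD_scaleR matrix_vector_mult_scaleR_right vsmult_scaleR scaleR_diff_right)

lemma TT_add: "cb L (Suc (Suc k)) B f \<Longrightarrow> cb L (Suc (Suc k)) B' g \<Longrightarrow> TT (\<lambda>x. f x + g x) = (\<lambda>x. TT f x + TT g x)"
  by (auto simp: TT_def DD_add matrix_vector_right_distrib vector_add_ldistrib)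

lemma DD_WW:
  assumes "cb L (Suc (Suc k)) BV V" "cb L (Suc (Suc k)) BV A" "cb L (Suc (Suc k)) B f"
  shows "DD (WW V A f) x = W_mat 1 (DD V) (DD A) x *v f x + W_mat 1 V A x *v DD f x"
proof -
  have d: "(f has_vector_derivative DD f y) (at y)" "(V has_real_derivative DD V y) (at y)" "(A has_real_derivative DD A y) (at y)" for y
    using assms cb_deriv by (auto simp: has_real_derivative_iff_has_vector_derivative)
  have "(WW V A f has_vector_derivative ((-\<i>) *s (V y *\<^sub>R DD f y + DD V y *\<^sub>R f y) +
      \<i> *s (A y *\<^sub>R (sigma1 *v DD f y) + DD A y *\<^sub>R (sigma1 *v f y)))) (at y)" for y
    unfolding WW_def[abs_def] W_mat_mult
    by (intro has_vector_derivative_add bounded_linear.has_vector_derivative[OF bounded_linear_vsmult_right]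
        has_vector_derivative_scaleR bounded_linear.has_vector_derivative[OF matrix_vector_mul_bounded_linear] d)
  then have "DD (WW V A f) = (\<lambda>y. ((-\<i>) *s (V y *\<^sub>R DD f y + DD V y *\<^sub>R f y) +
      \<i> *s (A y *\<^sub>R (sigma1 *v DD f y) + DD A y *\<^sub>R (sigma1 *v f y))))"
    by (rule DD_eqI)
  then show ?thesis by (simp add: W_mat_mult vector_add_ldistrib)
qed

text \<open>The derivative terms of the double commutator \<open>[W,[T,W]]\<close> cancel because \<open>W\<close> commutes with
  the matrix \<open>\<sigma>\<^sub>1\<close> in front of the derivative.\<close>

lemma QQ_commutator:
  assumes "cb L (Suc (Suc k)) BV V" "cb L (Suc (Suc k)) BV A" "cb L (Suc (Suc k)) B f"
  shows "QQ A f x = 2 *\<^sub>R WW V A (TT (WW V A f)) x - WW V A (WW V A (TT f)) x - TT (WW V A (WW V A f)) x"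
proof -
  note d1 = DD_WW[OF assms]
  note d2 = DD_WW[OF assms(1,2) cb_WW[OF assms]]
  show ?thesis
    unfolding TT_def d1 d2
    by (simp add: QQ_def WTW_mat_mult WW_def W_mat_mult d1 d2 vec_eq_iff forall_2 scaleR_complex algebra_simps)
qed

text \<open>A word is a list of letters, \<open>True\<close> for the operator \<open>T\<close> and \<open>False\<close> for \<open>W\<close>.\<close>

fun wop :: "(real \<Rightarrow> real) \<Rightarrow> (real \<Rightarrow> real) \<Rightarrow> bool list \<Rightarrow> (real \<Rightarrow> complex^2) \<Rightarrow> real \<Rightarrow> complex^2" where
  "wop V A [] f = f"
| "wop V A (b # w) f = (if b then TT (wop V A w f) else WW V A (wop V A w f))"

lemma wop_append: "wop V A (v @ w) f = wop V A v (wop V A w f)"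
  by (induction v) auto

lemma wop_True: "wop V A (replicate j True) f = (TT ^^ j) f"
  by (induction j) auto

text \<open>Each letter is charged one order of regularity, also \<open>W\<close>, which keeps the
  count equal to the length of the word. The factor per letter is 2 for \<open>T\<close> plus 32 BV
  = 2 * 2^4 * BV for \<open>W\<close>, since a product is formed on at most four orders.\<close>

lemma cb_wop:
  assumes V: "cb L 4 BV V" "cb L 4 BV A" and f: "cb L 5 B f"
  shows "length w \<le> 4 \<Longrightarrow> cb L (5 - length w) ((2 + 32 * BV) ^ length w * B) (wop V A w f)"
proof (induction w)
  case Nil
  then show ?case using f by simp
next
  case (Cons b w)
  define n where "n = length w"
  define C where "C = (2 + 32 * BV) ^ n * B"
  have nn: "0 \<le> BV" "0 \<le> C" using cb_nonneg[OF V(1)] cb_nonneg[OF f] by (simp_all add: C_def)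
  have n: "n \<le> 3" using Cons.prems by (simp add: n_def)
  have e: "5 - n = Suc (Suc (3 - n))" "5 - length (b # w) = Suc (3 - n)" using n by (simp_all add: n_def)
  have IH: "cb L (Suc (Suc (3 - n))) C (wop V A w f)"
    using Cons e(1) by (simp add: n_def C_def)
  have T: "cb L (Suc (3 - n)) (2 * C) (TT (wop V A w f))" by (rule cb_TT[OF IH])
  have "cb L (Suc (3 - n)) (2 * 2 ^ Suc (3 - n) * BV * C) (WW V A (wop V A w f))"
    using n by (intro cb_WW cb_le[OF V(1)] cb_le[OF V(2)] cb_Suc[OF IH]) auto
  moreover have "2 * 2 ^ Suc (3 - n) * BV * C \<le> 2 * 2 ^ 4 * BV * C"
    using nn n by (intro mult_right_mono mult_left_mono power_increasing) auto
  ultimately have W: "cb L (Suc (3 - n)) (32 * BV * C) (WW V A (wop V A w f))"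
    by (auto intro: cb_mono)
  have le: "2 * C \<le> (2 + 32 * BV) * C" "32 * BV * C \<le> (2 + 32 * BV) * C"
    using nn by (auto intro!: mult_right_mono)
  have "cb L (Suc (3 - n)) ((2 + 32 * BV) * C) (wop V A (b # w) f)"
    using cb_mono[OF T le(1)] cb_mono[OF W le(2)] by (cases b) (simp_all del: cb.simps)
  then show ?case unfolding e(2) by (simp add: C_def n_def mult_ac)
qed

definition W4 :: "bool list set" where "W4 = {w. length w \<le> 4}"

lemma finite_words: "finite {w :: bool list. length w \<le> n}"
  using finite_lists_length_le[of "UNIV :: bool set" n] by simp

lemma finite_W4: "finite W4" unfolding W4_def by (rule finite_words)

text \<open>The product of formal power series in the two non-commuting letters.\<close>

definition fmul :: "(bool list \<Rightarrow> real) \<Rightarrow> (bool list \<Rightarrow> real) \<Rightarrow> bool list \<Rightarrow> real" where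
  "fmul s p w = (\<Sum>j\<le>length w. s (take j w) * p (drop j w))"

text \<open>A pair of a prefix y and a suffix v is the same as the word y @ v with a marked
  splitting position. Both sides are cut at total length four, so the reindexing is a
  bijection.\<close>

lemma fmul_sum:
  fixes Z :: "bool list \<Rightarrow> 'a::real_vector"
  shows "(\<Sum>v\<in>W4. p v *\<^sub>R (\<Sum>y | length y + length v \<le> 4. s y *\<^sub>R Z (y @ v))) = (\<Sum>w\<in>W4. fmul s p w *\<^sub>R Z w)"
proof -
  have fin: "finite {y :: bool list. length y + length v \<le> 4}" for v :: "bool list"
    by (rule finite_subset[OF _ finite_words[of 4]]) auto
  have "(\<Sum>v\<in>W4. p v *\<^sub>R (\<Sum>y | length y + length v \<le> 4. s y *\<^sub>R Z (y @ v)))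
    = (\<Sum>v\<in>W4. \<Sum>y | length y + length v \<le> 4. (s y * p v) *\<^sub>R Z (y @ v))"
    by (simp add: scaleR_sum_right mult.commute)
  also have "\<dots> = (\<Sum>(v, y)\<in>Sigma W4 (\<lambda>v. {y. length y + length v \<le> 4}). (s y * p v) *\<^sub>R Z (y @ v))"
    by (rule sum.Sigma) (use fin finite_W4 in auto)
  also have "\<dots> = (\<Sum>(w, j)\<in>Sigma W4 (\<lambda>w. {..length w}). (s (take j w) * p (drop j w)) *\<^sub>R Z w)"
    by (rule sum.reindex_bij_witness[of _ "\<lambda>(w, j). (drop j w, take j w)" "\<lambda>(v, y). (y @ v, length y)"])
      (auto simp: W4_def)
  also have "\<dots> = (\<Sum>w\<in>W4. \<Sum>j\<le>length w. (s (take j w) * p (drop j w)) *\<^sub>R Z w)"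
    by (rule sum.Sigma[symmetric]) (use finite_W4 in auto)
  also have "\<dots> = (\<Sum>w\<in>W4. fmul s p w *\<^sub>R Z w)"
    by (simp add: fmul_def scaleR_sum_left)
  finally show ?thesis .
qed

text \<open>All constants have to be uniform in the data; they are hidden in existential statements over a
  family of data indexed by \<open>I\<close>.\<close>

locale dirac_family =
  fixes I :: "'i set" and L \<sigma> :: "'i \<Rightarrow> real" and V A :: "'i \<Rightarrow> real \<Rightarrow> real"
    and u :: "'i \<Rightarrow> real \<Rightarrow> complex^2" and BV BU :: real and m :: nat
  assumes m: "4 \<le> m"
    and L: "i \<in> I \<Longrightarrow> 0 < L i" and \<sigma>: "i \<in> I \<Longrightarrow> 0 < \<sigma> i" "i \<in> I \<Longrightarrow> \<sigma> i \<le> 1/2"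
    and cbV: "i \<in> I \<Longrightarrow> cb (L i) m BV (V i)" "i \<in> I \<Longrightarrow> cb (L i) m BV (A i)"
    and cbu: "i \<in> I \<Longrightarrow> cb (L i) m BU (u i)" "i \<in> I \<Longrightarrow> cb (L i) 5 BU (u i)"
begin

section \<open>Error calculus uniform over a family of data\<close>

lemma cbV4: "i \<in> I \<Longrightarrow> cb (L i) 4 BV (V i)" "i \<in> I \<Longrightarrow> cb (L i) 4 BV (A i)"
  using cbV m by (auto intro: cb_le)

text \<open>The power of \<sigma> is part of the word, so that the coefficients of an expansion are
  numbers common to the whole family, and a word of length n counts as a term of size
  \<sigma>^n.\<close>

definition Wd :: "bool list \<Rightarrow> 'i \<Rightarrow> real \<Rightarrow> complex^2" where
  "Wd w i x = \<sigma> i ^ length w *\<^sub>R wop (V i) (A i) w (u i) x"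

definition bigO :: "nat \<Rightarrow> ('i \<Rightarrow> real \<Rightarrow> complex^2) \<Rightarrow> bool" where
  "bigO n F \<longleftrightarrow> (\<exists>C\<ge>0. \<forall>i\<in>I. \<forall>x. norm (F i x) \<le> C * \<sigma> i ^ n)"

definition asy :: "('i \<Rightarrow> real \<Rightarrow> complex^2) \<Rightarrow> (bool list \<Rightarrow> real) \<Rightarrow> bool" where
  "asy F p \<longleftrightarrow> bigO 5 (\<lambda>i x. F i x - (\<Sum>w\<in>W4. p w *\<^sub>R Wd w i x))"

definition ucb :: "nat \<Rightarrow> ('i \<Rightarrow> real \<Rightarrow> complex^2) \<Rightarrow> bool" where
  "ucb k F \<longleftrightarrow> (\<exists>B\<ge>0. \<forall>i\<in>I. cb (L i) k B (F i))"

lemma bigO_add: "bigO n F \<Longrightarrow> bigO n G \<Longrightarrow> bigO n (\<lambda>i x. F i x + G i x)"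
proof -
  assume "bigO n F" "bigO n G"
  then obtain C D where C: "C \<ge> 0" "\<And>i x. i \<in> I \<Longrightarrow> norm (F i x) \<le> C * \<sigma> i ^ n"
    and D: "D \<ge> 0" "\<And>i x. i \<in> I \<Longrightarrow> norm (G i x) \<le> D * \<sigma> i ^ n" unfolding bigO_def by metis
  show ?thesis unfolding bigO_def
    by (intro exI[of _ "C + D"] conjI ballI allI)
      (use C D in \<open>auto simp: distrib_right intro: norm_triangle_mono\<close>)
qed

lemma bigO_scaleR: "bigO n F \<Longrightarrow> bigO n (\<lambda>i x. c *\<^sub>R F i x)"
proof -
  assume "bigO n F"
  then obtain C where C: "C \<ge> 0" "\<And>i x. i \<in> I \<Longrightarrow> norm (F i x) \<le> C * \<sigma> i ^ n"
    unfolding bigO_def by metis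
  show ?thesis unfolding bigO_def
    by (intro exI[of _ "\<bar>c\<bar> * C"] conjI ballI allI)
      (use C in \<open>auto simp: mult.assoc intro: mult_left_mono\<close>)
qed

lemma bigO_diff: "bigO n F \<Longrightarrow> bigO n G \<Longrightarrow> bigO n (\<lambda>i x. F i x - G i x)"
  using bigO_add[OF _ bigO_scaleR[where c="-1"], of n F G] by simp

lemma bigO_zero: "bigO n (\<lambda>i x. 0)"
  unfolding bigO_def by (intro exI[of _ 0]) auto

lemma bigO_sum: "(\<And>w. w \<in> S \<Longrightarrow> bigO n (F w)) \<Longrightarrow> bigO n (\<lambda>i x. \<Sum>w\<in>S. F w i x)"
  by (induction S rule: infinite_finite_induct) (auto intro: bigO_add bigO_zero)

lemma bigO_cong: "bigO n F \<Longrightarrow> (\<And>i x. i \<in> I \<Longrightarrow> F i x = G i x) \<Longrightarrow> bigO n G"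
  unfolding bigO_def by auto

lemma bigO_le: "bigO n F \<Longrightarrow> k \<le> n \<Longrightarrow> bigO k F"
proof -
  assume "bigO n F" and k: "k \<le> n"
  then obtain C where C: "C \<ge> 0" "\<And>i x. i \<in> I \<Longrightarrow> norm (F i x) \<le> C * \<sigma> i ^ n"
    unfolding bigO_def by metis
  have "norm (F i x) \<le> C * \<sigma> i ^ k" if i: "i \<in> I" for i x
  proof -
    have "\<sigma> i ^ n \<le> \<sigma> i ^ k" using \<sigma>[OF i] k by (intro power_decreasing) auto
    from mult_left_mono[OF this C(1)] C(2)[OF i, of x] show ?thesis by linarith
  qed
  then show ?thesis unfolding bigO_def using C(1) by (intro exI[of _ C]) auto
qed

lemma asy_add: "asy F p \<Longrightarrow> asy G q \<Longrightarrow> asy (\<lambda>i x. F i x + G i x) (\<lambda>w. p w + q w)"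
  unfolding asy_def by (drule (1) bigO_add, erule bigO_cong) (simp add: scaleR_add_left sum.distrib)

lemma asy_scaleR: "asy F p \<Longrightarrow> asy (\<lambda>i x. c *\<^sub>R F i x) (\<lambda>w. c * p w)"
  unfolding asy_def by (drule bigO_scaleR[where c=c], erule bigO_cong) (simp add: scaleR_diff_right scaleR_sum_right)

lemma asy_cong_coeff: "asy F p \<Longrightarrow> (\<And>w. length w \<le> 4 \<Longrightarrow> p w = q w) \<Longrightarrow> asy F q"
  unfolding asy_def W4_def by (erule bigO_cong) (auto intro!: sum.cong)

lemma asy_unique: "asy F p \<Longrightarrow> asy G p \<Longrightarrow> bigO 5 (\<lambda>i x. F i x - G i x)"
  unfolding asy_def by (drule (1) bigO_diff, erule bigO_cong) simp

lemma asy_u: "asy u (\<lambda>w. if w = [] then 1 else 0)"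
proof -
  have "(\<Sum>w\<in>W4. (if w = [] then 1 else 0) *\<^sub>R Wd w i x) = u i x" for i x
  proof -
    have "(\<Sum>w\<in>W4. (if w = [] then 1 else 0) *\<^sub>R Wd w i x) = (\<Sum>w\<in>W4. if w = [] then Wd w i x else 0)"
      by (intro sum.cong) auto
    also have "\<dots> = Wd [] i x" using finite_W4 by (simp add: W4_def)
    finally show ?thesis by (simp add: Wd_def)
  qed
  then show ?thesis by (simp add: asy_def bigO_zero)
qed

lemma ucb_le: "ucb k F \<Longrightarrow> j \<le> k \<Longrightarrow> ucb j F"
  unfolding ucb_def using cb_le by blast

lemma ucb_add: "ucb k F \<Longrightarrow> ucb k G \<Longrightarrow> ucb k (\<lambda>i x. F i x + G i x)"
proof -
  assume "ucb k F" "ucb k G"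
  then obtain C D where C: "C \<ge> 0" "\<And>i. i \<in> I \<Longrightarrow> cb (L i) k C (F i)"
    and D: "D \<ge> 0" "\<And>i. i \<in> I \<Longrightarrow> cb (L i) k D (G i)" unfolding ucb_def by metis
  show ?thesis unfolding ucb_def
    by (intro exI[of _ "C + D"] conjI ballI cb_add C D) (use C D in auto)
qed

lemma ucb_scaleR: "ucb k F \<Longrightarrow> ucb k (\<lambda>i x. c *\<^sub>R F i x)"
proof -
  assume "ucb k F"
  then obtain C where C: "C \<ge> 0" "\<And>i. i \<in> I \<Longrightarrow> cb (L i) k C (F i)"
    unfolding ucb_def by metis
  show ?thesis unfolding ucb_def
    by (intro exI[of _ "\<bar>c\<bar> * C"] conjI ballI cb_scaleR C) (use C in auto)
qed

lemma ucb_sigma: "ucb k F \<Longrightarrow> ucb k (\<lambda>i x. \<sigma> i ^ n *\<^sub>R F i x)"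
proof -
  assume "ucb k F"
  then obtain C where C: "C \<ge> 0" "\<And>i. i \<in> I \<Longrightarrow> cb (L i) k C (F i)"
    unfolding ucb_def by metis
  have "cb (L i) k C (\<lambda>x. \<sigma> i ^ n *\<^sub>R F i x)" if i: "i \<in> I" for i
  proof (rule cb_mono[OF cb_scaleR[OF C(2)[OF i]]])
    have "\<sigma> i ^ n \<le> 1" using \<sigma>[OF i] by (intro power_le_one) auto
    then show "\<bar>\<sigma> i ^ n\<bar> * C \<le> C" using C(1) \<sigma>[OF i] mult_right_mono[of "\<sigma> i ^ n" 1 C] by (simp add: power_abs)
  qed
  then show ?thesis unfolding ucb_def using C(1) by auto
qed

lemma ucb_WW: "ucb k F \<Longrightarrow> k \<le> m \<Longrightarrow> ucb k (\<lambda>i. WW (V i) (A i) (F i))"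
proof -
  assume "ucb k F" and k: "k \<le> m"
  then obtain C where C: "C \<ge> 0" "\<And>i. i \<in> I \<Longrightarrow> cb (L i) k C (F i)"
    unfolding ucb_def by metis
  have "cb (L i) k \<bar>2 * 2 ^ k * BV * C\<bar> (WW (V i) (A i) (F i))" if i: "i \<in> I" for i
    by (rule cb_mono[OF cb_WW[OF cb_le[OF cbV(1)[OF i] k] cb_le[OF cbV(2)[OF i] k] C(2)[OF i]]]) simp
  then show ?thesis unfolding ucb_def by (intro exI[of _ "\<bar>2 * 2 ^ k * BV * C\<bar>"]) auto
qed

lemma ucb_QQ: "ucb k F \<Longrightarrow> k \<le> m \<Longrightarrow> ucb k (\<lambda>i. QQ (A i) (F i))"
proof -
  assume "ucb k F" and k: "k \<le> m"
  then obtain C where C: "C \<ge> 0" "\<And>i. i \<in> I \<Longrightarrow> cb (L i) k C (F i)"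
    unfolding ucb_def by metis
  let ?D = "4 * (2 ^ k * BV * (2 ^ k * BV * C))"
  have "cb (L i) k \<bar>?D\<bar> (QQ (A i) (F i))" if i: "i \<in> I" for i
    by (rule cb_mono[OF cb_QQ[OF cb_le[OF cbV(2)[OF i] k] C(2)[OF i]]]) simp
  then show ?thesis unfolding ucb_def by (intro exI[of _ "\<bar>?D\<bar>"]) auto
qed

lemma ucb_Et:
  assumes "ucb k F" "1 \<le> k" "0 \<le> c" "c \<le> 1"
  shows "ucb k (\<lambda>i. Et (N i) (L i) (c * \<sigma> i) (F i))"
proof -
  obtain C where C: "C \<ge> 0" "\<And>i. i \<in> I \<Longrightarrow> cb (L i) k C (F i)"
    using assms(1) unfolding ucb_def by metis
  obtain k' where k: "k = Suc k'" using assms(2) by (cases k) auto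
  have "cb (L i) k (8 * C) (Et (N i) (L i) (c * \<sigma> i) (F i))" if i: "i \<in> I" for i
  proof -
    have "c * \<sigma> i \<le> 1 * (1/2)" "0 \<le> c * \<sigma> i" using assms(3,4) \<sigma>[OF i] by (intro mult_mono mult_nonneg_nonneg; simp)+
    then show ?thesis unfolding k by (intro cb_Et L[OF i] C(2)[OF i, unfolded k]) auto
  qed
  then show ?thesis unfolding ucb_def using C(1) by (intro exI[of _ "8 * C"]) auto
qed

lemma ucb_u: "ucb m u" "ucb 5 u"
  unfolding ucb_def using cb_mono[OF cbu(1) abs_ge_self] cb_mono[OF cbu(2) abs_ge_self]
  by (intro exI[of _ "\<bar>BU\<bar>"]; simp)+

lemma ucb_wop: "length w \<le> 4 \<Longrightarrow> ucb (5 - length w) (\<lambda>i. wop (V i) (A i) w (u i))"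
  unfolding ucb_def
  by (intro exI[of _ "\<bar>(2 + 32 * BV) ^ length w * BU\<bar>"] conjI ballI)
    (auto intro: cb_mono[OF cb_wop[OF cbV4 cbu(2)]])

lemma ucb_bound: "ucb k F \<Longrightarrow> bigO 0 F"
  unfolding ucb_def bigO_def by (auto dest: cb_bdd)

lemma bigO_sigma: "bigO k F \<Longrightarrow> bigO (n + k) (\<lambda>i x. \<sigma> i ^ n *\<^sub>R F i x)"
proof -
  assume "bigO k F"
  then obtain C where C: "C \<ge> 0" "\<And>i x. i \<in> I \<Longrightarrow> norm (F i x) \<le> C * \<sigma> i ^ k"
    unfolding bigO_def by metis
  have "norm (\<sigma> i ^ n *\<^sub>R F i x) \<le> C * \<sigma> i ^ (n + k)" if i: "i \<in> I" for i x
    using mult_left_mono[OF C(2)[OF i, of x], of "\<sigma> i ^ n"] \<sigma>[OF i]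
    by (simp add: power_abs power_add mult_ac)
  then show ?thesis unfolding bigO_def using C(1) by (intro exI[of _ C]) auto
qed

lemma ucb_Wd: "length w \<le> 4 \<Longrightarrow> ucb 1 (Wd w)"
  unfolding Wd_def by (rule ucb_sigma, rule ucb_le[OF ucb_wop]) auto

lemma ucb_sum: "finite S \<Longrightarrow> (\<And>w. w \<in> S \<Longrightarrow> ucb k (F w)) \<Longrightarrow> ucb k (\<lambda>i x. \<Sum>w\<in>S. F w i x)"
proof (induction S rule: finite_induct)
  case empty
  then show ?case by (auto simp: ucb_def intro!: exI[of _ 0] cb_zero)
qed (auto intro: ucb_add)

text \<open>Linear, with a supremum bound uniform in the family. This is what allows an operator to
  act on a remainder of size \<sigma>^5, about whose derivatives nothing is known.\<close>

definition stable :: "('i \<Rightarrow> (real \<Rightarrow> complex^2) \<Rightarrow> real \<Rightarrow> complex^2) \<Rightarrow> bool" where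
  "stable Op \<longleftrightarrow>
     (\<forall>i\<in>I. \<forall>f g x. continuous_on UNIV f \<longrightarrow> continuous_on UNIV g \<longrightarrow> Op i (\<lambda>x. f x + g x) x = Op i f x + Op i g x) \<and>
     (\<forall>i\<in>I. \<forall>c f x. Op i (\<lambda>x. c *\<^sub>R f x) x = c *\<^sub>R Op i f x) \<and>
     (\<exists>C\<ge>0. \<forall>i\<in>I. \<forall>f B x. continuous_on UNIV f \<longrightarrow> (\<forall>x. norm (f x) \<le> B) \<longrightarrow> norm (Op i f x) \<le> C * B)"

text \<open>Stability sends the remainder of F to a remainder, and linearity reduces the rest to
  single words. If the operator expands on every word v with the series s, regrouping the words y @
  v gives the product of the two series.\<close>

lemma asy_op:
  assumes st: "stable Op" and F: "asy F p" "ucb 1 F"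
    and ex: "\<And>v. length v \<le> 4 \<Longrightarrow> bigO 5 (\<lambda>i x. Op i (Wd v i) x - (\<Sum>y | length y + length v \<le> 4. s y *\<^sub>R Wd (y @ v) i x))"
  shows "asy (\<lambda>i. Op i (F i)) (fmul s p)"
proof -
  have add: "Op i (\<lambda>x. f x + g x) x = Op i f x + Op i g x"
    if "i \<in> I" "continuous_on UNIV f" "continuous_on UNIV g" for i f g x
    using st that unfolding stable_def by blast
  have scale: "Op i (\<lambda>x. c *\<^sub>R f x) x = c *\<^sub>R Op i f x" if "i \<in> I" for i c f x
    using st that unfolding stable_def by blast
  obtain C where C: "C \<ge> 0"
    "\<And>i f B x. i \<in> I \<Longrightarrow> continuous_on UNIV f \<Longrightarrow> (\<And>x. norm (f x) \<le> B) \<Longrightarrow> norm (Op i f x) \<le> C * B"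
    using st unfolding stable_def by metis
  have cont: "continuous_on UNIV (G i)" if G: "ucb 1 G" "i \<in> I" for G i
  proof -
    obtain B where "cb (L i) (Suc 0) B (G i)" using G unfolding ucb_def One_nat_def by blast
    then show ?thesis by (rule cb_continuous)
  qed
  have csum: "continuous_on UNIV (\<lambda>x. \<Sum>w\<in>S. p w *\<^sub>R Wd w i x)" if "S \<subseteq> W4" "i \<in> I" for S i
    using that cont[OF ucb_Wd, of _ i]
    by (intro continuous_on_sum continuous_on_scaleR continuous_on_const) (auto simp: W4_def)
  have sum: "Op i (\<lambda>x. \<Sum>w\<in>S. p w *\<^sub>R Wd w i x) x = (\<Sum>w\<in>S. p w *\<^sub>R Op i (Wd w i) x)"
    if i: "i \<in> I" and S: "S \<subseteq> W4" for i x S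
    using finite_subset[OF S finite_W4] S
  proof (induction S rule: finite_induct)
    case empty
    then show ?case using scale[OF i, of 0 "\<lambda>x. 0" x] by simp
  next
    case (insert w S)
    have "Op i (\<lambda>x. p w *\<^sub>R Wd w i x + (\<Sum>w\<in>S. p w *\<^sub>R Wd w i x)) x
      = p w *\<^sub>R Op i (Wd w i) x + Op i (\<lambda>x. \<Sum>w\<in>S. p w *\<^sub>R Wd w i x) x"
      by (subst add[OF i]) (use insert csum[of "{w}" i] csum[of S i] i scale[OF i] in auto)
    then show ?case using insert by simp
  qed
  let ?P = "\<lambda>i x. \<Sum>w\<in>W4. p w *\<^sub>R Wd w i x"
  have 1: "bigO 5 (\<lambda>i x. Op i (F i) x - (\<Sum>w\<in>W4. p w *\<^sub>R Op i (Wd w i) x))"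
  proof -
    obtain D where D: "D \<ge> 0" "\<And>i x. i \<in> I \<Longrightarrow> norm (F i x - ?P i x) \<le> D * \<sigma> i ^ 5"
      using F(1) unfolding asy_def bigO_def by metis
    have "norm (Op i (F i) x - (\<Sum>w\<in>W4. p w *\<^sub>R Op i (Wd w i) x)) \<le> (C * D) * \<sigma> i ^ 5" if i: "i \<in> I" for i x
    proof -
      have c: "continuous_on UNIV (\<lambda>x. F i x - ?P i x)"
        by (intro continuous_on_diff cont[OF F(2) i] csum[OF subset_refl i])
      have "Op i (F i) x = Op i (\<lambda>x. (F i x - ?P i x) + ?P i x) x" by simp
      also have "\<dots> = Op i (\<lambda>x. F i x - ?P i x) x + Op i (?P i) x"
        by (rule add[OF i c csum[OF subset_refl i]])
      finally have "Op i (F i) x - (\<Sum>w\<in>W4. p w *\<^sub>R Op i (Wd w i) x) = Op i (\<lambda>x. F i x - ?P i x) x"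
        using sum[OF i subset_refl, of x] by simp
      then show ?thesis using C(2)[OF i c D(2)[OF i], of x] by (simp add: mult.assoc)
    qed
    then show ?thesis unfolding bigO_def using C(1) D(1) by (intro exI[of _ "C * D"]) auto
  qed
  have 2: "bigO 5 (\<lambda>i x. \<Sum>w\<in>W4. p w *\<^sub>R (Op i (Wd w i) x - (\<Sum>y | length y + length w \<le> 4. s y *\<^sub>R Wd (y @ w) i x)))"
    by (intro bigO_sum bigO_scaleR ex) (auto simp: W4_def)
  show ?thesis unfolding asy_def
    by (rule bigO_cong[OF bigO_add[OF 1 2]])
      (simp add: scaleR_diff_right sum_subtractf fmul_sum[symmetric])
qed

end

section \<open>The order conditions\<close>

definition sW :: "bool list \<Rightarrow> real" where
  "sW y = (if y = [False] then 1 else 0)"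

definition sE :: "real \<Rightarrow> bool list \<Rightarrow> real" where
  "sE c y = (if y = replicate (length y) True then c ^ length y / fact (length y) else 0)"

text \<open>The coefficients of \<open>[W,[T,W]] / 72 = (2 W T W - W W T - T W W) / 72\<close>.\<close>

definition sQ :: "bool list \<Rightarrow> real" where
  "sQ y = (if y = [False, True, False] then 1 / 36
     else if y = [False, False, True] \<or> y = [True, False, False] then - 1 / 72 else 0)"

definition expW :: "real \<Rightarrow> (bool list \<Rightarrow> real) \<Rightarrow> bool list \<Rightarrow> real" where
  "expW c p w = (\<Sum>k\<le>4. c ^ k / fact k * (fmul sW ^^ k) p w)"

text \<open>The series of the five factors of the scheme, multiplied from the right; in \<open>p3\<close> the exponential of
  \<open>2/3 W + Q\<close> is expanded up to degree four, where \<open>Q\<close> has degree three.\<close>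

definition p0 :: "bool list \<Rightarrow> real" where "p0 w = (if w = [] then 1 else 0)"
definition p1 where "p1 = expW (1 / 6) p0"
definition p2 where "p2 = fmul (sE (1 / 2)) p1"
definition p3 where
  "p3 w = expW (2 / 3) p2 w + fmul sQ p2 w + 1 / 3 * (fmul sW (fmul sQ p2) w + fmul sQ (fmul sW p2) w)"
definition p4 where "p4 = fmul (sE (1 / 2)) p3"
definition p5 where "p5 = expW (1 / 6) p4"

lemma fmul_sW [simp]: "fmul sW p [] = 0" "fmul sW p (b # w) = (if b then 0 else p w)"
proof -
  have "sW (take j (b # w)) * p (drop j (b # w)) = (if j = 1 then if b then 0 else p w else 0)"
    if "j \<le> length (b # w)" for j
    using that by (cases j) (auto simp: sW_def)
  then have "fmul sW p (b # w) = (\<Sum>j\<le>length (b # w). if j = 1 then if b then 0 else p w else 0)"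
    unfolding fmul_def by (intro sum.cong refl) simp
  then show "fmul sW p (b # w) = (if b then 0 else p w)" by (auto simp: Suc_le_eq split: if_splits)
qed (simp add: fmul_def sW_def)

lemma fmul_sE [simp]: "fmul (sE c) p [] = p []"
  "fmul (sE c) p [a] = p [a] + sE c [a] * p []"
  "fmul (sE c) p [a, b] = p [a, b] + sE c [a] * p [b] + sE c [a, b] * p []"
  "fmul (sE c) p [a, b, d] = p [a, b, d] + sE c [a] * p [b, d] + sE c [a, b] * p [d] + sE c [a, b, d] * p []"
  "fmul (sE c) p [a, b, d, e] = p [a, b, d, e] + sE c [a] * p [b, d, e] + sE c [a, b] * p [d, e] + sE c [a, b, d] * p [e] + sE c [a, b, d, e] * p []"
  by (simp_all add: fmul_def sE_def)

lemma fmul_sQ [simp]: "fmul sQ p [] = 0" "fmul sQ p [a] = 0" "fmul sQ p [a, b] = 0"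
  "fmul sQ p [a, b, d] = sQ [a, b, d] * p []"
  "fmul sQ p [a, b, d, e] = sQ [a, b, d] * p [e]"
  by (simp_all add: fmul_def sQ_def)

lemma expW_eval:
  "expW c p w = p w + c * fmul sW p w + c ^ 2 / 2 * fmul sW (fmul sW p) w
     + c ^ 3 / 6 * fmul sW (fmul sW (fmul sW p)) w + c ^ 4 / 24 * fmul sW (fmul sW (fmul sW (fmul sW p))) w"
proof -
  have "{..4::nat} = {0, 1, 2, 3, 4}" by auto
  then show ?thesis by (simp add: expW_def fact_numeral eval_nat_numeral)
qed

lemma words4: "length w \<le> 4 \<Longrightarrow> w \<in> set (concat (map (\<lambda>n. List.n_lists n [True, False]) [0..<5]))"
  by (auto simp: set_n_lists intro!: bexI[of _ "length w"])

text \<open>The five tables are computed one from the other. Each one serves as a set of rewrite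
  rules for the next, which keeps the products from being unfolded through all factors at
  once.\<close>

lemma p1_table:
  "p1 [] = 1" "p1 [True] = 0" "p1 [False] = 1 / 6" "p1 [True, True] = 0" "p1 [True, False] = 0"
  "p1 [False, True] = 0" "p1 [False, False] = 1 / 72" "p1 [True, True, True] = 0"
  "p1 [True, True, False] = 0" "p1 [True, False, True] = 0" "p1 [True, False, False] = 0"
  "p1 [False, True, True] = 0" "p1 [False, True, False] = 0" "p1 [False, False, True] = 0"
  "p1 [False, False, False] = 1 / 1296" "p1 [True, True, True, True] = 0"
  "p1 [True, True, True, False] = 0" "p1 [True, True, False, True] = 0"
  "p1 [True, True, False, False] = 0" "p1 [True, False, True, True] = 0"
  "p1 [True, False, True, False] = 0" "p1 [True, False, False, True] = 0"
  "p1 [True, False, False, False] = 0" "p1 [False, True, True, True] = 0"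
  "p1 [False, True, True, False] = 0" "p1 [False, True, False, True] = 0"
  "p1 [False, True, False, False] = 0" "p1 [False, False, True, True] = 0"
  "p1 [False, False, True, False] = 0" "p1 [False, False, False, True] = 0"
  "p1 [False, False, False, False] = 1 / 31104"
  by (simp_all add: p1_def expW_eval p0_def power2_eq_square power3_eq_cube power4_eq_xxxx)

lemma p2_table:
  "p2 [] = 1" "p2 [True] = 1 / 2" "p2 [False] = 1 / 6" "p2 [True, True] = 1 / 8"
  "p2 [True, False] = 1 / 12" "p2 [False, True] = 0" "p2 [False, False] = 1 / 72"
  "p2 [True, True, True] = 1 / 48" "p2 [True, True, False] = 1 / 48" "p2 [True, False, True] = 0"
  "p2 [True, False, False] = 1 / 144" "p2 [False, True, True] = 0" "p2 [False, True, False] = 0"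
  "p2 [False, False, True] = 0" "p2 [False, False, False] = 1 / 1296"
  "p2 [True, True, True, True] = 1 / 384" "p2 [True, True, True, False] = 1 / 288"
  "p2 [True, True, False, True] = 0" "p2 [True, True, False, False] = 1 / 576"
  "p2 [True, False, True, True] = 0" "p2 [True, False, True, False] = 0"
  "p2 [True, False, False, True] = 0" "p2 [True, False, False, False] = 1 / 2592"
  "p2 [False, True, True, True] = 0" "p2 [False, True, True, False] = 0"
  "p2 [False, True, False, True] = 0" "p2 [False, True, False, False] = 0"
  "p2 [False, False, True, True] = 0" "p2 [False, False, True, False] = 0"
  "p2 [False, False, False, True] = 0" "p2 [False, False, False, False] = 1 / 31104"
  by (simp_all add: p2_def sE_def p1_table fact_numeral power2_eq_square power3_eq_cube power4_eq_xxxx)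

lemma p3_table:
  "p3 [] = 1" "p3 [True] = 1 / 2" "p3 [False] = 5 / 6" "p3 [True, True] = 1 / 8"
  "p3 [True, False] = 1 / 12" "p3 [False, True] = 1 / 3" "p3 [False, False] = 25 / 72"
  "p3 [True, True, True] = 1 / 48" "p3 [True, True, False] = 1 / 48" "p3 [True, False, True] = 0"
  "p3 [True, False, False] = - (1 / 144)" "p3 [False, True, True] = 1 / 12"
  "p3 [False, True, False] = 1 / 12" "p3 [False, False, True] = 7 / 72"
  "p3 [False, False, False] = 125 / 1296" "p3 [True, True, True, True] = 1 / 384"
  "p3 [True, True, True, False] = 1 / 288" "p3 [True, True, False, True] = 0"
  "p3 [True, True, False, False] = 1 / 576" "p3 [True, False, True, True] = 0"
  "p3 [True, False, True, False] = 0" "p3 [True, False, False, True] = - (1 / 144)"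
  "p3 [True, False, False, False] = - (17 / 2592)" "p3 [False, True, True, True] = 1 / 72"
  "p3 [False, True, True, False] = 1 / 72" "p3 [False, True, False, True] = 1 / 72"
  "p3 [False, True, False, False] = 1 / 72" "p3 [False, False, True, True] = 1 / 48"
  "p3 [False, False, True, False] = 1 / 48" "p3 [False, False, False, True] = 13 / 648"
  "p3 [False, False, False, False] = 625 / 31104"
  by (simp_all add: p3_def expW_eval sQ_def p2_table power2_eq_square power3_eq_cube power4_eq_xxxx)

lemma p4_table:
  "p4 [] = 1" "p4 [True] = 1" "p4 [False] = 5 / 6" "p4 [True, True] = 1 / 2"
  "p4 [True, False] = 1 / 2" "p4 [False, True] = 1 / 3" "p4 [False, False] = 25 / 72"
  "p4 [True, True, True] = 1 / 6" "p4 [True, True, False] = 1 / 6"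
  "p4 [True, False, True] = 1 / 6" "p4 [True, False, False] = 1 / 6"
  "p4 [False, True, True] = 1 / 12" "p4 [False, True, False] = 1 / 12"
  "p4 [False, False, True] = 7 / 72" "p4 [False, False, False] = 125 / 1296"
  "p4 [True, True, True, True] = 1 / 24" "p4 [True, True, True, False] = 1 / 24"
  "p4 [True, True, False, True] = 1 / 24" "p4 [True, True, False, False] = 1 / 24"
  "p4 [True, False, True, True] = 1 / 24" "p4 [True, False, True, False] = 1 / 24"
  "p4 [True, False, False, True] = 1 / 24" "p4 [True, False, False, False] = 1 / 24"
  "p4 [False, True, True, True] = 1 / 72" "p4 [False, True, True, False] = 1 / 72"
  "p4 [False, True, False, True] = 1 / 72" "p4 [False, True, False, False] = 1 / 72"
  "p4 [False, False, True, True] = 1 / 48" "p4 [False, False, True, False] = 1 / 48"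
  "p4 [False, False, False, True] = 13 / 648" "p4 [False, False, False, False] = 625 / 31104"
  by (simp_all add: p4_def sE_def p3_table fact_numeral power2_eq_square power3_eq_cube power4_eq_xxxx)

lemma p5_table:
  "p5 [] = 1" "p5 [True] = 1" "p5 [False] = 1" "p5 [True, True] = 1 / 2"
  "p5 [True, False] = 1 / 2" "p5 [False, True] = 1 / 2" "p5 [False, False] = 1 / 2"
  "p5 [True, True, True] = 1 / 6" "p5 [True, True, False] = 1 / 6"
  "p5 [True, False, True] = 1 / 6" "p5 [True, False, False] = 1 / 6"
  "p5 [False, True, True] = 1 / 6" "p5 [False, True, False] = 1 / 6"
  "p5 [False, False, True] = 1 / 6" "p5 [False, False, False] = 1 / 6"
  "p5 [True, True, True, True] = 1 / 24" "p5 [True, True, True, False] = 1 / 24"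
  "p5 [True, True, False, True] = 1 / 24" "p5 [True, True, False, False] = 1 / 24"
  "p5 [True, False, True, True] = 1 / 24" "p5 [True, False, True, False] = 1 / 24"
  "p5 [True, False, False, True] = 1 / 24" "p5 [True, False, False, False] = 1 / 24"
  "p5 [False, True, True, True] = 1 / 24" "p5 [False, True, True, False] = 1 / 24"
  "p5 [False, True, False, True] = 1 / 24" "p5 [False, True, False, False] = 1 / 24"
  "p5 [False, False, True, True] = 1 / 24" "p5 [False, False, True, False] = 1 / 24"
  "p5 [False, False, False, True] = 1 / 24" "p5 [False, False, False, False] = 1 / 24"
  by (simp_all add: p5_def expW_eval p4_table power2_eq_square power3_eq_cube power4_eq_xxxx)

text \<open>The order conditions for fourth order: in the formal exponential of T + W every word of
  length n has the coefficient 1/n!. The correction by [W,[T,W]] enters first at length three, where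
  W T W would otherwise get 5/36 in place of 1/6.\<close>

lemma p5_eq: "length w \<le> 4 \<Longrightarrow> p5 w = 1 / fact (length w)"
proof -
  assume "length w \<le> 4"
  from words4[OF this] show ?thesis
    by (simp add: upt_rec[of _ 5] eval_nat_numeral) (elim disjE; simp add: p5_table fact_numeral)
qed

lemma WW_scaleR: "WW V A (\<lambda>x. c *\<^sub>R f x) = (\<lambda>x. c *\<^sub>R WW V A f x)"
  by (auto simp: WW_def matrix_vector_mult_scaleR_right)

lemma QQ_scaleR: "QQ A (\<lambda>x. c *\<^sub>R f x) = (\<lambda>x. c *\<^sub>R QQ A f x)"
  by (auto simp: QQ_def matrix_vector_mult_scaleR_right)

lemma sum_single_word:
  fixes Z :: "bool list \<Rightarrow> 'a::real_vector"
  assumes "finite S" "y0 \<in> S" "\<And>y. y \<in> S \<Longrightarrow> y \<noteq> y0 \<Longrightarrow> s y = 0"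
  shows "(\<Sum>y\<in>S. s y *\<^sub>R Z y) = s y0 *\<^sub>R Z y0"
proof -
  have "(\<Sum>y\<in>S. s y *\<^sub>R Z y) = (\<Sum>y\<in>{y0}. s y *\<^sub>R Z y)"
    by (rule sum.mono_neutral_right) (use assms in auto)
  then show ?thesis by simp
qed

lemma finite_words_diff: "finite {y :: bool list. length y + n \<le> 4}"
  by (rule finite_subset[OF _ finite_words[of 4]]) auto

section \<open>Expansion of each factor on words\<close>

context dirac_family
begin

lemma W_bound: "i \<in> I \<Longrightarrow> norm (W_mat 1 (V i) (A i) x *v v) \<le> 2 * BV * norm v"
proof -
  assume i: "i \<in> I"
  have "\<bar>V i x\<bar> + \<bar>A i x\<bar> \<le> 2 * BV" using cb_bdd[OF cbV(1)[OF i], of x] cb_bdd[OF cbV(2)[OF i], of x] by simp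
  then show ?thesis by (rule order_trans[OF W_mat_bound mult_right_mono]) simp
qed

lemma Q_bound: "i \<in> I \<Longrightarrow> norm (WTW_mat 1 (A i) x *v v) \<le> 4 * BV\<^sup>2 * norm v"
proof -
  assume i: "i \<in> I"
  have "(A i x)\<^sup>2 \<le> BV\<^sup>2" using power_mono[OF cb_bdd[OF cbV(2)[OF i], of x], of 2] by simp
  then have "4 * (A i x)\<^sup>2 \<le> 4 * BV\<^sup>2" by simp
  then show ?thesis by (rule order_trans[OF WTW_mat_bound mult_right_mono]) simp
qed

lemma stable_mult:
  assumes "\<And>i x v. i \<in> I \<Longrightarrow> norm (B i x *v v) \<le> C * norm v"
  shows "stable (\<lambda>i f x. B i x *v f x)"
proof -
  have "norm (B i x *v f x) \<le> \<bar>C\<bar> * D" if "i \<in> I" "\<And>x. norm (f x) \<le> D" for i f D x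
  proof -
    have "norm (B i x *v f x) \<le> \<bar>C\<bar> * norm (f x)"
      using assms[OF that(1), of x "f x"] mult_right_mono[OF abs_ge_self[of C] norm_ge_zero[of "f x"]] by linarith
    also have "\<dots> \<le> \<bar>C\<bar> * D" by (intro mult_left_mono that) simp
    finally show ?thesis .
  qed
  then show ?thesis unfolding stable_def
    by (auto simp: matrix_vector_right_distrib matrix_vector_mult_scaleR_right intro!: exI[of _ "\<bar>C\<bar>"])
qed

lemma bigO_stable: "stable Op \<Longrightarrow> bigO k F \<Longrightarrow> (\<And>i. i \<in> I \<Longrightarrow> continuous_on UNIV (F i)) \<Longrightarrow> bigO k (\<lambda>i. Op i (F i))"
proof -
  assume st: "stable Op" and F: "bigO k F" and c: "\<And>i. i \<in> I \<Longrightarrow> continuous_on UNIV (F i)"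
  obtain C where C: "C \<ge> 0"
    "\<And>i f B x. i \<in> I \<Longrightarrow> continuous_on UNIV f \<Longrightarrow> (\<And>x. norm (f x) \<le> B) \<Longrightarrow> norm (Op i f x) \<le> C * B"
    using st unfolding stable_def by metis
  obtain D where D: "D \<ge> 0" "\<And>i x. i \<in> I \<Longrightarrow> norm (F i x) \<le> D * \<sigma> i ^ k"
    using F unfolding bigO_def by metis
  have "norm (Op i (F i) x) \<le> C * D * \<sigma> i ^ k" if "i \<in> I" for i x
    using C(2)[OF that c[OF that] D(2)[OF that], of x] by (simp add: mult.assoc)
  then show ?thesis unfolding bigO_def using C(1) D(1) by (intro exI[of _ "C * D"]) auto
qed

lemma ucb_cont: "ucb 1 F \<Longrightarrow> i \<in> I \<Longrightarrow> continuous_on UNIV (F i)"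
proof -
  assume F: "ucb 1 F" "i \<in> I"
  obtain B where "cb (L i) (Suc 0) B (F i)" using F unfolding ucb_def One_nat_def by blast
  then show ?thesis by (rule cb_continuous)
qed

lemma bigO_Wd: "length w \<le> 4 \<Longrightarrow> bigO (length w) (Wd w)"
  unfolding Wd_def using bigO_sigma[OF ucb_bound[OF ucb_wop]] by simp

definition aW :: "'i \<Rightarrow> (real \<Rightarrow> complex^2) \<Rightarrow> real \<Rightarrow> complex^2" where
  "aW i f x = \<sigma> i *\<^sub>R WW (V i) (A i) f x"

definition bQ :: "'i \<Rightarrow> (real \<Rightarrow> complex^2) \<Rightarrow> real \<Rightarrow> complex^2" where
  "bQ i f x = (\<sigma> i ^ 3 / 72) *\<^sub>R QQ (A i) f x"

lemma stable_WW: "stable (\<lambda>i. WW (V i) (A i))"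
  using stable_mult[of "\<lambda>i. W_mat 1 (V i) (A i)", OF W_bound] by (simp add: WW_def[abs_def])

lemma stable_QQ: "stable (\<lambda>i. QQ (A i))"
  using stable_mult[of "\<lambda>i. WTW_mat 1 (A i)", OF Q_bound] by (simp add: QQ_def[abs_def])

lemma stable_scale:
  assumes "stable Op" "\<And>i. i \<in> I \<Longrightarrow> \<bar>c i\<bar> \<le> 1"
  shows "stable (\<lambda>i f x. c i *\<^sub>R Op i f x)"
proof -
  obtain C where C: "C \<ge> 0"
    "\<And>i f B x. i \<in> I \<Longrightarrow> continuous_on UNIV f \<Longrightarrow> (\<And>x. norm (f x) \<le> B) \<Longrightarrow> norm (Op i f x) \<le> C * B"
    using assms(1) unfolding stable_def by metis
  have "norm (c i *\<^sub>R Op i f x) \<le> C * B" if "i \<in> I" "continuous_on UNIV f" "\<And>x. norm (f x) \<le> B" for i f B x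
    using mult_mono[OF assms(2)[OF that(1)] C(2)[OF that, of x]] by simp
  then show ?thesis using assms(1) C(1) unfolding stable_def
    by (auto simp: scaleR_add_right intro!: exI[of _ C])
qed

lemma sigma_le_1: "i \<in> I \<Longrightarrow> \<bar>\<sigma> i\<bar> \<le> 1" "i \<in> I \<Longrightarrow> \<bar>\<sigma> i ^ 3 / 72\<bar> \<le> 1"
proof -
  assume i: "i \<in> I"
  show "\<bar>\<sigma> i\<bar> \<le> 1" using \<sigma>[OF i] by simp
  have "\<sigma> i ^ 3 \<le> 1" using \<sigma>[OF i] by (intro power_le_one) auto
  then show "\<bar>\<sigma> i ^ 3 / 72\<bar> \<le> 1" using \<sigma>[OF i] by simp
qed

lemma stable_aW: "stable aW"
  using stable_scale[OF stable_WW sigma_le_1(1)] by (simp add: aW_def[abs_def])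

lemma stable_bQ: "stable bQ"
  using stable_scale[OF stable_QQ sigma_le_1(2)] by (simp add: bQ_def[abs_def])

lemma asy_aW: "asy F p \<Longrightarrow> ucb 1 F \<Longrightarrow> asy (\<lambda>i. aW i (F i)) (fmul sW p)"
proof (rule asy_op[OF stable_aW])
  fix v :: "bool list" assume v: "length v \<le> 4"
  have e: "aW i (Wd v i) x = Wd (False # v) i x" for i x
  proof -
    have "Wd v i = (\<lambda>x. \<sigma> i ^ length v *\<^sub>R wop (V i) (A i) v (u i) x)" by (rule ext) (rule Wd_def)
    then show ?thesis by (simp add: aW_def WW_scaleR Wd_def)
  qed
  show "bigO 5 (\<lambda>i x. aW i (Wd v i) x - (\<Sum>y | length y + length v \<le> 4. sW y *\<^sub>R Wd (y @ v) i x))"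
  proof (cases "length v = 4")
    \<comment> \<open>The additional letter would lead to length five, outside \<open>W4\<close>;
      the whole term is then already of size \<sigma>^5 and is left unexpanded.\<close>
    case True
    have "bigO (1 + 4) (\<lambda>i x. \<sigma> i ^ 1 *\<^sub>R WW (V i) (A i) (Wd v i) x)"
      using bigO_Wd[OF v] True by (intro bigO_sigma bigO_stable[OF stable_WW] ucb_cont[OF ucb_Wd[OF v]]) auto
    moreover have "(\<Sum>y | length y + length v \<le> 4. sW y *\<^sub>R Wd (y @ v) i x) = 0" for i x
      by (rule sum.neutral) (auto simp: sW_def True)
    ultimately show ?thesis by (simp add: aW_def)
  next
    case False
    have "(\<Sum>y | length y + length v \<le> 4. sW y *\<^sub>R Wd (y @ v) i x) = Wd (False # v) i x" for i x
      using sum_single_word[OF finite_words_diff[of "length v"], of "[False]" sW "\<lambda>y. Wd (y @ v) i x"] v False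
      by (simp add: sW_def)
    then show ?thesis using e by (simp add: bigO_zero)
  qed
qed

lemma asy_bQ: "asy F p \<Longrightarrow> ucb 1 F \<Longrightarrow> asy (\<lambda>i. bQ i (F i)) (fmul sQ p)"
proof (rule asy_op[OF stable_bQ])
  fix v :: "bool list" assume v: "length v \<le> 4"
  show "bigO 5 (\<lambda>i x. bQ i (Wd v i) x - (\<Sum>y | length y + length v \<le> 4. sQ y *\<^sub>R Wd (y @ v) i x))"
  proof (cases "length v \<le> 1")
    \<comment> \<open>The factor \<sigma>^3 on a word of length at least two is already of size
      \<sigma>^5.\<close>
    case False
    have "bigO (3 + length v) (\<lambda>i x. \<sigma> i ^ 3 *\<^sub>R QQ (A i) (Wd v i) x)"
      using bigO_Wd[OF v] by (intro bigO_sigma bigO_stable[OF stable_QQ] ucb_cont[OF ucb_Wd[OF v]]) auto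
    then have "bigO 5 (\<lambda>i x. \<sigma> i ^ 3 *\<^sub>R QQ (A i) (Wd v i) x)"
      by (rule bigO_le) (use False in simp)
    then have "bigO 5 (\<lambda>i x. (1/72) *\<^sub>R (\<sigma> i ^ 3 *\<^sub>R QQ (A i) (Wd v i) x))"
      by (rule bigO_scaleR)
    moreover have "(\<Sum>y | length y + length v \<le> 4. sQ y *\<^sub>R Wd (y @ v) i x) = 0" for i x
      using False by (intro sum.neutral) (auto simp: sQ_def)
    ultimately show ?thesis by (simp add: bQ_def[abs_def])
  next
    \<comment> \<open>The word has at most one letter and so leaves four orders of regularity,
      enough for \<open>QQ_commutator\<close> to write the multiplication as a combination of three
      words of length three.\<close>
    case True
    let ?S = "{[False, True, False], [False, False, True], [True, False, False]}"
    have "bQ i (Wd v i) x = (\<Sum>y | length y + length v \<le> 4. sQ y *\<^sub>R Wd (y @ v) i x)" if i: "i \<in> I" for i x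
    proof -
      have e: "Wd v i = (\<lambda>x. \<sigma> i ^ length v *\<^sub>R wop (V i) (A i) v (u i) x)" by (rule ext) (rule Wd_def)
      have "(\<Sum>y | length y + length v \<le> 4. sQ y *\<^sub>R Wd (y @ v) i x) = (\<Sum>y\<in>?S. sQ y *\<^sub>R Wd (y @ v) i x)"
        by (rule sum.mono_neutral_right[OF finite_words_diff]) (use True in \<open>auto simp: sQ_def\<close>)
      also have "\<dots> = (1/72) *\<^sub>R (2 *\<^sub>R Wd ([False, True, False] @ v) i x - Wd ([False, False, True] @ v) i x - Wd ([True, False, False] @ v) i x)"
        by (simp add: sQ_def scaleR_diff_right)
      also have "\<dots> = (\<sigma> i ^ (3 + length v) / 72) *\<^sub>R QQ (A i) (wop (V i) (A i) v (u i)) x"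
      proof -
        have four: "(4::nat) = Suc (Suc 2)" by simp
        have "cb (L i) 4 ((2 + 32 * BV) ^ length v * BU) (wop (V i) (A i) v (u i))"
          using cb_le[OF cb_wop[OF cbV4[OF i] cbu(2)[OF i] v], of 4] True by simp
        then have c: "cb (L i) (Suc (Suc 2)) ((2 + 32 * BV) ^ length v * BU) (wop (V i) (A i) v (u i))"
          by (simp only: four)
        have V': "cb (L i) (Suc (Suc 2)) BV (V i)" "cb (L i) (Suc (Suc 2)) BV (A i)"
          using cbV4[OF i] by (simp_all only: four)
        show ?thesis unfolding QQ_commutator[OF V' c] Wd_def
          by (simp add: scaleR_diff_right power_add mult_ac power3_eq_cube)
      qed
      also have "\<dots> = bQ i (Wd v i) x"
        unfolding e bQ_def QQ_scaleR by (simp add: power_add)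
      finally show ?thesis by simp
    qed
    then show ?thesis by (intro bigO_cong[OF bigO_zero]) simp
  qed
qed

lemma stable_Et:
  assumes "0 \<le> c" "c \<le> 1"
  shows "stable (\<lambda>i. Et (N i) (L i) (c * \<sigma> i))"
proof -
  have s: "0 \<le> c * \<sigma> i" "c * \<sigma> i \<le> 1/2" if "i \<in> I" for i
    using assms \<sigma>[OF that] mult_mono[of c 1 "\<sigma> i" "1/2"] by auto
  show ?thesis unfolding stable_def
  proof (intro conjI ballI allI impI)
    show "\<exists>C\<ge>0. \<forall>i\<in>I. \<forall>f B x. continuous_on UNIV f \<longrightarrow> (\<forall>x. norm (f x) \<le> B) \<longrightarrow> norm (Et (N i) (L i) (c * \<sigma> i) f x) \<le> C * B"
      by (rule exI[of _ 8]) (auto intro!: Et_bound L s continuous_on_subset[of UNIV])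
  qed (auto intro!: Et_add Et_scaleR intro: continuous_on_subset)
qed

text \<open>A word of length n leaves 5 - n orders of regularity and hence admits a Taylor expansion
  of degree k = 4 - n. Its remainder of order k + 1 and the weight \<sigma>^n of the word make up
  \<sigma>^5. The condition on N lets the smoothing cost no more than that.\<close>

lemma asy_Et:
  assumes c: "0 \<le> c" "c \<le> 1" and N: "\<And>i. i \<in> I \<Longrightarrow> L i / real (N i + 2) \<le> \<sigma> i ^ 5"
    and F: "asy F p" "ucb 1 F"
  shows "asy (\<lambda>i. Et (N i) (L i) (c * \<sigma> i) (F i)) (fmul (sE c) p)"
proof (rule asy_op[OF stable_Et[OF c] F])
  fix v :: "bool list" assume v: "length v \<le> 4"
  define n where "n = length v"
  define k where "k = 4 - n"
  have k: "5 - length v = Suc k" "k + n = 4" using v by (auto simp: k_def n_def)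
  let ?w = "\<lambda>i. wop (V i) (A i) v (u i)"
  define B where "B = (2 + 32 * BV) ^ n * BU"
  have sum: "(\<Sum>y | length y + length v \<le> 4. sE c y *\<^sub>R Wd (y @ v) i x)
     = \<sigma> i ^ n *\<^sub>R (\<Sum>j\<le>k. ((c * \<sigma> i) ^ j / fact j) *\<^sub>R (TT ^^ j) (?w i) x)" for i x
  proof -
    have "(\<Sum>y | length y + length v \<le> 4. sE c y *\<^sub>R Wd (y @ v) i x)
       = (\<Sum>y\<in>(\<lambda>j. replicate j True) ` {..k}. sE c y *\<^sub>R Wd (y @ v) i x)"
    proof (rule sum.mono_neutral_right[OF finite_words_diff])
      show "\<forall>y\<in>{y. length y + length v \<le> 4} - (\<lambda>j. replicate j True) ` {..k}. sE c y *\<^sub>R Wd (y @ v) i x = 0"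
      proof
        fix y assume y: "y \<in> {y. length y + length v \<le> 4} - (\<lambda>j. replicate j True) ` {..k}"
        then have "length y \<le> k" using k by (auto simp: n_def)
        then have "y \<noteq> replicate (length y) True" using y by blast
        then show "sE c y *\<^sub>R Wd (y @ v) i x = 0" by (simp add: sE_def)
      qed
    qed (use k in \<open>auto simp: n_def\<close>)
    also have "\<dots> = (\<Sum>j\<le>k. sE c (replicate j True) *\<^sub>R Wd (replicate j True @ v) i x)"
      by (subst sum.reindex) (auto simp: inj_on_def dest: arg_cong[where f=length])
    also have "\<dots> = (\<Sum>j\<le>k. \<sigma> i ^ n *\<^sub>R (((c * \<sigma> i) ^ j / fact j) *\<^sub>R (TT ^^ j) (?w i) x))"
      by (intro sum.cong refl)
        (simp add: sE_def Wd_def wop_append wop_True n_def power_add power_mult_distrib mult_ac)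
    finally show ?thesis by (simp add: scaleR_sum_right)
  qed
  define D where "D = 16 * (2 ^ k * (8 * \<bar>B\<bar>)) + real (Suc k) * (2 ^ k * \<bar>B\<bar>)"
  have "norm (Et (N i) (L i) (c * \<sigma> i) (Wd v i) x - (\<Sum>y | length y + length v \<le> 4. sE c y *\<^sub>R Wd (y @ v) i x)) \<le> D * \<sigma> i ^ 5"
    if i: "i \<in> I" for i x
  proof -
    have s: "0 \<le> c * \<sigma> i" "c * \<sigma> i \<le> 1/2" "c * \<sigma> i \<le> \<sigma> i"
      using c \<sigma>[OF i] mult_mono[of c 1 "\<sigma> i" "1/2"] mult_right_mono[of c 1 "\<sigma> i"] by auto
    have cw: "cb (L i) (Suc k) \<bar>B\<bar> (?w i)"
      using cb_mono[OF cb_wop[OF cbV4[OF i] cbu(2)[OF i] v] abs_ge_self] unfolding k B_def n_def .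
    have e: "Wd v i = (\<lambda>x. \<sigma> i ^ n *\<^sub>R ?w i x)" by (rule ext) (simp add: Wd_def n_def)
    have "norm (Et (N i) (L i) (c * \<sigma> i) (Wd v i) x - (\<Sum>y | length y + length v \<le> 4. sE c y *\<^sub>R Wd (y @ v) i x))
      = \<sigma> i ^ n * norm (Et (N i) (L i) (c * \<sigma> i) (?w i) x - (\<Sum>j\<le>k. ((c * \<sigma> i) ^ j / fact j) *\<^sub>R (TT ^^ j) (?w i) x))"
      unfolding sum e Et_scaleR scaleR_diff_right[symmetric] norm_scaleR using \<sigma>[OF i] by simp
    also have "\<dots> \<le> \<sigma> i ^ n * (16 * (2 ^ k * (8 * \<bar>B\<bar>)) * (c * \<sigma> i) ^ Suc k + real (Suc k) * (2 ^ k * \<bar>B\<bar> * \<sigma> i ^ 5))"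
      using \<sigma>[OF i] by (intro mult_left_mono Et_taylor[OF L[OF i] s(1,2) cw N[OF i]]) auto
    also have "\<dots> = 16 * (2 ^ k * (8 * \<bar>B\<bar>)) * (\<sigma> i ^ n * (c * \<sigma> i) ^ Suc k) + real (Suc k) * (2 ^ k * \<bar>B\<bar>) * (\<sigma> i ^ n * \<sigma> i ^ 5)"
      by (simp add: algebra_simps)
    also have "\<dots> \<le> 16 * (2 ^ k * (8 * \<bar>B\<bar>)) * \<sigma> i ^ 5 + real (Suc k) * (2 ^ k * \<bar>B\<bar>) * \<sigma> i ^ 5"
    proof (intro add_mono mult_left_mono)
      have "\<sigma> i ^ n * (c * \<sigma> i) ^ Suc k \<le> \<sigma> i ^ n * \<sigma> i ^ Suc k"
        using s \<sigma>[OF i] by (intro mult_left_mono power_mono) auto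
      also have "\<dots> = \<sigma> i ^ (n + Suc k)" by (simp add: power_add)
      also have "n + Suc k = 5" using k by simp
      finally show "\<sigma> i ^ n * (c * \<sigma> i) ^ Suc k \<le> \<sigma> i ^ 5" .
      have "\<sigma> i ^ n \<le> 1" using \<sigma>[OF i] by (intro power_le_one) auto
      then show "\<sigma> i ^ n * \<sigma> i ^ 5 \<le> \<sigma> i ^ 5" using \<sigma>[OF i] mult_right_mono[of "\<sigma> i ^ n" 1 "\<sigma> i ^ 5"] by simp
    qed auto
    finally show ?thesis by (simp add: D_def distrib_right)
  qed
  then show "bigO 5 (\<lambda>i x. Et (N i) (L i) (c * \<sigma> i) (Wd v i) x - (\<Sum>y | length y + length v \<le> 4. sE c y *\<^sub>R Wd (y @ v) i x))"
    unfolding bigO_def by (intro exI[of _ D]) (auto simp: D_def)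
qed

end

section \<open>Exponentials of the multiplication operators\<close>

lemma W_mat_skew: "v \<bullet> (W_mat 1 V A x *v v) = 0"
  unfolding W_mat_mult by (simp add: inner_vec_def UNIV_2 inner_complex_def algebra_simps)

lemma WTW_mat_skew: "v \<bullet> (WTW_mat \<epsilon> A x *v v) = 0"
  by (simp add: WTW_mat_def matrix_vector_mult_cscale inner_vec_def UNIV_2 inner_complex_def algebra_simps)

lemma matrix_pow_bound:
  fixes A :: "complex^2^2"
  assumes "\<And>v. norm (A *v v) \<le> r * norm v" "0 \<le> r"
  shows "norm (((*v) A ^^ k) v) \<le> r ^ k * norm v"
proof (induction k)
  case (Suc k)
  have "norm (((*v) A ^^ Suc k) v) \<le> r * norm (((*v) A ^^ k) v)"
    using assms(1) by simp
  also have "\<dots> \<le> r * (r ^ k * norm v)" using Suc assms(2) by (rule mult_left_mono)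
  finally show ?case by (simp add: mult_ac)
qed simp

text \<open>Every term in the difference of the powers contains B at least once, whence the single
  factor q. The recursion is (A + B) X - A Y = (A + B)(X - Y) + B Y.\<close>

lemma matrix_pow_diff:
  fixes A B :: "complex^2^2"
  assumes A: "\<And>v. norm (A *v v) \<le> r * norm v" and B: "\<And>v. norm (B *v v) \<le> q * norm v" and r: "0 \<le> r" "0 \<le> q" "q \<le> r"
  shows "norm (((*v) (A + B) ^^ k) v - ((*v) A ^^ k) v) \<le> real k * (2 * r) ^ (k - 1) * q * norm v"
proof (induction k)
  case (Suc k)
  let ?X = "((*v) (A + B) ^^ k) v" and ?Y = "((*v) A ^^ k) v"
  have "norm ((A + B) *v w) \<le> 2 * r * norm w" for w
  proof -
    have "norm ((A + B) *v w) \<le> r * norm w + q * norm w"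
      unfolding matrix_vector_mult_add_rdistrib by (rule norm_triangle_mono[OF A B])
    also have "\<dots> \<le> r * norm w + r * norm w" using r by (intro add_left_mono mult_right_mono) auto
    finally show ?thesis by simp
  qed
  then have "norm ((A + B) *v (?X - ?Y)) \<le> 2 * r * norm (?X - ?Y)" .
  also have "\<dots> \<le> 2 * r * (real k * (2 * r) ^ (k - 1) * q * norm v)"
    using Suc.IH r by (intro mult_left_mono) auto
  also have "\<dots> = real k * (2 * r) ^ k * q * norm v"
    by (cases k) auto
  finally have 1: "norm ((A + B) *v (?X - ?Y)) \<le> real k * (2 * r) ^ k * q * norm v" .
  have "norm (B *v ?Y) \<le> q * norm ?Y" by (rule B)
  also have "\<dots> \<le> q * (r ^ k * norm v)" by (rule mult_left_mono[OF matrix_pow_bound[OF A r(1)] r(2)])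
  also have "\<dots> \<le> q * ((2 * r) ^ k * norm v)" using r by (intro mult_left_mono mult_right_mono power_mono) auto
  finally have 2: "norm (B *v ?Y) \<le> (2 * r) ^ k * q * norm v" by (simp add: mult_ac)
  have "((*v) (A + B) ^^ Suc k) v - ((*v) A ^^ Suc k) v = (A + B) *v (?X - ?Y) + B *v ?Y"
    by (simp add: matrix_vector_mult_diff_distrib matrix_vector_mult_add_rdistrib)
  also have "norm \<dots> \<le> real k * (2 * r) ^ k * q * norm v + (2 * r) ^ k * q * norm v"
    by (rule norm_triangle_mono[OF 1 2])
  also have "\<dots> = real (Suc k) * (2 * r) ^ (Suc k - 1) * q * norm v" by (simp add: algebra_simps)
  finally show ?case .
qed simp

text \<open>A counts as order one and B as order three. Up to order four there remain the powers of
  A, then B, and (AB + BA)/2. The four summands of the constant belong to the tail of the series, to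
  the square of B, and to the cubic and quartic terms that contain B; all are of order five or
  six.\<close>

lemma mexp_perturb:
  fixes A B :: "complex^2^2"
  assumes A: "\<And>v. norm (A *v v) \<le> K * s * norm v" and B: "\<And>v. norm (B *v v) \<le> K * s ^ 3 * norm v"
    and K: "0 \<le> K" and s: "0 \<le> s" "s \<le> 1"
  shows "norm (mexp (A + B) *v v - ((\<Sum>k<5. (1 / fact k) *\<^sub>R ((*v) A ^^ k) v) + B *v v + (1/2) *\<^sub>R (A *v (B *v v) + B *v (A *v v))))
    \<le> (32 * K ^ 5 * exp (2 * K) + K\<^sup>2 + 2 * K ^ 3 + 2 * K ^ 4) * s ^ 5 * norm v"
proof -
  let ?X = "\<lambda>k. ((*v) (A + B) ^^ k) v" and ?Y = "\<lambda>k. ((*v) A ^^ k) v"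
  have s3: "s ^ 3 \<le> s" using power_decreasing[of 1 3 s] s by simp
  have q: "0 \<le> K * s" "0 \<le> K * s ^ 3" "K * s ^ 3 \<le> K * s"
    using K s s3 by (auto intro: mult_left_mono)
  have AB: "norm ((A + B) *v w) \<le> (2 * K * s) * norm w" for w
  proof -
    have "norm ((A + B) *v w) \<le> K * s * norm w + K * s ^ 3 * norm w"
      unfolding matrix_vector_mult_add_rdistrib by (rule norm_triangle_mono[OF A B])
    also have "\<dots> \<le> K * s * norm w + K * s * norm w" using q by (intro add_left_mono mult_right_mono) auto
    finally show ?thesis by simp
  qed
  have le: "(2 * K * s) ^ 5 * exp (2 * K * s) * norm v \<le> 32 * K ^ 5 * exp (2 * K) * s ^ 5 * norm v"
  proof -
    have "2 * K * s \<le> 2 * K" using s K mult_left_mono[of s 1 "2 * K"] by simp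
    then have "(2 * K * s) ^ 5 * exp (2 * K * s) \<le> (2 * K * s) ^ 5 * exp (2 * K)"
      using K s by (intro mult_left_mono) auto
    then have "(2 * K * s) ^ 5 * exp (2 * K * s) * norm v \<le> (2 * K * s) ^ 5 * exp (2 * K) * norm v"
      by (rule mult_right_mono) simp
    then show ?thesis by (simp add: power_mult_distrib mult_ac)
  qed
  have 0: "norm (mexp (A + B) *v v - (\<Sum>k<5. (1 / fact k) *\<^sub>R ?X k)) \<le> 32 * K ^ 5 * exp (2 * K) * s ^ 5 * norm v"
    by (rule order_trans[OF mexp_tail[OF AB] le]) (use K s in auto)
  have s6: "s ^ 6 \<le> s ^ 5" using s by (intro power_decreasing) auto
  have 2: "norm ((1/2) *\<^sub>R (B *v (B *v v))) \<le> K\<^sup>2 * s ^ 5 * norm v"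
  proof -
    have "norm (B *v (B *v v)) \<le> K * s ^ 3 * (K * s ^ 3 * norm v)"
      using B[of "B *v v"] mult_left_mono[OF B[of v] q(2)] by linarith
    also have "\<dots> = (K\<^sup>2 * norm v) * s ^ 6" by (simp add: power2_eq_square power_add[of s 3 3, simplified])
    also have "\<dots> \<le> (K\<^sup>2 * norm v) * s ^ 5" by (rule mult_left_mono[OF s6]) simp
    finally have b: "norm (B *v (B *v v)) \<le> K\<^sup>2 * s ^ 5 * norm v" by (simp add: mult_ac)
    have "norm ((1/2) *\<^sub>R (B *v (B *v v))) \<le> norm (B *v (B *v v))" by simp
    then show ?thesis using b by linarith
  qed
  have 3: "norm ((1/6) *\<^sub>R (?X 3 - ?Y 3)) \<le> 2 * K ^ 3 * s ^ 5 * norm v"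
  proof -
    have "norm (?X 3 - ?Y 3) \<le> real 3 * (2 * (K * s)) ^ (3 - 1) * (K * s ^ 3) * norm v"
      by (rule matrix_pow_diff[OF A B q])
    also have "\<dots> = 12 * K ^ 3 * s ^ 5 * norm v"
      by (simp add: power_mult_distrib power_add[of s 2 3, simplified] power_add[of K 2 1, simplified])
    finally show ?thesis by simp
  qed
  have 4: "norm ((1/24) *\<^sub>R (?X 4 - ?Y 4)) \<le> 2 * K ^ 4 * s ^ 5 * norm v"
  proof -
    have "norm (?X 4 - ?Y 4) \<le> real 4 * (2 * (K * s)) ^ (4 - 1) * (K * s ^ 3) * norm v"
      by (rule matrix_pow_diff[OF A B q])
    also have "\<dots> = (32 * K ^ 4 * norm v) * s ^ 6"
      by (simp add: power_mult_distrib power_add[of s 3 3, simplified] power_add[of K 3 1, simplified])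
    also have "\<dots> \<le> (32 * K ^ 4 * norm v) * s ^ 5" using K by (intro mult_left_mono[OF s6]) simp
    finally have "norm (?X 4 - ?Y 4) \<le> 32 * K ^ 4 * s ^ 5 * norm v" by (simp add: mult_ac)
    moreover have "0 \<le> K ^ 4 * s ^ 5 * norm v" using K s by simp
    ultimately show ?thesis by simp
  qed
  have X2: "?X 2 = ?Y 2 + (A *v (B *v v) + B *v (A *v v)) + B *v (B *v v)"
    by (simp add: numeral_2_eq_2 matrix_vector_mult_add_rdistrib matrix_vector_right_distrib)
  have S: "(\<Sum>k<5. (1 / fact k) *\<^sub>R Z k) = Z 0 + Z 1 + (1/2) *\<^sub>R Z 2 + (1/6) *\<^sub>R Z 3 + (1/24) *\<^sub>R Z 4" for Z :: "nat \<Rightarrow> complex^2"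
    by (simp add: eval_nat_numeral fact_numeral)
  have "mexp (A + B) *v v - ((\<Sum>k<5. (1 / fact k) *\<^sub>R ?Y k) + B *v v + (1/2) *\<^sub>R (A *v (B *v v) + B *v (A *v v)))
    = (mexp (A + B) *v v - (\<Sum>k<5. (1 / fact k) *\<^sub>R ?X k)) + (1/2) *\<^sub>R (B *v (B *v v)) + (1/6) *\<^sub>R (?X 3 - ?Y 3) + (1/24) *\<^sub>R (?X 4 - ?Y 4)"
    unfolding S X2 by (simp add: algebra_simps matrix_vector_mult_add_rdistrib scaleR_add_right)
  also have "norm \<dots> \<le> 32 * K ^ 5 * exp (2 * K) * s ^ 5 * norm v + K\<^sup>2 * s ^ 5 * norm v + 2 * K ^ 3 * s ^ 5 * norm v + 2 * K ^ 4 * s ^ 5 * norm v"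
    by (intro norm_triangle_mono 0 2 3 4)
  finally show ?thesis by (simp add: algebra_simps)
qed

context dirac_family
begin

text \<open>Words represent only polynomials in \<open>W\<close>, so the exponential is cut after
  the fourth power; the cut costs order five on bounded functions.\<close>

definition expO :: "real \<Rightarrow> 'i \<Rightarrow> (real \<Rightarrow> complex^2) \<Rightarrow> real \<Rightarrow> complex^2" where
  "expO c i f x = (\<Sum>k<5. (c ^ k / fact k) *\<^sub>R (aW i ^^ k) f x)"

lemma aW_pow: "(aW i ^^ k) f x = ((*v) (\<sigma> i *\<^sub>R W_mat 1 (V i) (A i) x) ^^ k) (f x)"
  by (induction k) (auto simp: aW_def WW_def matrix_vector_mult_scaleR)

lemma expO_eq: "expO c i f x = (\<Sum>k<5. (1 / fact k) *\<^sub>R ((*v) ((c * \<sigma> i) *\<^sub>R W_mat 1 (V i) (A i) x) ^^ k) (f x))"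
  unfolding expO_def aW_pow by (intro sum.cong refl) (simp add: power_matrix_scaleR power_mult_distrib)

lemma ucb_aW: "ucb k F \<Longrightarrow> k \<le> m \<Longrightarrow> ucb k (\<lambda>i. aW i (F i))"
  using ucb_sigma[OF ucb_WW, of k F 1] by (simp add: aW_def[abs_def])

lemma ucb_bQ: "ucb k F \<Longrightarrow> k \<le> m \<Longrightarrow> ucb k (\<lambda>i. bQ i (F i))"
  using ucb_scaleR[OF ucb_sigma[OF ucb_QQ], of k F "1/72" 3] by (simp add: bQ_def[abs_def])

lemma ucb_aW_pow: "ucb k F \<Longrightarrow> k \<le> m \<Longrightarrow> ucb k (\<lambda>i. (aW i ^^ j) (F i))"
  by (induction j) (auto intro: ucb_aW)

lemma ucb_expO: "ucb k F \<Longrightarrow> k \<le> m \<Longrightarrow> ucb k (\<lambda>i. expO c i (F i))"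
  unfolding expO_def[abs_def] by (intro ucb_sum ucb_scaleR ucb_aW_pow) auto

lemma asy_aW_pow: "asy F p \<Longrightarrow> ucb 1 F \<Longrightarrow> asy (\<lambda>i. (aW i ^^ j) (F i)) ((fmul sW ^^ j) p)"
proof (induction j)
  case (Suc j)
  have "1 \<le> m" using m by simp
  from asy_aW[OF Suc.IH[OF Suc.prems] ucb_aW_pow[OF Suc.prems(2) this]] show ?case by simp
qed simp

lemma asy_zero: "asy (\<lambda>i x. 0) (\<lambda>w. 0)"
  by (simp add: asy_def bigO_zero)

lemma asy_sum: "finite S \<Longrightarrow> (\<And>k. k \<in> S \<Longrightarrow> asy (F k) (p k)) \<Longrightarrow> asy (\<lambda>i x. \<Sum>k\<in>S. F k i x) (\<lambda>w. \<Sum>k\<in>S. p k w)"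
  by (induction S rule: finite_induct) (auto intro: asy_add asy_zero)

lemma asy_expO: "asy F p \<Longrightarrow> ucb 1 F \<Longrightarrow> asy (\<lambda>i. expO c i (F i)) (expW c p)"
proof -
  assume F: "asy F p" "ucb 1 F"
  have "asy (\<lambda>i x. \<Sum>k<5. (c ^ k / fact k) *\<^sub>R (aW i ^^ k) (F i) x) (\<lambda>w. \<Sum>k<5. (c ^ k / fact k) * (fmul sW ^^ k) p w)"
    by (intro asy_sum asy_scaleR asy_aW_pow F) auto
  moreover have "{..<5::nat} = {..4}" by auto
  ultimately show ?thesis unfolding expO_def[abs_def] expW_def[abs_def] by simp
qed

text \<open>The coefficient 1/3 is 1/2 from the exponential series times the weight 2/3 of
  \<open>W\<close> in the middle factor. Products of two double commutators are of order six and do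
  not occur.\<close>

definition midO :: "'i \<Rightarrow> (real \<Rightarrow> complex^2) \<Rightarrow> real \<Rightarrow> complex^2" where
  "midO i f x = expO (2/3) i f x + bQ i f x + (1/3) *\<^sub>R (aW i (bQ i f) x + bQ i (aW i f) x)"

lemma ucb_midO: "ucb k F \<Longrightarrow> k \<le> m \<Longrightarrow> ucb k (\<lambda>i. midO i (F i))"
  unfolding midO_def[abs_def] by (intro ucb_add ucb_scaleR ucb_expO ucb_aW ucb_bQ)

lemma asy_midO: "asy F p2 \<Longrightarrow> ucb 1 F \<Longrightarrow> asy (\<lambda>i. midO i (F i)) p3"
proof -
  assume F: "asy F p2" "ucb 1 F"
  have m1: "1 \<le> m" using m by simp
  show ?thesis unfolding midO_def[abs_def] p3_def[abs_def]
    by (intro asy_add asy_scaleR asy_expO asy_aW asy_bQ ucb_aW ucb_bQ F m1)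
qed

lemma expO_approx:
  assumes "ucb k F" "0 \<le> c" "c \<le> 1"
  shows "bigO 5 (\<lambda>i x. mexp ((c * \<sigma> i) *\<^sub>R W_mat 1 (V i) (A i) x) *v F i x - expO c i (F i) x)"
proof -
  obtain B where B: "B \<ge> 0" "\<And>i x. i \<in> I \<Longrightarrow> norm (F i x) \<le> B"
    using ucb_bound[OF assms(1)] unfolding bigO_def by (auto simp del: power_0_left)
  let ?K = "2 * \<bar>BV\<bar>"
  have "norm (mexp ((c * \<sigma> i) *\<^sub>R W_mat 1 (V i) (A i) x) *v F i x - expO c i (F i) x) \<le> ?K ^ 5 * exp ?K * B * \<sigma> i ^ 5" if i: "i \<in> I" for i x
  proof -
    define r where "r = ?K * \<sigma> i"
    have r: "0 \<le> r" "r \<le> ?K" using \<sigma>[OF i] mult_left_mono[of "\<sigma> i" 1 ?K] by (auto simp: r_def)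
    have "norm (((c * \<sigma> i) *\<^sub>R W_mat 1 (V i) (A i) x) *v v) \<le> r * norm v" for v
    proof -
      have "norm (W_mat 1 (V i) (A i) x *v v) \<le> ?K * norm v"
        using W_bound[OF i, of x v] mult_right_mono[OF abs_ge_self[of BV] norm_ge_zero[of v]] by simp
      moreover have "\<bar>c * \<sigma> i\<bar> \<le> \<sigma> i" using assms(2,3) \<sigma>[OF i] mult_right_mono[of c 1 "\<sigma> i"] by (simp add: abs_mult)
      ultimately have "\<bar>c * \<sigma> i\<bar> * norm (W_mat 1 (V i) (A i) x *v v) \<le> \<sigma> i * (?K * norm v)"
        by (intro mult_mono) (use \<sigma>[OF i] in auto)
      then show ?thesis by (simp add: matrix_vector_mult_scaleR r_def mult_ac)
    qed
    from mexp_tail[OF this r(1), of "F i x" 5]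
    have "norm (mexp ((c * \<sigma> i) *\<^sub>R W_mat 1 (V i) (A i) x) *v F i x - expO c i (F i) x) \<le> r ^ 5 * exp r * norm (F i x)"
      unfolding expO_eq .
    also have "\<dots> \<le> r ^ 5 * exp ?K * B"
      using r B(2)[OF i, of x] by (intro mult_mono) auto
    also have "\<dots> = ?K ^ 5 * exp ?K * B * \<sigma> i ^ 5" by (simp add: r_def power_mult_distrib mult_ac)
    finally show ?thesis .
  qed
  then show ?thesis unfolding bigO_def using B(1) by (intro exI[of _ "?K ^ 5 * exp ?K * B"]) auto
qed

lemma midO_approx:
  assumes "ucb k F"
  shows "bigO 5 (\<lambda>i x. mexp ((2/3 * \<sigma> i) *\<^sub>R W_mat 1 (V i) (A i) x + (\<sigma> i ^ 3 / 72) *\<^sub>R WTW_mat 1 (A i) x) *v F i x - midO i (F i) x)"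
proof -
  obtain B where B: "B \<ge> 0" "\<And>i x. i \<in> I \<Longrightarrow> norm (F i x) \<le> B"
    using ucb_bound[OF assms(1)] unfolding bigO_def by (auto simp del: power_0_left)
  \<comment> \<open>One constant that dominates the bounds of both matrices, as
    \<open>mexp_perturb\<close> expects; the weights 2/3 and 1/72 are simply estimated by
    one.\<close>
  define K where "K = 2 * \<bar>BV\<bar> + 4 * BV\<^sup>2"
  have K: "0 \<le> K" "2 * BV \<le> K" "4 * BV\<^sup>2 \<le> K" by (simp_all add: K_def) (use abs_ge_self[of BV] in \<open>auto intro: add_increasing2\<close>)
  define D where "D = 32 * K ^ 5 * exp (2 * K) + K\<^sup>2 + 2 * K ^ 3 + 2 * K ^ 4"
  have D: "0 \<le> D" using K by (simp add: D_def)
  have "norm (mexp ((2/3 * \<sigma> i) *\<^sub>R W_mat 1 (V i) (A i) x + (\<sigma> i ^ 3 / 72) *\<^sub>R WTW_mat 1 (A i) x) *v F i x - midO i (F i) x) \<le> D * B * \<sigma> i ^ 5"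
    if i: "i \<in> I" for i x
  proof -
    let ?P = "(2/3 * \<sigma> i) *\<^sub>R W_mat 1 (V i) (A i) x" and ?Q = "(\<sigma> i ^ 3 / 72) *\<^sub>R WTW_mat 1 (A i) x"
    have s: "0 \<le> \<sigma> i" "\<sigma> i \<le> 1" using \<sigma>[OF i] by auto
    have P: "norm (?P *v v) \<le> K * \<sigma> i * norm v" for v
    proof -
      have "norm (W_mat 1 (V i) (A i) x *v v) \<le> K * norm v"
        using W_bound[OF i, of x v] mult_right_mono[OF K(2) norm_ge_zero[of v]] by linarith
      then have "(2/3 * \<sigma> i) * norm (W_mat 1 (V i) (A i) x *v v) \<le> \<sigma> i * (K * norm v)"
        using s K by (intro mult_mono) auto
      then show ?thesis using s by (simp add: matrix_vector_mult_scaleR mult_ac)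
    qed
    have Q: "norm (?Q *v v) \<le> K * \<sigma> i ^ 3 * norm v" for v
    proof -
      have "norm (WTW_mat 1 (A i) x *v v) \<le> K * norm v"
        using Q_bound[OF i, of x v] mult_right_mono[OF K(3) norm_ge_zero[of v]] by linarith
      then have "(\<sigma> i ^ 3 / 72) * norm (WTW_mat 1 (A i) x *v v) \<le> \<sigma> i ^ 3 * (K * norm v)"
        using s K by (intro mult_mono) auto
      then show ?thesis using s by (simp add: matrix_vector_mult_scaleR mult_ac)
    qed
    have e: "midO i (F i) x = (\<Sum>k<5. (1 / fact k) *\<^sub>R ((*v) ?P ^^ k) (F i x)) + ?Q *v F i x + (1/2) *\<^sub>R (?P *v (?Q *v F i x) + ?Q *v (?P *v F i x))"
      unfolding midO_def expO_eq
      by (simp add: aW_def bQ_def WW_def QQ_def matrix_vector_mult_scaleR matrix_vector_mult_scaleR_right scaleR_add_right mult_ac)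
    have "norm (mexp (?P + ?Q) *v F i x - midO i (F i) x) \<le> D * \<sigma> i ^ 5 * norm (F i x)"
      unfolding e D_def by (rule mexp_perturb[OF P Q K(1) s])
    also have "\<dots> \<le> D * \<sigma> i ^ 5 * B" using D s B(2)[OF i] by (intro mult_left_mono) auto
    finally show ?thesis by (simp add: mult_ac)
  qed
  then show ?thesis unfolding bigO_def using B(1) D by (intro exI[of _ "D * B"]) auto
qed

end

section \<open>Composition of the five factors on the grid\<close>

locale dirac_scheme = dirac_family I L \<sigma> V A u BV BU m
  for I :: "'i set" and L \<sigma> V A u BV BU m +
  fixes M N :: "'i \<Rightarrow> nat"
  assumes M: "i \<in> I \<Longrightarrow> 0 < M i" "i \<in> I \<Longrightarrow> even (M i)"
    and N: "i \<in> I \<Longrightarrow> L i / real (N i + 2) \<le> \<sigma> i ^ 5"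
begin

text \<open>Couples the grid vectors of the scheme to functions on the line, which have derivatives
  and can be expanded in words. The quotient L/M is the rescaled mesh size. The smoothing degree
  \<open>N\<close> of the family is unrelated to the grid: it only has to make the smoothing error
  at most \<sigma>^5 and may exceed the number of modes by far.\<close>

definition ga :: "('i \<Rightarrow> nat \<Rightarrow> complex^2) \<Rightarrow> ('i \<Rightarrow> real \<Rightarrow> complex^2) \<Rightarrow> bool" where
  "ga U F \<longleftrightarrow> (\<exists>C\<ge>0. \<forall>i\<in>I. gnorm (M i) (\<lambda>j. U i j - F i (gp (L i) (M i) j)) \<le> C * (\<sigma> i ^ 5 + (L i / real (M i)) ^ m))"

lemma rate_nonneg: "i \<in> I \<Longrightarrow> 0 \<le> (L i / real (M i)) ^ m" "i \<in> I \<Longrightarrow> 0 \<le> \<sigma> i ^ 5"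
  using L \<sigma> by (auto simp: less_imp_le)

text \<open>A multiplication acts exactly at the nodes and is unitary there, so it preserves the
  error already present. A new error arises only from replacing the exponential by its
  expansion.\<close>

lemma ga_mult:
  assumes U: "ga U F" and sk: "\<And>i x v. i \<in> I \<Longrightarrow> v \<bullet> (B i x *v v) = 0"
    and ap: "bigO 5 (\<lambda>i x. mexp (B i x) *v F i x - G i x)"
  shows "ga (\<lambda>i. exp_mult 0 (L i) (M i) (B i) (U i)) G"
proof -
  obtain C where C: "C \<ge> 0" "\<And>i. i \<in> I \<Longrightarrow> gnorm (M i) (\<lambda>j. U i j - F i (gp (L i) (M i) j)) \<le> C * (\<sigma> i ^ 5 + (L i / real (M i)) ^ m)"
    using U unfolding ga_def by metis
  obtain D where D: "D \<ge> 0" "\<And>i x. i \<in> I \<Longrightarrow> norm (mexp (B i x) *v F i x - G i x) \<le> D * \<sigma> i ^ 5"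
    using ap unfolding bigO_def by metis
  have "gnorm (M i) (\<lambda>j. exp_mult 0 (L i) (M i) (B i) (U i) j - G i (gp (L i) (M i) j)) \<le> (C + D) * (\<sigma> i ^ 5 + (L i / real (M i)) ^ m)"
    if i: "i \<in> I" for i
  proof -
    let ?x = "\<lambda>j. gp (L i) (M i) j"
    have "gnorm (M i) (\<lambda>j. exp_mult 0 (L i) (M i) (B i) (U i) j - mexp (B i (?x j)) *v F i (?x j))
      = gnorm (M i) (\<lambda>j. U i j - F i (?x j))"
      unfolding exp_mult_def matrix_vector_mult_diff_distrib[symmetric]
      by (intro gnorm_cong norm_mexp_skew sk i)
    moreover have "gnorm (M i) (\<lambda>j. mexp (B i (?x j)) *v F i (?x j) - G i (?x j)) \<le> D * \<sigma> i ^ 5"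
      using D M[OF i] rate_nonneg[OF i] i by (intro gnorm_le_sup) auto
    moreover have "D * \<sigma> i ^ 5 \<le> D * (\<sigma> i ^ 5 + (L i / real (M i)) ^ m)"
      using D(1) rate_nonneg[OF i] by (intro mult_left_mono) auto
    ultimately show ?thesis
      using gnorm_triangle_diff[of "M i" "exp_mult 0 (L i) (M i) (B i) (U i)" "\<lambda>j. G i (?x j)" "\<lambda>j. mexp (B i (?x j)) *v F i (?x j)"] C(2)[OF i]
      by (simp add: distrib_right)
  qed
  then show ?thesis unfolding ga_def using C(1) D(1) by (intro exI[of _ "C + D"]) auto
qed

text \<open>The rate H^m of the spectral step requires all m orders of regularity of F. The
  intermediate functions of the scheme keep them, since the potentials have m orders and the
  smoothed evolution preserves \<open>cb\<close>.\<close>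

lemma ga_exp_T:
  assumes U: "ga U F" and F: "ucb m F"
  shows "ga (\<lambda>i. exp_T 1 0 (L i) (M i) (\<sigma> i / 2) (U i)) (\<lambda>i. Et (N i) (L i) (1/2 * \<sigma> i) (F i))"
proof -
  obtain C where C: "C \<ge> 0" "\<And>i. i \<in> I \<Longrightarrow> gnorm (M i) (\<lambda>j. U i j - F i (gp (L i) (M i) j)) \<le> C * (\<sigma> i ^ 5 + (L i / real (M i)) ^ m)"
    using U unfolding ga_def by metis
  obtain D where D: "D \<ge> 0" "\<And>i. i \<in> I \<Longrightarrow> cb (L i) m D (F i)" using F unfolding ucb_def by metis
  obtain k where k: "m = Suc k" using m by (cases m) auto
  define E where "E = C + 9 * (D * 2 ^ m) + 8 * D"
  have "gnorm (M i) (\<lambda>j. exp_T 1 0 (L i) (M i) (\<sigma> i / 2) (U i) j - Et (N i) (L i) (1/2 * \<sigma> i) (F i) (gp (L i) (M i) j)) \<le> E * (\<sigma> i ^ 5 + (L i / real (M i)) ^ m)"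
    if i: "i \<in> I" for i
  proof -
    let ?x = "\<lambda>j. gp (L i) (M i) j" and ?H = "(L i / real (M i)) ^ m"
    have "gnorm (M i) (\<lambda>j. exp_T 1 0 (L i) (M i) (\<sigma> i / 2) (U i) j - exp_T 1 0 (L i) (M i) (\<sigma> i / 2) (\<lambda>j. F i (?x j)) j)
      = gnorm (M i) (exp_T 1 0 (L i) (M i) (\<sigma> i / 2) (\<lambda>j. U i j - F i (?x j)))"
      by (simp only: exp_T_diff[symmetric])
    also have "\<dots> = gnorm (M i) (\<lambda>j. U i j - F i (?x j))" by (rule gnorm_exp_T[OF L[OF i] M[OF i]])
    finally have 1: "gnorm (M i) (\<lambda>j. exp_T 1 0 (L i) (M i) (\<sigma> i / 2) (U i) j - exp_T 1 0 (L i) (M i) (\<sigma> i / 2) (\<lambda>j. F i (?x j)) j)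
      \<le> C * (\<sigma> i ^ 5 + ?H)" using C(2)[OF i] by simp
    have 2: "gnorm (M i) (\<lambda>j. exp_T 1 0 (L i) (M i) (\<sigma> i / 2) (\<lambda>j. F i (?x j)) j - Et (N i) (L i) (1/2 * \<sigma> i) (F i) (?x j))
       \<le> 9 * (D * (2 * L i / real (M i)) ^ Suc k) + 8 * (D * \<sigma> i ^ 5)"
      using grid_exp_T[OF L[OF i] M[OF i], of "\<sigma> i / 2" k D "F i" "N i" "\<sigma> i ^ 5"] D(2)[OF i] N[OF i] \<sigma>[OF i] k by simp
    have eq: "(2 * L i / real (M i)) ^ Suc k = 2 ^ m * ?H"
      unfolding k[symmetric] by (simp add: power_mult_distrib power_divide)
    have 3: "gnorm (M i) (\<lambda>j. exp_T 1 0 (L i) (M i) (\<sigma> i / 2) (\<lambda>j. F i (?x j)) j - Et (N i) (L i) (1/2 * \<sigma> i) (F i) (?x j))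
       \<le> 9 * (D * 2 ^ m) * ?H + 8 * D * \<sigma> i ^ 5"
      using 2 unfolding eq by (simp only: mult.assoc)
    have "9 * (D * 2 ^ m) * ?H + 8 * D * \<sigma> i ^ 5 \<le> (9 * (D * 2 ^ m) + 8 * D) * (\<sigma> i ^ 5 + ?H)"
      using D(1) rate_nonneg[OF i] by (simp add: algebra_simps)
    then show ?thesis using order_trans[OF gnorm_triangle_diff add_mono[OF 1 3]] by (simp add: E_def algebra_simps)
  qed
  then show ?thesis unfolding ga_def using C(1) D(1) by (intro exI[of _ E]) (auto simp: E_def)
qed

text \<open>The functions F1, ..., F5 serve two estimates at once: the grid vectors after each
  factor are close to them by \<open>ga\<close>, and their expansions in words are the series p1,
  ..., p5.\<close>

lemma scheme_asy:
  "\<exists>F. ga (\<lambda>i. S4c_step 1 0 (L i) (V i) (A i) (M i) (\<sigma> i) (\<lambda>j. u i (gp (L i) (M i) j))) F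
     \<and> asy F (\<lambda>w. 1 / fact (length w))"
proof -
  have m1: "1 \<le> m" using m by simp
  define F1 where "F1 i = expO (1/6) i (u i)" for i
  define F2 where "F2 i = Et (N i) (L i) (1/2 * \<sigma> i) (F1 i)" for i
  define F3 where "F3 i = midO i (F2 i)" for i
  define F4 where "F4 i = Et (N i) (L i) (1/2 * \<sigma> i) (F3 i)" for i
  define F5 where "F5 i = expO (1/6) i (F4 i)" for i
  have u1: "ucb m F1" unfolding F1_def by (rule ucb_expO[OF ucb_u(1) order_refl])
  have u2: "ucb m F2" unfolding F2_def by (rule ucb_Et[OF u1 m1]) auto
  have u3: "ucb m F3" unfolding F3_def by (rule ucb_midO[OF u2 order_refl])
  have u4: "ucb m F4" unfolding F4_def by (rule ucb_Et[OF u3 m1]) auto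
  note le = ucb_le[OF _ m1]
  have a1: "asy F1 p1" unfolding F1_def p1_def
    by (rule asy_expO[OF _ le[OF ucb_u(1)]]) (simp add: p0_def[abs_def] asy_u)
  have a2: "asy F2 p2" unfolding F2_def p2_def by (rule asy_Et[OF _ _ N a1 le[OF u1]]) auto
  have a3: "asy F3 p3" unfolding F3_def by (rule asy_midO[OF a2 le[OF u2]])
  have a4: "asy F4 p4" unfolding F4_def p4_def by (rule asy_Et[OF _ _ N a3 le[OF u3]]) auto
  have a5: "asy F5 p5" unfolding F5_def p5_def by (rule asy_expO[OF a4 le[OF u4]])
  have g0: "ga (\<lambda>i j. u i (gp (L i) (M i) j)) u"
    unfolding ga_def by (rule exI[of _ 0]) (simp add: gnorm_def L2_set_def)
  have skW: "v \<bullet> (((\<sigma> i / 6) *\<^sub>R W_mat 1 (V i) (A i) x) *v v) = 0" for i x v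
    by (simp add: inner_matrix_scaleR W_mat_skew)
  have skM: "v \<bullet> (((2/3 * \<sigma> i) *\<^sub>R W_mat 1 (V i) (A i) x + (\<sigma> i ^ 3 / 72) *\<^sub>R WTW_mat 1 (A i) x) *v v) = 0" for i x v
    by (simp only: matrix_vector_mult_add_rdistrib inner_add_right inner_matrix_scaleR W_mat_skew WTW_mat_skew)
  have g1: "ga (\<lambda>i. exp_mult 0 (L i) (M i) (\<lambda>x. (\<sigma> i / 6) *\<^sub>R W_mat 1 (V i) (A i) x) (\<lambda>j. u i (gp (L i) (M i) j))) F1"
    by (rule ga_mult[OF g0 skW]) (use expO_approx[OF ucb_u(1), of "1/6"] in \<open>simp add: F1_def\<close>)
  have g2: "ga (\<lambda>i. exp_T 1 0 (L i) (M i) (\<sigma> i / 2) (exp_mult 0 (L i) (M i) (\<lambda>x. (\<sigma> i / 6) *\<^sub>R W_mat 1 (V i) (A i) x) (\<lambda>j. u i (gp (L i) (M i) j)))) F2"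
    unfolding F2_def by (rule ga_exp_T[OF g1 u1])
  note g3 = ga_mult[OF g2 skM midO_approx[OF u2, folded F3_def]]
  note g4 = ga_exp_T[OF g3 u3, folded F4_def]
  have "ga (\<lambda>i. S4c_step 1 0 (L i) (V i) (A i) (M i) (\<sigma> i) (\<lambda>j. u i (gp (L i) (M i) j))) F5"
    unfolding S4c_step_def o_def
    by (rule ga_mult[OF g4 skW]) (use expO_approx[OF u4, of "1/6"] in \<open>simp add: F5_def\<close>)
  moreover have "asy F5 (\<lambda>w. 1 / fact (length w))"
    by (rule asy_cong_coeff[OF a5 p5_eq])
  ultimately show ?thesis by blast
qed

end

section \<open>Taylor expansion of the exact flow\<close>

definition PP :: "(real \<Rightarrow> real) \<Rightarrow> (real \<Rightarrow> real) \<Rightarrow> (real \<Rightarrow> complex^2) \<Rightarrow> real \<Rightarrow> complex^2" where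
  "PP V A f x = TT f x + WW V A f x"

lemma cb_PP:
  assumes V: "cb L 4 BV V" "cb L 4 BV A" and f: "cb L (Suc (Suc k)) B f" and k: "k \<le> 3"
  shows "cb L (Suc k) ((2 + 32 * BV) * B) (PP V A f)"
proof -
  have nn: "0 \<le> BV" "0 \<le> B" using cb_nonneg[OF V(1)] cb_nonneg[OF f] .
  have "cb L (Suc k) (2 * 2 ^ Suc k * BV * B) (WW V A f)"
    using k by (intro cb_WW cb_le[OF V(1)] cb_le[OF V(2)] cb_Suc[OF f]) auto
  moreover have "2 * 2 ^ Suc k * BV * B \<le> 2 * 2 ^ 4 * BV * B"
    using nn k by (intro mult_right_mono mult_left_mono power_increasing) auto
  ultimately have "cb L (Suc k) (32 * BV * B) (WW V A f)" by (auto intro: cb_mono)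
  from cb_add[OF cb_TT[OF f] this] show ?thesis by (simp add: PP_def[abs_def] algebra_simps)
qed

lemma WW_add: "WW V A (\<lambda>x. f x + g x) x = WW V A f x + WW V A g x"
  by (simp add: WW_def matrix_vector_right_distrib)

lemma PP_add: "cb L (Suc (Suc k)) B f \<Longrightarrow> cb L (Suc (Suc k)) B' g \<Longrightarrow> PP V A (\<lambda>x. f x + g x) = (\<lambda>x. PP V A f x + PP V A g x)"
  by (auto simp: PP_def TT_add WW_add)

lemma PP_scaleR: "cb L (Suc (Suc k)) B f \<Longrightarrow> PP V A (\<lambda>x. c *\<^sub>R f x) = (\<lambda>x. c *\<^sub>R PP V A f x)"
  by (auto simp: PP_def TT_scaleR WW_scaleR scaleR_add_right)

text \<open>For applying linearity of derivatives only the existence of a bound matters. The actual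
  constants are kept apart from such side conditions.\<close>

definition rcb :: "real \<Rightarrow> nat \<Rightarrow> (real \<Rightarrow> 'a::real_normed_vector) \<Rightarrow> bool" where
  "rcb L k f \<longleftrightarrow> (\<exists>B. cb L k B f)"

lemma rcb_add: "rcb L k f \<Longrightarrow> rcb L k g \<Longrightarrow> rcb L k (\<lambda>x. f x + g x)"
  unfolding rcb_def using cb_add by blast

lemma rcb_scaleR: "rcb L k f \<Longrightarrow> rcb L k (\<lambda>x. c *\<^sub>R f x)"
  unfolding rcb_def using cb_scaleR by blast

lemma rcb_diff: "rcb L k f \<Longrightarrow> rcb L k g \<Longrightarrow> rcb L k (\<lambda>x. f x - g x)"
  unfolding rcb_def using cb_diff by blast

lemma rcb_sum: "finite S \<Longrightarrow> (\<And>j. j \<in> S \<Longrightarrow> rcb L k (f j)) \<Longrightarrow> rcb L k (\<lambda>x. \<Sum>j\<in>S. f j x)"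
proof (induction S rule: finite_induct)
  case empty
  then show ?case using cb_zero[of L k] by (auto simp: rcb_def)
qed (auto intro: rcb_add)

lemma rcb_DD: "rcb L (Suc (Suc k)) f \<Longrightarrow> rcb L (Suc k) (DD f)"
  unfolding rcb_def using cb_DD by blast

lemma DDk_add: "rcb L (Suc k) f \<Longrightarrow> rcb L (Suc k) g \<Longrightarrow> (DD ^^ k) (\<lambda>x. f x + g x) = (\<lambda>x. (DD ^^ k) f x + (DD ^^ k) g x)"
proof (induction k arbitrary: f g)
  case (Suc k)
  have "DD (\<lambda>x. f x + g x) = (\<lambda>x. DD f x + DD g x)" using Suc.prems DD_add unfolding rcb_def by blast
  then show ?case using Suc.IH[OF rcb_DD rcb_DD, OF Suc.prems] by (simp add: funpow_swap1 del: funpow.simps(2) add: funpow_Suc_right)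
qed simp

lemma DDk_scaleR: "rcb L (Suc k) f \<Longrightarrow> (DD ^^ k) (\<lambda>x. c *\<^sub>R f x) = (\<lambda>x. c *\<^sub>R (DD ^^ k) f x)"
proof (induction k arbitrary: f)
  case (Suc k)
  have "DD (\<lambda>x. c *\<^sub>R f x) = (\<lambda>x. c *\<^sub>R DD f x)" using Suc.prems DD_scaleR unfolding rcb_def by blast
  then show ?case using Suc.IH[OF rcb_DD, OF Suc.prems] by (simp add: funpow_Suc_right del: funpow.simps(2))
qed simp

lemma DDk_zero: "(DD ^^ k) (\<lambda>x. 0 :: 'a::real_normed_vector) = (\<lambda>x. 0)"
proof (induction k)
  case (Suc k)
  have "DD (\<lambda>x. 0 :: 'a) = (\<lambda>x. 0)" by (rule DD_eqI) simp
  then show ?case using Suc by simp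
qed simp

lemma DDk_sum: "finite S \<Longrightarrow> (\<And>j. j \<in> S \<Longrightarrow> rcb L (Suc k) (f j)) \<Longrightarrow>
    (DD ^^ k) (\<lambda>x. \<Sum>j\<in>S. f j x) = (\<lambda>x. \<Sum>j\<in>S. (DD ^^ k) (f j) x)"
proof (induction S rule: finite_induct)
  case empty
  then show ?case by (simp add: DDk_zero)
next
  case (insert j S)
  have "(DD ^^ k) (\<lambda>x. f j x + (\<Sum>j\<in>S. f j x)) = (\<lambda>x. (DD ^^ k) (f j) x + (DD ^^ k) (\<lambda>x. \<Sum>j\<in>S. f j x) x)"
    using insert by (intro DDk_add rcb_sum) auto
  then show ?case using insert by simp
qed

lemma time_growth:
  fixes h :: "real \<Rightarrow> 'a::real_normed_vector"
  assumes d: "\<And>r. r \<in> {0..S} \<Longrightarrow> (h has_vector_derivative h' r) (at r within {0..S})"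
    and b: "\<And>r. r \<in> {0..S} \<Longrightarrow> norm (h' r) \<le> M * r ^ n" and z: "h 0 = 0" and s: "s \<in> {0..S}" and M: "0 \<le> M"
  shows "norm (h s) \<le> M * s ^ Suc n"
proof -
  have "norm (h s - h 0) \<le> (M * s ^ n) * s"
  proof (rule bounded_deriv_diff)
    show "(h has_vector_derivative h' r) (at r within {0..s})" if "r \<in> {0..s}" for r
      using s that by (intro has_vector_derivative_within_subset[OF d]) auto
    show "norm (h' r) \<le> M * s ^ n" if "r \<in> {0..s}" for r
    proof -
      have "norm (h' r) \<le> M * r ^ n" using s that by (intro b) auto
      also have "\<dots> \<le> M * s ^ n" using that M by (intro mult_left_mono power_mono) auto
      finally show ?thesis .
    qed
  qed (use s in auto)
  then show ?thesis by (simp add: z mult_ac)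
qed

text \<open>Integration in time of a bound in the class \<open>cb\<close>. The highest order is a
  Lipschitz condition and not a derivative, so there the difference of the values at two points is
  integrated.\<close>

lemma cb_time_integral:
  fixes q g :: "real \<Rightarrow> real \<Rightarrow> 'a::real_normed_vector"
  assumes "\<And>s. s \<in> {0..S} \<Longrightarrow> rcb L (Suc j) (q s)"
    and "\<And>k s x. k \<le> j \<Longrightarrow> s \<in> {0..S} \<Longrightarrow> ((\<lambda>s. (DD ^^ k) (q s) x) has_vector_derivative (DD ^^ k) (g s) x) (at s within {0..S})"
    and "\<And>s. s \<in> {0..S} \<Longrightarrow> cb L (Suc j) (M * s ^ n) (g s)"
    and "\<And>k x. k \<le> j \<Longrightarrow> (DD ^^ k) (q 0) x = 0" and "s \<in> {0..S}" and "0 \<le> M"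
  shows "cb L (Suc j) (M * s ^ Suc n) (q s)"
  using assms(1-4)
proof (induction j arbitrary: q g)
  case 0
  obtain B where B: "cb L (Suc 0) B (q s)" using "0.prems"(1)[OF assms(5)] unfolding rcb_def by blast
  have "norm (q s x) \<le> M * s ^ Suc n" for x
    by (rule time_growth[of S _ "\<lambda>s. g s x"])
      (use "0.prems"(2)[of 0] "0.prems"(4)[of 0] cb_bdd[OF "0.prems"(3)] assms(5,6) in auto)
  moreover have "norm (q s x - q s y) \<le> (M * \<bar>x - y\<bar>) * s ^ Suc n" for x y
  proof (rule time_growth[of S _ "\<lambda>s. g s x - g s y"])
    show "norm (g r x - g r y) \<le> (M * \<bar>x - y\<bar>) * r ^ n" if "r \<in> {0..S}" for r
      using cb_lip[OF "0.prems"(3)[OF that], of x y] by (simp add: mult_ac)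
  qed (use "0.prems"(2)[of 0] "0.prems"(4)[of 0] assms(5,6) in \<open>auto intro: has_vector_derivative_diff\<close>)
  ultimately show ?case using cb_per[OF B] by (simp add: mult_ac)
next
  case (Suc j)
  obtain B where B: "cb L (Suc (Suc j)) B (q s)" using Suc.prems(1)[OF assms(5)] unfolding rcb_def by blast
  have "norm (q s x) \<le> M * s ^ Suc n" for x
    by (rule time_growth[of S _ "\<lambda>s. g s x"])
      (use Suc.prems(2)[of 0] Suc.prems(4)[of 0] cb_bdd[OF Suc.prems(3)] assms(5,6) in auto)
  moreover have "cb L (Suc j) (M * s ^ Suc n) (DD (q s))"
  proof (rule Suc.IH[of "\<lambda>s. DD (q s)" "\<lambda>s. DD (g s)"])
    show "rcb L (Suc j) (DD (q s))" if "s \<in> {0..S}" for s by (rule rcb_DD[OF Suc.prems(1)[OF that]])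
    show "((\<lambda>s. (DD ^^ k) (DD (q s)) x) has_vector_derivative (DD ^^ k) (DD (g s)) x) (at s within {0..S})" if "k \<le> j" "s \<in> {0..S}" for k s x
      using Suc.prems(2)[of "Suc k" s x] that by (simp add: funpow_Suc_right del: funpow.simps(2))
    show "cb L (Suc j) (M * s ^ n) (DD (g s))" if "s \<in> {0..S}" for s by (rule cb_DD[OF Suc.prems(3)[OF that]])
    show "(DD ^^ k) (DD (q 0)) x = 0" if "k \<le> j" for k x
      using Suc.prems(4)[of "Suc k" x] that by (simp add: funpow_Suc_right del: funpow.simps(2))
  qed
  ultimately show ?case using cb_per[OF B] cb_deriv[OF B] by simp
qed

definition tay :: "(real \<Rightarrow> real) \<Rightarrow> (real \<Rightarrow> real) \<Rightarrow> (real \<Rightarrow> complex^2) \<Rightarrow> nat \<Rightarrow> real \<Rightarrow> real \<Rightarrow> complex^2" where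
  "tay V A u n s x = (\<Sum>j<n. (s ^ j / fact j) *\<^sub>R (PP V A ^^ j) u x)"

text \<open>The hypothesis \<open>\<phi>_deriv\<close> is the evolution equation together with its
  first three space derivatives, as many as exist classically and can be differentiated in time when
  m = 4.\<close>

locale dirac_flow =
  fixes L S BV BU :: real and V A :: "real \<Rightarrow> real" and \<phi> :: "real \<Rightarrow> real \<Rightarrow> complex^2"
  assumes S: "0 < S" and V: "cb L 4 BV V" "cb L 4 BV A"
    and \<phi>: "\<And>s. s \<in> {0..S} \<Longrightarrow> cb L 5 BU (\<phi> s)"
    and \<phi>_deriv: "\<And>k s x. k \<le> 3 \<Longrightarrow> s \<in> {0..S} \<Longrightarrow>
      ((\<lambda>s. (DD ^^ k) (\<phi> s) x) has_vector_derivative (DD ^^ k) (PP V A (\<phi> s)) x) (at s within {0..S})"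
begin

abbreviation "u \<equiv> \<phi> 0"
abbreviation "K \<equiv> 2 + 32 * BV"

lemma cb_PP_pow: "j \<le> 4 \<Longrightarrow> cb L (5 - j) (K ^ j * BU) ((PP V A ^^ j) u)"
proof (induction j)
  case 0
  then show ?case using \<phi>[of 0] S by simp
next
  case (Suc j)
  have e: "5 - j = Suc (Suc (3 - j))" "5 - Suc j = Suc (3 - j)" using Suc.prems by auto
  have "cb L (Suc (Suc (3 - j))) (K ^ j * BU) ((PP V A ^^ j) u)" using Suc e(1) by simp
  from cb_PP[OF V this] show ?case unfolding e(2) by (simp add: mult_ac)
qed

lemma rcb_PP_pow: "j + k \<le> 5 \<Longrightarrow> j \<le> 4 \<Longrightarrow> rcb L k ((PP V A ^^ j) u)"
  using cb_le[OF cb_PP_pow, of j k] unfolding rcb_def by (metis le_diff_conv2 add.commute le_trans add_leE)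

lemma K: "0 \<le> K" "0 \<le> BU" "1 \<le> K"
  using cb_nonneg[OF V(1)] cb_nonneg[OF \<phi>[of 0]] S by auto

lemma rcb_tay: "n \<le> 5 \<Longrightarrow> n + k \<le> 6 \<Longrightarrow> rcb L k (tay V A u n s)"
  unfolding tay_def[abs_def] by (intro rcb_sum rcb_scaleR rcb_PP_pow) auto

lemma DDk_tay: "n \<le> 5 \<Longrightarrow> n + k \<le> 5 \<Longrightarrow> (DD ^^ k) (tay V A u n s) x = (\<Sum>j<n. (s ^ j / fact j) *\<^sub>R (DD ^^ k) ((PP V A ^^ j) u) x)"
proof -
  assume n: "n \<le> 5" "n + k \<le> 5"
  have r: "rcb L (Suc k) ((PP V A ^^ j) u)" if "j < n" for j using n that by (intro rcb_PP_pow) auto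
  have "(DD ^^ k) (\<lambda>x. \<Sum>j<n. (s ^ j / fact j) *\<^sub>R (PP V A ^^ j) u x) = (\<lambda>x. \<Sum>j<n. (DD ^^ k) (\<lambda>x. (s ^ j / fact j) *\<^sub>R (PP V A ^^ j) u x) x)"
    by (rule DDk_sum) (use r in \<open>auto intro: rcb_scaleR\<close>)
  also have "\<dots> = (\<lambda>x. \<Sum>j<n. (s ^ j / fact j) *\<^sub>R (DD ^^ k) ((PP V A ^^ j) u) x)"
    by (intro ext sum.cong refl) (use DDk_scaleR[OF r] in auto)
  finally show ?thesis by (simp add: tay_def[abs_def])
qed

lemma PP_tay: "n \<le> 4 \<Longrightarrow> PP V A (tay V A u n s) x = (\<Sum>j<n. (s ^ j / fact j) *\<^sub>R (PP V A ^^ Suc j) u x)"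
proof (induction n arbitrary: x)
  case 0
  have "PP V A (\<lambda>x. 0) x = 0"
    using PP_scaleR[OF cb_zero[of L "Suc (Suc 0)"], of V A 0] by (simp add: fun_eq_iff)
  then show ?case by (simp add: tay_def[abs_def])
next
  case (Suc n)
  obtain B where B: "cb L (Suc (Suc 0)) B (tay V A u n s)"
    using rcb_tay[of n 2 s] Suc.prems unfolding rcb_def numeral_2_eq_2 by auto
  obtain B' where B': "cb L (Suc (Suc 0)) B' ((PP V A ^^ n) u)"
    using rcb_PP_pow[of n 2] Suc.prems unfolding rcb_def numeral_2_eq_2 by auto
  have "tay V A u (Suc n) s = (\<lambda>x. tay V A u n s x + (s ^ n / fact n) *\<^sub>R (PP V A ^^ n) u x)"
    by (simp add: tay_def[abs_def])
  then have "PP V A (tay V A u (Suc n) s) x = PP V A (tay V A u n s) x + (s ^ n / fact n) *\<^sub>R PP V A ((PP V A ^^ n) u) x"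
    using PP_add[OF B cb_scaleR[OF B']] PP_scaleR[OF B'] by simp
  then show ?case using Suc by simp
qed

lemma tay_deriv:
  fixes Z :: "nat \<Rightarrow> complex^2"
  shows "((\<lambda>s. \<Sum>j<Suc n. (s ^ j / fact j) *\<^sub>R Z j) has_vector_derivative (\<Sum>j<n. (s ^ j / fact j) *\<^sub>R Z (Suc j))) (at s within T)"
proof -
  have "((\<lambda>s. (s ^ Suc j / fact (Suc j)) *\<^sub>R Z (Suc j)) has_vector_derivative (s ^ j / fact j) *\<^sub>R Z (Suc j)) (at s within T)" for j
  proof -
    have "real (Suc j) * s ^ j / fact (Suc j) = s ^ j / fact j"
      unfolding fact_Suc by (rule mult_divide_mult_cancel_left) (rule of_nat_neq_0)
    then have "((\<lambda>s. s ^ Suc j / fact (Suc j)) has_real_derivative s ^ j / fact j) (at s within T)"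
      using DERIV_cdivide[OF DERIV_pow[of "Suc j" s T], of "fact (Suc j)"] by simp
    then show ?thesis
      using has_vector_derivative_scaleR[of "\<lambda>r. r ^ Suc j / fact (Suc j)" "s ^ j / fact j" s T "\<lambda>_. Z (Suc j)" 0] by simp
  qed
  then have "((\<lambda>s. Z 0 + (\<Sum>j<n. (s ^ Suc j / fact (Suc j)) *\<^sub>R Z (Suc j))) has_vector_derivative
      0 + (\<Sum>j<n. (s ^ j / fact j) *\<^sub>R Z (Suc j))) (at s within T)"
    by (intro has_vector_derivative_add has_vector_derivative_const has_vector_derivative_sum)
  then show ?thesis unfolding sum.lessThan_Suc_shift power_0 fact_0 div_by_1 scaleR_one by (simp only: add_0)
qed

definition rem :: "nat \<Rightarrow> real \<Rightarrow> real \<Rightarrow> complex^2" where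
  "rem n s x = \<phi> s x - tay V A u n s x"

lemma rcb_\<phi>: "s \<in> {0..S} \<Longrightarrow> k \<le> 5 \<Longrightarrow> rcb L k (\<phi> s)"
  unfolding rcb_def using cb_le[OF \<phi>] by blast

lemma DDk_diff: "rcb L (Suc k) f \<Longrightarrow> rcb L (Suc k) g \<Longrightarrow> (DD ^^ k) (\<lambda>x. f x - g x) x = (DD ^^ k) f x - (DD ^^ k) (g :: real \<Rightarrow> complex^2) x"
  using DDk_add[of L k f "\<lambda>x. (-1) *\<^sub>R g x"] DDk_scaleR[of L k g "-1"] rcb_scaleR[of L "Suc k" g "-1"] by simp

lemma PP_rem: "n \<le> 4 \<Longrightarrow> s \<in> {0..S} \<Longrightarrow> PP V A (rem n s) x = PP V A (\<phi> s) x - (\<Sum>j<n. (s ^ j / fact j) *\<^sub>R (PP V A ^^ Suc j) u x)"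
proof -
  assume n: "n \<le> 4" and s: "s \<in> {0..S}"
  obtain B where B: "cb L (Suc (Suc 0)) B (tay V A u n s)"
    using rcb_tay[of n 2 s] n unfolding rcb_def numeral_2_eq_2 by auto
  have B': "cb L (Suc (Suc 0)) BU (\<phi> s)" by (rule cb_le[OF \<phi>[OF s]]) simp
  have "rem n s = (\<lambda>x. \<phi> s x + (-1) *\<^sub>R tay V A u n s x)" by (auto simp: rem_def)
  then have "PP V A (rem n s) x = PP V A (\<phi> s) x + (-1) *\<^sub>R PP V A (tay V A u n s) x"
    unfolding PP_add[OF B' cb_scaleR[OF B], of V A "-1"] PP_scaleR[OF B, of V A "-1", symmetric]
    by (simp only: PP_add[OF B' cb_scaleR[OF B]] PP_scaleR[OF B])
  then show ?thesis using PP_tay[OF n] by simp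
qed

text \<open>Differentiating the Taylor polynomial in s lowers its degree and applies the generator,
  so the time derivative of \<open>rem (Suc n)\<close> is the generator applied to
  \<open>rem n\<close>. This recursion drives the estimate of the remainders.\<close>

lemma rem_deriv:
  assumes n: "n \<le> 4" and k: "n + k \<le> 4" "k \<le> 3" and s: "s \<in> {0..S}"
  shows "((\<lambda>s. (DD ^^ k) (rem (Suc n) s) x) has_vector_derivative (DD ^^ k) (PP V A (rem n s)) x) (at s within {0..S})"
proof -
  have e: "(DD ^^ k) (rem (Suc n) s) x = (DD ^^ k) (\<phi> s) x - (\<Sum>j<Suc n. (s ^ j / fact j) *\<^sub>R (DD ^^ k) ((PP V A ^^ j) u) x)"
    if "s \<in> {0..S}" for s
  proof -
    have "(DD ^^ k) (rem (Suc n) s) x = (DD ^^ k) (\<phi> s) x - (DD ^^ k) (tay V A u (Suc n) s) x"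
      unfolding rem_def[abs_def] using n k that by (intro DDk_diff rcb_\<phi> rcb_tay) auto
    then show ?thesis using DDk_tay[of "Suc n" k s x] n k by simp
  qed
  have PPr: "PP V A (rem n s) = (\<lambda>x. PP V A (\<phi> s) x - (\<Sum>j<n. (s ^ j / fact j) *\<^sub>R (PP V A ^^ Suc j) u x))"
    using PP_rem[OF n s] by auto
  have rP: "rcb L (Suc k) (PP V A (\<phi> s))"
  proof -
    have "cb L (Suc (Suc k)) BU (\<phi> s)" using k by (intro cb_le[OF \<phi>[OF s]]) auto
    from cb_PP[OF V this k(2)] show ?thesis unfolding rcb_def by blast
  qed
  have rj: "rcb L (Suc k) ((PP V A ^^ Suc j) u)" if "j < n" for j
    using n k that by (intro rcb_PP_pow) auto
  have "(DD ^^ k) (PP V A (rem n s)) x = (DD ^^ k) (PP V A (\<phi> s)) x - (DD ^^ k) (\<lambda>x. \<Sum>j<n. (s ^ j / fact j) *\<^sub>R (PP V A ^^ Suc j) u x) x"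
    unfolding PPr by (intro DDk_diff rP rcb_sum rcb_scaleR rj) auto
  also have "(DD ^^ k) (\<lambda>x. \<Sum>j<n. (s ^ j / fact j) *\<^sub>R (PP V A ^^ Suc j) u x) x = (\<Sum>j<n. (DD ^^ k) (\<lambda>x. (s ^ j / fact j) *\<^sub>R (PP V A ^^ Suc j) u x) x)"
    by (subst DDk_sum[where L=L]) (auto intro!: rcb_scaleR rj simp del: funpow.simps)
  also have "\<dots> = (\<Sum>j<n. (s ^ j / fact j) *\<^sub>R (DD ^^ k) ((PP V A ^^ Suc j) u) x)"
    by (intro sum.cong refl) (use DDk_scaleR[OF rj] in \<open>auto simp del: funpow.simps\<close>)
  finally have g: "(DD ^^ k) (PP V A (rem n s)) x = (DD ^^ k) (PP V A (\<phi> s)) x - (\<Sum>j<n. (s ^ j / fact j) *\<^sub>R (DD ^^ k) ((PP V A ^^ Suc j) u) x)" .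
  show ?thesis
    unfolding g
  proof (rule has_vector_derivative_transform[OF s])
    show "((\<lambda>s. (DD ^^ k) (\<phi> s) x - (\<Sum>j<Suc n. (s ^ j / fact j) *\<^sub>R (DD ^^ k) ((PP V A ^^ j) u) x)) has_vector_derivative
       (DD ^^ k) (PP V A (\<phi> s)) x - (\<Sum>j<n. (s ^ j / fact j) *\<^sub>R (DD ^^ k) ((PP V A ^^ Suc j) u) x)) (at s within {0..S})"
      by (rule has_vector_derivative_diff[OF \<phi>_deriv[OF k(2) s] tay_deriv])
  qed (use e in auto)
qed

lemma rem_zero: "n + k \<le> 4 \<Longrightarrow> (DD ^^ k) (rem (Suc n) 0) x = 0"
proof -
  assume n: "n + k \<le> 4"
  have "tay V A u (Suc n) 0 = u"
    by (rule ext) (simp add: tay_def sum.lessThan_Suc_shift del: sum.lessThan_Suc)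
  then have "rem (Suc n) 0 = (\<lambda>x. 0)" by (auto simp: rem_def)
  then show ?thesis by (simp add: DDk_zero)
qed

text \<open>Every integration in time gains one power of \<open>s\<close> and loses one space derivative.\<close>

lemma cb_rem: "n \<le> 4 \<Longrightarrow> s \<in> {0..S} \<Longrightarrow> cb L (5 - n) (K ^ n * BU * s ^ n) (rem n s)"
proof (induction n arbitrary: s)
  case 0
  have "rem 0 s = \<phi> s" by (auto simp: rem_def tay_def)
  then show ?case using \<phi>[OF "0.prems"(2)] by simp
next
  case (Suc n)
  have e: "5 - n = Suc (Suc (3 - n))" "5 - Suc n = Suc (3 - n)" using Suc.prems by auto
  show ?case unfolding e(2)
  proof (rule cb_time_integral[where g="\<lambda>s. PP V A (rem n s)"])
    show "rcb L (Suc (3 - n)) (rem (Suc n) s)" if "s \<in> {0..S}" for s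
      unfolding rem_def[abs_def] using Suc.prems that by (intro rcb_diff rcb_\<phi> rcb_tay) auto
    show "cb L (Suc (3 - n)) (K ^ Suc n * BU * s ^ n) (PP V A (rem n s))" if "s \<in> {0..S}" for s
    proof -
      have "cb L (Suc (Suc (3 - n))) (K ^ n * BU * s ^ n) (rem n s)"
        using Suc.IH[OF _ that] Suc.prems e(1) by simp
      from cb_PP[OF V this] show ?thesis by (simp add: mult_ac)
    qed
    show "((\<lambda>s. (DD ^^ k) (rem (Suc n) s) x) has_vector_derivative (DD ^^ k) (PP V A (rem n s)) x) (at s within {0..S})"
      if "k \<le> 3 - n" "s \<in> {0..S}" for k s x
      using that Suc.prems by (intro rem_deriv) auto
    show "(DD ^^ k) (rem (Suc n) 0) x = 0" if "k \<le> 3 - n" for k x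
      using that Suc.prems by (intro rem_zero) auto
  qed (use Suc.prems K in auto)
qed

text \<open>The last integration stands outside the induction: of \<open>rem 4\<close> only a
  supremum and a Lipschitz bound are left, and the generator turns these into a supremum bound
  without any Lipschitz bound.\<close>

lemma rem5: "s \<in> {0..S} \<Longrightarrow> norm (rem 5 s x) \<le> K ^ 5 * BU * s ^ 5"
proof -
  assume s: "s \<in> {0..S}"
  have five: "K ^ 5 = K * K ^ 4" by (simp flip: power_Suc)
  have "norm (rem (Suc 4) s x) \<le> (K ^ 5 * BU) * s ^ Suc 4"
  proof (rule time_growth[of S _ "\<lambda>s. PP V A (rem 4 s) x"])
    show "((\<lambda>s. rem (Suc 4) s x) has_vector_derivative PP V A (rem 4 s) x) (at s within {0..S})" if "s \<in> {0..S}" for s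
      using rem_deriv[of 4 0 s x] that by simp
    show "rem (Suc 4) 0 x = 0" using rem_zero[of 4 0 x] by simp
    show "norm (PP V A (rem 4 s) x) \<le> (K ^ 5 * BU) * s ^ 4" if s: "s \<in> {0..S}" for s
    proof -
      let ?B = "K ^ 4 * BU * s ^ 4"
      have c: "cb L (Suc 0) ?B (rem 4 s)" using cb_rem[of 4 s] s by simp
      have B0: "0 \<le> ?B" by (rule cb_nonneg[OF c])
      obtain B' where B': "cb L (Suc (Suc 0)) B' (rem 4 s)"
      proof -
        have "rcb L (Suc (Suc 0)) (rem 4 s)"
          unfolding rem_def[abs_def] using s by (intro rcb_diff rcb_\<phi> rcb_tay) auto
        then show ?thesis using that unfolding rcb_def by blast
      qed
      have "norm (TT (rem 4 s) x) \<le> 2 * ?B"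
        by (rule TT_bound) (use cb_bdd[OF c] cb_lip[OF c] cb_deriv[OF B'] in auto)
      moreover have "norm (WW V A (rem 4 s) x) \<le> 32 * BV * ?B"
      proof -
        have "norm (WW V A (rem 4 s) x) \<le> (\<bar>V x\<bar> + \<bar>A x\<bar>) * norm (rem 4 s x)"
          unfolding WW_def by (rule W_mat_bound)
        also have "\<dots> \<le> (BV + BV) * ?B"
          using cb_bdd[OF V(1), of x] cb_bdd[OF V(2), of x] cb_bdd[OF c, of x] cb_nonneg[OF V(1)]
          by (intro mult_mono add_mono) auto
        also have "\<dots> \<le> (32 * BV) * ?B" using B0 cb_nonneg[OF V(1)] by (intro mult_right_mono) auto
        finally show ?thesis .
      qed
      ultimately have "norm (PP V A (rem 4 s) x) \<le> 2 * ?B + 32 * BV * ?B"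
        unfolding PP_def by (rule norm_triangle_mono)
      also have "\<dots> = K * ?B" by (simp add: distrib_right)
      also have "\<dots> = (K ^ 5 * BU) * s ^ 4" unfolding five by (simp only: mult_ac)
      finally show ?thesis .
    qed
  qed (use s K in auto)
  then show ?thesis by simp
qed

text \<open>Expansion of a power of T + W into non-commutative monomials. Linearity of the generator
  holds only for differentiable arguments, hence the inner induction, which is restricted to words
  of length at most three.\<close>

lemma PP_pow_words: "j \<le> 4 \<Longrightarrow> (PP V A ^^ j) u x = (\<Sum>w | length w = j. wop V A w u x)"
proof (induction j arbitrary: x)
  case 0
  have "{w :: bool list. length w = 0} = {[]}" by auto
  then show ?case by simp
next
  case (Suc j)
  have fin: "finite {w :: bool list. length w = n}" for n
    by (rule finite_subset[OF _ finite_words[of n]]) auto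
  have cw: "rcb L (Suc (Suc 0)) (wop V A w u)" if "length w \<le> 3" for w
  proof -
    have "0 \<in> {0..S}" using S by simp
    then have "cb L (5 - length w) (K ^ length w * BU) (wop V A w u)" using that by (intro cb_wop[OF V \<phi>]) auto
    from cb_le[OF this, of "Suc (Suc 0)"] that show ?thesis
      unfolding rcb_def by (intro exI[of _ "K ^ length w * BU"]) (simp del: cb.simps)
  qed
  have lin: "PP V A (\<lambda>x. \<Sum>w\<in>W. wop V A w u x) x = (\<Sum>w\<in>W. PP V A (wop V A w u) x)"
    if "finite W" "W \<subseteq> {w. length w \<le> 3}" for W x
    using that
  proof (induction W rule: finite_induct)
    case empty
    show ?case using PP_scaleR[OF cb_zero[of L "Suc (Suc 0)"], of V A 0] by (simp add: fun_eq_iff)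
  next
    case (insert w W)
    have "rcb L (Suc (Suc 0)) (\<lambda>x. \<Sum>w\<in>W. wop V A w u x)" using insert by (intro rcb_sum cw) auto
    moreover have "rcb L (Suc (Suc 0)) (wop V A w u)" using insert by (intro cw) auto
    ultimately obtain B B' where B: "cb L (Suc (Suc 0)) B (\<lambda>x. \<Sum>w\<in>W. wop V A w u x)" "cb L (Suc (Suc 0)) B' (wop V A w u)"
      unfolding rcb_def by blast
    have "PP V A (\<lambda>x. wop V A w u x + (\<Sum>w\<in>W. wop V A w u x)) x = PP V A (wop V A w u) x + PP V A (\<lambda>x. \<Sum>w\<in>W. wop V A w u x) x"
      by (rule fun_cong[OF PP_add[OF B(2,1)]])
    then show ?case using insert by simp
  qed
  have "(PP V A ^^ j) u = (\<lambda>x. \<Sum>w | length w = j. wop V A w u x)"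
    by (rule ext, rule Suc.IH) (use Suc.prems in simp)
  then have "(PP V A ^^ Suc j) u x = (\<Sum>w | length w = j. PP V A (wop V A w u) x)"
    using lin[OF fin[of j], of x] Suc.prems by (simp add: subset_eq)
  also have "\<dots> = (\<Sum>w | length w = j. wop V A (True # w) u x) + (\<Sum>w | length w = j. wop V A (False # w) u x)"
    by (simp add: PP_def sum.distrib)
  also have "\<dots> = (\<Sum>w\<in>Cons True ` {w. length w = j}. wop V A w u x) + (\<Sum>w\<in>Cons False ` {w. length w = j}. wop V A w u x)"
    by (simp add: sum.reindex)
  also have "\<dots> = (\<Sum>w\<in>Cons True ` {w. length w = j} \<union> Cons False ` {w. length w = j}. wop V A w u x)"
    by (rule sum.union_disjoint[symmetric]) (use fin in auto)
  also have "Cons True ` {w. length w = j} \<union> Cons False ` {w. length w = j} = {w. length w = Suc j}"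
  proof (intro equalityI subsetI)
    fix w :: "bool list" assume "w \<in> {w. length w = Suc j}"
    then obtain b v where "w = b # v" "length v = j" by (auto simp: length_Suc_conv)
    then show "w \<in> Cons True ` {w. length w = j} \<union> Cons False ` {w. length w = j}" by (cases b) auto
  qed auto
  finally show ?case .
qed

text \<open>Puts the Taylor polynomial of the exact flow into the same form as the expansion of the
  scheme, with the coefficients 1/n! that \<open>p5_eq\<close> has found there.\<close>

lemma tay_words: "tay V A u 5 s x = (\<Sum>w\<in>W4. (1 / fact (length w)) *\<^sub>R (s ^ length w *\<^sub>R wop V A w u x))"
proof -
  have "tay V A u 5 s x = (\<Sum>j<5. (s ^ j / fact j) *\<^sub>R (\<Sum>w | length w = j. wop V A w u x))"
    unfolding tay_def by (intro sum.cong refl) (simp add: PP_pow_words)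
  also have "\<dots> = (\<Sum>j<5. \<Sum>w | w \<in> W4 \<and> length w = j. (1 / fact (length w)) *\<^sub>R (s ^ length w *\<^sub>R wop V A w u x))"
  proof (rule sum.cong[OF refl])
    fix j :: nat assume "j \<in> {..<5}"
    then have "{w \<in> W4. length w = j} = {w. length w = j}" by (auto simp: W4_def)
    then show "(s ^ j / fact j) *\<^sub>R (\<Sum>w | length w = j. wop V A w u x) = (\<Sum>w | w \<in> W4 \<and> length w = j. (1 / fact (length w)) *\<^sub>R (s ^ length w *\<^sub>R wop V A w u x))"
      by (simp add: scaleR_sum_right)
  qed
  also have "\<dots> = (\<Sum>w\<in>W4. (1 / fact (length w)) *\<^sub>R (s ^ length w *\<^sub>R wop V A w u x))"
    by (rule sum.group) (auto intro: finite_subset[OF _ finite_words[of 4]] simp: W4_def)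
  finally show ?thesis .
qed

end

section \<open>Local error and stability\<close>

definition flow_data :: "nat \<Rightarrow> real \<Rightarrow> real \<Rightarrow> real \<Rightarrow> real \<Rightarrow> (real \<Rightarrow> real) \<Rightarrow> (real \<Rightarrow> real) \<Rightarrow>
    (real \<Rightarrow> real \<Rightarrow> complex^2) \<Rightarrow> bool" where
  "flow_data m BV BU L S V A \<phi> \<longleftrightarrow> 0 < L \<and> 0 < S \<and> cb L m BV V \<and> cb L m BV A \<and>
     (\<forall>s\<in>{0..S}. cb L m BU (\<phi> s) \<and> cb L 5 BU (\<phi> s)) \<and>
     (\<forall>k\<le>3. \<forall>s\<in>{0..S}. \<forall>x.
        ((\<lambda>s. (DD ^^ k) (\<phi> s) x) has_vector_derivative (DD ^^ k) (PP V A (\<phi> s)) x) (at s within {0..S}))"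

type_synonym flow_datum =
  "real \<times> real \<times> (real \<Rightarrow> real) \<times> (real \<Rightarrow> real) \<times> (real \<Rightarrow> real \<Rightarrow> complex^2) \<times> nat"

text \<open>The uniform constant is obtained by taking the tuple of data itself as the index and all
  admissible tuples as the index set: a constant for this one family serves every instance.\<close>

lemma local_error:
  assumes m: "4 \<le> m"
  shows "\<exists>C\<ge>0. \<forall>L S V A \<phi> M. flow_data m BV BU L S V A \<phi> \<longrightarrow> S \<le> 1/2 \<longrightarrow> 0 < M \<longrightarrow> even M \<longrightarrow>
    gnorm M (\<lambda>j. S4c_step 1 0 L V A M S (\<lambda>j. \<phi> 0 (gp L M j)) j - \<phi> S (gp L M j)) \<le> C * (S ^ 5 + (L / real M) ^ m)"
proof -
  define I where "I = {(L, S, V, A, \<phi>, M). flow_data m BV BU L S V A \<phi> \<and> S \<le> 1/2 \<and> 0 < M \<and> even M} \<inter> (UNIV :: flow_datum set)"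
  \<comment> \<open>Chosen so that L/(N+2) <= S^5, the smoothing error that the expansions
    tolerate.\<close>
  define N where "N i = (case i of (L, S, V, A, \<phi>, M) \<Rightarrow> nat \<lceil>L / S ^ 5\<rceil>)"
    for i :: flow_datum
  let ?L = "(\<lambda>(L, S, V, A, \<phi>, M). L) :: flow_datum \<Rightarrow> real" and ?S = "(\<lambda>(L, S, V, A, \<phi>, M). S) :: flow_datum \<Rightarrow> real"
    and ?V = "(\<lambda>(L, S, V, A, \<phi>, M). V) :: flow_datum \<Rightarrow> _" and ?A = "(\<lambda>(L, S, V, A, \<phi>, M). A) :: flow_datum \<Rightarrow> _"
    and ?f = "(\<lambda>(L, S, V, A, \<phi>, M). \<phi>) :: flow_datum \<Rightarrow> _" and ?u = "(\<lambda>(L, S, V, A, \<phi>, M). \<phi> 0) :: flow_datum \<Rightarrow> _"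
    and ?M = "(\<lambda>(L, S, V, A, \<phi>, M). M) :: flow_datum \<Rightarrow> _"
  have N: "L / real (nat \<lceil>L / S ^ 5\<rceil> + 2) \<le> S ^ 5" if "0 < L" "0 < S" for L S :: real
  proof -
    have "L / S ^ 5 \<le> real (nat \<lceil>L / S ^ 5\<rceil> + 2)"
      using real_nat_ceiling_ge[of "L / S ^ 5"] by simp
    then have "L \<le> S ^ 5 * real (nat \<lceil>L / S ^ 5\<rceil> + 2)" using that by (simp add: field_simps)
    then show ?thesis by (subst pos_divide_le_eq) auto
  qed
  interpret D: dirac_scheme I ?L ?S ?V ?A ?u BV BU m ?M N
  proof unfold_locales
    show "?L i / real (N i + 2) \<le> ?S i ^ 5" if "i \<in> I" for i
      using that N by (auto simp: I_def N_def flow_data_def)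
  qed (use m in \<open>auto simp: I_def flow_data_def\<close>)
  obtain F where F: "D.ga (\<lambda>i. S4c_step 1 0 (?L i) (?V i) (?A i) (?M i) (?S i) (\<lambda>j. ?u i (gp (?L i) (?M i) j))) F"
    "D.asy F (\<lambda>w. 1 / fact (length w))" using D.scheme_asy by blast
  have ex: "D.asy (\<lambda>i. ?f i (?S i)) (\<lambda>w. 1 / fact (length w))"
    unfolding D.asy_def D.bigO_def
  proof (intro exI[of _ "\<bar>(2 + 32 * BV) ^ 5 * BU\<bar>"] conjI ballI allI)
    fix i x assume "i \<in> I"
    then obtain L S V A \<phi> M where i: "i = (L, S, V, A, \<phi>, M)" and f: "flow_data m BV BU L S V A \<phi>"
      by (auto simp: I_def)
    interpret E: dirac_flow L S BV BU V A \<phi>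
      by unfold_locales (use f m in \<open>auto simp: flow_data_def intro: cb_le simp del: cb.simps\<close>)
    have S: "S \<in> {0..S}" using E.S by simp
    have "norm (E.rem 5 S x) \<le> \<bar>(2 + 32 * BV) ^ 5 * BU\<bar> * S ^ 5"
      using E.rem5[OF S, of x] E.S by (meson abs_ge_self less_imp_le mult_right_mono order_trans zero_le_power)
    then show "norm (?f i (?S i) x - (\<Sum>w\<in>W4. (1 / fact (length w)) *\<^sub>R D.Wd w i x)) \<le> \<bar>(2 + 32 * BV) ^ 5 * BU\<bar> * ?S i ^ 5"
      by (simp only: i prod.case D.Wd_def E.rem_def E.tay_words)
  qed simp
  obtain C where C: "C \<ge> 0" "\<And>i. i \<in> I \<Longrightarrow> gnorm (?M i) (\<lambda>j. S4c_step 1 0 (?L i) (?V i) (?A i) (?M i) (?S i) (\<lambda>j. ?u i (gp (?L i) (?M i) j)) j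
      - F i (gp (?L i) (?M i) j)) \<le> C * (?S i ^ 5 + (?L i / real (?M i)) ^ m)"
    using F(1) unfolding D.ga_def by blast
  obtain D where D: "D \<ge> 0" "\<And>i x. i \<in> I \<Longrightarrow> norm (F i x - ?f i (?S i) x) \<le> D * ?S i ^ 5"
    using D.asy_unique[OF F(2) ex] unfolding D.bigO_def by blast
  show ?thesis
  proof (intro exI[of _ "C + D"] conjI allI impI)
    fix L S :: real and V A :: "real \<Rightarrow> real" and \<phi> :: "real \<Rightarrow> real \<Rightarrow> complex^2" and M :: nat
    assume a: "flow_data m BV BU L S V A \<phi>" "S \<le> 1/2" "0 < M" "even M"
    let ?i = "(L, S, V, A, \<phi>, M)"
    have i: "?i \<in> I" using a by (simp add: I_def)
    have pos: "0 < L" "0 < S" using a(1) by (auto simp: flow_data_def)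
    have 1: "gnorm M (\<lambda>j. S4c_step 1 0 L V A M S (\<lambda>j. \<phi> 0 (gp L M j)) j - F ?i (gp L M j)) \<le> C * (S ^ 5 + (L / real M) ^ m)"
      using C(2)[OF i] by simp
    have 2: "gnorm M (\<lambda>j. F ?i (gp L M j) - \<phi> S (gp L M j)) \<le> D * S ^ 5"
      using D(2)[OF i] D(1) pos a(3) by (intro gnorm_le_sup) auto
    have "D * S ^ 5 \<le> D * (S ^ 5 + (L / real M) ^ m)"
      using D(1) pos by (intro mult_left_mono) auto
    then show "gnorm M (\<lambda>j. S4c_step 1 0 L V A M S (\<lambda>j. \<phi> 0 (gp L M j)) j - \<phi> S (gp L M j)) \<le> (C + D) * (S ^ 5 + (L / real M) ^ m)"
      using order_trans[OF gnorm_triangle_diff add_mono[OF 1 2]] by (simp add: distrib_right)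
  qed (use C(1) D(1) in simp)
qed

section \<open>Stability of one step and its invariance under rescaling\<close>

lemma gnorm_exp_mult:
  assumes "\<And>x v. v \<bullet> (B x *v v) = 0"
  shows "gnorm M (\<lambda>j. exp_mult a b M B U j - exp_mult a b M B U' j) = gnorm M (\<lambda>j. U j - U' j)"
  unfolding exp_mult_def matrix_vector_mult_diff_distrib[symmetric]
  by (intro gnorm_cong norm_mexp_skew assms)

lemma skew_scaleR: "v \<bullet> (A *v v) = 0 \<Longrightarrow> v \<bullet> ((c *\<^sub>R A) *v (v :: complex^2)) = 0"
  by (simp add: matrix_vector_mult_scaleR)

lemma skew_add: "v \<bullet> (A *v v) = 0 \<Longrightarrow> v \<bullet> (B *v v) = 0 \<Longrightarrow> v \<bullet> ((A + B) *v (v :: complex^2)) = 0"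
  by (simp add: matrix_vector_mult_add_rdistrib inner_add_right)

lemma gnorm_step:
  assumes "0 < L" "0 < M" "even M"
  shows "gnorm M (\<lambda>j. S4c_step 1 0 L V A M s U j - S4c_step 1 0 L V A M s U' j) = gnorm M (\<lambda>j. U j - U' j)"
proof -
  have "gnorm M (\<lambda>j. exp_T 1 0 L M r U j - exp_T 1 0 L M r U' j) = gnorm M (\<lambda>j. U j - U' j)" for r U U'
    unfolding exp_T_diff[symmetric] by (rule gnorm_exp_T[OF assms])
  then show ?thesis
    unfolding S4c_step_def comp_def
    by (simp add: gnorm_exp_mult skew_add skew_scaleR W_mat_skew WTW_mat_skew)
qed

text \<open>At the nodes the Fourier modes depend on the mode, the node and M, but not on the
  interval.\<close>

lemma dft_scale:
  assumes "a < b" "0 < \<epsilon>" "\<And>j. j < M \<Longrightarrow> U j = U' j"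
  shows "dft a b M U l = dft 0 ((b - a) / \<epsilon>) M U' l"
proof -
  have "0 < b - a" "0 < (b - a) / \<epsilon>" using assms by auto
  then show ?thesis unfolding dft_eq by (simp add: ee_grid assms(3) diff_divide_distrib)
qed

text \<open>The frequencies of the stretched interval are \<epsilon> times the original ones, so
  both terms of the symbol acquire the same factor 1/\<epsilon>.\<close>

lemma T_symbol_scale:
  assumes "a < b" "0 < \<epsilon>"
  shows "s *\<^sub>R T_symbol \<epsilon> (freq a b l) = (s / \<epsilon>) *\<^sub>R T_symbol 1 (freq 0 ((b - a) / \<epsilon>) l)"
  using assms by (simp add: T_symbol_def cscale_def freq_def vec_eq_iff forall_2 sigma1_def sigma3_def scaleR_complex field_simps)

lemma exp_T_scale:
  assumes "a < b" "0 < \<epsilon>" "\<And>j. j < M \<Longrightarrow> U j = U' j"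
  shows "exp_T \<epsilon> a b M s U j = exp_T 1 0 ((b - a) / \<epsilon>) M (s / \<epsilon>) U' j"
proof -
  have p: "0 < b - a" "0 < (b - a) / \<epsilon>" using assms by auto
  have "ee (b - a) l (gp (b - a) M j) = ee ((b - a) / \<epsilon>) l (gp ((b - a) / \<epsilon>) M j)" for l
    by (simp only: ee_grid[OF p(1)] ee_grid[OF p(2)])
  then show ?thesis
    unfolding exp_T_def exp_ee
    by (simp only: T_symbol_scale[OF assms(1,2)] dft_scale[OF assms] grid_shift diff_zero)
qed

lemma W_mat_scale:
  fixes V V' A A' :: "real \<Rightarrow> real"
  shows "V x = V' y \<Longrightarrow> A x = A' y \<Longrightarrow> s *\<^sub>R W_mat \<epsilon> V A x = (s / \<epsilon>) *\<^sub>R W_mat 1 V' A' y"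
  by (simp add: W_mat_def cscale_def vec_eq_iff forall_2 sigma1_def mat_def scaleR_complex)

text \<open>The double commutator carries \<epsilon>^(-3), which the third power of the time step
  absorbs; this is why the corrected scheme keeps its form under the rescaling.\<close>

lemma WTW_mat_scale: "A x = A' y \<Longrightarrow> (s ^ 3 / 72) *\<^sub>R WTW_mat \<epsilon> A x = ((s / \<epsilon>) ^ 3 / 72) *\<^sub>R WTW_mat 1 A' y"
  by (simp add: WTW_mat_def cscale_def vec_eq_iff forall_2 sigma3_def scaleR_complex power_divide)

lemma S4c_step_scale:
  assumes ab: "a < b" and \<epsilon>: "0 < \<epsilon>" and V: "\<And>j. j < M \<Longrightarrow> V (grid a b M j) = V' (gp ((b - a) / \<epsilon>) M j)"
    and A: "\<And>j. j < M \<Longrightarrow> A (grid a b M j) = A' (gp ((b - a) / \<epsilon>) M j)" and U: "\<And>j. j < M \<Longrightarrow> U j = U' j" and j: "j < M"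
  shows "S4c_step \<epsilon> a b V A M \<tau> U j = S4c_step 1 0 ((b - a) / \<epsilon>) V' A' M (\<tau> / \<epsilon>) U' j"
proof -
  have 1: "exp_mult a b M (\<lambda>x. (\<tau> / 6) *\<^sub>R W_mat \<epsilon> V A x) X i
      = exp_mult 0 ((b - a) / \<epsilon>) M (\<lambda>x. (\<tau> / \<epsilon> / 6) *\<^sub>R W_mat 1 V' A' x) X' i"
    if "i < M" "X i = X' i" for X X' i
    using W_mat_scale[where V=V and V'=V' and A=A and A'=A' and x="grid a b M i" and y="gp ((b - a) / \<epsilon>) M i" and \<epsilon>=\<epsilon> and s="\<tau> / 6", OF V[OF that(1)] A[OF that(1)]] that(2) by (simp add: exp_mult_def mult.commute)
  have 2: "exp_mult a b M (\<lambda>x. (2 / 3 * \<tau>) *\<^sub>R W_mat \<epsilon> V A x + (\<tau> ^ 3 / 72) *\<^sub>R WTW_mat \<epsilon> A x) X i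
      = exp_mult 0 ((b - a) / \<epsilon>) M (\<lambda>x. (2 / 3 * (\<tau> / \<epsilon>)) *\<^sub>R W_mat 1 V' A' x + ((\<tau> / \<epsilon>) ^ 3 / 72) *\<^sub>R WTW_mat 1 A' x) X' i"
    if "i < M" "X i = X' i" for X X' i
    using W_mat_scale[where V=V and V'=V' and A=A and A'=A' and x="grid a b M i" and y="gp ((b - a) / \<epsilon>) M i" and \<epsilon>=\<epsilon> and s="2 / 3 * \<tau>", OF V[OF that(1)] A[OF that(1)]] WTW_mat_scale[where A=A and A'=A' and x="grid a b M i" and y="gp ((b - a) / \<epsilon>) M i", OF A[OF that(1)], of \<tau> \<epsilon>] that(2)
    by (simp add: exp_mult_def)
  have 3: "exp_T \<epsilon> a b M (\<tau> / 2) X i = exp_T 1 0 ((b - a) / \<epsilon>) M (\<tau> / \<epsilon> / 2) X' i"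
    if "\<And>i. i < M \<Longrightarrow> X i = X' i" for X X' i
    using exp_T_scale[OF ab \<epsilon> that, where s="\<tau> / 2" and j=i] by (simp add: mult.commute)
  show ?thesis
    unfolding S4c_step_def comp_def by (intro 1 2 3 U j)
qed

section \<open>Interpolants and the L2 norm\<close>

lemma trig_norm_integral:
  fixes c :: "int \<Rightarrow> complex"
  assumes L: "0 < L" and fin: "finite S"
  shows "((\<lambda>y. (cmod (\<Sum>l\<in>S. ee L l y * c l))\<^sup>2) has_integral L * (\<Sum>l\<in>S. (cmod (c l))\<^sup>2)) {0..L}"
proof -
  have e: "of_real ((cmod (\<Sum>l\<in>S. ee L l y * c l))\<^sup>2) = (\<Sum>l\<in>S. \<Sum>k\<in>S. (c l * cnj (c k)) * ee L (l - k) y)" for y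
    unfolding complex_norm_square cnj_sum sum_product
    by (intro sum.cong refl) (simp add: cnj_ee ee_add_freq[of L _ y "- _", simplified, symmetric] mult_ac)
  have "((\<lambda>y. \<Sum>l\<in>S. \<Sum>k\<in>S. (c l * cnj (c k)) * ee L (l - k) y) has_integral
      (\<Sum>l\<in>S. \<Sum>k\<in>S. (c l * cnj (c k)) * (if l - k = 0 then of_real L else 0))) {0..L}"
    by (intro has_integral_sum fin has_integral_mult_right ee_integral L)
  moreover have "(\<Sum>l\<in>S. \<Sum>k\<in>S. (c l * cnj (c k)) * (if l - k = 0 then of_real L else 0)) = of_real (L * (\<Sum>l\<in>S. (cmod (c l))\<^sup>2))"
  proof -
    have "(\<Sum>k\<in>S. (c l * cnj (c k)) * (if l - k = 0 then of_real L else 0)) = of_real L * (c l * cnj (c l))" if "l \<in> S" for l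
    proof -
      have "(\<Sum>k\<in>S. (c l * cnj (c k)) * (if l - k = 0 then of_real L else 0)) = (\<Sum>k\<in>S. if l = k then of_real L * (c l * cnj (c l)) else 0)"
        by (intro sum.cong refl) auto
      then show ?thesis using fin that by simp
    qed
    then show ?thesis by (simp add: sum_distrib_left complex_norm_square flip: of_real_power)
  qed
  ultimately have "((\<lambda>y. complex_of_real ((cmod (\<Sum>l\<in>S. ee L l y * c l))\<^sup>2)) has_integral of_real (L * (\<Sum>l\<in>S. (cmod (c l))\<^sup>2))) {0..L}"
    unfolding e by simp
  from has_integral_linear[OF this bounded_linear_Re] show ?thesis by (simp add: comp_def)
qed

lemma interpolant_eq: "interpolant a b M U x = (\<Sum>l\<in>modes M. ee (b - a) l (x - a) *s dft a b M U l)"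
  unfolding interpolant_def exp_ee ..

lemma interpolant_continuous: "continuous_on S (interpolant a b M U)"
proof -
  have "continuous_on S (\<lambda>x. ee (b - a) l (x - a))" for l
    by (rule continuous_on_compose2[OF ee_continuous[of UNIV]]) (auto intro: continuous_intros)
  then show ?thesis unfolding interpolant_eq[abs_def] by (intro continuous_on_sum vsmult_continuous continuous_on_const)
qed

text \<open>Both sides are, up to the length of the interval, the sum of the squared discrete
  coefficients: by Parseval's identity on the interval and by the discrete one on the grid.\<close>

lemma interpolant_norm:
  assumes ab: "a < b" and M: "0 < M" "even M"
  shows "integral {a..b} (\<lambda>x. (norm (interpolant a b M U x))\<^sup>2) = (b - a) * (gnorm M U)\<^sup>2"
proof -
  let ?g = "\<lambda>y. (norm (\<Sum>l\<in>modes M. ee (b - a) l y *s dft a b M U l))\<^sup>2"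
  have L: "0 < b - a" using ab by simp
  have fin: "finite (modes M)" by (simp add: modes_def)
  have "(?g has_integral (b - a) * (\<Sum>l\<in>modes M. (cmod (dft a b M U l $ 1))\<^sup>2) + (b - a) * (\<Sum>l\<in>modes M. (cmod (dft a b M U l $ 2))\<^sup>2)) {0..b - a}"
    unfolding norm_vec2_sq
    using has_integral_add[OF trig_norm_integral[OF L fin, of "\<lambda>l. dft a b M U l $ 1"] trig_norm_integral[OF L fin, of "\<lambda>l. dft a b M U l $ 2"]] by simp
  then have 1: "integral {0..b - a} ?g = (b - a) * (\<Sum>l\<in>modes M. (norm (dft a b M U l))\<^sup>2)"
    by (simp add: norm_vec2_sq sum.distrib distrib_left integral_unique)
  have "continuous_on {0..b - a} ?g"
    by (intro continuous_intros)
  then have "integral {a..b} (?g \<circ> (\<lambda>x. x + - a)) = integral {0..b - a} ?g"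
    using integral_shift[of a "- a" b ?g] by simp
  moreover have "?g \<circ> (\<lambda>x. x + - a) = (\<lambda>x. (norm (interpolant a b M U x))\<^sup>2)"
    by (auto simp: interpolant_eq)
  moreover have "(\<Sum>l\<in>modes M. (norm (dft a b M U l))\<^sup>2) = (gnorm M U)\<^sup>2"
    using gnorm_dft[OF L M, of U] dft_scale[of a b 1 M U U] ab by simp
  ultimately show ?thesis using 1 by simp
qed

lemma interpolant_diff: "interpolant a b M (\<lambda>j. U j - U' j) x = interpolant a b M U x - interpolant a b M U' x"
proof -
  have "dft a b M (\<lambda>j. U j - U' j) = (\<lambda>l. dft a b M U l - dft a b M U' l)"
    by (rule ext) (simp add: dft_eq bounded_bilinear.diff_right[OF bounded_bilinear_vsmult] sum_subtractf)
  then show ?thesis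
    by (simp add: interpolant_eq bounded_bilinear.diff_right[OF bounded_bilinear_vsmult] sum_subtractf)
qed

lemma interpolant_trig:
  assumes ab: "a < b" and \<epsilon>: "0 < \<epsilon>" and M: "0 < M" "even M"
  shows "interpolant a b M (\<lambda>j. ev ((b - a) / \<epsilon>) (M div 2 - 1) c (gp ((b - a) / \<epsilon>) M j)) x = ev ((b - a) / \<epsilon>) (M div 2 - 1) c ((x - a) / \<epsilon>)"
proof -
  let ?L = "(b - a) / \<epsilon>" and ?S = "{- int (M div 2 - 1)..int (M div 2 - 1)}"
  have L: "0 < ?L" using ab \<epsilon> by simp
  have sub: "?S \<subseteq> modes M" using M by (auto simp: modes_def elim!: evenE)
  have fin: "finite (modes M)" by (simp add: modes_def)
  have e: "ee (b - a) l (x - a) = ee ?L l ((x - a) / \<epsilon>)" for l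
    using ab \<epsilon> by (simp add: ee_def freq_def mult_ac)
  have "interpolant a b M (\<lambda>j. ev ?L (M div 2 - 1) c (gp ?L M j)) x
      = (\<Sum>l\<in>modes M. ee ?L l ((x - a) / \<epsilon>) *s (if l \<in> ?S then c l else 0))"
    unfolding interpolant_eq e dft_scale[OF ab \<epsilon> refl] ev_def
    by (intro sum.cong refl) (simp only: dft_trig[OF L M(1) sub])
  also have "\<dots> = (\<Sum>l\<in>?S. ee ?L l ((x - a) / \<epsilon>) *s (if l \<in> ?S then c l else 0))"
    by (rule sum.mono_neutral_right[OF fin sub]) auto
  finally show ?thesis by (simp add: ev_def)
qed

section \<open>Rescaling to the unit semiclassical parameter\<close>

locale rescaling =
  fixes a b \<epsilon> :: real
  assumes ab: "a < b" and \<epsilon>: "0 < \<epsilon>"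
begin

definition L :: real where "L = (b - a) / \<epsilon>"

text \<open>Wraps the rescaled line onto [a,b); the value b is never taken. The periodic extension
  \<open>per\<close> of g is therefore continuous across the seams precisely through agreement of g
  at a and b.\<close>

definition pull :: "real \<Rightarrow> real" where
  "pull y = a + (b - a) * frac (y / L)"

definition per :: "(real \<Rightarrow> 'v) \<Rightarrow> real \<Rightarrow> 'v" where
  "per g y = g (pull y)"

lemma L_pos: "0 < L" using ab \<epsilon> by (simp add: L_def)

lemma pull_in: "pull y \<in> {a..b}"
proof -
  have "(b - a) * frac (y / L) \<le> (b - a) * 1"
    using ab frac_lt_1[of "y / L"] by (intro mult_left_mono) auto
  moreover have "0 \<le> (b - a) * frac (y / L)" using ab by simp
  ultimately show ?thesis by (simp add: pull_def)
qed

lemma pull_add_L: "pull (y + L) = pull y"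
proof -
  have "(y + L) / L = y / L + 1" using L_pos by (simp add: add_divide_distrib)
  then show ?thesis by (simp add: pull_def frac_1_eq)
qed

lemma pull_grid: "j < M \<Longrightarrow> pull (gp L M j) = grid a b M j"
proof -
  assume "j < M"
  then have "frac (real j / real M) = real j / real M" by (simp add: frac_eq)
  then show ?thesis using L_pos by (simp add: pull_def grid_def)
qed

lemma pull_scaled: "x \<in> {a..<b} \<Longrightarrow> pull ((x - a) / \<epsilon>) = x"
proof -
  assume x: "x \<in> {a..<b}"
  have "(x - a) / \<epsilon> / L = (x - a) / (b - a)" using \<epsilon> ab by (simp add: L_def)
  moreover have "frac ((x - a) / (b - a)) = (x - a) / (b - a)" using x by (simp add: frac_eq)
  ultimately have "pull ((x - a) / \<epsilon>) = a + (b - a) * ((x - a) / (b - a))" by (simp only: pull_def)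
  then show ?thesis using ab by simp
qed

text \<open>Agreement at a and b makes the affine formula valid on closed cells. Neighbouring cells
  then share an end point, at which one-sided statements can be joined.\<close>

lemma per_eq:
  assumes g: "g a = g b" and y: "y \<in> {of_int p * L..(of_int p + 1) * L}"
  shows "per g y = g (a + \<epsilon> * (y - of_int p * L))"
proof (cases "y = (of_int p + 1) * L")
  case True
  have "y / L = of_int (p + 1)" using L_pos by (simp add: True)
  then have "pull y = a" by (simp add: pull_def)
  moreover have "a + \<epsilon> * (y - of_int p * L) = b" using \<epsilon> 
  proof -
    have "y - of_int p * L = L" by (simp add: True distrib_right)
    then show ?thesis using \<epsilon> by (simp add: L_def)
  qed
  ultimately show ?thesis using g by (simp add: per_def)
next
  case False
  then have "of_int p \<le> y / L" "y / L < of_int p + 1"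
    using y L_pos by (auto simp: pos_le_divide_eq pos_divide_less_eq)
  then have "\<lfloor>y / L\<rfloor> = p" by (simp add: floor_eq_iff)
  then have "pull y = a + (b - a) * (y / L - of_int p)" by (simp add: pull_def frac_def)
  also have "(b - a) * (y / L - of_int p) = \<epsilon> * (y - of_int p * L)"
    using \<epsilon> ab by (simp add: L_def field_simps)
  finally show ?thesis by (simp add: per_def)
qed

lemma cell: "y \<in> {of_int \<lfloor>y / L\<rfloor> * L..(of_int \<lfloor>y / L\<rfloor> + 1) * L}"
proof -
  have "of_int \<lfloor>y / L\<rfloor> * L \<le> y / L * L" "y / L * L \<le> (of_int \<lfloor>y / L\<rfloor> + 1) * L"
    using L_pos by (intro mult_right_mono; linarith)+
  then show ?thesis using L_pos by simp
qed

lemma cell_in: "y \<in> {of_int p * L..(of_int p + 1) * L} \<Longrightarrow> a + \<epsilon> * (y - of_int p * L) \<in> {a..b}"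
proof -
  assume y: "y \<in> {of_int p * L..(of_int p + 1) * L}"
  have "\<epsilon> * (y - of_int p * L) \<le> \<epsilon> * L" using y \<epsilon> by (intro mult_left_mono) (auto simp: distrib_right)
  moreover have "0 \<le> \<epsilon> * (y - of_int p * L)" using y \<epsilon> by simp
  ultimately show ?thesis using \<epsilon> by (simp add: L_def)
qed

lemma per_lip:
  fixes g :: "real \<Rightarrow> 'v::real_normed_vector"
  assumes g: "g a = g b" and K: "\<And>x y. x \<in> {a..b} \<Longrightarrow> y \<in> {a..b} \<Longrightarrow> norm (g x - g y) \<le> K * \<bar>x - y\<bar>"
  shows "norm (per g x - per g y) \<le> K * \<epsilon> * \<bar>x - y\<bar>"
proof -
  have K0: "0 \<le> K" using order_trans[OF norm_ge_zero K[of a b]] ab by (simp add: zero_le_mult_iff)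
  have 1: "norm (per g x - per g y) \<le> K * \<epsilon> * \<bar>x - y\<bar>"
    if "x \<in> {of_int p * L..(of_int p + 1) * L}" "y \<in> {of_int p * L..(of_int p + 1) * L}" for p x y
  proof -
    have "\<bar>a + \<epsilon> * (x - of_int p * L) - (a + \<epsilon> * (y - of_int p * L))\<bar> = \<bar>\<epsilon> * (x - y)\<bar>"
      by (simp add: algebra_simps)
    then show ?thesis
      using K[OF cell_in[OF that(1)] cell_in[OF that(2)]] \<epsilon>
      by (simp add: per_eq[OF g that(1)] per_eq[OF g that(2)] abs_mult)
  qed
  have 2: "norm (per g x - per g y) \<le> K * \<epsilon> * \<bar>x - y\<bar>" if xy: "x \<le> y" for x y
  proof (cases "\<lfloor>x / L\<rfloor> = \<lfloor>y / L\<rfloor>")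
    case True
    then show ?thesis using 1[OF cell[of x]] cell[of y] by simp
  next
    \<comment> \<open>The extension takes the same value at all multiples of L. The step from the
      right end of the cell of x to the left end of the cell of y costs nothing, and the two
      remaining pieces are together no longer than the distance of x and y.\<close>
    case False
    let ?p = "\<lfloor>x / L\<rfloor>" and ?q = "\<lfloor>y / L\<rfloor>"
    have "?p \<le> ?q" using xy L_pos by (intro floor_mono divide_right_mono) auto
    then have pq: "of_int ?p + 1 \<le> (of_int ?q :: real)" using False by linarith
    have e: "(of_int ?p + 1) * L \<le> of_int ?q * L" using pq L_pos by (intro mult_right_mono) auto
    have c: "(of_int ?p + 1) * L \<in> {of_int ?p * L..(of_int ?p + 1) * L}" "of_int ?q * L \<in> {of_int ?q * L..(of_int ?q + 1) * L}"
      using L_pos by (auto intro: mult_right_mono)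
    have "per g (of_int i * L) = g a" for i :: int
      using per_eq[OF g, of "of_int i * L" i] L_pos by (simp add: distrib_right)
    from this[of "?p + 1"] this[of ?q] have eq: "per g ((of_int ?p + 1) * L) = per g (of_int ?q * L)" by simp
    have "norm (per g x - per g y) \<le> norm (per g x - per g ((of_int ?p + 1) * L)) + norm (per g (of_int ?q * L) - per g y)"
      using norm_triangle_ineq[of "per g x - per g ((of_int ?p + 1) * L)" "per g (of_int ?q * L) - per g y"] by (simp add: eq)
    also have "\<dots> \<le> K * \<epsilon> * \<bar>x - (of_int ?p + 1) * L\<bar> + K * \<epsilon> * \<bar>of_int ?q * L - y\<bar>"
      by (intro add_mono 1[OF cell c(1)] 1[OF c(2) cell])
    also have "\<dots> = K * \<epsilon> * (\<bar>x - (of_int ?p + 1) * L\<bar> + \<bar>of_int ?q * L - y\<bar>)" by (simp add: distrib_left)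
    also have "\<dots> \<le> K * \<epsilon> * \<bar>x - y\<bar>"
      using e cell[of x] cell[of y] K0 \<epsilon> by (intro mult_left_mono) auto
    finally show ?thesis .
  qed
  show ?thesis using 2[of x y] 2[of y x] by (cases "x \<le> y") (auto simp: norm_minus_commute abs_minus_commute)
qed

lemma per_deriv:
  fixes g g' :: "real \<Rightarrow> 'v::real_normed_vector"
  assumes g: "g a = g b" "g' a = g' b"
    and d: "\<And>x. x \<in> {a..b} \<Longrightarrow> (g has_vector_derivative g' x) (at x within {a..b})"
  shows "(per g has_vector_derivative \<epsilon> *\<^sub>R per g' y) (at y)"
proof -
  have 1: "(per g has_vector_derivative \<epsilon> *\<^sub>R per g' y) (at y within {of_int p * L..(of_int p + 1) * L})"
    if y: "y \<in> {of_int p * L..(of_int p + 1) * L}" for p y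
  proof -
    let ?S = "{of_int p * L..(of_int p + 1) * L}" and ?h = "\<lambda>y. a + \<epsilon> * (y - of_int p * L)"
    have "(?h has_vector_derivative \<epsilon>) (at y within ?S)" by (auto intro!: derivative_eq_intros)
    moreover have "(g has_vector_derivative g' (?h y)) (at (?h y) within ?h ` ?S)"
      by (rule has_vector_derivative_within_subset[OF d[OF cell_in[OF y]]]) (use cell_in in auto)
    ultimately have "((g \<circ> ?h) has_vector_derivative \<epsilon> *\<^sub>R g' (?h y)) (at y within ?S)"
      by (rule vector_diff_chain_within)
    then show ?thesis
      unfolding per_eq[OF g(2) y]
      by (rule has_vector_derivative_transform[OF y, rotated]) (simp add: per_eq[OF g(1)])
  qed
  let ?p = "\<lfloor>y / L\<rfloor>"
  show ?thesis
  proof (cases "y = of_int ?p * L")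
    case False
    then have "y > of_int ?p * L" using cell[of y] by simp
    moreover have "y < (of_int ?p + 1) * L"
      using L_pos by (subst pos_divide_less_eq[symmetric]) linarith+
    ultimately have "y \<in> interior {of_int ?p * L..(of_int ?p + 1) * L}" by simp
    then show ?thesis using 1[OF cell[of y]] by (simp only: at_within_interior)
  next
    \<comment> \<open>At a seam the two neighbouring cells give one-sided derivatives, which
      coincide because g' agrees at a and b.\<close>
    case True
    define q where "q = of_int ?p * L"
    have q: "y = q" using True by (simp add: q_def)
    have e: "(of_int (?p - 1) + 1) * L = q" "of_int (?p - 1) * L = q - L" "(of_int ?p + 1) * L = q + L"
      by (auto simp: q_def algebra_simps)
    have r: "(per g has_vector_derivative \<epsilon> *\<^sub>R per g' q) (at q within {q..q + L})"
      using 1[of q ?p] L_pos unfolding e q_def[symmetric] by simp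
    have l: "(per g has_vector_derivative \<epsilon> *\<^sub>R per g' q) (at q within {q - L..q})"
      using 1[of q "?p - 1"] L_pos unfolding e by simp
    have "(per g has_vector_derivative \<epsilon> *\<^sub>R per g' q) (at q within {q - L..q} \<union> {q..q + L})"
      using l r unfolding has_vector_derivative_iff_slope unfolding at_within_union by (rule filterlim_sup)
    moreover have "{q - L..q} \<union> {q..q + L} = {q - L..q + L}" using L_pos by auto
    moreover have "q \<in> interior {q - L..q + L}" using L_pos by simp
    ultimately show ?thesis unfolding q by (simp only: at_within_interior)
  qed
qed

text \<open>Every space derivative produces a factor \<epsilon>, which cancels the growth
  \<epsilon>^(-k) of the assumed bounds; thus B can be independent of \<epsilon>.\<close>

lemma cb_per_lift:
  fixes g :: "real \<Rightarrow> 'v::real_normed_vector"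
  assumes m: "0 < m" and c: "cls m a b g" and e: "\<And>k. k < m \<Longrightarrow> (dx a b ^^ k) g a = (dx a b ^^ k) g b"
    and B: "\<And>k x. k < m \<Longrightarrow> x \<in> {a..b} \<Longrightarrow> \<epsilon> ^ k * norm ((dx a b ^^ k) g x) \<le> B"
    and K: "\<And>x y. x \<in> {a..b} \<Longrightarrow> y \<in> {a..b} \<Longrightarrow> norm ((dx a b ^^ (m - 1)) g x - (dx a b ^^ (m - 1)) g y) \<le> K * \<bar>x - y\<bar>"
    and KB: "\<epsilon> ^ m * K \<le> B"
  shows "k < m \<Longrightarrow> (DD ^^ k) (per g) = (\<lambda>y. \<epsilon> ^ k *\<^sub>R per ((dx a b ^^ k) g) y)" and "cb L m B (per g)"
proof -
  let ?G = "\<lambda>k y. \<epsilon> ^ k *\<^sub>R per ((dx a b ^^ k) g) y"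
  have d: "(?G k has_vector_derivative ?G (Suc k) y) (at y)" if "Suc k < m" for k y
  proof -
    have "(per ((dx a b ^^ k) g) has_vector_derivative \<epsilon> *\<^sub>R per ((dx a b ^^ Suc k) g) y) (at y)"
      by (rule per_deriv) (use e[of k] e[of "Suc k"] clsD(2)[OF c that] that in auto)
    from bounded_linear.has_vector_derivative[OF bounded_linear_scaleR_right this, of "\<epsilon> ^ k"]
    show ?thesis by (simp add: mult.commute)
  qed
  then have D: "DD (?G k) = ?G (Suc k)" if "Suc k < m" for k using that by (intro DD_eqI)
  show "k < m \<Longrightarrow> (DD ^^ k) (per g) = ?G k"
  proof (induction k)
    case (Suc k)
    then show ?case using D[of k] by simp
  qed simp
  have P: "?G k (y + L) = ?G k y" "k < m \<Longrightarrow> norm (?G k y) \<le> B" for k y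
    using B[of k "pull y"] pull_in[of y] \<epsilon> by (auto simp: per_def pull_add_L)
  have "k + j = m - 1 \<Longrightarrow> cb L (Suc j) B (?G k)" for k j
  proof (induction j arbitrary: k)
    case 0
    have "norm (?G k x - ?G k y) \<le> B * \<bar>x - y\<bar>" for x y
    proof -
      have "norm (per ((dx a b ^^ k) g) x - per ((dx a b ^^ k) g) y) \<le> K * \<epsilon> * \<bar>x - y\<bar>"
        by (rule per_lip) (use K e[of k] 0 m in auto)
      then have "norm (?G k x - ?G k y) \<le> \<epsilon> ^ k * (K * \<epsilon> * \<bar>x - y\<bar>)"
        unfolding scaleR_diff_right[symmetric] norm_scaleR using \<epsilon> by simp
      also have "\<epsilon> ^ k * (K * \<epsilon> * \<bar>x - y\<bar>) = (\<epsilon> ^ Suc k * K) * \<bar>x - y\<bar>" by (simp add: mult_ac)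
      also have "Suc k = m" using 0 m by simp
      also have "(\<epsilon> ^ m * K) * \<bar>x - y\<bar> \<le> B * \<bar>x - y\<bar>" using KB by (intro mult_right_mono) auto
      finally show ?thesis .
    qed
    then show ?case using P[of k] 0 m by simp
  next
    case (Suc j)
    then have k: "Suc k < m" "k < m" by auto
    have "cb L (Suc j) B (?G (Suc k))" using Suc by (intro Suc.IH) simp
    then show ?case using P(1)[of k] P(2)[OF k(2)] d[OF k(1)] unfolding cb.simps D[OF k(1)] by blast
  qed
  from this[of 0 "m - 1"] show "cb L m B (per g)" using m by simp
qed

end

text \<open>The equation expresses the space derivative by the time derivative.  This yields the fifth
  derivative that the local error requires, although only \<open>m \<ge> 4\<close> is assumed.\<close>

lemma cb_from_PP:
  assumes V: "cb L 4 B V" "cb L 4 B A" and f: "cb L 4 B f" and P: "cb L 4 B (PP V A f)"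
  shows "cb L 5 (2 * B + 32 * B * B) f"
proof -
  have B: "0 \<le> B" by (rule cb_nonneg[OF f])
  have 4: "4 = Suc (Suc (Suc (Suc 0)))" "5 = Suc (Suc (Suc (Suc (Suc 0))))" by simp_all
  \<comment> \<open>This is \<open>- (sigma1 *v DD f x)\<close>; as the square of \<sigma>_1 is the
    identity, one more application of \<open>- sigma1\<close> returns the derivative.\<close>
  let ?h = "\<lambda>x. (PP V A f x - - (\<i> *s (sigma3 *v f x))) - WW V A f x"
  have "cb L 4 (B + B + 2 * 2 ^ 4 * B * B) ?h"
    by (intro cb_diff P cb_WW V f cb_linear[OF bounded_linear_s3])
      (auto simp: norm_vsmult intro: f simp del: cb.simps)
  then have "cb L 4 (B + B + 2 * 2 ^ 4 * B * B) (\<lambda>x. - (sigma1 *v ?h x))"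
    by (intro cb_linear[OF bounded_linear_s1]) auto
  moreover have "(\<lambda>x. - (sigma1 *v ?h x)) = DD f"
    by (auto simp: fun_eq_iff PP_def TT_def vec_eq_iff forall_2)
  ultimately have D: "cb L 4 (2 * B + 32 * B * B) (DD f)" by simp
  have le: "B \<le> 2 * B + 32 * B * B" using B by simp
  have f4: "cb L (Suc (Suc 2)) B f" using f by simp
  have "norm (f x) \<le> 2 * B + 32 * B * B" for x using order_trans[OF cb_bdd[OF f] le] .
  then show ?thesis
    using D cb_per[OF f] cb_deriv[OF f4] unfolding 4 by (simp only: cb.simps(3)) simp
qed

section \<open>Global error\<close>

locale dirac_data = rescaling a b \<epsilon> for a b \<epsilon> :: real +
  fixes m :: nat and T B :: real and C D :: "nat \<Rightarrow> real" and V A :: "real \<Rightarrow> real"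
    and \<Phi>0 :: "real \<Rightarrow> complex^2" and \<Phi> :: "real \<Rightarrow> real \<Rightarrow> complex^2"
  assumes m: "4 \<le> m" and \<epsilon>1: "\<epsilon> \<le> 1" and T: "0 < T"
    and sol: "dirac_solution \<epsilon> T a b V A \<Phi>0 \<Phi>" and \<Phi>: "\<Phi> \<in> C_time_W_inf_per 2 T m a b"
    and V: "V \<in> Cm_fun m a b" "periodic_upto m a b V" and A: "A \<in> Cm_fun m a b" "periodic_upto m a b A"
    and C: "\<And>r k. r \<le> 2 \<Longrightarrow> k \<le> m \<Longrightarrow> mixed_Linf_norm T a b r k \<Phi> \<le> ereal (C (r + k) / \<epsilon> ^ (r + k))"
    and DV: "\<And>k. k \<le> m \<Longrightarrow> Linf_norm a b ((dx a b ^^ k) V) \<le> ereal (D k)"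
    and DA: "\<And>k. k \<le> m \<Longrightarrow> Linf_norm a b ((dx a b ^^ k) A) \<le> ereal (D k)"
    and CB: "\<And>k. k \<le> m + 1 \<Longrightarrow> C k \<le> B" and DB: "\<And>k. k \<le> m \<Longrightarrow> D k \<le> B"
begin

lemma m0: "0 < m" using m by simp

lemma cb_potential:
  fixes W :: "real \<Rightarrow> real"
  assumes W: "W \<in> Cm_fun m a b" "periodic_upto m a b W" and DW: "\<And>k. k \<le> m \<Longrightarrow> Linf_norm a b ((dx a b ^^ k) W) \<le> ereal (D k)"
  shows "cb L m B (per W)"
proof (rule cb_per_lift(2)[OF m0])
  note r = regular_potential[OF ab m0 W DW]
  show "cls m a b W" using r(1) .
  show "(dx a b ^^ k) W a = (dx a b ^^ k) W b" if "k < m" for k using r(2)[OF _ that] .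
  show "norm ((dx a b ^^ (m - 1)) W x - (dx a b ^^ (m - 1)) W y) \<le> D m * \<bar>x - y\<bar>" if "x \<in> {a..b}" "y \<in> {a..b}" for x y
    using r(4)[OF _ that] .
  have le: "\<epsilon> ^ k * z \<le> B" if "0 \<le> z" "z \<le> D k" "k \<le> m" for z k
  proof -
    have "\<epsilon> ^ k * z \<le> 1 * z" using \<epsilon> \<epsilon>1 that by (intro mult_right_mono power_le_one) auto
    then show ?thesis using that DB[of k] by simp
  qed
  show "\<epsilon> ^ k * norm ((dx a b ^^ k) W x) \<le> B" if "k < m" "x \<in> {a..b}" for k x
    using r(3)[OF _ that] that by (intro le) auto
  have "0 \<le> D m"
    using order_trans[OF norm_ge_zero r(4)[of a b]] ab by (simp add: zero_le_mult_iff)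
  then show "\<epsilon> ^ m * D m \<le> B" by (intro le) auto
qed

text \<open>Of the assumed growth \<epsilon>^(-r-k) the rescaling in space removes the part
  \<epsilon>^(-k). The remaining \<epsilon>^(-r) is compensated later by the rescaling in
  time.\<close>

lemma reg_solution:
  assumes r: "r < 2" and t: "t \<in> {0..T}"
  shows "cls m a b ((dt T ^^ r) \<Phi> t)" "cb L m (B / \<epsilon> ^ r) (per ((dt T ^^ r) \<Phi> t))"
    "k < m \<Longrightarrow> (DD ^^ k) (per ((dt T ^^ r) \<Phi> t)) = (\<lambda>y. \<epsilon> ^ k *\<^sub>R per ((dx a b ^^ k) ((dt T ^^ r) \<Phi> t)) y)"
proof -
  let ?F = "(dt T ^^ r) \<Phi> t"
  have b: "mixed_Linf_norm T a b r k \<Phi> \<le> ereal (C (r + k) / \<epsilon> ^ (r + k))" if "k \<le> m" for k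
    using C r that by simp
  note s = regular_solution[OF ab T m0 \<Phi> r b t]
  show c: "cls m a b ?F" using s(1) .
  have e: "(dx a b ^^ k) ?F a = (dx a b ^^ k) ?F b" if "k < m" for k using s(2)[OF _ that] .
  have le: "\<epsilon> ^ k * (C (r + k) / \<epsilon> ^ (r + k)) \<le> B / \<epsilon> ^ r" if "k \<le> m" for k
    using CB[of "r + k"] r that \<epsilon> by (simp add: power_add divide_right_mono)
  have B: "\<epsilon> ^ k * norm ((dx a b ^^ k) ?F x) \<le> B / \<epsilon> ^ r" if "k < m" "x \<in> {a..b}" for k x
  proof -
    have "\<epsilon> ^ k * norm ((dx a b ^^ k) ?F x) \<le> \<epsilon> ^ k * (C (r + k) / \<epsilon> ^ (r + k))"
      using s(3)[OF _ that] \<epsilon> by (intro mult_left_mono) auto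
    also have "\<dots> \<le> B / \<epsilon> ^ r" using le that by simp
    finally show ?thesis .
  qed
  have K: "norm ((dx a b ^^ (m - 1)) ?F x - (dx a b ^^ (m - 1)) ?F y) \<le> C (r + m) / \<epsilon> ^ (r + m) * \<bar>x - y\<bar>"
    if "x \<in> {a..b}" "y \<in> {a..b}" for x y using s(4)[OF _ that] .
  show "cb L m (B / \<epsilon> ^ r) (per ?F)"
    by (rule cb_per_lift(2)[OF m0 c e B K le]) auto
  show "k < m \<Longrightarrow> (DD ^^ k) (per ?F) = (\<lambda>y. \<epsilon> ^ k *\<^sub>R per ((dx a b ^^ k) ?F) y)"
    by (rule cb_per_lift(1)[OF m0 c e B K le]) auto
qed

text \<open>The differential equation is assumed in the open interval only. Both sides are
  continuous on the closed one, and the periodic extension needs the equation at the seams as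
  well.\<close>

lemma equation:
  assumes t: "t \<in> {0..T}" and x: "x \<in> {a..b}"
  shows "\<epsilon> *\<^sub>R dt T \<Phi> t x = - (sigma1 *v (\<epsilon> *\<^sub>R dx a b (\<Phi> t) x)) - \<i> *s (sigma3 *v \<Phi> t x)
    + ((-\<i>) *s (V x *\<^sub>R \<Phi> t x) + \<i> *s (A x *\<^sub>R (sigma1 *v \<Phi> t x)))"
proof -
  let ?h = "\<lambda>x. \<epsilon> *\<^sub>R dt T \<Phi> t x - (- (sigma1 *v (\<epsilon> *\<^sub>R dx a b (\<Phi> t) x)) - \<i> *s (sigma3 *v \<Phi> t x)
    + ((-\<i>) *s (V x *\<^sub>R \<Phi> t x) + \<i> *s (A x *\<^sub>R (sigma1 *v \<Phi> t x))))"
  have pc: "continuous_on {a..b} W" if "periodic_upto m a b W" for W :: "real \<Rightarrow> real"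
    using that m0 unfolding periodic_upto_def by (metis funpow_0)
  have "continuous_on {a..b} (\<Phi> t)" "continuous_on {a..b} (dx a b (\<Phi> t))"
    using clsD(1)[OF reg_solution(1)[OF _ t, of 0], of 0] clsD(1)[OF reg_solution(1)[OF _ t, of 0], of 1] m by auto
  moreover have "continuous_on {a..b} (dt T \<Phi> t)"
    using clsD(1)[OF reg_solution(1)[OF _ t, of 1], of 0] m by auto
  ultimately have c: "continuous_on {a..b} ?h"
    by (intro continuous_on_add continuous_on_diff continuous_on_minus continuous_on_scaleR continuous_on_const
        bounded_linear.continuous_on[OF matrix_vector_mul_bounded_linear] vsmult_continuous pc V(2) A(2))
  have "norm (?h x) \<le> 0"
  proof (rule norm_le_closed[OF ab c _ x])
    fix x assume "x \<in> {a<..<b}"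
    then have q: "(\<i> * of_real \<epsilon>) *s dt T \<Phi> t x =
          (- \<i> * of_real \<epsilon>) *s (sigma1 *v dx a b (\<Phi> t) x) + sigma3 *v \<Phi> t x
          + of_real (V x) *s \<Phi> t x - of_real (A x) *s (sigma1 *v \<Phi> t x)"
      using sol t unfolding dirac_solution_def by blast
    have "\<epsilon> *\<^sub>R dt T \<Phi> t x = (-\<i>) *s ((\<i> * of_real \<epsilon>) *s dt T \<Phi> t x)"
      by (simp add: vec_eq_iff scaleR_complex)
    also have "\<dots> = - (sigma1 *v (\<epsilon> *\<^sub>R dx a b (\<Phi> t) x)) - \<i> *s (sigma3 *v \<Phi> t x)
      + ((-\<i>) *s (V x *\<^sub>R \<Phi> t x) + \<i> *s (A x *\<^sub>R (sigma1 *v \<Phi> t x)))"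
      unfolding q by (simp add: vec_eq_iff forall_2 scaleR_complex algebra_simps)
    finally show "norm (?h x) \<le> 0" by simp
  qed
  then show ?thesis by simp
qed

lemma PP_solution:
  assumes t: "t \<in> {0..T}"
  shows "PP (per V) (per A) (per (\<Phi> t)) = (\<lambda>y. \<epsilon> *\<^sub>R per (dt T \<Phi> t) y)"
proof
  fix y
  have "DD (per (\<Phi> t)) y = \<epsilon> *\<^sub>R per (dx a b (\<Phi> t)) y"
    using reg_solution(3)[OF _ t, of 0 1] m by (simp add: fun_eq_iff)
  then show "PP (per V) (per A) (per (\<Phi> t)) y = \<epsilon> *\<^sub>R per (dt T \<Phi> t) y"
    using equation[OF t pull_in[of y]] by (simp add: PP_def TT_def WW_def W_mat_mult per_def)
qed

lemma cb_PP_solution: "t \<in> {0..T} \<Longrightarrow> cb L m B (PP (per V) (per A) (per (\<Phi> t)))"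
  using cb_scaleR[OF reg_solution(2)[of 1 t], of \<epsilon>] \<epsilon> by (simp add: PP_solution)

lemma cb_solution: "t \<in> {0..T} \<Longrightarrow> cb L m B (per (\<Phi> t))"
  using reg_solution(2)[of 0 t] by simp

text \<open>The time origin is moved to the beginning of an arbitrary step, so that the local error,
  which concerns a step from time zero, covers all steps. The bound 2B + 32B^2 is the one for the
  fifth order of regularity in \<open>cb_from_PP\<close>.\<close>

lemma flow_data_solution:
  assumes t: "0 \<le> t\<^sub>0" "0 < \<tau>" "t\<^sub>0 + \<tau> \<le> T"
  shows "flow_data m B (2 * B + 32 * B * B) L (\<tau> / \<epsilon>) (per V) (per A) (\<lambda>s. per (\<Phi> (t\<^sub>0 + \<epsilon> * s)))"
proof -
  have V': "cb L m B (per V)" "cb L m B (per A)" by (intro cb_potential V A DV DA; assumption)+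
  have B: "0 \<le> B" by (rule cb_nonneg[OF V'(1)])
  have le: "B \<le> 2 * B + 32 * B * B" using B by simp
  have in_T: "t\<^sub>0 + \<epsilon> * s \<in> {0..T}" if "s \<in> {0..\<tau> / \<epsilon>}" for s
  proof -
    have "\<epsilon> * s \<le> \<epsilon> * (\<tau> / \<epsilon>)" using that \<epsilon> by (intro mult_left_mono) auto
    then show ?thesis using that t \<epsilon> by simp
  qed
  have "cb L m (2 * B + 32 * B * B) (per (\<Phi> (t\<^sub>0 + \<epsilon> * s)))" "cb L 5 (2 * B + 32 * B * B) (per (\<Phi> (t\<^sub>0 + \<epsilon> * s)))"
    if "s \<in> {0..\<tau> / \<epsilon>}" for s
    using cb_mono[OF cb_solution[OF in_T[OF that]] le]
      cb_from_PP[OF V'[THEN cb_le[OF _ m]] cb_le[OF cb_solution[OF in_T[OF that]] m] cb_le[OF cb_PP_solution[OF in_T[OF that]] m]] .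
  moreover have "((\<lambda>s. (DD ^^ k) (per (\<Phi> (t\<^sub>0 + \<epsilon> * s))) y) has_vector_derivative
      (DD ^^ k) (PP (per V) (per A) (per (\<Phi> (t\<^sub>0 + \<epsilon> * s)))) y) (at s within {0..\<tau> / \<epsilon>})"
    if k: "k \<le> 3" and s: "s \<in> {0..\<tau> / \<epsilon>}" for k s y
  proof -
    let ?h = "\<lambda>s. t\<^sub>0 + \<epsilon> * s" and ?x = "pull y"
    have km: "k < m" using k m by simp
    let ?g = "\<lambda>t. (dx a b ^^ k) (\<Phi> t) ?x" and ?g' = "\<lambda>t. (dx a b ^^ k) (dt T \<Phi> t) ?x"
    have "(?h has_vector_derivative \<epsilon>) (at s within {0..\<tau> / \<epsilon>})" by (auto intro!: derivative_eq_intros)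
    moreover have "(?g has_vector_derivative ?g' (?h s)) (at (?h s) within {0..T})"
      using time_deriv[OF ab \<Phi> _ km in_T[OF s] pull_in, of 0] by simp
    then have "(?g has_vector_derivative ?g' (?h s)) (at (?h s) within ?h ` {0..\<tau> / \<epsilon>})"
      by (rule has_vector_derivative_within_subset) (use in_T in auto)
    ultimately have "((?g \<circ> ?h) has_vector_derivative \<epsilon> *\<^sub>R ?g' (?h s)) (at s within {0..\<tau> / \<epsilon>})"
      by (rule vector_diff_chain_within)
    from bounded_linear.has_vector_derivative[OF bounded_linear_scaleR_right this, of "\<epsilon> ^ k"]
    have "((\<lambda>s. \<epsilon> ^ k *\<^sub>R ?g (?h s)) has_vector_derivative \<epsilon> ^ k *\<^sub>R (\<epsilon> *\<^sub>R ?g' (?h s))) (at s within {0..\<tau> / \<epsilon>})"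
      by (simp add: comp_def)
    then have d: "((\<lambda>s. (DD ^^ k) (per (\<Phi> (?h s))) y) has_vector_derivative \<epsilon> ^ k *\<^sub>R (\<epsilon> *\<^sub>R ?g' (?h s))) (at s within {0..\<tau> / \<epsilon>})"
    proof (rule has_vector_derivative_transform[OF s, rotated])
      show "(DD ^^ k) (per (\<Phi> (?h r))) y = \<epsilon> ^ k *\<^sub>R ?g (?h r)" if "r \<in> {0..\<tau> / \<epsilon>}" for r
        using reg_solution(3)[OF _ in_T[OF that], of 0 k] km by (simp add: per_def)
    qed
    have r: "rcb L (Suc k) (per (dt T \<Phi> (?h s)))"
      unfolding rcb_def using cb_le[OF reg_solution(2)[OF _ in_T[OF s], of 1], of "Suc k"] km by auto
    have "(DD ^^ k) (PP (per V) (per A) (per (\<Phi> (?h s)))) = (\<lambda>y. \<epsilon> *\<^sub>R (DD ^^ k) (per (dt T \<Phi> (?h s))) y)"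
      unfolding PP_solution[OF in_T[OF s]] by (rule DDk_scaleR[OF r])
    moreover have "(DD ^^ k) (per (dt T \<Phi> (?h s))) y = \<epsilon> ^ k *\<^sub>R ?g' (?h s)"
      using reg_solution(3)[OF _ in_T[OF s], of 1 k] km by (simp add: per_def)
    ultimately have "(DD ^^ k) (PP (per V) (per A) (per (\<Phi> (?h s)))) y = \<epsilon> ^ k *\<^sub>R (\<epsilon> *\<^sub>R ?g' (?h s))"
      by (simp add: mult.commute)
    then show ?thesis using d by simp
  qed
  ultimately show ?thesis unfolding flow_data_def using L_pos t \<epsilon> V' by auto
qed

lemma step_scaled: "j < M \<Longrightarrow> S4c_step \<epsilon> a b V A M \<tau> U j = S4c_step 1 0 L (per V) (per A) M (\<tau> / \<epsilon>) U j"
  unfolding L_def by (rule S4c_step_scale[OF ab \<epsilon>]) (simp_all add: per_def pull_grid flip: L_def)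

lemma gnorm_step_scaled:
  assumes "0 < M" "even M"
  shows "gnorm M (\<lambda>j. S4c_step \<epsilon> a b V A M \<tau> U j - S4c_step \<epsilon> a b V A M \<tau> U' j) = gnorm M (\<lambda>j. U j - U' j)"
proof -
  have "gnorm M (\<lambda>j. S4c_step \<epsilon> a b V A M \<tau> U j - S4c_step \<epsilon> a b V A M \<tau> U' j)
    = gnorm M (\<lambda>j. S4c_step 1 0 L (per V) (per A) M (\<tau> / \<epsilon>) U j - S4c_step 1 0 L (per V) (per A) M (\<tau> / \<epsilon>) U' j)"
    by (rule gnorm_cong) (simp only: step_scaled)
  then show ?thesis using gnorm_step[OF L_pos assms] by (rule trans)
qed

lemma S4c_Suc: "S4c \<epsilon> a b V A M \<tau> \<Phi>0 (Suc n) = S4c_step \<epsilon> a b V A M \<tau> (S4c \<epsilon> a b V A M \<tau> \<Phi>0 n)"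
  by (simp add: S4c_def)

lemma initial: "j < M \<Longrightarrow> S4c \<epsilon> a b V A M \<tau> \<Phi>0 0 j = \<Phi> 0 (grid a b M j)"
  using sol pull_in[of "gp L M j"] by (simp add: S4c_def dirac_solution_def flip: pull_grid)

text \<open>The exact solution at time n \<tau>, sampled and propagated by one numerical step, is
  compared with both sides. The isometry carries the old error over without growth, so the local
  errors just add up and no exponential in T/\<epsilon> appears.\<close>

lemma global_error:
  assumes M: "0 < M" "even M" and \<tau>: "0 < \<tau>" "\<tau> / \<epsilon> \<le> 1/2"
    and K: "\<forall>L S V A \<phi> M. flow_data m B (2 * B + 32 * B * B) L S V A \<phi> \<longrightarrow> S \<le> 1/2 \<longrightarrow> 0 < M \<longrightarrow> even M \<longrightarrow>
      gnorm M (\<lambda>j. S4c_step 1 0 L V A M S (\<lambda>j. \<phi> 0 (gp L M j)) j - \<phi> S (gp L M j)) \<le> K * (S ^ 5 + (L / real M) ^ m)"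
  shows "real n * \<tau> \<le> T \<Longrightarrow> gnorm M (\<lambda>j. S4c \<epsilon> a b V A M \<tau> \<Phi>0 n j - \<Phi> (real n * \<tau>) (grid a b M j))
    \<le> real n * (K * ((\<tau> / \<epsilon>) ^ 5 + (L / real M) ^ m))"
proof (induction n)
  case 0
  have "gnorm M (\<lambda>j. S4c \<epsilon> a b V A M \<tau> \<Phi>0 0 j - \<Phi> (real 0 * \<tau>) (grid a b M j)) \<le> 0"
    using M initial by (intro gnorm_le_sup) auto
  then show ?case by simp
next
  case (Suc n)
  let ?t = "real n * \<tau>" and ?R = "K * ((\<tau> / \<epsilon>) ^ 5 + (L / real M) ^ m)" and ?U = "S4c \<epsilon> a b V A M \<tau> \<Phi>0 n"
    and ?S = "S4c_step \<epsilon> a b V A M \<tau>"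
  have t: "?t + \<tau> = real (Suc n) * \<tau>" by (simp add: distrib_right)
  have t': "0 \<le> ?t" "?t + \<tau> \<le> T" "?t \<le> T" using Suc.prems \<tau> unfolding t by (auto simp: distrib_right)
  have "gnorm M (\<lambda>j. S4c_step 1 0 L (per V) (per A) M (\<tau> / \<epsilon>) (\<lambda>j. per (\<Phi> (?t + \<epsilon> * 0)) (gp L M j)) j
      - per (\<Phi> (?t + \<epsilon> * (\<tau> / \<epsilon>))) (gp L M j)) \<le> ?R"
    using K flow_data_solution[OF t'(1) \<tau>(1) t'(2)] \<tau>(2) M by blast
  also have "gnorm M (\<lambda>j. S4c_step 1 0 L (per V) (per A) M (\<tau> / \<epsilon>) (\<lambda>j. per (\<Phi> (?t + \<epsilon> * 0)) (gp L M j)) j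
      - per (\<Phi> (?t + \<epsilon> * (\<tau> / \<epsilon>))) (gp L M j))
    = gnorm M (\<lambda>j. ?S (\<lambda>j. \<Phi> ?t (grid a b M j)) j - \<Phi> (real (Suc n) * \<tau>) (grid a b M j))"
  proof (rule gnorm_cong)
    fix j assume j: "j < M"
    have "?S (\<lambda>j. \<Phi> ?t (grid a b M j)) j = S4c_step 1 0 L (per V) (per A) M (\<tau> / \<epsilon>) (\<lambda>j. per (\<Phi> (?t + \<epsilon> * 0)) (gp L M j)) j"
      unfolding L_def by (rule S4c_step_scale[OF ab \<epsilon> _ _ _ j]) (simp_all add: per_def pull_grid flip: L_def)
    moreover have "per (\<Phi> (?t + \<epsilon> * (\<tau> / \<epsilon>))) (gp L M j) = \<Phi> (real (Suc n) * \<tau>) (grid a b M j)"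
      using \<epsilon> j by (simp add: per_def pull_grid t)
    ultimately show "norm (S4c_step 1 0 L (per V) (per A) M (\<tau> / \<epsilon>) (\<lambda>j. per (\<Phi> (?t + \<epsilon> * 0)) (gp L M j)) j
      - per (\<Phi> (?t + \<epsilon> * (\<tau> / \<epsilon>))) (gp L M j)) = norm (?S (\<lambda>j. \<Phi> ?t (grid a b M j)) j - \<Phi> (real (Suc n) * \<tau>) (grid a b M j))"
      by (simp only:)
  qed
  finally have loc: "gnorm M (\<lambda>j. ?S (\<lambda>j. \<Phi> ?t (grid a b M j)) j - \<Phi> (real (Suc n) * \<tau>) (grid a b M j)) \<le> ?R" .
  have "gnorm M (\<lambda>j. ?S ?U j - ?S (\<lambda>j. \<Phi> ?t (grid a b M j)) j) \<le> real n * ?R"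
    unfolding gnorm_step_scaled[OF M] by (rule Suc.IH[OF t'(3)])
  from order_trans[OF gnorm_triangle_diff add_mono[OF this loc]] show ?case
    unfolding S4c_Suc by (simp add: distrib_right)
qed

lemma gnorm_solution: "t \<in> {0..T} \<Longrightarrow> 0 < M \<Longrightarrow> gnorm M (\<lambda>j. \<Phi> t (grid a b M j)) \<le> B"
proof -
  assume t: "t \<in> {0..T}" and M: "0 < M"
  have "norm (\<Phi> t (grid a b M j)) \<le> B" if "j < M" for j
    using cb_bdd[OF cb_solution[OF t], of "gp L M j"] that by (simp add: per_def pull_grid)
  then show ?thesis using M cb_nonneg[OF cb_solution[OF t]] by (intro gnorm_le_sup) auto
qed

text \<open>Comparison with the zero vector, which the step leaves fixed at the nodes. The bound
  holds for every time step and is meant for those too large for an expansion.\<close>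

lemma S4c_bounded:
  assumes M: "0 < M" "even M"
  shows "gnorm M (S4c \<epsilon> a b V A M \<tau> \<Phi>0 n) \<le> B"
proof (induction n)
  case 0
  have "gnorm M (S4c \<epsilon> a b V A M \<tau> \<Phi>0 0) = gnorm M (\<lambda>j. \<Phi> 0 (grid a b M j))"
    by (intro gnorm_cong) (simp add: initial)
  then show ?case using gnorm_solution[of 0 M] M T by simp
next
  case (Suc n)
  have z: "S4c_step \<epsilon> a b V A M \<tau> (\<lambda>j. 0) j = 0" if "j < M" for j
  proof -
    have "exp_T 1 0 L M s (\<lambda>j. 0) = (\<lambda>j. 0)" for s
      using exp_T_diff[of L M s "\<lambda>j. 0" "\<lambda>j. 0"] by auto
    then show ?thesis unfolding step_scaled[OF that] unfolding S4c_step_def comp_def exp_mult_def by simp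
  qed
  have "gnorm M (S4c \<epsilon> a b V A M \<tau> \<Phi>0 (Suc n)) = gnorm M (\<lambda>j. S4c_step \<epsilon> a b V A M \<tau> (S4c \<epsilon> a b V A M \<tau> \<Phi>0 n) j
      - S4c_step \<epsilon> a b V A M \<tau> (\<lambda>j. 0) j)"
    unfolding S4c_Suc by (intro gnorm_cong) (simp add: z)
  then show ?case using Suc unfolding gnorm_step_scaled[OF M] by simp
qed

text \<open>Interpolation reproduces the approximating polynomial p, so the error is \<Phi> - p plus
  the interpolant of the grid difference p - U. The first part is uniformly small, the second one is
  measured by the grid norm; a Lebesgue constant of the interpolation never enters. The term of
  Jackson's theorem occurs twice, once in each part.\<close>

lemma interpolation_error:
  assumes M: "0 < M" "even M" and t: "t \<in> {0..T}"
  shows "L2_norm a b (\<lambda>x. \<Phi> t x - interpolant a b M U x)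
    \<le> sqrt (2 * (b - a)) * (2 * (B * (2 * L / real M) ^ m) + gnorm M (\<lambda>j. U j - \<Phi> t (grid a b M j)))"
proof -
  define \<beta> where "\<beta> = B * (2 * L / real M) ^ m"
  obtain k where k: "m = Suc k" using m0 by (cases m) auto
  have cbk: "cb L (Suc k) B (per (\<Phi> t))" using cb_solution[OF t] unfolding k .
  obtain c where c: "\<And>y. norm (per (\<Phi> t) y - ev L (M div 2 - 1) c y) \<le> B * (2 * L / real M) ^ Suc k"
    "\<And>l. \<bar>l\<bar> > int (M div 2 - 1) \<Longrightarrow> c l = 0"
    by (rule trig_approx[OF L_pos M cbk]) (rule that)
  note c = c(1)[folded k, folded \<beta>_def]
  let ?p = "\<lambda>x. ev L (M div 2 - 1) c ((x - a) / \<epsilon>)" and ?G = "\<lambda>j. ev L (M div 2 - 1) c (gp L M j)"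
  have G: "interpolant a b M ?G x = ?p x" for x
    unfolding L_def by (rule interpolant_trig[OF ab \<epsilon> M])
  let ?f = "interpolant a b M (\<lambda>j. ?G j - U j)"
  have \<beta>0: "0 \<le> \<beta>" using order_trans[OF norm_ge_zero c[of 0]] .
  define g where "g = gnorm M (\<lambda>j. ?G j - U j)"
  have g0: "0 \<le> g" by (simp add: g_def gnorm_nonneg)
  have "gnorm M (\<lambda>j. ?G j - \<Phi> t (grid a b M j)) \<le> \<beta>"
  proof (rule gnorm_le_sup)
    show "norm (?G j - \<Phi> t (grid a b M j)) \<le> \<beta>" if "j < M" for j
      using c[of "gp L M j"] that by (simp add: per_def pull_grid norm_minus_commute)
  qed (use M \<beta>0 in auto)
  moreover have "gnorm M (\<lambda>j. \<Phi> t (grid a b M j) - U j) = gnorm M (\<lambda>j. U j - \<Phi> t (grid a b M j))"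
    by (intro gnorm_cong) (simp add: norm_minus_commute)
  ultimately have g: "g \<le> \<beta> + gnorm M (\<lambda>j. U j - \<Phi> t (grid a b M j))"
    unfolding g_def using gnorm_triangle_diff[of M ?G U "\<lambda>j. \<Phi> t (grid a b M j)"] by linarith
  \<comment> \<open>Squares are compared pointwise by (x + y)^2 <= 2 x^2 + 2 y^2, which avoids a
    triangle inequality for \<open>L2_norm\<close> and accounts for the 2 under the root.\<close>
  have pt: "(norm (\<Phi> t x - interpolant a b M U x))\<^sup>2 \<le> 2 * \<beta>\<^sup>2 + 2 * (norm (?f x))\<^sup>2" if "x \<in> {a<..<b}" for x
  proof -
    have "norm (\<Phi> t x - ?p x) \<le> \<beta>"
      using c[of "(x - a) / \<epsilon>"] that by (simp add: per_def pull_scaled)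
    moreover have "\<Phi> t x - interpolant a b M U x = (\<Phi> t x - ?p x) + ?f x"
      unfolding interpolant_diff G by simp
    ultimately have "norm (\<Phi> t x - interpolant a b M U x) \<le> \<beta> + norm (?f x)"
      by (simp only:) (rule norm_triangle_mono, auto)
    then have "(norm (\<Phi> t x - interpolant a b M U x))\<^sup>2 \<le> (\<beta> + norm (?f x))\<^sup>2" by (rule power_mono) simp
    also have "\<dots> \<le> 2 * \<beta>\<^sup>2 + 2 * (norm (?f x))\<^sup>2"
      using sum_squares_bound[of \<beta> "norm (?f x)"] by (simp add: power2_sum)
    finally show ?thesis .
  qed
  have c\<Phi>: "continuous_on {a..b} (\<Phi> t)"
    using clsD(1)[OF reg_solution(1)[OF _ t, of 0], of 0] m by auto
  have c2: "continuous_on {a..b} (\<lambda>x. 2 * \<beta>\<^sup>2 + 2 * (norm (?f x))\<^sup>2)"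
    by (intro continuous_intros interpolant_continuous)
  have "(LINT x|lebesgue_on {a<..<b}. (norm (\<Phi> t x - interpolant a b M U x))\<^sup>2)
    \<le> (LINT x|lebesgue_on {a<..<b}. 2 * \<beta>\<^sup>2 + 2 * (norm (?f x))\<^sup>2)"
    by (intro integral_mono lint_cont(1) c2 continuous_intros c\<Phi> interpolant_continuous) (use pt in simp)
  also have "\<dots> = integral {a..b} (\<lambda>x. 2 * \<beta>\<^sup>2 + 2 * (norm (?f x))\<^sup>2)" by (rule lint_cont(2)[OF c2])
  also have "\<dots> = integral {a..b} (\<lambda>x. 2 * \<beta>\<^sup>2) + integral {a..b} (\<lambda>x. 2 * (norm (?f x))\<^sup>2)"
    by (intro Henstock_Kurzweil_Integration.integral_add integrable_continuous_interval continuous_intros interpolant_continuous)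
  also have "\<dots> = 2 * (b - a) * (\<beta>\<^sup>2 + g\<^sup>2)"
    using ab by (simp add: interpolant_norm[OF ab M] g_def algebra_simps)
  also have "\<dots> \<le> 2 * (b - a) * (\<beta> + g)\<^sup>2"
    using ab \<beta>0 g0 by (intro mult_left_mono) (auto simp: power2_sum)
  finally have "L2_norm a b (\<lambda>x. \<Phi> t x - interpolant a b M U x) \<le> sqrt (2 * (b - a) * (\<beta> + g)\<^sup>2)"
    unfolding L2_norm_def by (rule real_sqrt_le_mono)
  also have "\<dots> = sqrt (2 * (b - a)) * (\<beta> + g)" using \<beta>0 g0 by (simp add: real_sqrt_mult)
  also have "\<dots> \<le> sqrt (2 * (b - a)) * (2 * \<beta> + gnorm M (\<lambda>j. U j - \<Phi> t (grid a b M j)))"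
    using g ab by (intro mult_left_mono) auto
  finally show ?thesis unfolding \<beta>_def .
qed

end

theorem theorem3p3:
  fixes m :: nat and T a b :: real and C D :: "nat \<Rightarrow> real" and \<eta> :: "real \<Rightarrow> real"
  assumes "4 \<le> m" and "a < b" and "0 < T"
    and "bounded (\<eta> ` {0<..1})" and "\<forall>\<epsilon>\<in>{0<..1}. 0 < \<eta> \<epsilon>" and "(\<eta> \<longlongrightarrow> 0) (at_right 0)"
  shows "\<exists>C3>0. \<exists>E>0.
    \<forall>(\<epsilon>::real) (V::real \<Rightarrow> real) (A1::real \<Rightarrow> real)
      (\<Phi>0::real \<Rightarrow> complex^2) (\<Phi>::real \<Rightarrow> real \<Rightarrow> complex^2) (M::nat) (h::real) (\<tau>::real) (n::nat).
      0 < \<epsilon> \<and> \<epsilon> \<le> 1 \<longrightarrow>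
      dirac_solution \<epsilon> T a b V A1 \<Phi>0 \<Phi> \<longrightarrow>
      \<Phi> \<in> C_time_W_inf_per 2 T m a b \<longrightarrow>
      V \<in> Cm_fun m a b \<and> periodic_upto m a b V \<longrightarrow>
      A1 \<in> Cm_fun m a b \<and> periodic_upto m a b A1 \<longrightarrow>
      (\<forall>r\<le>2. \<forall>k\<le>m. mixed_Linf_norm T a b r k \<Phi> \<le> ereal (C (r + k) / \<epsilon> ^ (r + k))) \<longrightarrow>
      (\<forall>k\<le>m. Linf_norm a b ((dx a b ^^ k) V) \<le> ereal (D k)) \<longrightarrow>
      (\<forall>k\<le>m. Linf_norm a b ((dx a b ^^ k) A1) \<le> ereal (D k)) \<longrightarrow>
      0 < M \<and> even M \<and> h = (b - a) / real M \<longrightarrow>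
      0 < \<tau> \<longrightarrow>
      \<tau> / \<epsilon> \<le> \<eta> \<epsilon> \<and> h / \<epsilon> \<le> \<eta> \<epsilon> \<longrightarrow>
      real n \<le> T / \<tau> \<longrightarrow>
      L2_norm a b (\<lambda>x. \<Phi> (real n * \<tau>) x - interpolant a b M (S4c \<epsilon> a b V A1 M \<tau> \<Phi>0 n) x)
        \<le> C3 * T * (\<tau> ^ 4 / \<epsilon> ^ 5) + E * (T / \<tau>) * (h / (\<epsilon> * (b - a))) ^ m"
proof -
  \<comment> \<open>A single bound for all constants of the data. The absolute values make it
    nonnegative, whatever the signs of the given numbers.\<close>
  define B where "B = (\<Sum>k\<le>m + 1. \<bar>C k\<bar>) + (\<Sum>k\<le>m. \<bar>D k\<bar>)"
  have B0: "0 \<le> B" unfolding B_def by (intro add_nonneg_nonneg sum_nonneg) auto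
  have BC: "C k \<le> B" if "k \<le> m + 1" for k
  proof -
    have "C k \<le> \<bar>C k\<bar>" by simp
    also have "\<dots> \<le> (\<Sum>k\<le>m + 1. \<bar>C k\<bar>)" using that by (intro member_le_sum) auto
    also have "\<dots> \<le> B" unfolding B_def by (simp add: sum_nonneg)
    finally show ?thesis .
  qed
  have BD: "D k \<le> B" if "k \<le> m" for k
  proof -
    have "D k \<le> \<bar>D k\<bar>" by simp
    also have "\<dots> \<le> (\<Sum>k\<le>m. \<bar>D k\<bar>)" using that by (intro member_le_sum) auto
    also have "\<dots> \<le> B" unfolding B_def by (simp add: sum_nonneg)
    finally show ?thesis .
  qed
  obtain e where e: "0 < e" "\<And>\<epsilon>. \<epsilon> \<in> {0<..1} \<Longrightarrow> \<eta> \<epsilon> \<le> e"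
  proof -
    obtain e where "0 < e" and e: "\<And>y. y \<in> \<eta> ` {0<..1} \<Longrightarrow> norm y \<le> e"
      using assms(4) unfolding bounded_pos by blast
    have "\<eta> \<epsilon> \<le> e" if "\<epsilon> \<in> {0<..1}" for \<epsilon> using e[OF imageI[OF that]] by simp
    then show ?thesis using that \<open>0 < e\<close> by blast
  qed
  obtain K where K: "K \<ge> 0" "\<forall>L S V A \<phi> M. flow_data m B (2 * B + 32 * B * B) L S V A \<phi> \<longrightarrow> S \<le> 1/2 \<longrightarrow> 0 < M \<longrightarrow> even M \<longrightarrow>
      gnorm M (\<lambda>j. S4c_step 1 0 L V A M S (\<lambda>j. \<phi> 0 (gp L M j)) j - \<phi> S (gp L M j)) \<le> K * (S ^ 5 + (L / real M) ^ m)"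
    using local_error[OF assms(1), of B "2 * B + 32 * B * B"] by blast
  define q where "q = sqrt (2 * (b - a))"
  have q: "0 \<le> q" using assms(2) by (simp add: q_def)
  \<comment> \<open>The 64 is 2 * 2^5: for \<sigma> > 1/2 the error is at most 2 B = 64 B (1/2)^5.
    The quotient e/T comes from charging this single error to the factor T/\<tau>.\<close>
  define k1 where "k1 = K + 64 * B * e / T"
  define k2 where "k2 = 2 * B * 2 ^ m * e / T + K"
  have k: "0 \<le> k1" "0 \<le> k2" using K(1) B0 e(1) assms(3) by (auto simp: k1_def k2_def)
  have main: "L2_norm a b (\<lambda>x. \<Phi> (real n * \<tau>) x - interpolant a b M (S4c \<epsilon> a b V A1 M \<tau> \<Phi>0 n) x)
      \<le> (q * k1 + 1) * T * (\<tau> ^ 4 / \<epsilon> ^ 5) + (q * k2 * (b - a) ^ m + 1) * (T / \<tau>) * (h / (\<epsilon> * (b - a))) ^ m"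
    if \<epsilon>: "0 < \<epsilon>" "\<epsilon> \<le> 1" and sol: "dirac_solution \<epsilon> T a b V A1 \<Phi>0 \<Phi>" and \<Phi>: "\<Phi> \<in> C_time_W_inf_per 2 T m a b"
      and V: "V \<in> Cm_fun m a b" "periodic_upto m a b V" and A1: "A1 \<in> Cm_fun m a b" "periodic_upto m a b A1"
      and C: "\<forall>r\<le>2. \<forall>k\<le>m. mixed_Linf_norm T a b r k \<Phi> \<le> ereal (C (r + k) / \<epsilon> ^ (r + k))"
      and D: "\<forall>k\<le>m. Linf_norm a b ((dx a b ^^ k) V) \<le> ereal (D k)" "\<forall>k\<le>m. Linf_norm a b ((dx a b ^^ k) A1) \<le> ereal (D k)"
      and M: "0 < M" "even M" and h: "h = (b - a) / real M" and \<tau>: "0 < \<tau>" "\<tau> / \<epsilon> \<le> \<eta> \<epsilon>" and n: "real n \<le> T / \<tau>"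
    for \<epsilon> V A1 \<Phi>0 \<Phi> M h \<tau> n
  proof -
    interpret P: dirac_data a b \<epsilon> m T B C D V A1 \<Phi>0 \<Phi>
      by unfold_locales (use assms \<epsilon> sol \<Phi> V A1 C D BC BD in auto)
    define \<sigma> where "\<sigma> = \<tau> / \<epsilon>"
    define H where "H = (P.L / real M) ^ m"
    let ?t = "real n * \<tau>"
    define E where "E = gnorm M (\<lambda>j. S4c \<epsilon> a b V A1 M \<tau> \<Phi>0 n j - \<Phi> ?t (grid a b M j))"
    have H: "0 \<le> H" using P.L_pos by (simp add: H_def)
    have \<sigma>: "0 < \<sigma>" using \<tau> \<epsilon> by (simp add: \<sigma>_def)
    have t: "?t \<le> T" "?t \<in> {0..T}" using n \<tau> by (auto simp: pos_le_divide_eq)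
    have "\<tau> \<le> \<epsilon> * \<eta> \<epsilon>" using \<tau>(2) \<epsilon> by (simp add: pos_divide_le_eq mult.commute)
    also have "\<dots> \<le> 1 * e" using e \<epsilon> assms(5) by (intro mult_mono) (auto simp: less_imp_le)
    finally have "\<tau> \<le> e" by simp
    \<comment> \<open>As \<tau> is bounded by e, an error that arises once can be charged as if it
      arose in every step; this concerns the interpolation at the final time and the case of large
      \<sigma>.\<close>
    then have one: "1 \<le> T / \<tau> * (e / T)" using \<tau> assms(3) by simp
    have E: "E \<le> T / \<tau> * (k1 * \<sigma> ^ 5 + K * H)"
    proof (cases "\<sigma> \<le> 1/2")
      case True
      have "E \<le> real n * (K * (\<sigma> ^ 5 + H))"
        unfolding E_def H_def \<sigma>_def by (rule P.global_error[OF M \<tau>(1) _ K(2) t(1)]) (use True in \<open>simp add: \<sigma>_def\<close>)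
      also have "\<dots> \<le> T / \<tau> * (K * (\<sigma> ^ 5 + H))" using n K(1) \<sigma> H by (intro mult_right_mono) auto
      also have "\<dots> \<le> T / \<tau> * (k1 * \<sigma> ^ 5 + K * H)"
      proof -
        have "K * \<sigma> ^ 5 \<le> k1 * \<sigma> ^ 5"
          using B0 e(1) assms(3) \<sigma> by (intro mult_right_mono) (auto simp: k1_def)
        then show ?thesis using assms(3) \<tau> by (intro mult_left_mono) (auto simp: distrib_left)
      qed
      finally show ?thesis .
    next
      case False
      have "E \<le> gnorm M (S4c \<epsilon> a b V A1 M \<tau> \<Phi>0 n) + gnorm M (\<lambda>j. - \<Phi> ?t (grid a b M j))"
        unfolding E_def using gnorm_triangle[of M "S4c \<epsilon> a b V A1 M \<tau> \<Phi>0 n" "\<lambda>j. - \<Phi> ?t (grid a b M j)"] by simp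
      also have "gnorm M (\<lambda>j. - \<Phi> ?t (grid a b M j)) = gnorm M (\<lambda>j. \<Phi> ?t (grid a b M j))"
        by (rule gnorm_cong) simp
      also have "gnorm M (S4c \<epsilon> a b V A1 M \<tau> \<Phi>0 n) + gnorm M (\<lambda>j. \<Phi> ?t (grid a b M j)) \<le> B + B"
        by (intro add_mono P.S4c_bounded P.gnorm_solution M t)
      also have "\<dots> = 64 * B * (1/2) ^ 5" by (simp add: power_divide)
      also have "\<dots> \<le> 64 * B * \<sigma> ^ 5" using False B0 by (intro mult_left_mono power_mono) auto
      also have "\<dots> = (64 * B * \<sigma> ^ 5) * 1" by simp
      also have "\<dots> \<le> (64 * B * \<sigma> ^ 5) * (T / \<tau> * (e / T))"
        using one B0 \<sigma> by (intro mult_left_mono) auto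
      also have "\<dots> = T / \<tau> * (64 * B * e / T * \<sigma> ^ 5)" by simp
      also have "\<dots> \<le> T / \<tau> * (k1 * \<sigma> ^ 5 + K * H)"
        using K(1) H \<sigma> assms(3) \<tau> by (intro mult_left_mono) (auto simp: k1_def distrib_right)
      finally show ?thesis .
    qed
    have "2 * (B * (2 * P.L / real M) ^ m) = (2 * B * 2 ^ m * H) * 1"
      by (simp add: H_def power_mult_distrib power_divide)
    also have "\<dots> \<le> (2 * B * 2 ^ m * H) * (T / \<tau> * (e / T))"
      using one B0 H by (intro mult_left_mono) auto
    also have "\<dots> = T / \<tau> * (2 * B * 2 ^ m * e / T * H)" by simp
    finally have "2 * (B * (2 * P.L / real M) ^ m) + E \<le> T / \<tau> * (k1 * \<sigma> ^ 5 + k2 * H)"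
      using E by (simp add: k2_def distrib_left distrib_right)
    then have "L2_norm a b (\<lambda>x. \<Phi> ?t x - interpolant a b M (S4c \<epsilon> a b V A1 M \<tau> \<Phi>0 n) x) \<le> q * (T / \<tau> * (k1 * \<sigma> ^ 5 + k2 * H))"
      using order_trans[OF P.interpolation_error[OF M t(2), of "S4c \<epsilon> a b V A1 M \<tau> \<Phi>0 n"]] q
      unfolding q_def[symmetric] E_def[symmetric] by (meson mult_left_mono)
    also have "\<dots> = q * k1 * (T / \<tau> * \<sigma> ^ 5) + q * k2 * (T / \<tau> * H)" by (simp add: distrib_left mult_ac)
    also have "T / \<tau> * \<sigma> ^ 5 = T * (\<tau> ^ 4 / \<epsilon> ^ 5)"
    proof -
      have "\<tau> ^ 5 = \<tau> * \<tau> ^ 4" by (simp flip: power_Suc)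
      then show ?thesis using \<tau> by (simp add: \<sigma>_def power_divide)
    qed
    also have "H = (b - a) ^ m * (h / (\<epsilon> * (b - a))) ^ m"
    proof -
      have "P.L / real M = (b - a) * (h / (\<epsilon> * (b - a)))" using assms(2) by (simp add: P.L_def h mult.commute)
      then show ?thesis unfolding H_def by (simp only: power_mult_distrib)
    qed
    also have "q * k1 * (T * (\<tau> ^ 4 / \<epsilon> ^ 5)) + q * k2 * (T / \<tau> * ((b - a) ^ m * (h / (\<epsilon> * (b - a))) ^ m))
      = (q * k1) * (T * (\<tau> ^ 4 / \<epsilon> ^ 5)) + (q * k2 * (b - a) ^ m) * (T / \<tau> * (h / (\<epsilon> * (b - a))) ^ m)"
      by (simp only: mult_ac)
    also have "\<dots> \<le> (q * k1 + 1) * (T * (\<tau> ^ 4 / \<epsilon> ^ 5)) + (q * k2 * (b - a) ^ m + 1) * (T / \<tau> * (h / (\<epsilon> * (b - a))) ^ m)"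
      using assms(3) \<tau> \<epsilon> assms(2) by (intro add_mono mult_right_mono) (auto simp: h)
    finally show ?thesis by (simp only: mult.assoc)
  qed
  show ?thesis
  proof (intro exI conjI allI impI)
    \<comment> \<open>The summands 1 secure strict positivity of the constants even when k1 or k2
      vanishes.\<close>
    show "0 < q * k1 + 1" "0 < q * k2 * (b - a) ^ m + 1"
      using q k assms(2) by (auto intro!: add_nonneg_pos mult_nonneg_nonneg)
  qed (rule main; simp)
qed

end
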